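(* Let $\mu$ be a conjugation-symmetric probability Borel measure on $\mathbb T$ with infinite support whose recurrence coefficients satisfy $\alpha_i\to0$ as $i\to\infty$, let $\varphi_i$ be its orthonormal polynomials, and let $P_n=\sum_{i=0}^{n-1}\eta_i\varphi_i$ with $\eta_i$ i.i.d. standard real Gaussian variables. Let $S$ be a compact subset of $\mathbb T\setminus\{\pm1\}$ and assume that $\mu$ is absolutely continuous with respect to arclength on an open set containing $S$, with Radon–Nikodym derivative positive and continuous at each point of $S$. Given $-\infty<\tau_1<\tau_2<\infty$, $$\frac1n\mathbb E\big[N_n(\Omega(S,\tau_1,\tau_2))\big]\to\frac{|S|}{2\pi}\left(\frac{H'(\tau_2)}{H(\tau_2)}-\frac{H'(\tau_1)}{H(\tau_1)}\right)\quad(n\to\infty),$$ where $\Omega(S,\tau_1,\tau_2):=\{rz:\ z\in S,\ r\in(1+\frac{\tau_1}{2n},1+\frac{\tau_2}{2n})\}$, $H(\tau):=\frac{e^\tau-1}{\tau}$, $N_n(\Omega)$ is the number of zeros of $P_n$ in $\Omega$, and $|S|$ is the arclength measure of $S$.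
   Context: Recurrence coefficients are defined by the Szegő recursion $\Phi_{i+1}(z)=z\Phi_i(z)-\alpha_i\Phi_i^*(z)$ for the monic orthogonal polynomials $\Phi_i$ of $\mu$, with $\Phi_i^*(z)=z^i\Phi_i(1/z)$. $H(0)$ is understood as $1$ by continuity. *)

theory Defs
  imports "HOL-Probability.Probability" "HOL-Computational_Algebra.Polynomial"
begin

definition msupport :: "complex measure \<Rightarrow> complex set" where
  "msupport \<mu> = {z. \<forall>e>0. emeasure \<mu> (ball z e) > 0}"

definition conj_symmetric :: "complex measure \<Rightarrow> bool" where
  "conj_symmetric \<mu> \<longleftrightarrow> (\<forall>A \<in> sets \<mu>. emeasure \<mu> (cnj ` A) = emeasure \<mu> A)"

definition monic_OP :: "complex measure \<Rightarrow> (nat \<Rightarrow> complex poly) \<Rightarrow> bool" where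
  "monic_OP \<mu> \<Phi> \<longleftrightarrow>
     (\<forall>i. degree (\<Phi> i) = i \<and> lead_coeff (\<Phi> i) = 1 \<and>
        (\<forall>j<i. (LINT z|\<mu>. poly (\<Phi> i) z * cnj (poly (\<Phi> j) z)) = 0))"

definition L2norm_poly :: "complex measure \<Rightarrow> complex poly \<Rightarrow> real" where
  "L2norm_poly \<mu> p = sqrt (LINT z|\<mu>. (cmod (poly p z))\<^sup>2)"

definition orthonormal_poly :: "complex measure \<Rightarrow> (nat \<Rightarrow> complex poly) \<Rightarrow> nat \<Rightarrow> complex poly" where
  "orthonormal_poly \<mu> \<Phi> i = smult (complex_of_real (1 / L2norm_poly \<mu> (\<Phi> i))) (\<Phi> i)"

definition arclen :: "complex set \<Rightarrow> real" where
  "arclen A = measure lborel {\<theta> \<in> {0..<2*pi}. cis \<theta> \<in> A}"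

definition H :: "real \<Rightarrow> real" where
  "H \<tau> = (if \<tau> = 0 then 1 else (exp \<tau> - 1) / \<tau>)"

definition Omega :: "complex set \<Rightarrow> real \<Rightarrow> real \<Rightarrow> nat \<Rightarrow> complex set" where
  "Omega S \<tau>1 \<tau>2 n = {complex_of_real r * z | z r. z \<in> S \<and>
      1 + \<tau>1 / (2 * real n) < r \<and> r < 1 + \<tau>2 / (2 * real n)}"

end

theory Submission
  imports Defs "HOL-Complex_Analysis.Complex_Analysis" "HOL-Real_Asymp.Real_Asymp"
    "HOL-Computational_Algebra.Fundamental_Theorem_Algebra"
begin

text \<open>
  In the exponential coordinate \<open>\<zeta>\<close> with \<open>z = exp \<zeta>\<close>, the mean value of \<open>ln \<bar>P\<^sub>n(exp \<zeta>)\<bar>\<close> over a circle of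
  radius \<open>r\<close> exceeds the value at its centre by the sum of \<open>ln\<^sup>+ (r / \<bar>clog a - \<zeta>\<bar>)\<close> over the zeros \<open>a\<close>
  (Jensen), so expected zero counts are bounded as soon as the expectation of this excess is known
  to second order in \<open>r\<close>. By rotation invariance of Gaussian vectors, the expectation of
  \<open>ln \<bar>P\<^sub>n(z)\<bar>\<close> is an explicit function of \<open>\<Sum> \<bar>\<phi>\<^sub>i(z)\<bar>\<^sup>2\<close> and \<open>\<bar>\<Sum> \<phi>\<^sub>i(z)\<^sup>2\<bar>\<close>. Near \<open>S\<close>, at scale \<open>1/n\<close>, the
  reproducing kernel is universal, \<open>2 \<pi> w K\<^sub>n / n \<rightarrow> H\<close>: localising polynomials compare it with the geometric
  kernel of arclength. The sum without conjugation is \<open>o(n)\<close> by the Christoffel-Darboux formula,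
  because \<open>S\<close> avoids \<open>\<plusminus>1\<close>. Hence the second difference of the expected logarithm is governed by
  \<open>(ln H)''\<close>, whose integral across the annulus is \<open>H'/H\<close> at \<open>\<tau>2\<close> minus \<open>H'/H\<close> at \<open>\<tau>1\<close>.
\<close>

section \<open>The function H on the complex plane and means over circles\<close>

text \<open>Away from \<open>S\<close> the measure is arbitrary, so the only global information is
  that \<alpha> tends to 0. It makes the orthonormal polynomials grow subexponentially on the
  circle, which is just enough against a localising factor whose degree is a small multiple of n and
  which is exponentially small far from its base point. The second obstacle is that universality is
  an o(1) statement, while counting zeros needs the expected logarithm up to a small multiple of s^2
  in the scaled displacement s. No derivative of a kernel is estimated for this: s is made complex,
  all kernels become holomorphic in it, and Cauchy estimates on a disc of fixed radius turn a small
  uniform error into a small multiple of s^2. The price is that universality is required for pairs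
  of distinct points. For fixed n the radius of the smoothing discs tends to 0 before n grows, with
  Fatou's lemma for the upper and its reverse for the lower bound, so no density of the zeros has to
  be constructed for finite n. Conjugation symmetry makes all polynomials real, so the sum without
  conjugation is the kernel at a point and a conjugate point.\<close>

definition Hc :: "complex \<Rightarrow> complex" where
  "Hc y = (if y = 0 then 1 else (exp y - 1) / y)"

lemma Hc_mult: "y * Hc y = exp y - 1"
  by (simp add: Hc_def)

lemma Hc_of_real: "Hc (of_real x) = of_real (H x)"
  by (simp add: Hc_def H_def exp_of_real)

lemma Hc_holomorphic_UNIV: "Hc holomorphic_on UNIV"
proof -
  have "(\<lambda>y. if y = 0 then deriv exp 0 else (exp y - exp 0) / (y - 0)) holomorphic_on (UNIV::complex set)"
    by (rule pole_lemma_open) (auto intro!: holomorphic_intros)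
  moreover have "deriv exp (0::complex) = 1" using DERIV_imp_deriv[OF DERIV_exp, of "0::complex"] by simp
  ultimately show ?thesis by (simp add: Hc_def[abs_def] cong: if_cong)
qed

lemma Hc_holomorphic [holomorphic_intros]:
  "f holomorphic_on A \<Longrightarrow> (\<lambda>x. Hc (f x)) holomorphic_on A"
  using holomorphic_on_compose_gen[OF _ Hc_holomorphic_UNIV, of f A] by (simp add: o_def)

lemma Hc_continuous [continuous_intros]:
  "continuous_on A f \<Longrightarrow> continuous_on A (\<lambda>x. Hc (f x))"
  using continuous_on_compose2[OF holomorphic_on_imp_continuous_on[OF Hc_holomorphic_UNIV], of A f] by auto

text \<open>The zeros of \<open>exp y - 1\<close> are the integer multiples of 2 pi i, and the one
  at 0 has been divided out. So \<open>exp y - 1\<close> divided by its only zero is zero-free on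
  the small discs on which Jensen's formula is applied.\<close>

lemma Hc_nonzero: "cmod y < 2 * pi \<Longrightarrow> Hc y \<noteq> 0"
proof
  assume y: "cmod y < 2 * pi" "Hc y = 0"
  then have "exp y = 1" "y \<noteq> 0" using Hc_mult[of y] by (auto simp: Hc_def)
  then obtain n :: int where n: "Re y = 0" "Im y = of_int (2 * n) * pi" by (auto simp: exp_eq_1)
  with \<open>y \<noteq> 0\<close> have "n \<noteq> 0" by (auto simp: complex_eq_iff)
  then have "\<bar>Im y\<bar> \<ge> 2 * pi" using n by (simp add: abs_mult)
  with abs_Im_le_cmod[of y] y show False by linarith
qed

lemma H_pos: "H x > 0"
proof (cases "x < 0")
  case True
  then have "exp x - 1 < 0" by simp
  with True show ?thesis unfolding H_def using divide_neg_neg[of "exp x - 1" x] by simp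
qed (auto simp: H_def)

lemma Hc_near_0:
  assumes "cmod y \<le> 1" shows "cmod (Hc y - 1) \<le> 3 * cmod y"
proof (cases "y = 0")
  case False
  have "cmod (exp y - (\<Sum>k\<le>1. y ^ k / fact k)) \<le> exp (cmod y) * cmod y ^ Suc 1 / fact 1"
    by (rule Taylor_exp_field)
  also have "\<dots> \<le> 3 * cmod y ^ 2"
    using assms order_trans[OF _ exp_le, of "exp (cmod y)"]
    by (simp add: power2_eq_square) (intro mult_right_mono, auto)
  finally have *: "cmod (exp y - 1 - y) \<le> 3 * cmod y ^ 2" by (simp add: algebra_simps)
  have "Hc y - 1 = (exp y - 1 - y) / y" using False by (simp add: Hc_def field_simps)
  then have "cmod (Hc y - 1) = cmod (exp y - 1 - y) / cmod y" by (simp add: norm_divide)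
  also have "\<dots> \<le> 3 * cmod y" using * False by (simp add: divide_le_eq power2_eq_square)
  finally show ?thesis .
qed (simp add: Hc_def)

text \<open>A geometric series with ratio \<open>exp (y / n)\<close>. The product form avoids
  dividing by \<open>Hc (y / n)\<close>, which may vanish; for bounded \<open>y\<close> that factor
  tends to 1, so the mean of the summands tends to \<open>Hc y\<close>.\<close>

lemma geometric_Hc:
  assumes "n > 0"
  shows "(\<Sum>j<n. exp (of_nat j * y / of_nat n)) * Hc (y / of_nat n) = of_nat n * Hc y"
proof (cases "y = 0")
  case False
  define q where "q = exp (y / of_nat n)"
  have qj: "exp (of_nat j * y / of_nat n) = q ^ j" for j
    by (simp add: q_def exp_of_nat_mult[symmetric])
  have qn: "q ^ n = exp y" using assms by (simp add: qj[symmetric])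
  have "(\<Sum>j<n. q ^ j) * (q - 1) = q ^ n - 1"
    using power_diff_1_eq[of q n] by (simp add: mult.commute)
  moreover have "q - 1 = y / of_nat n * Hc (y / of_nat n)"
    by (simp add: Hc_mult q_def)
  moreover have "exp y - 1 = y * Hc y" by (simp add: Hc_mult)
  ultimately have "(\<Sum>j<n. q ^ j) * (y / of_nat n * Hc (y / of_nat n)) = y * Hc y"
    by (simp add: qn)
  then show ?thesis using False assms unfolding qj by (simp add: field_simps)
qed (simp add: Hc_def)

section \<open>Parseval's identity and mean values on circles\<close>

lemma has_integral_cis_int:
  fixes m :: int
  shows "((\<lambda>t. cis (of_int m * t)) has_integral (if m = 0 then of_real (2 * pi) else 0)) {0..2*pi}"
proof (cases "m = 0")
  case True
  then show ?thesis using has_integral_const_real[of "1::complex" 0 "2*pi"] by (simp add: scaleR_conv_of_real)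
next
  case False
  have "((\<lambda>t. cis (of_int m * t)) has_integral
      (cis (of_int m * (2 * pi)) / (\<i> * of_int m) - cis (of_int m * 0) / (\<i> * of_int m))) {0..2*pi}"
  proof (rule fundamental_theorem_of_calculus)
    show "0 \<le> 2 * pi" by simp
    fix x
    show "((\<lambda>t. cis (of_int m * t) / (\<i> * of_int m)) has_vector_derivative cis (of_int m * x)) (at x within {0..2*pi})"
      unfolding cis_conv_exp
      by (rule has_vector_derivative_real_field derivative_eq_intros refl | simp add: False field_simps)+
  qed
  moreover have "cis (of_int m * (2 * pi)) = 1"
    by (metis cis_multiple_2pi mult.commute Ints_of_int)
  ultimately show ?thesis using False by simp
qed

text \<open>Orthogonality of the characters. The nonnegative integral over a half-open period
  matches the form in which \<mu> is given by a density, so both integrals can be compared pointwise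
  under the integral sign.\<close>

lemma parseval_circle:
  fixes p :: "complex poly"
  assumes "degree p < N"
  shows "(\<integral>\<^sup>+ t. ennreal ((cmod (poly p (cis t)))\<^sup>2) * indicator {0..<2*pi} t \<partial>lborel)
       = ennreal (2 * pi * (\<Sum>j<N. (cmod (coeff p j))\<^sup>2))"
proof -
  define c where "c = coeff p"
  have p: "poly p z = (\<Sum>j<N. c j * z ^ j)" for z
  proof -
    have "poly p z = (\<Sum>j\<le>degree p. c j * z ^ j)" by (simp add: poly_altdef c_def)
    also have "\<dots> = (\<Sum>j<N. c j * z ^ j)"
      using assms by (intro sum.mono_neutral_left) (auto simp: c_def coeff_eq_0)
    finally show ?thesis .
  qed
  have expand: "complex_of_real ((cmod (poly p (cis t)))\<^sup>2)
      = (\<Sum>j<N. \<Sum>k<N. (c j * cnj (c k)) * cis (of_int (int j - int k) * t))" for t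
  proof -
    have "complex_of_real ((cmod (poly p (cis t)))\<^sup>2) = poly p (cis t) * cnj (poly p (cis t))"
      by (rule complex_norm_square)
    also have "\<dots> = (\<Sum>j<N. \<Sum>k<N. c j * cis t ^ j * cnj (c k * cis t ^ k))"
      by (simp only: p cnj_sum sum_product)
    also have "(\<Sum>j<N. \<Sum>k<N. c j * cis t ^ j * cnj (c k * cis t ^ k)) = (\<Sum>j<N. \<Sum>k<N. (c j * cnj (c k)) * cis (of_int (int j - int k) * t))"
    proof (intro sum.cong refl)
      fix j k
      have 1: "cis t ^ j = cis (real j * t)" "cis t ^ k = cis (real k * t)"
        by (rule Complex.DeMoivre)+
      have "cis t ^ j * cnj (cis t ^ k) = cis (of_int (int j - int k) * t)"
        unfolding 1 cis_cnj cis_mult by (simp add: left_diff_distrib)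
      moreover have "c j * cis t ^ j * cnj (c k * cis t ^ k) = c j * cnj (c k) * (cis t ^ j * cnj (cis t ^ k))"
        by (simp only: complex_cnj_mult mult_ac)
      ultimately show "c j * cis t ^ j * cnj (c k * cis t ^ k) = c j * cnj (c k) * cis (of_int (int j - int k) * t)"
        by (simp only:)
    qed
    finally show ?thesis .
  qed
  have "((\<lambda>t. complex_of_real ((cmod (poly p (cis t)))\<^sup>2)) has_integral
     (\<Sum>j<N. \<Sum>k<N. (c j * cnj (c k)) * (if int j - int k = 0 then of_real (2 * pi) else 0))) {0..2*pi}"
    unfolding expand by (intro has_integral_sum has_integral_mult_right has_integral_cis_int finite_lessThan)
  also have "(\<Sum>j<N. \<Sum>k<N. (c j * cnj (c k)) * (if int j - int k = 0 then of_real (2 * pi) else 0))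
     = (\<Sum>j<N. \<Sum>k<N. if k = j then (c j * cnj (c j)) * of_real (2 * pi) else 0)"
    by (intro sum.cong refl) auto
  also have "\<dots> = complex_of_real (2 * pi * (\<Sum>j<N. (cmod (c j))\<^sup>2))"
  proof -
    have "(\<Sum>j<N. \<Sum>k<N. if k = j then (c j * cnj (c j)) * of_real (2 * pi) else 0)
        = (\<Sum>j<N. complex_of_real (2 * pi * (cmod (c j))\<^sup>2))"
      by (intro sum.cong refl) (simp only: sum.delta finite_lessThan lessThan_iff if_True, simp add: complex_norm_square[symmetric] mult_ac flip: of_real_power)
    then show ?thesis by (simp only: of_real_sum[symmetric] sum_distrib_left)
  qed
  finally have hi: "((\<lambda>t. complex_of_real ((cmod (poly p (cis t)))\<^sup>2)) has_integral
      complex_of_real (2 * pi * (\<Sum>j<N. (cmod (c j))\<^sup>2))) {0..2*pi}" .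
  have "((\<lambda>t. (cmod (poly p (cis t)))\<^sup>2) has_integral (2 * pi * (\<Sum>j<N. (cmod (c j))\<^sup>2))) {0..2*pi}"
    using has_integral_linear[OF hi bounded_linear_Re] by (simp only: o_def Re_complex_of_real)
  then have "((\<lambda>t. if t \<in> {0..2*pi} then (cmod (poly p (cis t)))\<^sup>2 else 0) has_integral (2 * pi * (\<Sum>j<N. (cmod (c j))\<^sup>2))) UNIV"
    by (simp only: has_integral_restrict_UNIV)
  moreover have meas: "(\<lambda>t. if t \<in> {0..2*pi} then (cmod (poly p (cis t)))\<^sup>2 else 0) \<in> borel_measurable borel"
    by (intro measurable_If borel_measurable_continuous_onI continuous_intros) auto
  ultimately have "(\<integral>\<^sup>+ t. ennreal (if t \<in> {0..2*pi} then (cmod (poly p (cis t)))\<^sup>2 else 0) \<partial>lborel)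
      = ennreal (2 * pi * (\<Sum>j<N. (cmod (c j))\<^sup>2))"
    by (intro nn_integral_has_integral_lborel meas) auto
  moreover have "(\<integral>\<^sup>+ t. ennreal (if t \<in> {0..2*pi} then (cmod (poly p (cis t)))\<^sup>2 else 0) \<partial>lborel)
     = (\<integral>\<^sup>+ t. ennreal ((cmod (poly p (cis t)))\<^sup>2) * indicator {0..<2*pi} t \<partial>lborel)"
    using AE_lborel_singleton[of "2*pi"]
    by (intro nn_integral_cong_AE) (auto elim!: eventually_mono simp: indicator_def)
  ultimately show ?thesis by (simp add: c_def)
qed

text \<open>Cauchy-Schwarz in the coefficients: together with Parseval, this carries a mean-square
  bound on the circle to single points off the circle.\<close>

lemma poly_eval_bound:
  fixes c :: "nat \<Rightarrow> complex"
  shows "(cmod (\<Sum>j<N. c j * z ^ j))\<^sup>2 \<le> (\<Sum>j<N. (cmod (c j))\<^sup>2) * (\<Sum>j<N. (cmod z) ^ (2*j))"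
proof -
  have "(cmod (\<Sum>j<N. c j * z ^ j))\<^sup>2 \<le> (\<Sum>j<N. cmod (c j) * cmod z ^ j)\<^sup>2"
    by (intro power_mono order_trans[OF norm_sum]) (auto simp: norm_mult norm_power)
  also have "\<dots> \<le> (\<Sum>j<N. (cmod (c j))\<^sup>2) * (\<Sum>j<N. (cmod z ^ j)\<^sup>2)"
    by (rule Cauchy_Schwarz_ineq_sum)
  finally show ?thesis by (simp add: power_mult[symmetric] mult.commute)
qed

text \<open>The parameter of a circle, normalised to mass 1 so that means over circles are
  expectations and combine with other probability measures by Fubini.\<close>

definition unitI :: "real measure" where "unitI = restrict_space lborel {0..1}"

lemma sets_unitI: "sets unitI = sets (restrict_space borel {0..1})"
  by (simp add: unitI_def sets_restrict_space)

lemma space_unitI [simp]: "space unitI = {0..1}"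
  by (simp add: unitI_def space_restrict_space)

lemma measurable_unitI [measurable_dest]: "f \<in> borel_measurable borel \<Longrightarrow> f \<in> borel_measurable unitI"
  unfolding unitI_def by (simp add: measurable_restrict_space1)

lemma prob_space_unitI: "prob_space unitI"
  by (rule prob_spaceI) (simp add: unitI_def emeasure_restrict_space space_restrict_space)

lemma has_bochner_integral_unitI:
  fixes f :: "real \<Rightarrow> 'a::euclidean_space"
  assumes "continuous_on {0..1} f" "(f has_integral x) {0..1}"
  shows "integrable unitI f" "integral\<^sup>L unitI f = x"
proof -
  have si: "set_integrable lborel {0..1} f" by (rule borel_integrable_atLeastAtMost') (rule assms)
  then show "integrable unitI f"
    unfolding unitI_def by (subst integrable_restrict_space) (auto simp: set_integrable_def)
  have "integral\<^sup>L unitI f = (LINT x:{0..1}|lborel. f x)"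
    unfolding unitI_def by (subst integral_restrict_space) (auto simp: set_lebesgue_integral_def)
  also have "\<dots> = x" using set_borel_integral_eq_integral(2)[OF si] assms(2) by (simp add: integral_unique)
  finally show "integral\<^sup>L unitI f = x" .
qed

text \<open>A zero-free function has a holomorphic logarithm on the contractible closed disc;
  Cauchy's formula gives that logarithm at the centre, and the real part is the claim.\<close>

lemma circle_mean_log:
  assumes hol: "f holomorphic_on UNIV" and nz: "\<And>w. cmod w \<le> 1 \<Longrightarrow> f w \<noteq> 0"
  shows "integrable unitI (\<lambda>t. ln (cmod (f (cis (2*pi*t)))))"
    and "(LINT t|unitI. ln (cmod (f (cis (2*pi*t))))) = ln (cmod (f 0))"
proof -
  have "contractible (cball (0::complex) 1)" by (simp add: convex_imp_contractible)
  then obtain g where g: "g holomorphic_on cball 0 1" "\<And>z. z \<in> cball 0 1 \<Longrightarrow> f z = exp (g z)"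
    using contractible_imp_holomorphic_log[of f "cball 0 1"] hol nz
    by (metis holomorphic_on_subset subset_UNIV mem_cball_0)
  have lnf: "ln (cmod (f w)) = Re (g w)" if "cmod w \<le> 1" for w
    using g(2)[of w] that by simp
  have cis: "cis (2*pi*t) = exp (2 * of_real pi * \<i> * of_real t)" for t
    by (simp add: cis_conv_exp mult_ac)
  have "((\<lambda>u. g u/(u-0)) has_contour_integral (2 * of_real pi * \<i> * g 0)) (circlepath 0 1)"
    by (rule Cauchy_integral_circlepath_simple) (use g in auto)
  then have "((\<lambda>t. g (circlepath 0 1 t) / (circlepath 0 1 t) * vector_derivative (circlepath 0 1) (at t)) has_integral
      (2 * of_real pi * \<i> * g 0)) {0..1}"
    by (simp add: has_contour_integral)
  then have "((\<lambda>t. (2 * of_real pi * \<i>) * g (cis (2*pi*t))) has_integral (2 * of_real pi * \<i> * g 0)) {0..1}"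
    by (rule has_integral_eq[rotated]) (simp only: vector_derivative_circlepath, simp add: circlepath cis)
  then have "((\<lambda>t. inverse (2 * of_real pi * \<i>) * ((2 * of_real pi * \<i>) * g (cis (2*pi*t)))) has_integral
     (inverse (2 * of_real pi * \<i>) * (2 * of_real pi * \<i> * g 0))) {0..1}"
    by (rule has_integral_mult_right)
  then have "((\<lambda>t. g (cis (2*pi*t))) has_integral g 0) {0..1}"
    by (simp add: field_simps)
  from has_integral_linear[OF this bounded_linear_Re]
  have hi: "((\<lambda>t. ln (cmod (f (cis (2*pi*t))))) has_integral ln (cmod (f 0))) {0..1}"
    by (simp add: o_def lnf)
  have "continuous_on {0..1} (\<lambda>t. ln (cmod (f (cis (2*pi*t)))))"
    unfolding cis_conv_exp
    by (intro continuous_intros continuous_on_compose2[OF holomorphic_on_imp_continuous_on[OF hol]])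
       (auto simp: nz)
  from has_bochner_integral_unitI[OF this hi]
  show "integrable unitI (\<lambda>t. ln (cmod (f (cis (2*pi*t)))))"
    and "(LINT t|unitI. ln (cmod (f (cis (2*pi*t))))) = ln (cmod (f 0))" .
qed

text \<open>The logarithm as the length of a set of heights. With Fubini, integrals of logarithmic
  singularities reduce to measures of intervals or discs of radius proportional to
  \<open>exp (-h)\<close>.\<close>

lemma layer_cake_ln:
  assumes "u > 0" "u \<le> 1"
  shows "ennreal (- ln u) = (\<integral>\<^sup>+ h. indicator {0..} h * indicator {h. u < exp (-h)} h \<partial>lborel)"
proof -
  have "{h. u < exp (-h)} = {..< - ln u}"
    using assms by (auto simp: less_minus_iff ln_less_cancel_iff[symmetric] simp del: ln_less_cancel_iff)
  then have "(\<integral>\<^sup>+ h. indicator {0..} h * indicator {h. u < exp (-h)} h \<partial>lborel)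
    = (\<integral>\<^sup>+ h. indicator {0..< -ln u} h \<partial>lborel)"
    by (intro nn_integral_cong) (auto simp: indicator_def)
  also have "\<dots> = ennreal (- ln u)" using assms by simp
  finally show ?thesis by simp
qed

lemma nn_integral_exp_Ici:
  assumes "k > 0"
  shows "(\<integral>\<^sup>+ h. ennreal (exp (-k*h)) * indicator {0..} h \<partial>lborel) = ennreal (1 / k)"
proof -
  have "(\<integral>\<^sup>+ h. ennreal (exp (-k*h)) * indicator {0..} h \<partial>lborel) = ennreal (0 - (- exp (-k*0) / k))"
  proof (rule nn_integral_FTC_atLeast)
    show "((\<lambda>h. - exp (-k*h) / k) \<longlongrightarrow> 0) at_top" using assms by real_asymp
    fix x show "DERIV (\<lambda>h. - exp (-k*h) / k) x :> exp (-k*x)"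
      using assms by (auto intro!: derivative_eq_intros)
  qed auto
  then show ?thesis using assms by simp
qed

section \<open>Logarithms of complex linear forms in Gaussian variables\<close>

abbreviation gauss :: "real measure" where "gauss \<equiv> density lborel std_normal_density"

interpretation gauss: prob_space gauss
  by (rule prob_space_normal_density) simp

lemma emeasure_gauss_UNIV [simp]: "emeasure gauss UNIV = 1"
  using gauss.emeasure_space_1 by simp

interpretation gauss2: pair_prob_space gauss gauss ..

text \<open>For nonzero \<open>c\<close> the rotation is a composition of two affine substitutions
  in one variable each, with an exchange of the integrals in between, and the scaling factors
  cancel. For \<open>c = 0\<close> it is a swap of the axes up to signs.\<close>

lemma rotation_lborel2:
  fixes f :: "real \<Rightarrow> real \<Rightarrow> ennreal"
  assumes f [measurable]: "(\<lambda>(x, y). f x y) \<in> borel_measurable (borel \<Otimes>\<^sub>M borel)"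
    and cs: "c\<^sup>2 + s\<^sup>2 = (1::real)"
  shows "(\<integral>\<^sup>+ x. \<integral>\<^sup>+ y. f (c * x - s * y) (s * x + c * y) \<partial>lborel \<partial>lborel) = (\<integral>\<^sup>+ x. \<integral>\<^sup>+ y. f x y \<partial>lborel \<partial>lborel)"
proof (cases "c = 0")
  case False
  have 1: "(c * x - s * ((y - s * x) / c)) = (x - s * y) / c" for x y
  proof -
    have "c * (c * x - s * ((y - s * x) / c)) = (c\<^sup>2 + s\<^sup>2) * x - s * y"
      using False by (simp add: field_simps power2_eq_square)
    then have "c * (c * x - s * ((y - s * x) / c)) = x - s * y" by (simp only: cs mult_1)
    then show ?thesis using False by (metis nonzero_mult_div_cancel_left)
  qed
  have "(\<integral>\<^sup>+ x. \<integral>\<^sup>+ y. f (c * x - s * y) (s * x + c * y) \<partial>lborel \<partial>lborel)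
      = (\<integral>\<^sup>+ x. (\<integral>\<^sup>+ y. ennreal \<bar>1 / c\<bar> * f ((x - s * y) / c) y \<partial>lborel) \<partial>lborel)"
  proof (rule nn_integral_cong)
    fix x
    have "(\<integral>\<^sup>+ y. f (c * x - s * y) (s * x + c * y) \<partial>lborel)
       = ennreal \<bar>1 / c\<bar> * (\<integral>\<^sup>+ y. f (c * x - s * (- s * x / c + 1 / c * y)) (s * x + c * (- s * x / c + 1 / c * y)) \<partial>lborel)"
      using False by (subst nn_integral_real_affine[where c = "1 / c" and t = "- s * x / c"]) auto
    also have "(\<lambda>y. f (c * x - s * (- s * x / c + 1 / c * y)) (s * x + c * (- s * x / c + 1 / c * y)))
      = (\<lambda>y. f ((x - s * y) / c) y)"
    proof
      fix y
      have "- s * x / c + 1 / c * y = (y - s * x) / c" by (simp add: diff_divide_distrib)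
      moreover have "s * x + c * ((y - s * x) / c) = y" using False by simp
      ultimately show "f (c * x - s * (- s * x / c + 1 / c * y)) (s * x + c * (- s * x / c + 1 / c * y)) = f ((x - s * y) / c) y"
        by (simp only: 1)
    qed
    finally show "(\<integral>\<^sup>+ y. f (c * x - s * y) (s * x + c * y) \<partial>lborel) = (\<integral>\<^sup>+ y. ennreal \<bar>1 / c\<bar> * f ((x - s * y) / c) y \<partial>lborel)"
      by (subst nn_integral_cmult) auto
  qed
  also have "\<dots> = (\<integral>\<^sup>+ y. (\<integral>\<^sup>+ x. ennreal \<bar>1 / c\<bar> * f ((x - s * y) / c) y \<partial>lborel) \<partial>lborel)"
    by (rule lborel_pair.Fubini'[symmetric]) measurable
  also have "\<dots> = (\<integral>\<^sup>+ y. (\<integral>\<^sup>+ x. f x y \<partial>lborel) \<partial>lborel)"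
  proof (rule nn_integral_cong)
    fix y
    have "(\<integral>\<^sup>+ x. f x y \<partial>lborel) = ennreal \<bar>1 / c\<bar> * (\<integral>\<^sup>+ x. f (- s * y / c + 1 / c * x) y \<partial>lborel)"
      using False by (subst nn_integral_real_affine[where c = "1 / c" and t = "- s * y / c"]) auto
    also have "\<dots> = (\<integral>\<^sup>+ x. ennreal \<bar>1 / c\<bar> * f ((x - s * y) / c) y \<partial>lborel)"
      by (subst nn_integral_cmult[symmetric]) (auto simp: diff_divide_distrib)
    finally show "(\<integral>\<^sup>+ x. ennreal \<bar>1 / c\<bar> * f ((x - s * y) / c) y \<partial>lborel) = (\<integral>\<^sup>+ x. f x y \<partial>lborel)" ..
  qed
  also have "\<dots> = (\<integral>\<^sup>+ x. (\<integral>\<^sup>+ y. f x y \<partial>lborel) \<partial>lborel)"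
    by (rule lborel_pair.Fubini') measurable
  finally show ?thesis .
next
  case True
  then have s: "\<bar>s\<bar> = 1" using cs by (simp add: abs_square_eq_1)
  then have s0: "s \<noteq> 0" by auto
  have "(\<integral>\<^sup>+ x. \<integral>\<^sup>+ y. f (c * x - s * y) (s * x + c * y) \<partial>lborel \<partial>lborel) = (\<integral>\<^sup>+ x. \<integral>\<^sup>+ y. f (- s * y) (s * x) \<partial>lborel \<partial>lborel)"
    by (simp add: True)
  also have "\<dots> = (\<integral>\<^sup>+ x. \<integral>\<^sup>+ y. f y (s * x) \<partial>lborel \<partial>lborel)"
  proof (rule nn_integral_cong)
    fix x
    have "(\<integral>\<^sup>+ y. f y (s * x) \<partial>lborel) = ennreal \<bar>- s\<bar> * (\<integral>\<^sup>+ y. f (0 + - s * y) (s * x) \<partial>lborel)"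
      by (rule nn_integral_real_affine) (use s0 in auto)
    then show "(\<integral>\<^sup>+ y. f (- s * y) (s * x) \<partial>lborel) = (\<integral>\<^sup>+ y. f y (s * x) \<partial>lborel)" by (simp add: s)
  qed
  also have "\<dots> = (\<integral>\<^sup>+ x. \<integral>\<^sup>+ y. f y x \<partial>lborel \<partial>lborel)"
  proof -
    have "(\<integral>\<^sup>+ x. \<integral>\<^sup>+ y. f y x \<partial>lborel \<partial>lborel) = ennreal \<bar>s\<bar> * (\<integral>\<^sup>+ x. \<integral>\<^sup>+ y. f y (0 + s * x) \<partial>lborel \<partial>lborel)"
      by (rule nn_integral_real_affine) (use s0 in auto)
    then show ?thesis by (simp add: s)
  qed
  also have "\<dots> = (\<integral>\<^sup>+ x. (\<integral>\<^sup>+ y. f x y \<partial>lborel) \<partial>lborel)"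
    by (rule lborel_pair.Fubini') measurable
  finally show ?thesis .
qed

text \<open>The joint density depends only on x^2 + y^2, so the invariance of planar Lebesgue
  measure carries over.\<close>

lemma rotation_gauss2:
  fixes f :: "real \<Rightarrow> real \<Rightarrow> ennreal"
  assumes f [measurable]: "(\<lambda>(x, y). f x y) \<in> borel_measurable (borel \<Otimes>\<^sub>M borel)"
    and cs: "c\<^sup>2 + s\<^sup>2 = (1::real)"
  shows "(\<integral>\<^sup>+ x. \<integral>\<^sup>+ y. f (c * x - s * y) (s * x + c * y) \<partial>gauss \<partial>gauss) = (\<integral>\<^sup>+ x. \<integral>\<^sup>+ y. f x y \<partial>gauss \<partial>gauss)"
proof -
  have dens: "(\<integral>\<^sup>+ x. \<integral>\<^sup>+ y. g x y \<partial>gauss \<partial>gauss)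
     = (\<integral>\<^sup>+ x. \<integral>\<^sup>+ y. ennreal (1 / (2 * pi) * exp (- (x\<^sup>2 + y\<^sup>2) / 2)) * g x y \<partial>lborel \<partial>lborel)"
    if g [measurable]: "(\<lambda>(x, y). g x y) \<in> borel_measurable (borel \<Otimes>\<^sub>M borel)" for g :: "real \<Rightarrow> real \<Rightarrow> ennreal"
  proof -
    have "(\<integral>\<^sup>+ x. \<integral>\<^sup>+ y. g x y \<partial>gauss \<partial>gauss)
      = (\<integral>\<^sup>+ x. ennreal (std_normal_density x) * (\<integral>\<^sup>+ y. ennreal (std_normal_density y) * g x y \<partial>lborel) \<partial>lborel)"
      by (simp add: nn_integral_density)
    also have "\<dots> = (\<integral>\<^sup>+ x. \<integral>\<^sup>+ y. ennreal (1 / (2 * pi) * exp (- (x\<^sup>2 + y\<^sup>2) / 2)) * g x y \<partial>lborel \<partial>lborel)"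
    proof (rule nn_integral_cong)
      fix x
      have "ennreal (std_normal_density x) * (\<integral>\<^sup>+ y. ennreal (std_normal_density y) * g x y \<partial>lborel)
        = (\<integral>\<^sup>+ y. ennreal (std_normal_density x) * (ennreal (std_normal_density y) * g x y) \<partial>lborel)"
        by (subst nn_integral_cmult) auto
      also have "\<dots> = (\<integral>\<^sup>+ y. ennreal (1 / (2 * pi) * exp (- (x\<^sup>2 + y\<^sup>2) / 2)) * g x y \<partial>lborel)"
      proof (rule nn_integral_cong)
        fix y
        have "std_normal_density x * std_normal_density y = 1 / (2 * pi) * exp (- (x\<^sup>2 + y\<^sup>2) / 2)"
          by (simp add: std_normal_density_def exp_add[symmetric] add_divide_distrib
              real_sqrt_mult[symmetric] del: real_sqrt_mult)
        then show "ennreal (std_normal_density x) * (ennreal (std_normal_density y) * g x y)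
           = ennreal (1 / (2 * pi) * exp (- (x\<^sup>2 + y\<^sup>2) / 2)) * g x y"
          by (simp add: mult.assoc[symmetric] ennreal_mult[symmetric])
      qed
      finally show "ennreal (std_normal_density x) * (\<integral>\<^sup>+ y. ennreal (std_normal_density y) * g x y \<partial>lborel)
        = (\<integral>\<^sup>+ y. ennreal (1 / (2 * pi) * exp (- (x\<^sup>2 + y\<^sup>2) / 2)) * g x y \<partial>lborel)" .
    qed
    finally show ?thesis .
  qed
  have sq: "(c * x - s * y)\<^sup>2 + (s * x + c * y)\<^sup>2 = x\<^sup>2 + y\<^sup>2" for x y
  proof -
    have "(c * x - s * y)\<^sup>2 + (s * x + c * y)\<^sup>2 = (c\<^sup>2 + s\<^sup>2) * (x\<^sup>2 + y\<^sup>2)"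
      by (simp add: power2_eq_square algebra_simps)
    then show ?thesis by (simp add: cs)
  qed
  have "(\<integral>\<^sup>+ x. \<integral>\<^sup>+ y. f (c * x - s * y) (s * x + c * y) \<partial>gauss \<partial>gauss)
    = (\<integral>\<^sup>+ x. \<integral>\<^sup>+ y. (\<lambda>x y. ennreal (1 / (2 * pi) * exp (- (x\<^sup>2 + y\<^sup>2) / 2)) * f x y) (c * x - s * y) (s * x + c * y) \<partial>lborel \<partial>lborel)"
    by (subst dens) (auto simp: sq)
  also have "\<dots> = (\<integral>\<^sup>+ x. \<integral>\<^sup>+ y. ennreal (1 / (2 * pi) * exp (- (x\<^sup>2 + y\<^sup>2) / 2)) * f x y \<partial>lborel \<partial>lborel)"
    by (rule rotation_lborel2) (use cs in auto)
  also have "\<dots> = (\<integral>\<^sup>+ x. \<integral>\<^sup>+ y. f x y \<partial>gauss \<partial>gauss)"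
    by (subst dens) auto
  finally show ?thesis .
qed

lemma rotate_linear_form:
  fixes F :: "complex \<Rightarrow> ennreal"
  assumes [measurable]: "F \<in> borel_measurable borel" and cs: "c\<^sup>2 + s\<^sup>2 = (1::real)"
  shows "(\<integral>\<^sup>+ x. \<integral>\<^sup>+ y. F (p * of_real x + q * of_real y) \<partial>gauss \<partial>gauss)
    = (\<integral>\<^sup>+ x. \<integral>\<^sup>+ y. F ((p * of_real c + q * of_real s) * of_real x + (q * of_real c - p * of_real s) * of_real y) \<partial>gauss \<partial>gauss)"
proof -
  have "(\<integral>\<^sup>+ x. \<integral>\<^sup>+ y. F (p * of_real x + q * of_real y) \<partial>gauss \<partial>gauss)
    = (\<integral>\<^sup>+ x. \<integral>\<^sup>+ y. F (p * of_real (c * x - s * y) + q * of_real (s * x + c * y)) \<partial>gauss \<partial>gauss)"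
    by (rule rotation_gauss2[symmetric, OF _ cs]) measurable
  then show ?thesis by (simp add: algebra_simps)
qed

lemma Givens_rotation: "\<exists>c s::real. c\<^sup>2 + s\<^sup>2 = 1 \<and> b * c - a * s = 0"
proof (cases "a = 0 \<and> b = 0")
  case True
  then show ?thesis by (intro exI[of _ 1] exI[of _ 0]) simp
next
  case False
  then have pos: "a\<^sup>2 + b\<^sup>2 > 0" by (simp add: sum_power2_gt_zero_iff)
  define r where "r = sqrt (a\<^sup>2 + b\<^sup>2)"
  have r: "r\<^sup>2 = a\<^sup>2 + b\<^sup>2" "r\<^sup>2 \<noteq> 0" using pos by (auto simp: r_def)
  have "(a / r)\<^sup>2 + (b / r)\<^sup>2 = r\<^sup>2 / r\<^sup>2" by (simp only: power_divide add_divide_distrib[symmetric] r)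
  then show ?thesis using r(2)
    by (intro exI[of _ "a / r"] exI[of _ "b / r"]) (simp add: mult.commute)
qed

text \<open>A real rotation acts on the pair (p, q) as a real orthogonal matrix, hence preserves
  both p^2 + q^2 and the sum of squared moduli. The angle is chosen to annihilate the imaginary part
  of the second entry. If both entries are real, the same rotation is applied to the real parts
  instead and annihilates the second entry altogether; \<open>a\<close> and \<open>b\<close> encode
  this choice.\<close>

lemma rotate_pair:
  fixes p q :: complex
  obtains p' q' where "Im q' = 0" "p'\<^sup>2 + q'\<^sup>2 = p\<^sup>2 + q\<^sup>2" "(cmod p')\<^sup>2 + (cmod q')\<^sup>2 = (cmod p)\<^sup>2 + (cmod q)\<^sup>2"
    "Im p = 0 \<Longrightarrow> Im q = 0 \<Longrightarrow> q' = 0"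
    "\<And>F. F \<in> borel_measurable borel \<Longrightarrow> (\<integral>\<^sup>+ x. \<integral>\<^sup>+ y. F (p * of_real x + q * of_real y) \<partial>gauss \<partial>gauss)
       = (\<integral>\<^sup>+ x. \<integral>\<^sup>+ y. (F (p' * of_real x + q' * of_real y) :: ennreal) \<partial>gauss \<partial>gauss)"
proof -
  define a where "a = (if Im p = 0 \<and> Im q = 0 then Re p else Im p)"
  define b where "b = (if Im p = 0 \<and> Im q = 0 then Re q else Im q)"
  obtain c s :: real where cs: "c\<^sup>2 + s\<^sup>2 = 1" "b * c - a * s = 0" using Givens_rotation by blast
  have cs': "(of_real c)\<^sup>2 + (of_real s)\<^sup>2 = (1::complex)" using cs(1) by (metis of_real_1 of_real_add of_real_power)
  define p' where "p' = p * of_real c + q * of_real s"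
  define q' where "q' = q * of_real c - p * of_real s"
  show ?thesis
  proof (rule that[of q' p'])
    show "Im q' = 0" using cs(2) by (auto simp: q'_def a_def b_def split: if_splits)
    show "q' = 0" if "Im p = 0" "Im q = 0"
      using cs(2) that by (auto simp: q'_def a_def b_def complex_eq_iff)
    have "p'\<^sup>2 + q'\<^sup>2 = (p\<^sup>2 + q\<^sup>2) * ((of_real c)\<^sup>2 + (of_real s)\<^sup>2)"
      by (simp add: p'_def q'_def power2_eq_square algebra_simps)
    then show "p'\<^sup>2 + q'\<^sup>2 = p\<^sup>2 + q\<^sup>2" by (simp add: cs')
    have "(cmod p')\<^sup>2 + (cmod q')\<^sup>2 = ((cmod p)\<^sup>2 + (cmod q)\<^sup>2) * (c\<^sup>2 + s\<^sup>2)"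
      by (simp only: cmod_power2) (simp add: p'_def q'_def power2_eq_square algebra_simps)
    then show "(cmod p')\<^sup>2 + (cmod q')\<^sup>2 = (cmod p)\<^sup>2 + (cmod q)\<^sup>2" by (simp add: cs)
    show "(\<integral>\<^sup>+ x. \<integral>\<^sup>+ y. F (p * of_real x + q * of_real y) \<partial>gauss \<partial>gauss)
       = (\<integral>\<^sup>+ x. \<integral>\<^sup>+ y. (F (p' * of_real x + q' * of_real y) :: ennreal) \<partial>gauss \<partial>gauss)"
      if "F \<in> borel_measurable borel" for F
      unfolding p'_def q'_def by (rule rotate_linear_form[OF that cs(1)])
  qed
qed

lemma gauss_Fubini:
  fixes f :: "real \<Rightarrow> real \<Rightarrow> ennreal"
  assumes [measurable]: "(\<lambda>(x, y). f x y) \<in> borel_measurable (borel \<Otimes>\<^sub>M borel)"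
  shows "(\<integral>\<^sup>+ x. \<integral>\<^sup>+ y. f x y \<partial>gauss \<partial>gauss) = (\<integral>\<^sup>+ y. \<integral>\<^sup>+ x. f x y \<partial>gauss \<partial>gauss)"
  by (rule gauss2.Fubini') (use assms in \<open>simp cong: measurable_cong_sets sets_pair_measure_cong\<close>)

text \<open>The real and imaginary parts of three complex coefficients are two vectors in 3-space,
  so some rotation removes a third coordinate. It is built from plane rotations: make
  \<open>r1\<close> real, make \<open>q2\<close> real, then rotate these two real entries into
  one.\<close>

lemma rotate_triple:
  fixes p q r :: complex
  obtains p' q' where "p'\<^sup>2 + q'\<^sup>2 = p\<^sup>2 + q\<^sup>2 + r\<^sup>2" "(cmod p')\<^sup>2 + (cmod q')\<^sup>2 = (cmod p)\<^sup>2 + (cmod q)\<^sup>2 + (cmod r)\<^sup>2"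
    "\<And>F. F \<in> borel_measurable borel \<Longrightarrow> (\<integral>\<^sup>+ x. \<integral>\<^sup>+ y. \<integral>\<^sup>+ z. F (p * of_real x + (q * of_real y + r * of_real z)) \<partial>gauss \<partial>gauss \<partial>gauss)
       = (\<integral>\<^sup>+ x. \<integral>\<^sup>+ y. (F (p' * of_real x + q' * of_real y) :: ennreal) \<partial>gauss \<partial>gauss)"
proof -
  obtain q1 r1 where 1: "Im r1 = 0" "q1\<^sup>2 + r1\<^sup>2 = q\<^sup>2 + r\<^sup>2" "(cmod q1)\<^sup>2 + (cmod r1)\<^sup>2 = (cmod q)\<^sup>2 + (cmod r)\<^sup>2"
    "\<And>F. F \<in> borel_measurable borel \<Longrightarrow> (\<integral>\<^sup>+ x. \<integral>\<^sup>+ y. F (q * of_real x + r * of_real y) \<partial>gauss \<partial>gauss)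
       = (\<integral>\<^sup>+ x. \<integral>\<^sup>+ y. (F (q1 * of_real x + r1 * of_real y) :: ennreal) \<partial>gauss \<partial>gauss)"
    by (rule rotate_pair[of q r]) blast
  obtain p2 q2 where 2: "Im q2 = 0" "p2\<^sup>2 + q2\<^sup>2 = p\<^sup>2 + q1\<^sup>2" "(cmod p2)\<^sup>2 + (cmod q2)\<^sup>2 = (cmod p)\<^sup>2 + (cmod q1)\<^sup>2"
    "\<And>F. F \<in> borel_measurable borel \<Longrightarrow> (\<integral>\<^sup>+ x. \<integral>\<^sup>+ y. F (p * of_real x + q1 * of_real y) \<partial>gauss \<partial>gauss)
       = (\<integral>\<^sup>+ x. \<integral>\<^sup>+ y. (F (p2 * of_real x + q2 * of_real y) :: ennreal) \<partial>gauss \<partial>gauss)"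
    by (rule rotate_pair[of p q1]) blast
  obtain q3 r3 where 3: "Im r3 = 0" "q3\<^sup>2 + r3\<^sup>2 = q2\<^sup>2 + r1\<^sup>2" "(cmod q3)\<^sup>2 + (cmod r3)\<^sup>2 = (cmod q2)\<^sup>2 + (cmod r1)\<^sup>2"
    "Im q2 = 0 \<Longrightarrow> Im r1 = 0 \<Longrightarrow> r3 = 0"
    "\<And>F. F \<in> borel_measurable borel \<Longrightarrow> (\<integral>\<^sup>+ x. \<integral>\<^sup>+ y. F (q2 * of_real x + r1 * of_real y) \<partial>gauss \<partial>gauss)
       = (\<integral>\<^sup>+ x. \<integral>\<^sup>+ y. (F (q3 * of_real x + r3 * of_real y) :: ennreal) \<partial>gauss \<partial>gauss)"
    by (rule rotate_pair[of q2 r1]) blast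
  have r3: "r3 = 0" using 3(4) 2(1) 1(1) by simp
  show ?thesis
  proof (rule that[of p2 q3])
    show "p2\<^sup>2 + q3\<^sup>2 = p\<^sup>2 + q\<^sup>2 + r\<^sup>2" 
    proof -
      have "q3\<^sup>2 = q2\<^sup>2 + r1\<^sup>2" using 3(2) r3 by simp
      then show ?thesis using 1(2) 2(2) by (metis add.assoc)
    qed
    show "(cmod p2)\<^sup>2 + (cmod q3)\<^sup>2 = (cmod p)\<^sup>2 + (cmod q)\<^sup>2 + (cmod r)\<^sup>2" 
      using 1(3) 2(3) 3(3) unfolding r3 by (simp only: norm_zero power_zero_numeral)
    fix F :: "complex \<Rightarrow> ennreal" assume F [measurable]: "F \<in> borel_measurable borel"
    have "(\<integral>\<^sup>+ x. \<integral>\<^sup>+ y. \<integral>\<^sup>+ z. F (p * of_real x + (q * of_real y + r * of_real z)) \<partial>gauss \<partial>gauss \<partial>gauss)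
      = (\<integral>\<^sup>+ x. \<integral>\<^sup>+ y. \<integral>\<^sup>+ z. F (p * of_real x + (q1 * of_real y + r1 * of_real z)) \<partial>gauss \<partial>gauss \<partial>gauss)"
      by (intro nn_integral_cong 1(4)) measurable
    also have "\<dots> = (\<integral>\<^sup>+ x. \<integral>\<^sup>+ z. \<integral>\<^sup>+ y. F ((p * of_real x + q1 * of_real y) + r1 * of_real z) \<partial>gauss \<partial>gauss \<partial>gauss)"
      by (subst gauss_Fubini) (auto simp: add.assoc)
    also have "\<dots> = (\<integral>\<^sup>+ z. \<integral>\<^sup>+ x. \<integral>\<^sup>+ y. F ((p * of_real x + q1 * of_real y) + r1 * of_real z) \<partial>gauss \<partial>gauss \<partial>gauss)"
      by (rule gauss_Fubini) measurable
    also have "\<dots> = (\<integral>\<^sup>+ z. \<integral>\<^sup>+ x. \<integral>\<^sup>+ y. F ((p2 * of_real x + q2 * of_real y) + r1 * of_real z) \<partial>gauss \<partial>gauss \<partial>gauss)"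
      by (intro nn_integral_cong 2(4)[of "\<lambda>w. F (w + r1 * of_real z)" for z]) measurable
    also have "\<dots> = (\<integral>\<^sup>+ x. \<integral>\<^sup>+ z. \<integral>\<^sup>+ y. F ((p2 * of_real x + q2 * of_real y) + r1 * of_real z) \<partial>gauss \<partial>gauss \<partial>gauss)"
      by (rule gauss_Fubini) measurable
    also have "\<dots> = (\<integral>\<^sup>+ x. \<integral>\<^sup>+ y. \<integral>\<^sup>+ z. F (p2 * of_real x + (q2 * of_real y + r1 * of_real z)) \<partial>gauss \<partial>gauss \<partial>gauss)"
      by (subst gauss_Fubini) (auto simp: add.assoc)
    also have "\<dots> = (\<integral>\<^sup>+ x. \<integral>\<^sup>+ y. \<integral>\<^sup>+ z. F (p2 * of_real x + (q3 * of_real y + r3 * of_real z)) \<partial>gauss \<partial>gauss \<partial>gauss)"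
      by (intro nn_integral_cong 3(5)) measurable
    also have "\<dots> = (\<integral>\<^sup>+ x. \<integral>\<^sup>+ y. F (p2 * of_real x + q3 * of_real y) \<partial>gauss \<partial>gauss)"
      by (simp add: r3 gauss.emeasure_space_1)
    finally show "(\<integral>\<^sup>+ x. \<integral>\<^sup>+ y. \<integral>\<^sup>+ z. F (p * of_real x + (q * of_real y + r * of_real z)) \<partial>gauss \<partial>gauss \<partial>gauss) = \<dots>" .
  qed
qed

interpretation gauss_prod: product_sigma_finite "\<lambda>_::nat. gauss" ..

text \<open>Givens rotations reduce a complex linear form in \<open>n\<close> Gaussians to one in two Gaussians with the same
  invariants \<open>\<Sum> c\<^sub>i\<^sup>2\<close> and \<open>\<Sum> \<bar>c\<^sub>i\<bar>\<^sup>2\<close>.\<close>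

lemma PiM_gauss_linear_form:
  fixes c :: "nat \<Rightarrow> complex"
  shows "\<exists>p q. p\<^sup>2 + q\<^sup>2 = (\<Sum>i<n. (c i)\<^sup>2) \<and> (cmod p)\<^sup>2 + (cmod q)\<^sup>2 = (\<Sum>i<n. (cmod (c i))\<^sup>2) \<and>
    (\<forall>F \<in> borel_measurable borel. (\<integral>\<^sup>+ x. F (\<Sum>i<n. c i * of_real (x i)) \<partial>Pi\<^sub>M {..<n} (\<lambda>_. gauss))
       = (\<integral>\<^sup>+ x. \<integral>\<^sup>+ y. (F (p * of_real x + q * of_real y) :: ennreal) \<partial>gauss \<partial>gauss))"
proof (induction n)
  case 0
  show ?case
    by (intro exI[of _ 0] conjI ballI) (auto simp: PiM_empty nn_integral_count_space_finite gauss.emeasure_space_1 max_def)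
next
  case (Suc n)
  then obtain p q where pq: "p\<^sup>2 + q\<^sup>2 = (\<Sum>i<n. (c i)\<^sup>2)" "(cmod p)\<^sup>2 + (cmod q)\<^sup>2 = (\<Sum>i<n. (cmod (c i))\<^sup>2)"
    "\<And>F. F \<in> borel_measurable borel \<Longrightarrow> (\<integral>\<^sup>+ x. F (\<Sum>i<n. c i * of_real (x i)) \<partial>Pi\<^sub>M {..<n} (\<lambda>_. gauss))
       = (\<integral>\<^sup>+ x. \<integral>\<^sup>+ y. (F (p * of_real x + q * of_real y) :: ennreal) \<partial>gauss \<partial>gauss)" by blast
  obtain p' q' where pq': "p'\<^sup>2 + q'\<^sup>2 = (c n)\<^sup>2 + p\<^sup>2 + q\<^sup>2" "(cmod p')\<^sup>2 + (cmod q')\<^sup>2 = (cmod (c n))\<^sup>2 + (cmod p)\<^sup>2 + (cmod q)\<^sup>2"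
    "\<And>F. F \<in> borel_measurable borel \<Longrightarrow> (\<integral>\<^sup>+ x. \<integral>\<^sup>+ y. \<integral>\<^sup>+ z. F (c n * of_real x + (p * of_real y + q * of_real z)) \<partial>gauss \<partial>gauss \<partial>gauss)
       = (\<integral>\<^sup>+ x. \<integral>\<^sup>+ y. (F (p' * of_real x + q' * of_real y) :: ennreal) \<partial>gauss \<partial>gauss)"
    by (rule rotate_triple[of "c n" p q]) blast
  show ?case
  proof (rule exI[of _ p'], rule exI[of _ q'], intro conjI ballI)
    show "p'\<^sup>2 + q'\<^sup>2 = (\<Sum>i<Suc n. (c i)\<^sup>2)" using pq'(1) pq(1) by (simp add: algebra_simps)
    show "(cmod p')\<^sup>2 + (cmod q')\<^sup>2 = (\<Sum>i<Suc n. (cmod (c i))\<^sup>2)" using pq'(2) pq(2) by simp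
    fix F :: "complex \<Rightarrow> ennreal" assume F [measurable]: "F \<in> borel_measurable borel"
    have sets: "sets (Pi\<^sub>M I (\<lambda>_. gauss)) = sets (Pi\<^sub>M I (\<lambda>_. borel))" for I :: "nat set"
      by (rule sets_PiM_cong) auto
    have "(\<integral>\<^sup>+ x. F (\<Sum>i<Suc n. c i * of_real (x i)) \<partial>Pi\<^sub>M {..<Suc n} (\<lambda>_. gauss))
      = (\<integral>\<^sup>+ y. \<integral>\<^sup>+ x. F (\<Sum>i<Suc n. c i * of_real ((x(n := y)) i)) \<partial>Pi\<^sub>M {..<n} (\<lambda>_. gauss) \<partial>gauss)"
      unfolding lessThan_Suc
    proof (rule gauss_prod.product_nn_integral_insert_rev)
      show "(\<lambda>x. F (\<Sum>i\<in>insert n {..<n}. c i * of_real (x i))) \<in> borel_measurable (Pi\<^sub>M (insert n {..<n}) (\<lambda>_. gauss))"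
        unfolding measurable_cong_sets[OF sets refl] by measurable
    qed auto
    also have "\<dots> = (\<integral>\<^sup>+ y. \<integral>\<^sup>+ x. F (c n * of_real y + (\<Sum>i<n. c i * of_real (x i))) \<partial>Pi\<^sub>M {..<n} (\<lambda>_. gauss) \<partial>gauss)"
      by (intro nn_integral_cong) (simp add: add.commute)
    also have "\<dots> = (\<integral>\<^sup>+ y. \<integral>\<^sup>+ x. \<integral>\<^sup>+ z. F (c n * of_real y + (p * of_real x + q * of_real z)) \<partial>gauss \<partial>gauss \<partial>gauss)"
      by (intro nn_integral_cong pq(3)) measurable
    also have "\<dots> = (\<integral>\<^sup>+ x. \<integral>\<^sup>+ y. F (p' * of_real x + q' * of_real y) \<partial>gauss \<partial>gauss)"
      by (rule pq'(3)) measurable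
    finally show "(\<integral>\<^sup>+ x. F (\<Sum>i<Suc n. c i * of_real (x i)) \<partial>Pi\<^sub>M {..<Suc n} (\<lambda>_. gauss)) = \<dots>" .
  qed
qed

section \<open>The standard complex Gaussian and its logarithm\<close>

text \<open>Real and imaginary part both have variance 1, so the mean of |z|^2 is 2. This
  normalisation causes the denominators 2 and 4 in the coefficients of linear forms below.\<close>

definition gaussc :: "complex measure" where
  "gaussc = distr (gauss \<Otimes>\<^sub>M gauss) borel (\<lambda>(x, y). Complex x y)"

lemma sets_gaussc [measurable_cong]: "sets gaussc = sets borel"
  by (simp add: gaussc_def)

lemma sets_gauss_pair: "sets (gauss \<Otimes>\<^sub>M gauss) = sets (borel \<Otimes>\<^sub>M borel)"
  by (rule sets_pair_measure_cong) auto

lemma measurable_Complex: "(\<lambda>(x, y). Complex x y) \<in> borel_measurable (borel \<Otimes>\<^sub>M borel)"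
  unfolding Complex_eq by measurable

lemma measurable_Complex_gauss: "(\<lambda>(x, y). Complex x y) \<in> borel_measurable (gauss \<Otimes>\<^sub>M gauss)"
  unfolding measurable_cong_sets[OF sets_gauss_pair refl] by (rule measurable_Complex)

interpretation gaussc: prob_space gaussc
  unfolding gaussc_def by (rule gauss2.prob_space_distr) (rule measurable_Complex_gauss)

lemma nn_integral_gaussc:
  assumes [measurable]: "F \<in> borel_measurable borel"
  shows "(\<integral>\<^sup>+ z. F z \<partial>gaussc) = (\<integral>\<^sup>+ x. \<integral>\<^sup>+ y. F (Complex x y) \<partial>gauss \<partial>gauss)"
proof -
  have [measurable]: "(\<lambda>(x, y). Complex x y) \<in> borel_measurable (gauss \<Otimes>\<^sub>M gauss)" by (rule measurable_Complex_gauss)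
  have "(\<integral>\<^sup>+ z. F z \<partial>gaussc) = (\<integral>\<^sup>+ xy. F (case xy of (x, y) \<Rightarrow> Complex x y) \<partial>(gauss \<Otimes>\<^sub>M gauss))"
    unfolding gaussc_def by (rule nn_integral_distr) measurable
  also have "\<dots> = (\<integral>\<^sup>+ x. \<integral>\<^sup>+ y. F (Complex x y) \<partial>gauss \<partial>gauss)"
    by (subst gauss.nn_integral_fst[symmetric]) (auto)
  finally show ?thesis .
qed

lemma gaussc_rotate: "distr gaussc borel (\<lambda>z. cis \<phi> * z) = gaussc"
proof (rule measure_eqI)
  show "sets (distr gaussc borel (\<lambda>z. cis \<phi> * z)) = sets gaussc" by (simp add: sets_gaussc)
  fix A assume "A \<in> sets (distr gaussc borel (\<lambda>z. cis \<phi> * z))"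
  then have A [measurable]: "A \<in> sets borel" by simp
  have "emeasure (distr gaussc borel (\<lambda>z. cis \<phi> * z)) A = (\<integral>\<^sup>+ z. indicator A z \<partial>distr gaussc borel (\<lambda>z. cis \<phi> * z))"
    by simp
  also have "\<dots> = (\<integral>\<^sup>+ z. indicator A (cis \<phi> * z) \<partial>gaussc)"
    by (rule nn_integral_distr) measurable
  also have "\<dots> = (\<integral>\<^sup>+ x. \<integral>\<^sup>+ y. indicator A (cis \<phi> * Complex x y) \<partial>gauss \<partial>gauss)"
    by (rule nn_integral_gaussc) measurable
  also have "\<dots> = (\<integral>\<^sup>+ x. \<integral>\<^sup>+ y. indicator A (Complex (cos \<phi> * x - sin \<phi> * y) (sin \<phi> * x + cos \<phi> * y)) \<partial>gauss \<partial>gauss)"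
    by (intro nn_integral_cong arg_cong[where f = "indicator A"]) (simp add: complex_eq_iff)
  also have "\<dots> = (\<integral>\<^sup>+ x. \<integral>\<^sup>+ y. indicator A (Complex x y) \<partial>gauss \<partial>gauss)"
    by (rule rotation_gauss2[of "\<lambda>x y. indicator A (Complex x y)"]) (auto simp: Complex_eq)
  also have "\<dots> = emeasure gaussc A"
    by (subst nn_integral_gaussc[symmetric]) (auto simp: sets_gaussc)
  finally show "emeasure (distr gaussc borel (\<lambda>z. cis \<phi> * z)) A = emeasure gaussc A" .
qed

text \<open>Stronger than almost sure nonvanishing of \<open>z\<close>: the bound of
  \<open>ln (cmod z)\<close> from below by \<open>ln \<bar>Re z\<bar>\<close> needs the real part
  itself to be nonzero.\<close>

lemma gaussc_AE_Re_nonzero: "AE z in gaussc. Re z \<noteq> 0"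
proof -
  have "AE x in lborel. x \<noteq> (0::real)" by (rule AE_lborel_singleton)
  then have "AE x in gauss. x \<noteq> 0" by (subst AE_density) auto
  then have "emeasure gauss {x. \<not> x \<noteq> 0} = 0" by (subst (asm) AE_iff_measurable[OF _ refl]) auto
  then have z: "emeasure gauss {0} = 0" by simp
  have "emeasure gaussc {z. \<not> Re z \<noteq> 0} = (\<integral>\<^sup>+ z. indicator {z. Re z = 0} z \<partial>gaussc)" by (simp add: sets_gaussc)
  also have "\<dots> = (\<integral>\<^sup>+ x. \<integral>\<^sup>+ y. indicator {0} x \<partial>gauss \<partial>gauss)"
    by (subst nn_integral_gaussc) (auto intro!: nn_integral_cong simp: indicator_def)
  also have "\<dots> = 0" by (simp add: gauss.emeasure_space_1 z)
  finally show ?thesis by (subst AE_iff_measurable[OF _ refl]) (auto simp: sets_gaussc sets_eq_imp_space_eq[OF sets_gaussc])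
qed

lemma nn_integral_minus_ln:
  "(\<integral>\<^sup>+ (x::real). (if 0 < \<bar>x\<bar> \<and> \<bar>x\<bar> \<le> 1 then ennreal (- ln \<bar>x\<bar>) else 0) \<partial>lborel) \<le> 2"
proof -
  have "(\<integral>\<^sup>+ (x::real). (if 0 < \<bar>x\<bar> \<and> \<bar>x\<bar> \<le> 1 then ennreal (- ln \<bar>x\<bar>) else 0) \<partial>lborel)
    \<le> (\<integral>\<^sup>+ (x::real). \<integral>\<^sup>+ h. indicator {0..} h * indicator {(x, h). \<bar>x\<bar> < exp (-h)} (x, h) \<partial>lborel \<partial>lborel)"
  proof (rule nn_integral_mono)
    fix x :: real
    show "(if 0 < \<bar>x\<bar> \<and> \<bar>x\<bar> \<le> 1 then ennreal (- ln \<bar>x\<bar>) else 0)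
      \<le> (\<integral>\<^sup>+ h. indicator {0..} h * indicator {(x, h). \<bar>x\<bar> < exp (-h)} (x, h) \<partial>lborel)"
      using layer_cake_ln[of "\<bar>x\<bar>"] by (auto simp: indicator_def)
  qed
  also have "\<dots> = (\<integral>\<^sup>+ h. \<integral>\<^sup>+ (x::real). indicator {0..} h * indicator {(x, h). \<bar>x\<bar> < exp (-h)} (x, h) \<partial>lborel \<partial>lborel)"
    by (rule lborel_pair.Fubini'[symmetric]) measurable
  also have "\<dots> = (\<integral>\<^sup>+ h. 2 * (ennreal (exp (-1 * h)) * indicator {0..} h) \<partial>lborel)"
  proof (rule nn_integral_cong)
    fix h :: real
    have "(\<integral>\<^sup>+ x. indicator {0..} h * indicator {(x, h). \<bar>x\<bar> < exp (-h)} (x, h) \<partial>lborel)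
      = indicator {0..} h * (\<integral>\<^sup>+ x. indicator {- exp (-h) <..< exp (-h)} x \<partial>lborel)"
      by (subst nn_integral_cmult[symmetric]) (auto simp: indicator_def intro!: nn_integral_cong)
    also have "(\<integral>\<^sup>+ x. indicator {- exp (-h) <..< exp (-h)} x \<partial>lborel) = ennreal (2 * exp (-h))"
      by simp
    finally show "(\<integral>\<^sup>+ x. indicator {0..} h * indicator {(x, h). \<bar>x\<bar> < exp (-h)} (x, h) \<partial>lborel) = 2 * (ennreal (exp (-1 * h)) * indicator {0..} h)"
      by (simp add: ennreal_mult mult_ac)
  qed
  also have "\<dots> = 2 * ennreal (1 / 1)"
    by (subst nn_integral_cmult) (simp, simp only: nn_integral_exp_Ici[OF zero_less_one])
  finally show ?thesis by simp
qed

text \<open>Inside the unit disc the logarithm is dominated by the one-dimensional singularity - ln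
  |Re z|, integrable because the Gaussian density is at most 1; outside it is dominated by |Re z| +
  |Im z|, which has a finite mean.\<close>

lemma gaussc_ln_integrable: "integrable gaussc (\<lambda>z. ln (cmod z))"
proof (rule integrableI_bounded)
  show "(\<lambda>z. ln (cmod z)) \<in> borel_measurable gaussc" by measurable
  define g where "g = (\<lambda>x::real. if 0 < \<bar>x\<bar> \<and> \<bar>x\<bar> \<le> 1 then ennreal (- ln \<bar>x\<bar>) else 0)"
  have [measurable]: "g \<in> borel_measurable borel" unfolding g_def by measurable
  have "integrable lborel (\<lambda>x. std_normal_density x * \<bar>x\<bar> ^ 1)" by (rule integrable_std_normal_moment_abs)
  then have fin: "(\<integral>\<^sup>+ x. ennreal \<bar>x\<bar> \<partial>gauss) < \<infinity>"
    by (subst nn_integral_density) (auto simp: integrable_iff_bounded ennreal_mult[symmetric])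
  have "(\<integral>\<^sup>+ x. g x \<partial>gauss) = (\<integral>\<^sup>+ x. ennreal (std_normal_density x) * g x \<partial>lborel)"
    by (subst nn_integral_density) auto
  also have "\<dots> \<le> (\<integral>\<^sup>+ x. 1 * g x \<partial>lborel)"
  proof (intro nn_integral_mono mult_right_mono)
    fix x :: real
    have "1 / sqrt (2 * pi) * exp (- x\<^sup>2 / 2) \<le> 1 * 1"
      by (intro mult_mono) (use pi_gt3 in \<open>auto simp: field_simps\<close>)
    then show "ennreal (std_normal_density x) \<le> 1"
      by (simp add: std_normal_density_def ennreal_le_1)
  qed auto
  also have "\<dots> \<le> 2" using nn_integral_minus_ln by (simp add: g_def)
  finally have fin2: "(\<integral>\<^sup>+ x. g x \<partial>gauss) < \<infinity>" by (rule order.strict_trans1) simp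
  have "(\<integral>\<^sup>+ z. ennreal (norm (ln (cmod z))) \<partial>gaussc) \<le> (\<integral>\<^sup>+ z. g (Re z) + (ennreal \<bar>Re z\<bar> + ennreal \<bar>Im z\<bar>) \<partial>gaussc)"
  proof (rule nn_integral_mono_AE)
    show "AE z in gaussc. ennreal (norm (ln (cmod z))) \<le> g (Re z) + (ennreal \<bar>Re z\<bar> + ennreal \<bar>Im z\<bar>)"
      using gaussc_AE_Re_nonzero
    proof eventually_elim
      case (elim z)
      then have z: "0 < \<bar>Re z\<bar>" "\<bar>Re z\<bar> \<le> cmod z" using abs_Re_le_cmod by auto
      show ?case
      proof (cases "cmod z \<le> 1")
        case True
        have "ln \<bar>Re z\<bar> \<le> ln (cmod z)" "ln (cmod z) \<le> 0"
          using z True by (auto intro!: ln_mono ln_le_zero_iff[THEN iffD2])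
        then have "norm (ln (cmod z)) \<le> - ln \<bar>Re z\<bar>" by simp
        then have "ennreal (norm (ln (cmod z))) \<le> g (Re z)" using z True by (auto simp: g_def ennreal_leI)
        then show ?thesis by (rule order_trans) simp
      next
        case False
        then have "0 < cmod z" "1 \<le> cmod z" by linarith+
        then have "norm (ln (cmod z)) \<le> cmod z" using ln_le_minus_one[of "cmod z"] ln_ge_zero[of "cmod z"] by simp
        also have "\<dots> \<le> \<bar>Re z\<bar> + \<bar>Im z\<bar>" by (rule cmod_le)
        finally have "ennreal (norm (ln (cmod z))) \<le> ennreal \<bar>Re z\<bar> + ennreal \<bar>Im z\<bar>"
          by (simp add: ennreal_leI flip: ennreal_plus)
        then show ?thesis by (rule order_trans) simp
      qed
    qed
  qed
  also have "\<dots> = (\<integral>\<^sup>+ x. \<integral>\<^sup>+ y. g x + (ennreal \<bar>x\<bar> + ennreal \<bar>y\<bar>) \<partial>gauss \<partial>gauss)"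
    by (subst nn_integral_gaussc) auto
  also have "\<dots> = (\<integral>\<^sup>+ x. g x \<partial>gauss) + ((\<integral>\<^sup>+ x. ennreal \<bar>x\<bar> \<partial>gauss) + (\<integral>\<^sup>+ x. ennreal \<bar>x\<bar> \<partial>gauss))"
    by (simp add: nn_integral_add gauss.emeasure_space_1)
  also have "\<dots> < \<infinity>" using fin fin2 by simp
  finally show "(\<integral>\<^sup>+ z. ennreal (norm (ln (cmod z))) \<partial>gaussc) < \<infinity>" .
qed

lemma gaussc_AE_nonzero: "AE z in gaussc. z \<noteq> 0"
  using gaussc_AE_Re_nonzero by eventually_elim auto

text \<open>Additive constants common to all evaluation points. The first cancels between a circle
  and its centre; the second enters uniform bounds that justify Fubini.\<close>

definition gauss_log :: real where "gauss_log = (LINT z|gaussc. ln (cmod z))"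
definition gauss_abs_log :: real where "gauss_abs_log = (LINT z|gaussc. \<bar>ln (cmod z)\<bar>)"

lemma gaussc_integrable_rotate:
  assumes [measurable]: "f \<in> borel_measurable borel" and "integrable gaussc f"
  shows "integrable gaussc (\<lambda>z. f (cis \<phi> * z) :: real)"
proof -
  have "integrable (distr gaussc borel (\<lambda>z. cis \<phi> * z)) f" by (simp add: gaussc_rotate assms)
  then show ?thesis by (subst (asm) integrable_distr_eq) auto
qed

lemma gaussc_integral_rotate:
  assumes [measurable]: "f \<in> borel_measurable borel"
  shows "(LINT z|gaussc. f (cis \<phi> * z) :: real) = (LINT z|gaussc. f z)"
proof -
  have "(LINT z|gaussc. f z) = (LINT z|distr gaussc borel (\<lambda>z. cis \<phi> * z). f z)" by (simp add: gaussc_rotate)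
  also have "\<dots> = (LINT z|gaussc. f (cis \<phi> * z))" by (rule integral_distr) auto
  finally show ?thesis ..
qed

text \<open>Rotating \<open>z\<close> turns \<open>\<bar>A z + B cnj z\<bar>\<close> into \<open>\<bar>A z + u B cnj z\<bar>\<close> with \<open>u\<close> on the unit circle, and the mean
  of the logarithm over \<open>u\<close> is its value at \<open>u = 0\<close>.\<close>

lemma gaussc_log_linear:
  fixes A B :: complex
  assumes AB: "cmod B < cmod A"
  defines "f \<equiv> \<lambda>z. ln (cmod (A * z + B * cnj z))"
  shows "integrable gaussc f" "(LINT z|gaussc. f z) = ln (cmod A) + gauss_log"
    "(LINT z|gaussc. \<bar>f z\<bar>) \<le> \<bar>ln (cmod A - cmod B)\<bar> + \<bar>ln (cmod A + cmod B)\<bar> + gauss_abs_log"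
proof -
  have [measurable]: "f \<in> borel_measurable borel"
    unfolding f_def by (intro borel_measurable_ln borel_measurable_continuous_onI continuous_intros)
  define c where "c = \<bar>ln (cmod A - cmod B)\<bar> + \<bar>ln (cmod A + cmod B)\<bar>"
  have bound: "\<bar>f z\<bar> \<le> c + \<bar>ln (cmod z)\<bar>" if "z \<noteq> 0" for z
  proof -
    have 1: "(cmod A - cmod B) * cmod z \<le> cmod (A * z + B * cnj z)"
      using norm_triangle_ineq4[of "A * z + B * cnj z" "B * cnj z"] by (simp add: norm_mult algebra_simps)
    have 2: "cmod (A * z + B * cnj z) \<le> (cmod A + cmod B) * cmod z"
      using norm_triangle_ineq[of "A * z" "B * cnj z"] by (simp add: norm_mult algebra_simps)
    have pos: "0 < (cmod A - cmod B) * cmod z" "0 < cmod A + cmod B" "0 < cmod A - cmod B" "0 < cmod z"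
      using AB that norm_ge_zero[of B] by (auto simp del: norm_ge_zero intro!: mult_pos_pos)
    have "ln ((cmod A - cmod B) * cmod z) \<le> f z"
      unfolding f_def using 1 pos by (intro ln_mono) auto
    moreover have "f z \<le> ln ((cmod A + cmod B) * cmod z)"
      unfolding f_def using less_le_trans[OF pos(1) 1] 2 pos by (intro ln_mono) auto
    ultimately show ?thesis
      using pos by (simp add: ln_mult c_def)
  qed
  have int_b: "integrable gaussc (\<lambda>z. c + \<bar>ln (cmod z)\<bar>)"
    using gaussc_ln_integrable by auto
  have AEb: "AE z in gaussc. norm (f z) \<le> norm (c + \<bar>ln (cmod z)\<bar>)"
    using gaussc_AE_nonzero by eventually_elim (use bound in fastforce)
  show int: "integrable gaussc f"
    by (rule Bochner_Integration.integrable_bound[OF int_b _ AEb]) measurable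
  have "AE z in gaussc. \<bar>f z\<bar> \<le> c + \<bar>ln (cmod z)\<bar>"
    using gaussc_AE_nonzero by eventually_elim (rule bound)
  then have "(LINT z|gaussc. \<bar>f z\<bar>) \<le> (LINT z|gaussc. c + \<bar>ln (cmod z)\<bar>)"
    by (intro integral_mono_AE integrable_abs int int_b)
  also have "\<dots> = c + gauss_abs_log"
    using gaussc_ln_integrable by (simp add: gauss_abs_log_def gaussc.prob_space)
  finally show "(LINT z|gaussc. \<bar>f z\<bar>) \<le> \<bar>ln (cmod A - cmod B)\<bar> + \<bar>ln (cmod A + cmod B)\<bar> + gauss_abs_log"
    by (simp add: c_def)
  interpret U: prob_space unitI by (rule prob_space_unitI)
  interpret UG: pair_prob_space unitI gaussc ..
  have sets_UG: "sets (unitI \<Otimes>\<^sub>M gaussc) = sets (restrict_space borel {0..1} \<Otimes>\<^sub>M borel)"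
    by (rule sets_pair_measure_cong) (simp_all add: sets_unitI sets_gaussc)
  have meas: "(\<lambda>(t, z). f (cis (pi * t) * z)) \<in> borel_measurable (unitI \<Otimes>\<^sub>M gaussc)"
  proof -
    have [measurable]: "fst \<in> unitI \<Otimes>\<^sub>M gaussc \<rightarrow>\<^sub>M borel"
      by (rule measurable_compose[OF measurable_fst]) (rule measurable_unitI, simp)
    have [measurable]: "cis \<in> borel_measurable borel" by (intro borel_measurable_continuous_onI continuous_intros)
    show ?thesis unfolding case_prod_beta by measurable
  qed
  have intUG: "integrable (unitI \<Otimes>\<^sub>M gaussc) (\<lambda>(t, z). f (cis (pi * t) * z))"
  proof (rule UG.Fubini_integrable[OF meas])
    have "(LINT z|gaussc. norm (f (cis (pi * t) * z))) = (LINT z|gaussc. \<bar>f z\<bar>)" for t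
      using gaussc_integral_rotate[of "\<lambda>z. \<bar>f z\<bar>"] by simp
    then show "integrable unitI (\<lambda>t. LINT z|gaussc. norm (case (t, z) of (t, z) \<Rightarrow> f (cis (pi * t) * z)))"
      by simp
    show "AE t in unitI. integrable gaussc (\<lambda>z. case (t, z) of (t, z) \<Rightarrow> f (cis (pi * t) * z))"
      by (rule AE_I2) (simp add: gaussc_integrable_rotate int)
  qed
  have inner: "(LINT t|unitI. f (cis (pi * t) * z)) = ln (cmod A) + ln (cmod z)" if "z \<noteq> 0" for z
  proof -
    \<comment> \<open>Rotation by the half angle \<open>pi * t\<close> multiplies the ratio of the
      two terms by a full-angle factor. After conjugating and multiplying by
      \<open>cis (pi * t)\<close>, which keeps the modulus, the form is a linear polynomial in
      \<open>cis (2 * pi * t)\<close>; its root lies outside the closed unit disc because |B| <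
      |A|.\<close>
    define g where "g = (\<lambda>w. cnj (A * z) + cnj B * z * w)"
    have "f (cis (pi * t) * z) = ln (cmod (g (cis (2 * pi * t))))" for t
    proof -
      have "cis (pi * t) * cnj (A * (cis (pi * t) * z) + B * cnj (cis (pi * t) * z)) = g (cis (2 * pi * t))"
      proof -
        have 1: "cis (pi * t) * cnj (cis (pi * t)) = 1" by (simp add: cis_cnj cis_mult)
        have 2: "cis (2 * pi * t) = cis (pi * t) * cis (pi * t)"
        proof -
          have "2 * pi * t = pi * t + pi * t" by simp
          then show ?thesis by (simp only: cis_mult)
        qed
        have "cis (pi * t) * cnj (A * (cis (pi * t) * z) + B * cnj (cis (pi * t) * z))
          = (cis (pi * t) * cnj (cis (pi * t))) * cnj (A * z) + cnj B * z * (cis (pi * t) * cis (pi * t))"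
          by (simp add: algebra_simps)
        then show ?thesis by (simp only: 1 2 g_def mult_1)
      qed
      then have "cmod (g (cis (2 * pi * t))) = cmod (cis (pi * t)) * cmod (cnj (A * (cis (pi * t) * z) + B * cnj (cis (pi * t) * z)))"
        by (metis norm_mult)
      then show ?thesis unfolding f_def complex_mod_cnj norm_cis by simp
    qed
    then have "(LINT t|unitI. f (cis (pi * t) * z)) = (LINT t|unitI. ln (cmod (g (cis (2 * pi * t)))))" by simp
    also have "\<dots> = ln (cmod (g 0))"
    proof (rule circle_mean_log(2))
      show "g holomorphic_on UNIV" unfolding g_def by (intro holomorphic_intros)
      fix w :: complex assume w: "cmod w \<le> 1"
      have "cmod (cnj B * z * w) \<le> cmod B * cmod z * 1" unfolding norm_mult complex_mod_cnj by (intro mult_left_mono w) auto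
      also have "\<dots> < cmod (cnj (A * z))" using AB that by (simp add: norm_mult)
      finally show "g w \<noteq> 0" unfolding g_def
        by (metis add_eq_0_iff less_irrefl norm_minus_cancel)
    qed
    also have "\<dots> = ln (cmod A) + ln (cmod z)"
    proof -
      have "cmod A > 0" using AB norm_ge_zero[of B] by linarith
      then show ?thesis using that by (simp add: g_def norm_mult ln_mult)
    qed
    finally show ?thesis .
  qed
  have "(LINT z|gaussc. f z) = (LINT t|unitI. (LINT z|gaussc. f (cis (pi * t) * z)))"
    using U.prob_space by (simp add: gaussc_integral_rotate)
  also have "\<dots> = (LINT z|gaussc. (LINT t|unitI. f (cis (pi * t) * z)))"
    by (rule UG.Fubini_integral[OF intUG, symmetric])
  also have "\<dots> = (LINT z|gaussc. ln (cmod A) + ln (cmod z))"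
  proof (rule integral_cong_AE)
    have "(\<lambda>(z, t). f (cis (pi * t) * z)) \<in> borel_measurable (gaussc \<Otimes>\<^sub>M unitI)"
      using measurable_compose[OF measurable_pair_swap' meas] by (simp add: case_prod_beta)
    then show "(\<lambda>z. LINT t|unitI. f (cis (pi * t) * z)) \<in> borel_measurable gaussc"
      by (rule U.borel_measurable_lebesgue_integral)
    show "AE z in gaussc. (LINT t|unitI. f (cis (pi * t) * z)) = ln (cmod A) + ln (cmod z)"
      using gaussc_AE_nonzero by eventually_elim (rule inner)
  qed measurable
  also have "\<dots> = ln (cmod A) + gauss_log"
    using gaussc_ln_integrable by (simp add: gauss_log_def gaussc.prob_space)
  finally show "(LINT z|gaussc. f z) = ln (cmod A) + gauss_log" .
qed

section \<open>Linear forms in independent real Gaussians\<close>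

locale std_gaussians = prob_space M for M :: "'a measure" +
  fixes \<eta> :: "nat \<Rightarrow> 'a \<Rightarrow> real"
  assumes indep: "indep_vars (\<lambda>_. borel) \<eta> UNIV"
    and dist: "\<And>i. distributed M lborel (\<eta> i) std_normal_density"
begin

lemma eta_measurable [measurable]: "\<eta> i \<in> borel_measurable M"
  using distributed_measurable[OF dist[of i]] by simp

lemma distr_eta: "distr M borel (\<eta> i) = gauss"
proof -
  have "distr M borel (\<eta> i) = distr M lborel (\<eta> i)" by (rule distr_cong) auto
  then show ?thesis using distributed_distr_eq_density[OF dist] by simp
qed

lemma distr_PiM:
  assumes "n > 0"
  shows "distr M (Pi\<^sub>M {..<n} (\<lambda>_. borel)) (\<lambda>\<omega>. \<lambda>i\<in>{..<n}. \<eta> i \<omega>) = Pi\<^sub>M {..<n} (\<lambda>_. gauss)"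
proof -
  have "indep_vars (\<lambda>_. borel) \<eta> {..<n}" by (rule indep_vars_subset[OF indep]) auto
  then show ?thesis
    by (subst (asm) indep_vars_iff_distr_eq_PiM) (use assms in \<open>auto simp: distr_eta\<close>)
qed

lemma nn_integral_eta:
  assumes "n > 0" and F: "F \<in> borel_measurable (Pi\<^sub>M {..<n} (\<lambda>_. borel))"
  shows "(\<integral>\<^sup>+ \<omega>. F (\<lambda>i\<in>{..<n}. \<eta> i \<omega>) \<partial>M) = (\<integral>\<^sup>+ x. F x \<partial>Pi\<^sub>M {..<n} (\<lambda>_. gauss))"
proof -
  have "(\<integral>\<^sup>+ x. F x \<partial>Pi\<^sub>M {..<n} (\<lambda>_. gauss)) = (\<integral>\<^sup>+ x. F x \<partial>distr M (Pi\<^sub>M {..<n} (\<lambda>_. borel)) (\<lambda>\<omega>. \<lambda>i\<in>{..<n}. \<eta> i \<omega>))"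
    by (simp add: distr_PiM assms)
  also have "\<dots> = (\<integral>\<^sup>+ \<omega>. F (\<lambda>i\<in>{..<n}. \<eta> i \<omega>) \<partial>M)"
  proof (rule nn_integral_distr)
    show "(\<lambda>\<omega>. \<lambda>i\<in>{..<n}. \<eta> i \<omega>) \<in> measurable M (Pi\<^sub>M {..<n} (\<lambda>_. borel))"
      by (intro measurable_restrict eta_measurable)
  qed (use F in simp)
  finally show ?thesis ..
qed

text \<open>The reduced form p x + q y is rewritten as A z + B cnj z with z = x + i y, so A = (p - i
  q) / 2 and B = (p + i q) / 2. The two rotation invariants of the coefficients become |A|^2 + |B|^2
  and A B, hence they determine the larger and the smaller of the two moduli.\<close>

lemma linear_form_law:
  fixes c :: "nat \<Rightarrow> complex"
  assumes n: "n > 0"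
  shows "\<exists>A B. (cmod A)\<^sup>2 + (cmod B)\<^sup>2 = (\<Sum>i<n. (cmod (c i))\<^sup>2) / 2 \<and> A * B = (\<Sum>i<n. (c i)\<^sup>2) / 4 \<and>
    distr M borel (\<lambda>\<omega>. \<Sum>i<n. c i * of_real (\<eta> i \<omega>)) = distr gaussc borel (\<lambda>z. A * z + B * cnj z)"
proof -
  obtain p q where pq: "p\<^sup>2 + q\<^sup>2 = (\<Sum>i<n. (c i)\<^sup>2)" "(cmod p)\<^sup>2 + (cmod q)\<^sup>2 = (\<Sum>i<n. (cmod (c i))\<^sup>2)"
    "\<And>F. F \<in> borel_measurable borel \<Longrightarrow> (\<integral>\<^sup>+ x. F (\<Sum>i<n. c i * of_real (x i)) \<partial>Pi\<^sub>M {..<n} (\<lambda>_. gauss))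
       = (\<integral>\<^sup>+ x. \<integral>\<^sup>+ y. (F (p * of_real x + q * of_real y) :: ennreal) \<partial>gauss \<partial>gauss)"
    using PiM_gauss_linear_form[where n = n and c = c] by blast
  define A where "A = (p - \<i> * q) / 2"
  define B where "B = (p + \<i> * q) / 2"
  have AB: "A * Complex x y + B * cnj (Complex x y) = p * of_real x + q * of_real y" for x y
    by (simp add: A_def B_def complex_eq_iff field_simps)
  have [measurable]: "(\<lambda>z. A * z + B * cnj z) \<in> borel_measurable borel"
    by (intro borel_measurable_continuous_onI continuous_intros)
  have "(cmod A)\<^sup>2 + (cmod B)\<^sup>2 = ((cmod p)\<^sup>2 + (cmod q)\<^sup>2) / 2"
    by (simp only: cmod_power2) (simp add: A_def B_def power2_eq_square field_simps)
  moreover have "A * B = (p\<^sup>2 + q\<^sup>2) / 4"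
    by (simp add: A_def B_def power2_eq_square field_simps)
  moreover have "distr M borel (\<lambda>\<omega>. \<Sum>i<n. c i * of_real (\<eta> i \<omega>)) = distr gaussc borel (\<lambda>z. A * z + B * cnj z)"
  proof (rule measure_eqI)
    fix S assume "S \<in> sets (distr M borel (\<lambda>\<omega>. \<Sum>i<n. c i * of_real (\<eta> i \<omega>)))"
    then have [measurable]: "S \<in> sets borel" by simp
    have "emeasure (distr M borel (\<lambda>\<omega>. \<Sum>i<n. c i * of_real (\<eta> i \<omega>))) S
      = (\<integral>\<^sup>+ w. indicator S w \<partial>distr M borel (\<lambda>\<omega>. \<Sum>i<n. c i * of_real (\<eta> i \<omega>)))" by simp
    also have "\<dots> = (\<integral>\<^sup>+ \<omega>. indicator S (\<Sum>i<n. c i * of_real (\<eta> i \<omega>)) \<partial>M)"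
      by (rule nn_integral_distr) measurable
    also have "\<dots> = (\<integral>\<^sup>+ \<omega>. indicator S (\<Sum>i<n. c i * of_real ((\<lambda>i\<in>{..<n}. \<eta> i \<omega>) i)) \<partial>M)"
      by simp
    also have "\<dots> = (\<integral>\<^sup>+ x. indicator S (\<Sum>i<n. c i * of_real (x i)) \<partial>Pi\<^sub>M {..<n} (\<lambda>_. gauss))"
      by (rule nn_integral_eta[OF n]) measurable
    also have "\<dots> = (\<integral>\<^sup>+ x. \<integral>\<^sup>+ y. indicator S (p * of_real x + q * of_real y) \<partial>gauss \<partial>gauss)"
      by (rule pq(3)) measurable
    also have "\<dots> = (\<integral>\<^sup>+ z. indicator S (A * z + B * cnj z) \<partial>gaussc)"
      by (subst nn_integral_gaussc) (auto simp: AB)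
    also have "\<dots> = (\<integral>\<^sup>+ w. indicator S w \<partial>distr gaussc borel (\<lambda>z. A * z + B * cnj z))"
      by (rule nn_integral_distr[symmetric]) measurable
    finally show "emeasure (distr M borel (\<lambda>\<omega>. \<Sum>i<n. c i * of_real (\<eta> i \<omega>))) S = emeasure (distr gaussc borel (\<lambda>z. A * z + B * cnj z)) S"
      by simp
  qed simp
  ultimately show ?thesis using pq(1,2) by (intro exI[of _ A] exI[of _ B]) simp
qed

text \<open>With a the larger and b the smaller modulus of the two coefficients, a^2 + b^2 = K / 2
  and a b = |L| / 4, so a^2 = (K + sqrt (K^2 - |L|^2)) / 4, and the expected logarithm is ln a up to
  a constant. The condition |L| \<le> K / 2 keeps a and b apart, which makes the third bound depend
  on K alone.\<close>

lemma gaussian_log: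
  fixes c :: "nat \<Rightarrow> complex" and n :: nat
  defines "K \<equiv> \<Sum>i<n. (cmod (c i))\<^sup>2" and "L \<equiv> \<Sum>i<n. (c i)\<^sup>2"
  assumes K: "K > 0" and L: "cmod L \<le> K / 2"
  defines "X \<equiv> \<lambda>\<omega>. \<Sum>i<n. c i * of_real (\<eta> i \<omega>)"
  shows "integrable M (\<lambda>\<omega>. ln (cmod (X \<omega>)))"
    and "expectation (\<lambda>\<omega>. ln (cmod (X \<omega>))) = ln (K + sqrt (K\<^sup>2 - (cmod L)\<^sup>2)) / 2 - ln 2 + gauss_log"
    and "expectation (\<lambda>\<omega>. \<bar>ln (cmod (X \<omega>))\<bar>) \<le> \<bar>ln K\<bar> + 4 + gauss_abs_log"
proof -
  have n: "n > 0" using K by (cases n) (auto simp: K_def)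
  obtain A0 B0 where AB0: "(cmod A0)\<^sup>2 + (cmod B0)\<^sup>2 = K / 2" "A0 * B0 = L / 4"
    "distr M borel X = distr gaussc borel (\<lambda>z. A0 * z + B0 * cnj z)"
    using linear_form_law[OF n, of c] unfolding K_def L_def X_def by blast
  have ABs: "cmod A0 * cmod B0 = cmod L / 4" using AB0(2) by (metis norm_mult norm_divide norm_numeral)
  define a where "a = max (cmod A0) (cmod B0)"
  define b where "b = min (cmod A0) (cmod B0)"
  have ab: "a\<^sup>2 + b\<^sup>2 = K / 2" "a * b = cmod L / 4" "b \<le> a" "0 \<le> b"
    using AB0(1) ABs by (auto simp: a_def b_def max_def min_def algebra_simps)
  have sq: "(a\<^sup>2 - b\<^sup>2)\<^sup>2 = (K\<^sup>2 - (cmod L)\<^sup>2) / 4"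
  proof -
    have "(a\<^sup>2 - b\<^sup>2)\<^sup>2 = (a\<^sup>2 + b\<^sup>2)\<^sup>2 - 4 * (a * b)\<^sup>2" by (simp add: power2_eq_square algebra_simps)
    then show ?thesis unfolding ab by (simp add: power2_eq_square field_simps)
  qed
  have L2: "(cmod L)\<^sup>2 \<le> K\<^sup>2 / 4" using power_mono[OF L norm_ge_zero, of 2] by (simp add: power_divide)
  have diff: "a\<^sup>2 - b\<^sup>2 = sqrt (K\<^sup>2 - (cmod L)\<^sup>2) / 2"
  proof -
    have "sqrt ((a\<^sup>2 - b\<^sup>2)\<^sup>2) = a\<^sup>2 - b\<^sup>2" using ab power_mono[OF ab(3,4), of 2] by simp
    then show ?thesis unfolding sq by (simp add: real_sqrt_divide)
  qed
  \<comment> \<open>From |L| \<le> K / 2 the radicand is at least 3/4 of K^2, and 16/25 <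
    3/4.\<close>
  have root: "sqrt (K\<^sup>2 - (cmod L)\<^sup>2) \<ge> K * 4 / 5"
  proof (rule real_le_rsqrt)
    have "(K * 4 / 5)\<^sup>2 = 16 / 25 * K\<^sup>2" by (simp add: power_mult_distrib power_divide)
    then show "(K * 4 / 5)\<^sup>2 \<le> K\<^sup>2 - (cmod L)\<^sup>2" using L2 zero_le_power2[of K] by linarith
  qed
  have ba: "b < a"
  proof (rule ccontr)
    assume "\<not> b < a" then have "a = b" using ab by simp
    then show False using diff root K by simp
  qed
  have a2: "a\<^sup>2 = (K + sqrt (K\<^sup>2 - (cmod L)\<^sup>2)) / 4" using diff ab(1) by (simp add: field_simps)
  have a0: "a > 0" using ba ab by simp
  obtain f where f: "distr M borel (\<lambda>\<omega>. ln (cmod (X \<omega>))) = distr gaussc borel f"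
    "f \<in> borel_measurable borel"
    "integrable gaussc f" "(LINT z|gaussc. f z) = ln a + gauss_log"
    "(LINT z|gaussc. \<bar>f z\<bar>) \<le> \<bar>ln (a - b)\<bar> + \<bar>ln (a + b)\<bar> + gauss_abs_log"
  proof -
    define f where "f = (\<lambda>z. ln (cmod (A0 * z + B0 * cnj z)))"
    have lin [measurable]: "(\<lambda>z. A0 * z + B0 * cnj z) \<in> borel_measurable borel"
      by (intro borel_measurable_continuous_onI continuous_intros)
    have fm: "f \<in> borel_measurable borel" unfolding f_def by measurable
    have [measurable]: "X \<in> borel_measurable M" unfolding X_def by measurable
    have "distr M borel (\<lambda>\<omega>. ln (cmod (X \<omega>))) = distr (distr M borel X) borel (\<lambda>w. ln (cmod w))"
      by (subst distr_distr) (auto simp: o_def)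
    also have "\<dots> = distr gaussc borel f"
      unfolding AB0(3) by (subst distr_distr) (auto simp: o_def f_def)
    finally have 1: "distr M borel (\<lambda>\<omega>. ln (cmod (X \<omega>))) = distr gaussc borel f" .
    show thesis
    proof (cases "cmod B0 < cmod A0")
      case True
      then have "a = cmod A0" "b = cmod B0" by (auto simp: a_def b_def)
      with 1 fm gaussc_log_linear[OF True] show thesis by (intro that) (auto simp: f_def)
    next
      case False
      \<comment> \<open>If the coefficient of \<open>cnj z\<close> dominates, conjugating the form
        exchanges the two roles without changing its modulus.\<close>
      then have a: "a = cmod (cnj B0)" and b: "b = cmod (cnj A0)" by (auto simp: a_def b_def)
      then have lt: "cmod (cnj A0) < cmod (cnj B0)" using ba by simp
      have "f = (\<lambda>z. ln (cmod (cnj B0 * z + cnj A0 * cnj z)))"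
      proof
        fix z
        have "cnj (A0 * z + B0 * cnj z) = cnj B0 * z + cnj A0 * cnj z" by simp
        then show "f z = ln (cmod (cnj B0 * z + cnj A0 * cnj z))" unfolding f_def by (metis complex_mod_cnj)
      qed
      with 1 fm gaussc_log_linear[OF lt] show thesis by (intro that[of f]) (auto simp: a b)
    qed
  qed
  have [measurable]: "X \<in> borel_measurable M" unfolding X_def by measurable
  have int_distr: "integrable (distr gaussc borel f) (\<lambda>x. x)"
    using f(2,3) by (subst integrable_distr_eq) auto
  then have "integrable (distr M borel (\<lambda>\<omega>. ln (cmod (X \<omega>)))) (\<lambda>x. x)" by (simp add: f(1))
  then show "integrable M (\<lambda>\<omega>. ln (cmod (X \<omega>)))" by (subst (asm) integrable_distr_eq) auto
  have tr: "expectation (\<lambda>\<omega>. g (ln (cmod (X \<omega>)))) = (LINT z|gaussc. g (f z))"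
    if [measurable]: "g \<in> borel_measurable borel" for g :: "real \<Rightarrow> real"
  proof -
    have [measurable]: "f \<in> borel_measurable borel" by (rule f(2))
    have "expectation (\<lambda>\<omega>. g (ln (cmod (X \<omega>)))) = (LINT x|distr M borel (\<lambda>\<omega>. ln (cmod (X \<omega>))). g x)"
      by (rule integral_distr[symmetric]) auto
    also have "\<dots> = (LINT z|gaussc. g (f z))" unfolding f(1) by (rule integral_distr) auto
    finally show ?thesis .
  qed
  have "ln a = ln (a\<^sup>2) / 2" using a0 by (simp add: ln_realpow)
  also have "\<dots> = ln (K + sqrt (K\<^sup>2 - (cmod L)\<^sup>2)) / 2 - ln 4 / 2"
    unfolding a2 using K root by (subst ln_div) (auto simp: diff_divide_distrib)
  also have "ln 4 = 2 * ln (2::real)" using ln_realpow[of 2 2] by simp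
  finally have "ln a = ln (K + sqrt (K\<^sup>2 - (cmod L)\<^sup>2)) / 2 - ln 2" by simp
  then show "expectation (\<lambda>\<omega>. ln (cmod (X \<omega>))) = ln (K + sqrt (K\<^sup>2 - (cmod L)\<^sup>2)) / 2 - ln 2 + gauss_log"
    using tr[of "\<lambda>x. x"] f(4) by simp
  \<comment> \<open>To be used for a + b and a - b, whose squares are K / 2 plus and minus |L| / 2
    and so lie between K / 4 and K; 25 leaves room and still has a logarithm below 4.\<close>
  have lnb: "\<bar>ln y\<bar> \<le> \<bar>ln K\<bar> / 2 + 2" if y: "y > 0" "y\<^sup>2 \<le> K" "y\<^sup>2 \<ge> K / 25" for y
  proof -
    have "ln (y\<^sup>2) \<le> ln K" "ln (K / 25) \<le> ln (y\<^sup>2)" using y K by (auto intro!: ln_mono)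
    moreover have "ln (y\<^sup>2) = 2 * ln y" using y by (simp add: ln_realpow)
    moreover have "ln (K / 25) = ln K - ln 25" using K by (simp add: ln_div)
    moreover have "ln (25::real) \<le> 4"
    proof -
      have "(25::real) \<le> (1 + 1 + 1/2) ^ 4" by (simp add: power4_eq_xxxx)
      also have "\<dots> \<le> exp 1 ^ 4" using exp_lower_Taylor_quadratic[of "1::real"] by (intro power_mono) auto
      also have "\<dots> = exp 4" by (simp flip: exp_of_nat_mult)
      finally have "ln 25 \<le> ln (exp (4::real))" by (intro ln_mono) auto
      then show ?thesis by simp
    qed
    ultimately show ?thesis by linarith
  qed
  have s1: "\<bar>ln (a + b)\<bar> \<le> \<bar>ln K\<bar> / 2 + 2"
  proof (rule lnb)
    show "a + b > 0" using a0 ab by simp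
    have "(a + b)\<^sup>2 = K / 2 + cmod L / 2" using ab(1,2) by (simp add: power2_sum)
    moreover have "0 \<le> cmod L" by simp
    ultimately show "(a + b)\<^sup>2 \<le> K" "(a + b)\<^sup>2 \<ge> K / 25" using L K by linarith+
  qed
  have s2: "\<bar>ln (a - b)\<bar> \<le> \<bar>ln K\<bar> / 2 + 2"
  proof (rule lnb)
    show "a - b > 0" using ba by simp
    have "(a - b)\<^sup>2 = K / 2 - cmod L / 2" using ab(1,2) by (simp add: power2_diff)
    moreover have "0 \<le> cmod L" by simp
    ultimately show "(a - b)\<^sup>2 \<le> K" "(a - b)\<^sup>2 \<ge> K / 25" using L K by linarith+
  qed
  show "expectation (\<lambda>\<omega>. \<bar>ln (cmod (X \<omega>))\<bar>) \<le> \<bar>ln K\<bar> + 4 + gauss_abs_log"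
    using tr[of abs] f(5) s1 s2 by simp
qed

end

section \<open>Zeros in exponential coordinates\<close>

text \<open>The cut of \<open>clog\<close> is the positive real axis, which \<open>S\<close> avoids.\<close>

definition clog :: "complex \<Rightarrow> complex" where "clog a = Complex (ln (cmod a)) (Arg2pi a)"

lemma exp_clog: "a \<noteq> 0 \<Longrightarrow> exp (clog a) = a"
proof -
  assume a: "a \<noteq> 0"
  have "exp (clog a) = of_real (cmod a) * exp (\<i> * of_real (Arg2pi a))"
    using a by (simp add: clog_def Complex_eq exp_add exp_of_real)
  then show ?thesis using Arg2pi_eq[of a] by simp
qed

lemma Im_clog: "0 \<le> Im (clog a)" "Im (clog a) < 2 * pi"
  by (auto simp: clog_def Arg2pi_ge_0 Arg2pi_lt_2pi)

lemma exp_eq_clog: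
  assumes "exp z = a" "0 \<le> Im z" "Im z < 2 * pi"
  shows "z = clog a"
proof -
  have "a \<noteq> 0" using assms(1) by auto
  then have "exp z = exp (clog a)" using assms exp_clog by simp
  then obtain k :: int where k: "z = clog a + (of_int (2 * k) * pi) * \<i>" by (auto simp: exp_eq)
  then have "Im z = Im (clog a) + 2 * k * pi" by simp
  then have "\<bar>2 * k * pi\<bar> < 2 * pi" using assms Im_clog[of a] by linarith
  then have "\<bar>real_of_int k\<bar> < 1" by (simp add: abs_mult)
  then have "k = 0" by linarith
  then show ?thesis using k by simp
qed

text \<open>The truncated logarithmic kernel ln^+ (r / |w|). Its singular point \<open>w = 0\<close>
  is excluded by hypothesis or lies in a null set wherever the value matters.\<close>

definition logpos :: "real \<Rightarrow> complex \<Rightarrow> real" where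
  "logpos r w = (if cmod w < r then ln (r / cmod w) else 0)"

lemma logpos_nonneg: "w \<noteq> 0 \<Longrightarrow> 0 \<le> logpos r w"
  by (auto simp: logpos_def intro!: ln_ge_zero)

text \<open>Jensen's formula for one factor. The strip condition keeps the disc inside the range of
  angles of \<open>clog\<close>, so \<open>clog a\<close> is the only logarithm of \<open>a\<close>
  that it can contain. The radius \<open>c\<close> is complex so that \<open>- r\<close> can be used
  as well, which traverses the circle from the antipodal point.\<close>

lemma circle_mean_log_exp_minus:
  fixes c :: complex
  assumes a: "a \<noteq> 0" and r: "0 < cmod c" "cmod c < 1"
    and strip: "cmod c < Im \<zeta>" "Im \<zeta> + cmod c < 2 * pi"
    and ne: "\<zeta> \<noteq> clog a" "cmod (clog a - \<zeta>) \<noteq> cmod c"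
  shows "integrable unitI (\<lambda>t. ln (cmod (exp (\<zeta> + c * cis (2*pi*t)) - a)))"
    and "(LINT t|unitI. ln (cmod (exp (\<zeta> + c * cis (2*pi*t)) - a))) = ln (cmod (exp \<zeta> - a)) + logpos (cmod c) (clog a - \<zeta>)"
    and "cmod w = 1 \<Longrightarrow> exp (\<zeta> + c * w) \<noteq> a"
proof -
  have root: "\<zeta> + c * w = clog a" if "cmod w \<le> 1" "exp (\<zeta> + c * w) = a" for w
  proof (rule exp_eq_clog[OF that(2)])
    have "\<bar>Im (c * w)\<bar> \<le> cmod c * cmod w" using abs_Im_le_cmod[of "c * w"] by (simp add: norm_mult)
    also have "\<dots> \<le> cmod c * 1" by (intro mult_left_mono that) auto
    finally have "\<bar>Im (c * w)\<bar> \<le> cmod c" by simp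
    then show "0 \<le> Im (\<zeta> + c * w)" "Im (\<zeta> + c * w) < 2 * pi" using strip by (auto simp: abs_le_iff)
  qed
  have root': "cmod (clog a - \<zeta>) \<le> cmod c * cmod w" if "cmod w \<le> 1" "exp (\<zeta> + c * w) = a" for w
    using root[OF that] by (metis add_diff_cancel_left' norm_mult order_refl)
  show "exp (\<zeta> + c * w) \<noteq> a" if w: "cmod w = 1" for w
  proof
    assume "exp (\<zeta> + c * w) = a"
    then have "c * w = clog a - \<zeta>" using root[of w] w by (simp add: algebra_simps)
    then show False using ne(2) w by (metis norm_mult mult.right_neutral)
  qed
  have "integrable unitI (\<lambda>t. ln (cmod (exp (\<zeta> + c * cis (2*pi*t)) - a))) \<and>
    (LINT t|unitI. ln (cmod (exp (\<zeta> + c * cis (2*pi*t)) - a))) = ln (cmod (exp \<zeta> - a)) + logpos (cmod c) (clog a - \<zeta>)"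
  proof (cases "cmod (clog a - \<zeta>) < cmod c")
    case False
    define f where "f = (\<lambda>w. exp (\<zeta> + c * w) - a)"
    have "f holomorphic_on UNIV" unfolding f_def by (intro holomorphic_intros)
    moreover have "f w \<noteq> 0" if "cmod w \<le> 1" for w
    proof
      assume "f w = 0"
      then have "cmod (clog a - \<zeta>) \<le> cmod c * cmod w" using root'[OF that] by (simp add: f_def)
      also have "\<dots> \<le> cmod c * 1" by (intro mult_left_mono that) auto
      finally show False using False ne(2) by simp
    qed
    ultimately show ?thesis using circle_mean_log[of f] False by (simp add: f_def logpos_def)
  next
    case True
    define b where "b = (clog a - \<zeta>) / c"
    have c0: "c \<noteq> 0" using r by auto
    have cb: "clog a = \<zeta> + c * b" using c0 by (simp add: b_def)
    have b: "cmod b < 1" "b \<noteq> 0" using True ne(1) r by (auto simp: b_def norm_divide divide_less_eq)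
    have fact: "exp (\<zeta> + c * w) - a = a * (c * (w - b)) * Hc (c * (w - b))" for w
    proof -
      have "exp (\<zeta> + c * w) = exp (clog a) * exp (c * (w - b))"
        unfolding cb by (simp add: exp_add[symmetric] algebra_simps)
      then have "exp (\<zeta> + c * w) - a = a * (exp (c * (w - b)) - 1)" using exp_clog[OF a] by (simp add: algebra_simps)
      then show ?thesis by (simp add: Hc_mult[symmetric] mult_ac)
    qed
    \<comment> \<open>The linear factor w - b is replaced by the Blaschke reflection 1 - cnj b w:
      same modulus on the unit circle, no zero in the closed disc. The factor \<open>Hc\<close> is
      zero-free since c (w - b) has modulus at most 2.\<close>
    define h where "h = (\<lambda>w. a * c * (1 - cnj b * w) * Hc (c * (w - b)))"
    have hol: "h holomorphic_on UNIV" unfolding h_def by (intro holomorphic_intros)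
    have nz: "h w \<noteq> 0" if "cmod w \<le> 1" for w
    proof -
      have "cmod (cnj b * w) \<le> cmod b * 1" unfolding norm_mult complex_mod_cnj by (intro mult_left_mono that) auto
      then have "cnj b * w \<noteq> 1" using b by auto
      moreover have "Hc (c * (w - b)) \<noteq> 0"
      proof (rule Hc_nonzero)
        have "cmod (w - b) \<le> 1 + 1" using norm_triangle_ineq4[of w b] that b by simp
        then have "cmod (c * (w - b)) \<le> 1 * (1 + 1)" unfolding norm_mult using r by (intro mult_mono) auto
        also have "\<dots> < 2 * pi" using pi_gt3 by simp
        finally show "cmod (c * (w - b)) < 2 * pi" .
      qed
      ultimately show ?thesis using a c0 by (simp add: h_def)
    qed
    have eq: "cmod (exp (\<zeta> + c * cis s) - a) = cmod (h (cis s))" for s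
    proof -
      have "cnj (cis s) * (cis s - b) = cnj (1 - cnj b * cis s)"
        by (simp add: algebra_simps) (simp add: cis_cnj cis_mult)
      then have "cmod (cis s - b) = cmod (1 - cnj b * cis s)"
        by (metis complex_mod_cnj mult_1 norm_cis norm_mult)
      then show ?thesis unfolding fact h_def by (simp add: norm_mult)
    qed
    have "ln (cmod (h 0)) = ln (cmod (exp \<zeta> - a)) + logpos (cmod c) (clog a - \<zeta>)"
    proof -
      have 1: "exp \<zeta> - a = - (h 0 * b)" using fact[of 0] by (simp add: h_def)
      have "h 0 \<noteq> 0" using nz[of 0] by simp
      then have "ln (cmod (exp \<zeta> - a)) = ln (cmod (h 0)) + ln (cmod b)" using b unfolding 1 by (simp add: norm_mult ln_mult)
      moreover have "logpos (cmod c) (clog a - \<zeta>) = - ln (cmod b)"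
        using True ne(1) c0 by (simp add: logpos_def b_def norm_divide ln_div)
      ultimately show ?thesis by simp
    qed
    then show ?thesis using circle_mean_log[OF hol nz] by (simp add: eq)
  qed
  then show "integrable unitI (\<lambda>t. ln (cmod (exp (\<zeta> + c * cis (2*pi*t)) - a)))"
    and "(LINT t|unitI. ln (cmod (exp (\<zeta> + c * cis (2*pi*t)) - a))) = ln (cmod (exp \<zeta> - a)) + logpos (cmod c) (clog a - \<zeta>)"
    by auto
qed

text \<open>Sum of the one-factor formulas over the linear factors. A root at 0 contributes nothing,
  because \<open>exp\<close> has no zeros; hence the sum over nonzero roots. Simple roots allow
  summing over the root set without multiplicities.\<close>

lemma circle_mean_log_poly:
  fixes p :: "complex poly" and c :: complex
  assumes p: "rsquarefree p" and r: "0 < cmod c" "cmod c < 1"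
    and strip: "cmod c < Im \<zeta>" "Im \<zeta> + cmod c < 2 * pi"
    and ne: "\<And>a. poly p a = 0 \<Longrightarrow> a \<noteq> 0 \<Longrightarrow> \<zeta> \<noteq> clog a \<and> cmod (clog a - \<zeta>) \<noteq> cmod c"
  shows "integrable unitI (\<lambda>t. ln (cmod (poly p (exp (\<zeta> + c * cis (2*pi*t))))))"
    and "(LINT t|unitI. ln (cmod (poly p (exp (\<zeta> + c * cis (2*pi*t)))))) = ln (cmod (poly p (exp \<zeta>)))
      + (\<Sum>a | poly p a = 0 \<and> a \<noteq> 0. logpos (cmod c) (clog a - \<zeta>))"
proof -
  interpret U: prob_space unitI by (rule prob_space_unitI)
  have p0: "p \<noteq> 0" using p by (auto simp: rsquarefree_def)
  define R where "R = {a. poly p a = 0}"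
  have fin: "finite R" unfolding R_def by (rule poly_roots_finite[OF p0])
  define l where "l = ln (cmod (lead_coeff p))"
  have lc: "lead_coeff p \<noteq> 0" using p0 by simp
  have dec: "ln (cmod (poly p z)) = l + (\<Sum>a\<in>R. ln (cmod (z - a)))" if "poly p z \<noteq> 0" for z
  proof -
    have "poly p z = lead_coeff p * (\<Prod>a\<in>R. z - a)"
      by (subst complex_poly_decompose_rsquarefree[OF p, symmetric]) (simp add: poly_prod R_def)
    moreover have "(\<Prod>a\<in>R. cmod (z - a)) > 0" "\<And>a. a \<in> R \<Longrightarrow> cmod (z - a) > 0"
      using that by (auto intro!: prod_pos simp: R_def)
    moreover from this have "ln (\<Prod>a\<in>R. cmod (z - a)) = (\<Sum>a\<in>R. ln (cmod (z - a)))"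
      using fin by (intro ln_prod) auto
    ultimately show ?thesis using lc by (simp add: norm_mult prod_norm[symmetric] ln_mult l_def)
  qed
  have ne0: "poly p (exp \<zeta>) \<noteq> 0"
  proof
    assume "poly p (exp \<zeta>) = 0"
    then have "\<zeta> \<noteq> clog (exp \<zeta>)" using ne by simp
    moreover have "\<zeta> = clog (exp \<zeta>)" using strip r by (intro exp_eq_clog) (simp, linarith+)
    ultimately show False by simp
  qed
  have nec: "poly p (exp (\<zeta> + c * w)) \<noteq> 0" if "cmod w = 1" for w
    using circle_mean_log_exp_minus(3)[OF _ r strip _ _ that, of "exp (\<zeta> + c * w)"] ne[of "exp (\<zeta> + c * w)"] by auto
  have each: "integrable unitI (\<lambda>t. ln (cmod (exp (\<zeta> + c * cis (2*pi*t)) - a))) \<and>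
    (LINT t|unitI. ln (cmod (exp (\<zeta> + c * cis (2*pi*t)) - a))) = ln (cmod (exp \<zeta> - a)) + (if a = 0 then 0 else logpos (cmod c) (clog a - \<zeta>))"
    if "a \<in> R" for a
  proof (cases "a = 0")
    case True
    show ?thesis using circle_mean_log[of "\<lambda>w. exp (\<zeta> + c * w)"] True by (simp add: holomorphic_intros)
  next
    case False
    then show ?thesis using circle_mean_log_exp_minus(1,2)[OF False r strip] ne that by (auto simp: R_def)
  qed
  have eq: "(\<lambda>t. ln (cmod (poly p (exp (\<zeta> + c * cis (2*pi*t)))))) = (\<lambda>t. l + (\<Sum>a\<in>R. ln (cmod (exp (\<zeta> + c * cis (2*pi*t)) - a))))"
    by (intro ext dec nec) simp
  show "integrable unitI (\<lambda>t. ln (cmod (poly p (exp (\<zeta> + c * cis (2*pi*t))))))"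
    unfolding eq using each by (intro Bochner_Integration.integrable_add Bochner_Integration.integrable_sum) auto
  have "(LINT t|unitI. ln (cmod (poly p (exp (\<zeta> + c * cis (2*pi*t))))))
    = l + (\<Sum>a\<in>R. ln (cmod (exp \<zeta> - a)) + (if a = 0 then 0 else logpos (cmod c) (clog a - \<zeta>)))"
    unfolding eq using each U.prob_space
    by (subst Bochner_Integration.integral_add) (auto simp: Bochner_Integration.integral_sum)
  also have "\<dots> = ln (cmod (poly p (exp \<zeta>))) + (\<Sum>a\<in>R. if a = 0 then 0 else logpos (cmod c) (clog a - \<zeta>))"
    by (simp add: dec[OF ne0] sum.distrib)
  also have "(\<Sum>a\<in>R. if a = 0 then 0 else logpos (cmod c) (clog a - \<zeta>)) = (\<Sum>a | poly p a = 0 \<and> a \<noteq> 0. logpos (cmod c) (clog a - \<zeta>))"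
    by (rule sum.mono_neutral_cong_right) (use fin in \<open>auto simp: R_def\<close>)
  finally show "(LINT t|unitI. ln (cmod (poly p (exp (\<zeta> + c * cis (2*pi*t)))))) = ln (cmod (poly p (exp \<zeta>)))
      + (\<Sum>a | poly p a = 0 \<and> a \<noteq> 0. logpos (cmod c) (clog a - \<zeta>))" .
qed

text \<open>Antipodal points of the circle are paired because the asymptotics below come as second differences.\<close>

definition log_excess :: "complex poly \<Rightarrow> real \<Rightarrow> complex \<Rightarrow> real" where
  "log_excess p r \<zeta> = (LINT t|unitI. (ln (cmod (poly p (exp (\<zeta> + of_real r * cis (2*pi*t)))))
       + ln (cmod (poly p (exp (\<zeta> - of_real r * cis (2*pi*t)))))) / 2) - ln (cmod (poly p (exp \<zeta>)))"

lemma log_excess_eq: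
  assumes p: "rsquarefree p" and r: "0 < r" "r < 1" and strip: "r < Im \<zeta>" "Im \<zeta> + r < 2 * pi"
    and ne: "\<And>a. poly p a = 0 \<Longrightarrow> a \<noteq> 0 \<Longrightarrow> \<zeta> \<noteq> clog a \<and> cmod (clog a - \<zeta>) \<noteq> r"
  shows "log_excess p r \<zeta> = (\<Sum>a | poly p a = 0 \<and> a \<noteq> 0. logpos r (clog a - \<zeta>))"
  using circle_mean_log_poly[OF p, of "of_real r" \<zeta>] circle_mean_log_poly[OF p, of "- of_real r" \<zeta>] assms
  by (simp add: log_excess_def add_divide_distrib)

section \<open>Zero counts from log excesses by smoothing with the logarithmic kernel\<close>

text \<open>The logarithmic plane is kept as a product of two real lines, so that its Lebesgue
  measure splits into a radial and an angular factor.\<close>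

definition cpx :: "real \<times> real \<Rightarrow> complex" where "cpx p = Complex (fst p) (snd p)"

lemma cpx_measurable [measurable]: "cpx \<in> borel_measurable borel"
  unfolding cpx_def Complex_eq by (intro borel_measurable_continuous_onI continuous_intros)

lemma dist_cpx: "cmod (cpx a - cpx b) = dist a b"
  by (simp add: cpx_def cmod_def dist_prod_def dist_real_def)

lemma cpx_Re_Im [simp]: "cpx (Re z, Im z) = z" "Re (cpx a) = fst a" "Im (cpx a) = snd a"
  by (auto simp: cpx_def)

text \<open>Layers of the kernel are discs of radius r exp (-h), so the integral is pi r^2 times the
  integral of exp (-2 h). The value fixes the normalisation 2 / (pi r^2) everywhere below.\<close>

lemma nn_integral_logpos:
  assumes r: "r > 0"
  shows "(\<integral>\<^sup>+ \<zeta>. ennreal (logpos r (cpx \<rho> - cpx \<zeta>)) \<partial>lborel) = ennreal (pi * r\<^sup>2 / 2)"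
proof -
  have [measurable]: "(\<lambda>\<zeta>. dist \<rho> \<zeta>) \<in> borel_measurable borel"
    by (intro borel_measurable_continuous_onI continuous_intros)
  have "(\<integral>\<^sup>+ \<zeta>. ennreal (logpos r (cpx \<rho> - cpx \<zeta>)) \<partial>lborel)
    = (\<integral>\<^sup>+ \<zeta>. (\<integral>\<^sup>+ h. indicator {0..} h * indicator {(\<zeta>, h). dist \<rho> \<zeta> < r * exp (-h)} (\<zeta>, h) \<partial>lborel) \<partial>lborel)"
  proof (rule nn_integral_cong_AE)
    show "AE \<zeta> in lborel. ennreal (logpos r (cpx \<rho> - cpx \<zeta>)) = (\<integral>\<^sup>+ h. indicator {0..} h * indicator {(\<zeta>, h). dist \<rho> \<zeta> < r * exp (-h)} (\<zeta>, h) \<partial>lborel)"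
      using AE_lborel_singleton[of \<rho>]
    proof eventually_elim
      case (elim \<zeta>)
      define d where "d = dist \<rho> \<zeta>"
      have d: "d > 0" using elim by (simp add: d_def)
      have "(\<integral>\<^sup>+ h. indicator {0..} h * indicator {(\<zeta>, h). dist \<rho> \<zeta> < r * exp (-h)} (\<zeta>, h) \<partial>lborel)
        = (\<integral>\<^sup>+ h. indicator {0..} h * indicator {h. d / r < exp (-h)} h \<partial>lborel)"
        using r by (intro nn_integral_cong) (auto simp: indicator_def d_def field_simps)
      also have "\<dots> = ennreal (logpos r (cpx \<rho> - cpx \<zeta>))"
      proof (cases "d < r")
        case True
        then show ?thesis using layer_cake_ln[of "d / r"] d r
          by (simp add: logpos_def dist_cpx d_def[symmetric] ln_div)
      next
        case False
        have "(\<integral>\<^sup>+ h. indicator {0..} h * indicator {h. d / r < exp (-h)} h \<partial>lborel) = (\<integral>\<^sup>+ (h::real). 0 \<partial>lborel)"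
        proof (rule nn_integral_cong)
          fix h :: real
          have "\<not> d / r < exp (-h)" if "h \<ge> 0"
          proof -
            have "exp (-h) \<le> 1" using that by simp
            also have "1 \<le> d / r" using False r by simp
            finally show ?thesis by simp
          qed
          then show "indicator {0..} h * indicator {h. d / r < exp (-h)} h = (0::ennreal)" by (auto simp: indicator_def)
        qed
        then show ?thesis using False by (simp add: logpos_def dist_cpx d_def)
      qed
      finally show ?case ..
    qed
  qed
  also have "\<dots> = (\<integral>\<^sup>+ h. (\<integral>\<^sup>+ \<zeta>. indicator {0..} h * indicator {(\<zeta>, h). dist \<rho> \<zeta> < r * exp (-h)} (\<zeta>, h) \<partial>lborel) \<partial>lborel)"
    by (rule lborel_pair.Fubini'[symmetric]) measurable
  also have "\<dots> = (\<integral>\<^sup>+ h. ennreal (pi * r\<^sup>2) * (ennreal (exp (-2 * h)) * indicator {0..} h) \<partial>lborel)"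
  proof (rule nn_integral_cong)
    fix h :: real
    have "(\<integral>\<^sup>+ \<zeta>. indicator {0..} h * indicator {(\<zeta>, h). dist \<rho> \<zeta> < r * exp (-h)} (\<zeta>, h) \<partial>lborel)
      = (\<integral>\<^sup>+ \<zeta>. indicator {0..} h * indicator (ball \<rho> (r * exp (-h))) \<zeta> \<partial>lborel)"
      by (intro nn_integral_cong) (auto simp: indicator_def)
    also have "\<dots> = indicator {0..} h * emeasure lborel (ball \<rho> (r * exp (-h)))"
      by (subst nn_integral_cmult) (auto intro!: borel_measurable_indicator)
    also have "emeasure lborel (ball \<rho> (r * exp (-h))) = ennreal (pi * (r * exp (-h))\<^sup>2)"
      using r by (subst emeasure_ball) (auto simp: eval_unit_ball_vol power2_eq_square)
    also have "pi * (r * exp (-h))\<^sup>2 = (pi * r\<^sup>2) * exp (-2 * h)"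
      by (simp add: power_mult_distrib exp_of_nat_mult[symmetric])
    finally show "(\<integral>\<^sup>+ \<zeta>. indicator {0..} h * indicator {(\<zeta>, h). dist \<rho> \<zeta> < r * exp (-h)} (\<zeta>, h) \<partial>lborel)
      = ennreal (pi * r\<^sup>2) * (ennreal (exp (-2 * h)) * indicator {0..} h)"
      by (simp add: ennreal_mult mult_ac)
  qed
  also have "\<dots> = ennreal (pi * r\<^sup>2) * ennreal (1 / 2)"
    by (subst nn_integral_cmult) (simp, simp only: nn_integral_exp_Ici[OF zero_less_numeral])
  also have "\<dots> = ennreal (pi * r\<^sup>2 * (1 / 2))" by (rule ennreal_mult[symmetric]) auto
  also have "pi * r\<^sup>2 * (1 / 2) = pi * r\<^sup>2 / 2" by simp
  finally show ?thesis .
qed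

definition zero_count :: "complex poly \<Rightarrow> (real \<times> real) set \<Rightarrow> nat" where
  "zero_count p A = card {a. poly p a = 0 \<and> a \<noteq> 0 \<and> (Re (clog a), Im (clog a)) \<in> A}"

text \<open>The share of the normalised kernel centred at \<rho> that falls into \<open>A\<close>: a
  number in [0, 1] that tends to the indicator of \<open>A\<close> as r shrinks, except at boundary
  points.\<close>

definition kernel_mass :: "real \<Rightarrow> (real \<times> real) set \<Rightarrow> complex \<Rightarrow> ennreal" where
  "kernel_mass r A \<rho> = ennreal (2 / (pi * r\<^sup>2)) * (\<integral>\<^sup>+ \<zeta>. ennreal (logpos r (\<rho> - cpx \<zeta>)) * indicator A \<zeta> \<partial>lborel)"

lemma logpos_measurable [measurable]: "logpos r \<in> borel_measurable borel"
  unfolding logpos_def by measurable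

lemma kernel_mass_total:
  assumes "r > 0"
  shows "ennreal (2 / (pi * r\<^sup>2)) * (\<integral>\<^sup>+ \<zeta>. ennreal (logpos r (\<rho> - cpx \<zeta>)) \<partial>lborel) = 1"
proof -
  have "ennreal (2 / (pi * r\<^sup>2)) * ennreal (pi * r\<^sup>2 / 2) = 1"
    using assms by (subst ennreal_mult[symmetric]) auto
  then show ?thesis using nn_integral_logpos[OF assms, of "(Re \<rho>, Im \<rho>)"] by simp
qed

lemma kernel_mass_le_1: "r > 0 \<Longrightarrow> kernel_mass r A \<rho> \<le> 1"
  unfolding kernel_mass_total[symmetric, of r \<rho>] kernel_mass_def
  by (intro mult_left_mono nn_integral_mono) (auto simp: indicator_def)

lemma kernel_mass_eq_1:
  assumes "r > 0" "ball (Re \<rho>, Im \<rho>) r \<subseteq> A"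
  shows "kernel_mass r A \<rho> = 1"
  unfolding kernel_mass_total[OF assms(1), symmetric, of \<rho>] kernel_mass_def
proof (intro arg_cong2[where f = "(*)"] refl nn_integral_cong)
  fix \<zeta>
  have "cmod (\<rho> - cpx \<zeta>) = dist (Re \<rho>, Im \<rho>) \<zeta>" using dist_cpx[of "(Re \<rho>, Im \<rho>)" \<zeta>] by simp
  then show "ennreal (logpos r (\<rho> - cpx \<zeta>)) * indicator A \<zeta> = ennreal (logpos r (\<rho> - cpx \<zeta>))"
    using assms(2) by (auto simp: indicator_def logpos_def)
qed

lemma kernel_mass_eq_0:
  assumes "ball (Re \<rho>, Im \<rho>) r \<inter> A = {}"
  shows "kernel_mass r A \<rho> = 0"
proof -
  have "(\<integral>\<^sup>+ \<zeta>. ennreal (logpos r (\<rho> - cpx \<zeta>)) * indicator A \<zeta> \<partial>lborel) = (\<integral>\<^sup>+ (\<zeta>::real \<times> real). 0 \<partial>lborel)"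
  proof (rule nn_integral_cong)
    fix \<zeta>
    have "cmod (\<rho> - cpx \<zeta>) = dist (Re \<rho>, Im \<rho>) \<zeta>" using dist_cpx[of "(Re \<rho>, Im \<rho>)" \<zeta>] by simp
    then show "ennreal (logpos r (\<rho> - cpx \<zeta>)) * indicator A \<zeta> = 0"
      using assms by (auto simp: indicator_def logpos_def)
  qed
  then show ?thesis by (simp add: kernel_mass_def)
qed

text \<open>The excluded centres are the logarithms of the roots and the circles of radius r around
  them, finitely many null sets.\<close>

lemma AE_log_excess_eq:
  assumes p: "rsquarefree p" and r: "0 < r" "r < 1"
    and strip: "\<forall>\<zeta>\<in>A. r < snd \<zeta> \<and> snd \<zeta> + r < 2 * pi"
  shows "AE \<zeta> in lborel. \<zeta> \<in> A \<longrightarrow> (\<forall>a. poly p a = 0 \<and> a \<noteq> 0 \<longrightarrow> clog a \<noteq> cpx \<zeta>) \<and>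
     log_excess p r (cpx \<zeta>) = (\<Sum>a | poly p a = 0 \<and> a \<noteq> 0. logpos r (clog a - cpx \<zeta>))"
proof -
  define R where "R = {a. poly p a = 0 \<and> a \<noteq> 0}"
  have p0: "p \<noteq> 0" using p by (auto simp: rsquarefree_def)
  have fin: "finite R" unfolding R_def using poly_roots_finite[OF p0] by (rule rev_finite_subset) auto
  have one: "AE \<zeta> in lborel. \<zeta> \<noteq> (Re (clog a), Im (clog a)) \<and> \<zeta> \<notin> sphere (Re (clog a), Im (clog a)) r" for a
  proof -
    have "AE \<zeta> in lborel. \<zeta> \<notin> sphere (Re (clog a), Im (clog a)) r"
    proof (rule AE_not_in)
      have "negligible (sphere (Re (clog a), Im (clog a)) r)" by (rule negligible_sphere)
      then have "emeasure lebesgue (sphere (Re (clog a), Im (clog a)) r) = 0"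
        by (auto simp: negligible_iff_null_sets)
      then show "sphere (Re (clog a), Im (clog a)) r \<in> null_sets lborel"
        by (subst (asm) emeasure_completion) (auto simp: null_sets_def)
    qed
    with AE_lborel_singleton[of "(Re (clog a), Im (clog a))"] show ?thesis by eventually_elim auto
  qed
  have "AE \<zeta> in lborel. \<forall>a\<in>R. \<zeta> \<noteq> (Re (clog a), Im (clog a)) \<and> \<zeta> \<notin> sphere (Re (clog a), Im (clog a)) r"
    using fin one by (rule AE_finite_allI)
  then show ?thesis
  proof eventually_elim
    case (elim \<zeta>)
    have ne: "cpx \<zeta> \<noteq> clog a \<and> cmod (clog a - cpx \<zeta>) \<noteq> r" if "poly p a = 0" "a \<noteq> 0" for a
    proof -
      have "cmod (clog a - cpx \<zeta>) = dist (Re (clog a), Im (clog a)) \<zeta>"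
        using dist_cpx[of "(Re (clog a), Im (clog a))" \<zeta>] by simp
      then show ?thesis using elim that by (auto simp: R_def cpx_def)
    qed
    show ?case using log_excess_eq[OF p r _ _ ne] strip ne by fastforce
  qed
qed

lemma nn_integral_log_excess:
  assumes p: "rsquarefree p" and r: "0 < r" "r < 1"
    and strip: "\<forall>\<zeta>\<in>A. r < snd \<zeta> \<and> snd \<zeta> + r < 2 * pi"
    and A [measurable]: "A \<in> sets borel"
  shows "ennreal (2 / (pi * r\<^sup>2)) * (\<integral>\<^sup>+ \<zeta>. ennreal (log_excess p r (cpx \<zeta>)) * indicator A \<zeta> \<partial>lborel)
    = (\<Sum>a | poly p a = 0 \<and> a \<noteq> 0. kernel_mass r A (clog a))"
proof -
  define R where "R = {a. poly p a = 0 \<and> a \<noteq> 0}"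
  have "(\<integral>\<^sup>+ \<zeta>. ennreal (log_excess p r (cpx \<zeta>)) * indicator A \<zeta> \<partial>lborel)
     = (\<integral>\<^sup>+ \<zeta>. (\<Sum>a\<in>R. ennreal (logpos r (clog a - cpx \<zeta>)) * indicator A \<zeta>) \<partial>lborel)"
  proof (rule nn_integral_cong_AE)
    show "AE \<zeta> in lborel. ennreal (log_excess p r (cpx \<zeta>)) * indicator A \<zeta>
      = (\<Sum>a\<in>R. ennreal (logpos r (clog a - cpx \<zeta>)) * indicator A \<zeta>)"
      using AE_log_excess_eq[OF p r strip]
    proof eventually_elim
      case (elim \<zeta>)
      show ?case
      proof (cases "\<zeta> \<in> A")
        case True
        then have "log_excess p r (cpx \<zeta>) = (\<Sum>a\<in>R. logpos r (clog a - cpx \<zeta>))" and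
          "\<And>a. a \<in> R \<Longrightarrow> 0 \<le> logpos r (clog a - cpx \<zeta>)"
          using elim by (auto simp: R_def intro!: logpos_nonneg)
        then show ?thesis using True by (simp add: sum_ennreal)
      qed simp
    qed
  qed
  also have "\<dots> = (\<Sum>a\<in>R. \<integral>\<^sup>+ \<zeta>. ennreal (logpos r (clog a - cpx \<zeta>)) * indicator A \<zeta> \<partial>lborel)"
    by (rule nn_integral_sum) measurable
  finally show ?thesis by (simp add: sum_distrib_left kernel_mass_def R_def)
qed

section \<open>Bounds for expected zero counts\<close>

text \<open>The degree bound makes the number of zeros bounded by a constant, the dominating
  function for the reverse Fatou lemma.\<close>

locale random_poly = prob_space M for M :: "'a measure" +
  fixes P :: "'a \<Rightarrow> complex poly" and n :: nat
  assumes meas: "(\<lambda>(\<omega>, z). poly (P \<omega>) z) \<in> borel_measurable (M \<Otimes>\<^sub>M borel)"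
    and simple: "AE \<omega> in M. rsquarefree (P \<omega>)"
    and deg: "\<And>\<omega>. degree (P \<omega>) \<le> n"
begin

lemma log_excess_measurable:
  "(\<lambda>(\<omega>, \<zeta>). log_excess (P \<omega>) r (cpx \<zeta>)) \<in> borel_measurable (M \<Otimes>\<^sub>M lborel)"
proof -
  interpret U: prob_space unitI by (rule prob_space_unitI)
  have ln_meas: "(\<lambda>x. ln (cmod (poly (P (f x)) (g x)))) \<in> borel_measurable N"
    if "f \<in> measurable N M" "g \<in> borel_measurable N" for f g and N :: "'b measure"
    using measurable_compose[OF measurable_Pair[OF that] meas] by simp
  have ex: "exp \<in> borel_measurable (borel :: complex measure)" by (intro borel_measurable_continuous_onI continuous_intros)
  have ci: "(\<lambda>t. cis (2 * pi * t)) \<in> borel_measurable borel" by (intro borel_measurable_continuous_onI continuous_intros)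
  let ?N = "(M \<Otimes>\<^sub>M lborel) \<Otimes>\<^sub>M unitI :: (('a \<times> (real \<times> real)) \<times> real) measure"
  have f1: "(\<lambda>x. fst (fst x)) \<in> measurable ?N M" by measurable
  have f2: "(\<lambda>x. cpx (snd (fst x))) \<in> borel_measurable ?N" by measurable
  have f3: "(\<lambda>x. cis (2 * pi * snd x)) \<in> borel_measurable ?N"
    by (rule measurable_compose[OF measurable_snd]) (rule measurable_unitI[OF ci])
  have m1: "(\<lambda>x. ln (cmod (poly (P (fst (fst x))) (exp (cpx (snd (fst x)) + of_real r * cis (2 * pi * snd x)))))) \<in> borel_measurable ?N"
    by (intro ln_meas f1 measurable_compose[OF _ ex] borel_measurable_add borel_measurable_times f2 f3 borel_measurable_const)
  have m2: "(\<lambda>x. ln (cmod (poly (P (fst (fst x))) (exp (cpx (snd (fst x)) - of_real r * cis (2 * pi * snd x)))))) \<in> borel_measurable ?N"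
    by (intro ln_meas f1 measurable_compose[OF _ ex] borel_measurable_diff borel_measurable_times f2 f3 borel_measurable_const)
  have m3: "(\<lambda>x. ln (cmod (poly (P (fst x)) (exp (cpx (snd x)))))) \<in> borel_measurable (M \<Otimes>\<^sub>M lborel)"
    by (intro ln_meas measurable_fst measurable_compose[OF _ ex]) measurable
  note m12 = borel_measurable_divide[OF borel_measurable_add[OF m1 m2] borel_measurable_const[of 2]]
  show ?thesis
    unfolding log_excess_def case_prod_beta
    by (intro borel_measurable_diff m3 U.borel_measurable_lebesgue_integral)
       (use m12 in \<open>simp add: case_prod_beta\<close>)
qed

text \<open>For each sample the excess is a sum of nonnegative kernels at almost every centre.
  Exchanging the null sets gives almost sure nonnegativity at almost every fixed centre, so that
  there the nonnegative integral over samples equals the expectation.\<close>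

lemma AE_log_excess_nonneg:
  assumes r: "0 < r" "r < 1" and strip: "\<forall>\<zeta>\<in>A. r < snd \<zeta> \<and> snd \<zeta> + r < 2 * pi"
    and A [measurable]: "A \<in> sets borel"
  shows "AE \<zeta> in lborel. AE \<omega> in M. \<zeta> \<in> A \<longrightarrow> 0 \<le> log_excess (P \<omega>) r (cpx \<zeta>)"
proof -
  interpret PM: pair_sigma_finite M lborel ..
  have [measurable]: "(\<lambda>x. log_excess (P (fst x)) r (cpx (snd x))) \<in> borel_measurable (M \<Otimes>\<^sub>M lborel)"
    using log_excess_measurable[of r] by (simp add: case_prod_beta)
  have "AE \<omega> in M. AE \<zeta> in lborel. \<zeta> \<in> A \<longrightarrow> 0 \<le> log_excess (P \<omega>) r (cpx \<zeta>)"
    using simple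
  proof eventually_elim
    case (elim \<omega>)
    show ?case using AE_log_excess_eq[OF elim r strip]
    proof eventually_elim
      case (elim \<zeta>)
      then show ?case by (auto intro!: sum_nonneg logpos_nonneg)
    qed
  qed
  moreover have "{x \<in> space (M \<Otimes>\<^sub>M lborel). snd x \<in> A \<longrightarrow> 0 \<le> log_excess (P (fst x)) r (cpx (snd x))} \<in> sets (M \<Otimes>\<^sub>M lborel)"
    by measurable
  ultimately show ?thesis
    using PM.AE_commute[of "\<lambda>\<omega> \<zeta>. \<zeta> \<in> A \<longrightarrow> 0 \<le> log_excess (P \<omega>) r (cpx \<zeta>)"] by simp
qed

definition smoothed :: "(real \<times> real) set \<Rightarrow> real \<Rightarrow> 'a \<Rightarrow> ennreal" where
  "smoothed A r \<omega> = ennreal (2 / (pi * r\<^sup>2)) * (\<integral>\<^sup>+ \<zeta>. ennreal (log_excess (P \<omega>) r (cpx \<zeta>)) * indicator A \<zeta> \<partial>lborel)"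

lemma smoothed_measurable:
  assumes [measurable]: "A \<in> sets borel" shows "smoothed A r \<in> borel_measurable M"
proof -
  have [measurable]: "(\<lambda>x. log_excess (P (fst x)) r (cpx (snd x))) \<in> borel_measurable (M \<Otimes>\<^sub>M lborel)"
    using log_excess_measurable[of r] by (simp add: case_prod_beta)
  show ?thesis unfolding smoothed_def
    by (intro borel_measurable_times_ennreal borel_measurable_const lborel.borel_measurable_nn_integral)
       (simp add: case_prod_beta)
qed

lemma nn_integral_smoothed:
  assumes [measurable]: "A \<in> sets borel"
  shows "(\<integral>\<^sup>+ \<omega>. smoothed A r \<omega> \<partial>M)
    = (\<integral>\<^sup>+ \<zeta>. (ennreal (2 / (pi * r\<^sup>2)) * (\<integral>\<^sup>+ \<omega>. ennreal (log_excess (P \<omega>) r (cpx \<zeta>)) \<partial>M)) * indicator A \<zeta> \<partial>lborel)"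
proof -
  interpret PM: pair_sigma_finite M lborel ..
  have m [measurable]: "(\<lambda>x. log_excess (P (fst x)) r (cpx (snd x))) \<in> borel_measurable (M \<Otimes>\<^sub>M lborel)"
    using log_excess_measurable[of r] by (simp add: case_prod_beta)
  have m2: "(\<lambda>\<omega>. log_excess (P \<omega>) r (cpx \<zeta>)) \<in> borel_measurable M" for \<zeta>
  proof -
    have "(\<lambda>\<omega>. (\<omega>, \<zeta>)) \<in> measurable M (M \<Otimes>\<^sub>M lborel)" by simp
    from measurable_compose[OF this m] show ?thesis by simp
  qed
  have m3: "(\<lambda>(\<omega>, \<zeta>). ennreal (log_excess (P \<omega>) r (cpx \<zeta>)) * indicator A \<zeta>) \<in> borel_measurable (M \<Otimes>\<^sub>M lborel)"
    by (simp add: case_prod_beta)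
  have "(\<integral>\<^sup>+ \<omega>. smoothed A r \<omega> \<partial>M)
    = ennreal (2 / (pi * r\<^sup>2)) * (\<integral>\<^sup>+ \<omega>. \<integral>\<^sup>+ \<zeta>. ennreal (log_excess (P \<omega>) r (cpx \<zeta>)) * indicator A \<zeta> \<partial>lborel \<partial>M)"
    unfolding smoothed_def by (rule nn_integral_cmult) (rule lborel.borel_measurable_nn_integral[OF m3])
  also have "(\<integral>\<^sup>+ \<omega>. \<integral>\<^sup>+ \<zeta>. ennreal (log_excess (P \<omega>) r (cpx \<zeta>)) * indicator A \<zeta> \<partial>lborel \<partial>M)
    = (\<integral>\<^sup>+ \<zeta>. \<integral>\<^sup>+ \<omega>. ennreal (log_excess (P \<omega>) r (cpx \<zeta>)) * indicator A \<zeta> \<partial>M \<partial>lborel)"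
    by (rule PM.Fubini'[OF m3, symmetric])
  also have "\<dots> = (\<integral>\<^sup>+ \<zeta>. (\<integral>\<^sup>+ \<omega>. ennreal (log_excess (P \<omega>) r (cpx \<zeta>)) \<partial>M) * indicator A \<zeta> \<partial>lborel)"
    by (intro nn_integral_cong nn_integral_multc) (use m2 in measurable)
  also have "ennreal (2 / (pi * r\<^sup>2)) * \<dots> = (\<integral>\<^sup>+ \<zeta>. ennreal (2 / (pi * r\<^sup>2)) * ((\<integral>\<^sup>+ \<omega>. ennreal (log_excess (P \<omega>) r (cpx \<zeta>)) \<partial>M) * indicator A \<zeta>) \<partial>lborel)"
  proof (rule nn_integral_cmult[symmetric])
    have "(\<lambda>\<zeta>. \<integral>\<^sup>+ \<omega>. ennreal (log_excess (P \<omega>) r (cpx \<zeta>)) \<partial>M) \<in> borel_measurable lborel"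
      by (rule borel_measurable_nn_integral) (use measurable_compose[OF measurable_pair_swap' m] in \<open>simp add: case_prod_beta\<close>)
    then show "(\<lambda>\<zeta>. (\<integral>\<^sup>+ \<omega>. ennreal (log_excess (P \<omega>) r (cpx \<zeta>)) \<partial>M) * indicator A \<zeta>) \<in> borel_measurable lborel"
      by measurable
  qed
  finally show ?thesis by (simp add: mult.assoc)
qed

lemma nn_integral_log_excess_AE:
  assumes r: "0 < r" "r < 1" and strip: "\<forall>\<zeta>\<in>A. r < snd \<zeta> \<and> snd \<zeta> + r < 2 * pi"
    and A [measurable]: "A \<in> sets borel"
    and int: "\<And>\<zeta>. \<zeta> \<in> A \<Longrightarrow> integrable M (\<lambda>\<omega>. log_excess (P \<omega>) r (cpx \<zeta>))"
  shows "AE \<zeta> in lborel. \<zeta> \<in> A \<longrightarrow> (\<integral>\<^sup>+ \<omega>. ennreal (log_excess (P \<omega>) r (cpx \<zeta>)) \<partial>M) = ennreal (expectation (\<lambda>\<omega>. log_excess (P \<omega>) r (cpx \<zeta>)))"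
  using AE_log_excess_nonneg[OF r strip A]
proof eventually_elim
  case (elim \<zeta>)
  then show ?case using int[of \<zeta>] by (auto intro!: nn_integral_eq_integral)
qed

text \<open>A zero in \<open>A\<close> is an interior point of \<open>U\<close>, so its kernel mass
  in \<open>U\<close> is exactly 1 once the radius is small. The count is thus at most the lower
  limit of the smoothed counts, and Fatou's lemma passes to expectations. The hypothesis on the
  excess is needed at all small radii for the same polynomial.\<close>

lemma expected_zeros_upper:
  assumes r1: "0 < r1" "r1 < 1" and strip: "\<forall>\<zeta>\<in>U. r1 < snd \<zeta> \<and> snd \<zeta> + r1 < 2 * pi"
    and U: "open U" "A \<subseteq> U"
    and int: "\<And>\<zeta> r. \<zeta> \<in> U \<Longrightarrow> 0 < r \<Longrightarrow> r \<le> r1 \<Longrightarrow> integrable M (\<lambda>\<omega>. log_excess (P \<omega>) r (cpx \<zeta>))"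
    and bnd: "\<And>\<zeta> r. \<zeta> \<in> U \<Longrightarrow> 0 < r \<Longrightarrow> r \<le> r1 \<Longrightarrow> expectation (\<lambda>\<omega>. log_excess (P \<omega>) r (cpx \<zeta>)) \<le> pi * r\<^sup>2 / 2 * g \<zeta>"
  shows "(\<integral>\<^sup>+ \<omega>. of_nat (zero_count (P \<omega>) A) \<partial>M) \<le> (\<integral>\<^sup>+ \<zeta>. ennreal (g \<zeta>) * indicator U \<zeta> \<partial>lborel)"
proof -
  have Ub [measurable]: "U \<in> sets borel" using U by auto
  define R where "R = (\<lambda>k::nat. r1 / real (Suc k))"
  have R: "0 < R k" "R k \<le> r1" "R k < 1" for k
  proof -
    show "0 < R k" "R k \<le> r1" using r1 by (auto simp: R_def divide_le_eq)
    then show "R k < 1" using r1 by simp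
  qed
  have Rlim: "R \<longlonglongrightarrow> 0" unfolding R_def by (rule LIMSEQ_Suc) (rule lim_const_over_n)
  have "(\<integral>\<^sup>+ \<omega>. of_nat (zero_count (P \<omega>) A) \<partial>M) \<le> (\<integral>\<^sup>+ \<omega>. liminf (\<lambda>k. smoothed U (R k) \<omega>) \<partial>M)"
  proof (rule nn_integral_mono_AE)
    show "AE \<omega> in M. of_nat (zero_count (P \<omega>) A) \<le> liminf (\<lambda>k. smoothed U (R k) \<omega>)"
      using simple
    proof eventually_elim
      case (elim \<omega>)
      note sqf = elim
      then have p0: "P \<omega> \<noteq> 0" by (auto simp: rsquarefree_def)
      define Z where "Z = {a. poly (P \<omega>) a = 0 \<and> a \<noteq> 0}"
      have fin: "finite Z" unfolding Z_def using poly_roots_finite[OF p0] by (rule rev_finite_subset) auto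
      define ZA where "ZA = {a \<in> Z. (Re (clog a), Im (clog a)) \<in> A}"
      have "\<forall>a\<in>ZA. eventually (\<lambda>k. kernel_mass (R k) U (clog a) = 1) sequentially"
      proof
        fix a assume "a \<in> ZA"
        then have "(Re (clog a), Im (clog a)) \<in> U" using U by (auto simp: ZA_def)
        then obtain e where e: "e > 0" "ball (Re (clog a), Im (clog a)) e \<subseteq> U" using U(1) openE by blast
        have "eventually (\<lambda>k. R k < e) sequentially" using Rlim e(1) by (rule order_tendstoD)
        then show "eventually (\<lambda>k. kernel_mass (R k) U (clog a) = 1) sequentially"
        proof eventually_elim
          case (elim k)
          then have "ball (Re (clog a), Im (clog a)) (R k) \<subseteq> U" using e(2) subset_ball[of "R k" e] by fastforce
          then show ?case using R by (intro kernel_mass_eq_1) auto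
        qed
      qed
      then have "eventually (\<lambda>k. \<forall>a\<in>ZA. kernel_mass (R k) U (clog a) = 1) sequentially"
        using fin by (intro eventually_ball_finite) (auto simp: ZA_def)
      then have "eventually (\<lambda>k. of_nat (zero_count (P \<omega>) A) \<le> smoothed U (R k) \<omega>) sequentially"
      proof eventually_elim
        case (elim k)
        have "of_nat (zero_count (P \<omega>) A) = (\<Sum>a\<in>ZA. (1::ennreal))"
          by (simp add: zero_count_def ZA_def Z_def conj_assoc)
        also have "\<dots> = (\<Sum>a\<in>ZA. kernel_mass (R k) U (clog a))" using elim by simp
        also have "\<dots> \<le> (\<Sum>a\<in>Z. kernel_mass (R k) U (clog a))"
          using fin by (intro sum_mono2) (auto simp: ZA_def)
        also have "\<dots> = smoothed U (R k) \<omega>"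
          unfolding smoothed_def Z_def
          using R[of k] strip by (intro nn_integral_log_excess[symmetric] sqf) fastforce+
        finally show ?case .
      qed
      then show ?case by (rule Liminf_bounded)
    qed
  qed
  also have "\<dots> \<le> liminf (\<lambda>k. \<integral>\<^sup>+ \<omega>. smoothed U (R k) \<omega> \<partial>M)"
    by (intro nn_integral_liminf smoothed_measurable Ub)
  also have "\<dots> \<le> liminf (\<lambda>k. \<integral>\<^sup>+ \<zeta>. ennreal (g \<zeta>) * indicator U \<zeta> \<partial>lborel)"
  proof (intro Liminf_mono always_eventually allI)
    fix k
    have "AE \<zeta> in lborel. \<zeta> \<in> U \<longrightarrow> (\<integral>\<^sup>+ \<omega>. ennreal (log_excess (P \<omega>) (R k) (cpx \<zeta>)) \<partial>M) = ennreal (expectation (\<lambda>\<omega>. log_excess (P \<omega>) (R k) (cpx \<zeta>)))"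
      using R[of k] strip by (intro nn_integral_log_excess_AE int) fastforce+
    then show "(\<integral>\<^sup>+ \<omega>. smoothed U (R k) \<omega> \<partial>M) \<le> (\<integral>\<^sup>+ \<zeta>. ennreal (g \<zeta>) * indicator U \<zeta> \<partial>lborel)"
      unfolding nn_integral_smoothed[OF Ub]
    proof (intro nn_integral_mono_AE, eventually_elim)
      case (elim \<zeta>)
      show ?case
      proof (cases "\<zeta> \<in> U")
        case True
        have "ennreal (2 / (pi * (R k)\<^sup>2)) * ennreal (expectation (\<lambda>\<omega>. log_excess (P \<omega>) (R k) (cpx \<zeta>)))
           \<le> ennreal (2 / (pi * (R k)\<^sup>2)) * ennreal (pi * (R k)\<^sup>2 / 2 * g \<zeta>)"
          using bnd[OF True R(1) R(2)] by (intro mult_left_mono ennreal_leI) auto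
        also have "\<dots> = ennreal (g \<zeta>)"
          using R(1)[of k] by (subst ennreal_mult'[symmetric]) auto
        finally show ?thesis using elim True by simp
      qed simp
    qed
  qed
  also have "\<dots> = (\<integral>\<^sup>+ \<zeta>. ennreal (g \<zeta>) * indicator U \<zeta> \<partial>lborel)" by (simp add: Liminf_const)
  finally show ?thesis .
qed

text \<open>Dual to the upper bound: a zero outside \<open>A\<close> has positive distance from the
  closed set \<open>C\<close>, so its kernel mass in \<open>C\<close> is eventually 0, while zeros
  in \<open>A\<close> contribute at most 1 each. The limit passes through the expectation by the
  reverse Fatou lemma, with domination by the degree.\<close>

lemma expected_zeros_lower:
  assumes r1: "0 < r1" "r1 < 1" and strip: "\<forall>\<zeta>\<in>C. r1 < snd \<zeta> \<and> snd \<zeta> + r1 < 2 * pi"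
    and C: "closed C" "C \<subseteq> A"
    and int: "\<And>\<zeta> r. \<zeta> \<in> C \<Longrightarrow> 0 < r \<Longrightarrow> r \<le> r1 \<Longrightarrow> integrable M (\<lambda>\<omega>. log_excess (P \<omega>) r (cpx \<zeta>))"
    and bnd: "\<And>\<zeta> r. \<zeta> \<in> C \<Longrightarrow> 0 < r \<Longrightarrow> r \<le> r1 \<Longrightarrow> pi * r\<^sup>2 / 2 * g \<zeta> \<le> expectation (\<lambda>\<omega>. log_excess (P \<omega>) r (cpx \<zeta>))"
  shows "(\<integral>\<^sup>+ \<zeta>. ennreal (g \<zeta>) * indicator C \<zeta> \<partial>lborel) \<le> (\<integral>\<^sup>+ \<omega>. of_nat (zero_count (P \<omega>) A) \<partial>M)"
proof -
  have Cb [measurable]: "C \<in> sets borel" using C by auto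
  define R where "R = (\<lambda>k::nat. r1 / real (Suc k))"
  have R: "0 < R k" "R k \<le> r1" "R k < 1" for k
  proof -
    show "0 < R k" "R k \<le> r1" using r1 by (auto simp: R_def divide_le_eq)
    then show "R k < 1" using r1 by simp
  qed
  have Rlim: "R \<longlonglongrightarrow> 0" unfolding R_def by (rule LIMSEQ_Suc) (rule lim_const_over_n)
  have sm: "smoothed C (R k) \<omega> = (\<Sum>a | poly (P \<omega>) a = 0 \<and> a \<noteq> 0. kernel_mass (R k) C (clog a))"
    if "rsquarefree (P \<omega>)" for k \<omega>
    unfolding smoothed_def using R[of k] strip by (intro nn_integral_log_excess that) fastforce+
  have "(\<integral>\<^sup>+ \<zeta>. ennreal (g \<zeta>) * indicator C \<zeta> \<partial>lborel) = limsup (\<lambda>k. \<integral>\<^sup>+ \<zeta>. ennreal (g \<zeta>) * indicator C \<zeta> \<partial>lborel)"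
    by (simp add: Limsup_const)
  also have "\<dots> \<le> limsup (\<lambda>k. \<integral>\<^sup>+ \<omega>. smoothed C (R k) \<omega> \<partial>M)"
  proof (intro Limsup_mono always_eventually allI)
    fix k
    have "AE \<zeta> in lborel. \<zeta> \<in> C \<longrightarrow> (\<integral>\<^sup>+ \<omega>. ennreal (log_excess (P \<omega>) (R k) (cpx \<zeta>)) \<partial>M) = ennreal (expectation (\<lambda>\<omega>. log_excess (P \<omega>) (R k) (cpx \<zeta>)))"
      using R[of k] strip by (intro nn_integral_log_excess_AE int) fastforce+
    then show "(\<integral>\<^sup>+ \<zeta>. ennreal (g \<zeta>) * indicator C \<zeta> \<partial>lborel) \<le> (\<integral>\<^sup>+ \<omega>. smoothed C (R k) \<omega> \<partial>M)"
      unfolding nn_integral_smoothed[OF Cb]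
    proof (intro nn_integral_mono_AE, eventually_elim)
      case (elim \<zeta>)
      show ?case
      proof (cases "\<zeta> \<in> C")
        case True
        have "ennreal (g \<zeta>) = ennreal (2 / (pi * (R k)\<^sup>2)) * ennreal (pi * (R k)\<^sup>2 / 2 * g \<zeta>)"
          using R(1)[of k] by (subst ennreal_mult'[symmetric]) auto
        also have "\<dots> \<le> ennreal (2 / (pi * (R k)\<^sup>2)) * ennreal (expectation (\<lambda>\<omega>. log_excess (P \<omega>) (R k) (cpx \<zeta>)))"
          using bnd[OF True R(1) R(2)] by (intro mult_left_mono ennreal_leI) auto
        finally show ?thesis using elim True by simp
      qed simp
    qed
  qed
  also have "\<dots> \<le> (\<integral>\<^sup>+ \<omega>. limsup (\<lambda>k. smoothed C (R k) \<omega>) \<partial>M)"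
  proof (rule nn_integral_limsup[where w = "\<lambda>_. of_nat n"])
    show "AE \<omega> in M. smoothed C (R k) \<omega> \<le> of_nat n" for k
      using simple
    proof eventually_elim
      case (elim \<omega>)
      note sqf = elim
      then have p0: "P \<omega> \<noteq> 0" by (auto simp: rsquarefree_def)
      have "smoothed C (R k) \<omega> \<le> (\<Sum>a | poly (P \<omega>) a = 0 \<and> a \<noteq> 0. 1)"
        unfolding sm[OF elim] by (intro sum_mono kernel_mass_le_1 R)
      also have "\<dots> = of_nat (card {a. poly (P \<omega>) a = 0 \<and> a \<noteq> 0})" by simp
      also have "card {a. poly (P \<omega>) a = 0 \<and> a \<noteq> 0} \<le> card {a. poly (P \<omega>) a = 0}"
        by (intro card_mono poly_roots_finite p0) auto
      also have "card {a. poly (P \<omega>) a = 0} \<le> n"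
        using card_poly_roots_bound[OF p0] deg[of \<omega>] by linarith
      finally show ?case by simp
    qed
  qed (auto intro: smoothed_measurable simp: emeasure_space_1 of_nat_less_top)
  also have "\<dots> \<le> (\<integral>\<^sup>+ \<omega>. of_nat (zero_count (P \<omega>) A) \<partial>M)"
  proof (rule nn_integral_mono_AE)
    show "AE \<omega> in M. limsup (\<lambda>k. smoothed C (R k) \<omega>) \<le> of_nat (zero_count (P \<omega>) A)"
      using simple
    proof eventually_elim
      case (elim \<omega>)
      note sqf = elim
      then have p0: "P \<omega> \<noteq> 0" by (auto simp: rsquarefree_def)
      define Z where "Z = {a. poly (P \<omega>) a = 0 \<and> a \<noteq> 0}"
      have fin: "finite Z" unfolding Z_def using poly_roots_finite[OF p0] by (rule rev_finite_subset) auto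
      define ZA where "ZA = {a \<in> Z. (Re (clog a), Im (clog a)) \<in> A}"
      have "\<forall>a\<in>Z - ZA. eventually (\<lambda>k. kernel_mass (R k) C (clog a) = 0) sequentially"
      proof
        fix a assume "a \<in> Z - ZA"
        then have "(Re (clog a), Im (clog a)) \<in> - C" using C by (auto simp: ZA_def)
        moreover have "open (- C)" using C by auto
        ultimately obtain e where e: "e > 0" "ball (Re (clog a), Im (clog a)) e \<subseteq> - C" using openE by blast
        have "eventually (\<lambda>k. R k < e) sequentially" using Rlim e(1) by (rule order_tendstoD)
        then show "eventually (\<lambda>k. kernel_mass (R k) C (clog a) = 0) sequentially"
        proof eventually_elim
          case (elim k)
          then have "ball (Re (clog a), Im (clog a)) (R k) \<inter> C = {}" using e(2) subset_ball[of "R k" e] by fastforce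
          then show ?case by (rule kernel_mass_eq_0)
        qed
      qed
      then have "eventually (\<lambda>k. \<forall>a\<in>Z - ZA. kernel_mass (R k) C (clog a) = 0) sequentially"
        using fin by (intro eventually_ball_finite) auto
      then have "eventually (\<lambda>k. smoothed C (R k) \<omega> \<le> of_nat (zero_count (P \<omega>) A)) sequentially"
      proof eventually_elim
        case (elim k)
        have "smoothed C (R k) \<omega> = (\<Sum>a\<in>Z. kernel_mass (R k) C (clog a))" by (simp add: sm sqf Z_def)
        also have "\<dots> = (\<Sum>a\<in>ZA. kernel_mass (R k) C (clog a))"
          using fin elim by (intro sum.mono_neutral_right) (auto simp: ZA_def)
        also have "\<dots> \<le> (\<Sum>a\<in>ZA. 1)" by (intro sum_mono kernel_mass_le_1 R)
        also have "\<dots> = of_nat (zero_count (P \<omega>) A)"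
          by (simp add: zero_count_def ZA_def Z_def conj_assoc)
        finally show ?case .
      qed
      then show ?case by (rule Limsup_bounded)
    qed
  qed
  finally show ?thesis .
qed

end

section \<open>Almost sure simplicity of the zeros\<close>

lemma pderiv_sum_distrib: "pderiv (\<Sum>i\<in>A. p i) = (\<Sum>i\<in>A. pderiv (p i))"
  by (induction A rule: infinite_finite_induct) (auto simp: pderiv_add)

text \<open>The existence of a double root is a projection onto the coefficients, so measurability
  is not immediate. It holds because a common zero of P and P' exists exactly if |P| + |P'| has
  infimum 0 on some ball: by compactness the infimum over the closed ball is attained, and by
  continuity it can be taken over a countable dense set.\<close>

lemma double_root_measurable:
  fixes p :: "nat \<Rightarrow> complex poly"
  shows "{x \<in> space (Pi\<^sub>M {..<n} (\<lambda>_. borel)). \<not> rsquarefree (\<Sum>i<n. smult (of_real (x i)) (p i))} \<in> sets (Pi\<^sub>M {..<n} (\<lambda>_. (borel :: real measure)))"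
proof -
  define N where "N = Pi\<^sub>M {..<n} (\<lambda>_. (borel :: real measure))"
  define f where "f x z = cmod (\<Sum>i<n. of_real (x i) * poly (p i) z) + cmod (\<Sum>i<n. of_real (x i) * poly (pderiv (p i)) z)"
    for x :: "nat \<Rightarrow> real" and z
  obtain D :: "complex set" where D: "countable D" "\<And>X. open X \<Longrightarrow> X \<noteq> {} \<Longrightarrow> \<exists>d\<in>D. d \<in> X"
    by (rule countable_dense_setE) blast
  have fm [measurable]: "(\<lambda>x. f x z) \<in> borel_measurable N" for z
    unfolding f_def N_def by measurable
  have fc: "continuous_on A (f x)" for A x unfolding f_def by (intro continuous_intros)
  define m where "m k x = (INF z\<in>D \<inter> ball 0 (real (Suc k)). ennreal (f x z))" for k x
  have mm [measurable]: "m k \<in> borel_measurable N" for k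
    unfolding m_def using D(1) by (intro borel_measurable_INF countable_Int1) measurable
  have iff: "\<not> rsquarefree (\<Sum>i<n. smult (of_real (x i)) (p i)) \<longleftrightarrow> (\<exists>k. m k x = 0)" for x
  proof -
    have "\<not> rsquarefree (\<Sum>i<n. smult (of_real (x i)) (p i)) \<longleftrightarrow> (\<exists>a. f x a = 0)"
    proof -
      have "f x a = 0 \<longleftrightarrow> poly (\<Sum>i<n. smult (of_real (x i)) (p i)) a = 0 \<and> poly (pderiv (\<Sum>i<n. smult (of_real (x i)) (p i))) a = 0" for a
        unfolding f_def by (subst add_nonneg_eq_0_iff) (simp_all add: poly_sum pderiv_sum_distrib pderiv_smult)
      then show ?thesis unfolding rsquarefree_roots by blast
    qed
    also have "\<dots> \<longleftrightarrow> (\<exists>k. m k x = 0)"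
    proof
      assume "\<exists>a. f x a = 0"
      then obtain a where a: "f x a = 0" by blast
      obtain k where k: "cmod a < real k" using reals_Archimedean2 by blast
      have "m k x \<le> ennreal e" if e: "e > 0" for e
      proof -
        have op: "open {z. f x z < e}" by (intro open_Collect_less fc continuous_on_const)
        have "open ({z. f x z < e} \<inter> ball 0 (real (Suc k)))" using op by (intro open_Int) auto
        moreover have "a \<in> {z. f x z < e} \<inter> ball 0 (real (Suc k))" using a e k by auto
        ultimately obtain d where "d \<in> D" "d \<in> {z. f x z < e} \<inter> ball 0 (real (Suc k))" using D(2) by blast
        then show ?thesis unfolding m_def by (intro INF_lower2[of d]) (auto intro: ennreal_leI)
      qed
      then have "m k x \<le> 0" using ennreal_le_epsilon[of 0 "m k x"] by simp
      then show "\<exists>k. m k x = 0" by auto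
    next
      assume "\<exists>k. m k x = 0"
      then obtain k where k: "m k x = 0" by blast
      obtain a where a: "a \<in> cball 0 (real (Suc k))" "\<And>z. z \<in> cball 0 (real (Suc k)) \<Longrightarrow> f x a \<le> f x z"
        using continuous_attains_inf[of "cball 0 (real (Suc k))" "f x"] fc by auto
      have "ennreal (f x a) \<le> m k x"
        unfolding m_def by (intro INF_greatest ennreal_leI a(2)) auto
      moreover have "f x a \<ge> 0" by (simp add: f_def)
      ultimately have "f x a = 0" using k by simp
      then show "\<exists>a. f x a = 0" by blast
    qed
    finally show ?thesis .
  qed
  show ?thesis unfolding iff N_def[symmetric] by measurable
qed

context std_gaussians
begin

text \<open>All coefficients except that of the constant polynomial are frozen, leaving y c0 + Q
  with y Gaussian. A double root is a critical point of Q, and each critical point allows only one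
  value of y, so finitely many y are bad. That Q is not constant follows from the almost surely
  nonzero top coefficient and n \<ge> 2.\<close>

lemma AE_rsquarefree:
  fixes p :: "nat \<Rightarrow> complex poly"
  assumes deg: "\<And>i. i < n \<Longrightarrow> degree (p i) = i" and p0: "p 0 \<noteq> 0" and n: "n \<ge> 2"
  shows "AE \<omega> in M. rsquarefree (\<Sum>i<n. smult (of_real (\<eta> i \<omega>)) (p i))"
proof -
  define B where "B = {x \<in> space (Pi\<^sub>M {..<n} (\<lambda>_. borel)). \<not> rsquarefree (\<Sum>i<n. smult (of_real (x i)) (p i))}"
  have B: "B \<in> sets (Pi\<^sub>M {..<n} (\<lambda>_. (borel :: real measure)))" unfolding B_def by (rule double_root_measurable)
  have sets: "sets (Pi\<^sub>M I (\<lambda>_. gauss)) = sets (Pi\<^sub>M I (\<lambda>_. borel))" for I :: "nat set"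
    by (rule sets_PiM_cong) auto
  have split: "{..<n} = insert 0 {1..<n}" using n by auto
  obtain c0 where c0: "p 0 = [:c0:]" using deg[of 0] n by (metis degree_eq_zeroE pos2 less_le_trans)
  then have c0': "c0 \<noteq> 0" using p0 by auto
  have "emeasure (Pi\<^sub>M {..<n} (\<lambda>_. gauss)) B = (\<integral>\<^sup>+ x. indicator B x \<partial>Pi\<^sub>M {..<n} (\<lambda>_. gauss))"
    using B by (simp add: sets)
  also have "\<dots> = (\<integral>\<^sup>+ x. (\<integral>\<^sup>+ y. indicator B (x(0 := y)) \<partial>gauss) \<partial>Pi\<^sub>M {1..<n} (\<lambda>_. gauss))"
    unfolding split
  proof (rule gauss_prod.product_nn_integral_insert)
    show "indicator B \<in> borel_measurable (Pi\<^sub>M (insert 0 {1..<n}) (\<lambda>_. gauss))"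
      using B unfolding split by (intro borel_measurable_indicator) (simp add: sets)
  qed auto
  also have "\<dots> = (\<integral>\<^sup>+ x. 0 \<partial>Pi\<^sub>M {1..<n} (\<lambda>_. gauss))"
  proof (rule nn_integral_cong_AE)
    have "AE y in lborel. y \<noteq> (0::real)" by (rule AE_lborel_singleton)
    then have "AE y in gauss. y \<noteq> 0" by (subst AE_density) auto
    then have "AE x in Pi\<^sub>M {1..<n} (\<lambda>_. gauss). x (n - 1) \<noteq> 0"
      using n by (intro AE_PiM_component[of "{1..<n}" "\<lambda>_. gauss" "n - 1" "\<lambda>y. y \<noteq> 0"] gauss.prob_space_axioms) auto
    then show "AE x in Pi\<^sub>M {1..<n} (\<lambda>_. gauss). (\<integral>\<^sup>+ y. indicator B (x(0 := y)) \<partial>gauss) = 0"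
    proof eventually_elim
      case (elim x)
      define Q where "Q = (\<Sum>i=1..<n. smult (of_real (x i)) (p i))"
      have Pxy: "(\<Sum>i<n. smult (of_real ((x(0 := y)) i)) (p i)) = [:of_real y * c0:] + Q" for y
        unfolding split by (subst sum.insert) (auto simp: c0 Q_def intro!: sum.cong)
      have "coeff Q (n - 1) \<noteq> 0"
      proof -
        have "coeff Q (n - 1) = (\<Sum>i=1..<n. of_real (x i) * coeff (p i) (n - 1))" by (simp add: Q_def coeff_sum)
        also have "\<dots> = (\<Sum>i\<in>{n - 1}. of_real (x i) * coeff (p i) (n - 1))"
          using n deg by (intro sum.mono_neutral_right) (auto intro!: coeff_eq_0)
        finally have "coeff Q (n - 1) = of_real (x (n - 1)) * coeff (p (n - 1)) (n - 1)" by simp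
        moreover have "p (n - 1) \<noteq> 0" using deg[of "n - 1"] n by auto
        then have "coeff (p (n - 1)) (n - 1) \<noteq> 0" using deg[of "n - 1"] n
          by (metis diff_less leading_coeff_0_iff less_le_trans pos2 zero_less_one)
        ultimately show ?thesis using elim by simp
      qed
      then have "degree Q \<ge> n - 1" by (rule le_degree)
      then have "pderiv Q \<noteq> 0" using n by (auto simp: pderiv_eq_0_iff)
      then have fin: "finite {a. poly (pderiv Q) a = 0}" by (rule poly_roots_finite)
      define Y where "Y = (\<lambda>a. Re (- poly Q a / c0)) ` {a. poly (pderiv Q) a = 0}"
      have "finite Y" unfolding Y_def using fin by simp
      have "indicator B (x(0 := y)) \<le> (indicator Y y :: ennreal)" for y
      proof (cases "x(0 := y) \<in> B")
        case True
        then obtain a where a: "poly ([:of_real y * c0:] + Q) a = 0" "poly (pderiv ([:of_real y * c0:] + Q)) a = 0"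
          unfolding B_def by (auto simp: Pxy rsquarefree_roots simp del: fun_upd_apply)
        have "poly (pderiv Q) a = 0" using a(2) by (simp add: pderiv_add pderiv_pCons)
        moreover have "of_real y = - poly Q a / c0" using a(1) c0' by (simp add: field_simps add_eq_0_iff)
        then have "y = Re (- poly Q a / c0)" by (metis Re_complex_of_real)
        ultimately have "y \<in> Y" unfolding Y_def by blast
        then show ?thesis by (simp add: indicator_def)
      qed simp
      then have "(\<integral>\<^sup>+ y. indicator B (x(0 := y)) \<partial>gauss) \<le> (\<integral>\<^sup>+ y. indicator Y y \<partial>gauss)"
        by (intro nn_integral_mono)
      also have "\<dots> = 0"
      proof -
        have "Y \<in> null_sets lborel" using \<open>finite Y\<close> by (rule finite_imp_null_set_lborel)
        then have "AE y in lborel. y \<notin> Y" by (rule AE_not_in)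
        then have "AE y in gauss. y \<notin> Y" by (subst AE_density) auto
        then show ?thesis using \<open>finite Y\<close> by (subst nn_integral_0_iff_AE) (auto simp: indicator_def intro!: borel_measurable_indicator borel_closed finite_imp_closed)
      qed
      finally show ?case by simp
    qed
  qed
  finally have null: "emeasure (Pi\<^sub>M {..<n} (\<lambda>_. gauss)) B = 0" by simp
  have Bm: "indicator B \<in> borel_measurable (Pi\<^sub>M {..<n} (\<lambda>_. (borel :: real measure)))"
    using B by simp
  have Xm: "(\<lambda>\<omega>. \<lambda>i\<in>{..<n}. \<eta> i \<omega>) \<in> measurable M (Pi\<^sub>M {..<n} (\<lambda>_. borel))"
    by (intro measurable_restrict eta_measurable)
  have "(\<integral>\<^sup>+ \<omega>. indicator B (\<lambda>i\<in>{..<n}. \<eta> i \<omega>) \<partial>M) = (\<integral>\<^sup>+ x. indicator B x \<partial>Pi\<^sub>M {..<n} (\<lambda>_. gauss))"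
    using n by (intro nn_integral_eta Bm) auto
  also have "\<dots> = 0" using null B by (simp add: sets)
  finally have "AE \<omega> in M. indicator B (\<lambda>i\<in>{..<n}. \<eta> i \<omega>) = (0::ennreal)"
    by (subst (asm) nn_integral_0_iff_AE) (rule measurable_compose[OF Xm Bm])
  then show ?thesis
  proof eventually_elim
    case (elim \<omega>)
    have "(\<lambda>i\<in>{..<n}. \<eta> i \<omega>) \<in> space (Pi\<^sub>M {..<n} (\<lambda>_. (borel :: real measure)))" by (auto simp: space_PiM)
    moreover have "(\<lambda>i\<in>{..<n}. \<eta> i \<omega>) \<notin> B" using elim by (auto simp: indicator_def split: if_splits)
    ultimately show ?case by (simp add: B_def)
  qed
qed

end

section \<open>Orthogonal polynomials on the unit circle\<close>

locale opuc = prob_space \<mu> for \<mu> :: "complex measure" +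
  fixes \<Phi> :: "nat \<Rightarrow> complex poly" and \<alpha> :: "nat \<Rightarrow> complex"
  assumes sets_\<mu> [measurable_cong]: "sets \<mu> = sets borel"
    and on_circle: "emeasure \<mu> (sphere 0 1) = 1"
    and symm: "conj_symmetric \<mu>"
    and inf_supp: "infinite (msupport \<mu>)"
    and OP: "monic_OP \<mu> \<Phi>"
    and szego: "\<And>i. \<Phi> (Suc i) = [:0, 1:] * \<Phi> i - smult (\<alpha> i) (reflect_poly (\<Phi> i))"
begin

lemma space_\<mu> [simp]: "space \<mu> = UNIV"
  using sets_eq_imp_space_eq[OF sets_\<mu>] by simp

lemma AE_circle: "AE z in \<mu>. cmod z = 1"
proof -
  have "prob (sphere 0 1) = 1" using on_circle by (simp add: measure_def)
  then have "AE z in \<mu>. z \<in> sphere 0 1" by (subst AE_in_set_eq_1) (auto simp: sets_\<mu>)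
  then show ?thesis by simp
qed

lemma integrable_continuous:
  fixes f :: "complex \<Rightarrow> 'b::{banach, second_countable_topology}"
  assumes f: "continuous_on UNIV f" shows "integrable \<mu> f"
proof -
  have "bounded (f ` sphere 0 1)"
    by (intro compact_imp_bounded compact_continuous_image continuous_on_subset[OF f]) auto
  then obtain B where "\<forall>x\<in>f ` sphere 0 1. norm x \<le> B" unfolding bounded_iff by blast
  then have B: "\<And>z. cmod z = 1 \<Longrightarrow> norm (f z) \<le> B" by simp
  have "f \<in> borel_measurable borel" using f by (rule borel_measurable_continuous_onI)
  then have "f \<in> borel_measurable \<mu>" by (simp add: measurable_cong_sets[OF sets_\<mu> refl])
  then show ?thesis
    using AE_circle B by (intro integrable_const_bound[where B = B]) auto
qed

definition ip :: "complex poly \<Rightarrow> complex poly \<Rightarrow> complex" where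
  "ip p q = (LINT z|\<mu>. poly p z * cnj (poly q z))"

lemma ip_integrable: "integrable \<mu> (\<lambda>z. poly p z * cnj (poly q z))"
  by (intro integrable_continuous continuous_intros)

lemma ip_add_left: "ip (p + q) r = ip p r + ip q r"
  unfolding ip_def by (simp add: distrib_right Bochner_Integration.integral_add ip_integrable)

lemma ip_diff_left: "ip (p - q) r = ip p r - ip q r"
  unfolding ip_def by (simp add: left_diff_distrib Bochner_Integration.integral_diff ip_integrable)

lemma ip_smult_left: "ip (smult c p) r = c * ip p r"
  unfolding ip_def by (simp add: mult.assoc)

lemma ip_cnj: "ip q p = cnj (ip p q)"
  unfolding ip_def by (subst Bochner_Integration.integral_cnj[symmetric]) (simp add: mult.commute)

lemma ip_0_left [simp]: "ip 0 r = 0" by (simp add: ip_def)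

lemma ip_sum_left: "ip (\<Sum>i\<in>A. f i) r = (\<Sum>i\<in>A. ip (f i) r)"
  by (induction A rule: infinite_finite_induct) (auto simp: ip_add_left)

lemma ip_smult_right: "ip p (smult c q) = cnj c * ip p q"
  by (subst (1 2) ip_cnj) (simp add: ip_smult_left)

lemma ip_sum_right: "ip r (\<Sum>i\<in>A. f i) = (\<Sum>i\<in>A. ip r (f i))"
  by (subst (1 2) ip_cnj) (simp add: ip_sum_left)

lemma ip_diff_right: "ip r (p - q) = ip r p - ip r q"
  by (subst (1 2 3) ip_cnj) (simp add: ip_diff_left)

lemma ip_self: "ip p p = of_real (LINT z|\<mu>. (cmod (poly p z))\<^sup>2)"
  unfolding ip_def by (simp add: integral_complex_of_real[symmetric] complex_norm_square del: of_real_power)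

lemma norm2_integrable: "integrable \<mu> (\<lambda>z. (cmod (poly p z))\<^sup>2)"
  by (intro integrable_continuous continuous_intros)

text \<open>If the norm vanishes, \<mu> is carried by the zero set of \<open>p\<close>; this finite
  set is closed, hence contains the support. This is where infinite support enters.\<close>

lemma norm2_pos:
  assumes "p \<noteq> 0" shows "(LINT z|\<mu>. (cmod (poly p z))\<^sup>2) > 0"
proof (rule ccontr)
  assume "\<not> ?thesis"
  moreover have "(LINT z|\<mu>. (cmod (poly p z))\<^sup>2) \<ge> 0" by simp
  ultimately have "(LINT z|\<mu>. (cmod (poly p z))\<^sup>2) = 0" by linarith
  then have AE: "AE z in \<mu>. (cmod (poly p z))\<^sup>2 = 0"
    by (subst (asm) integral_nonneg_eq_0_iff_AE) (auto simp: norm2_integrable)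
  define Z where "Z = {z. poly p z = 0}"
  have fin: "finite Z" unfolding Z_def by (rule poly_roots_finite[OF assms])
  have "msupport \<mu> \<subseteq> Z"
  proof
    fix z assume z: "z \<in> msupport \<mu>"
    show "z \<in> Z"
    proof (rule ccontr)
      assume "z \<notin> Z"
      moreover have "open (- Z)" using fin by (simp add: finite_imp_closed open_Compl)
      ultimately obtain e where e: "e > 0" "ball z e \<subseteq> - Z" using openE[of "-Z" z] by blast
      have "AE x in \<mu>. x \<notin> ball z e" using AE by eventually_elim (use e in \<open>auto simp: Z_def\<close>)
      then have "emeasure \<mu> (ball z e) = 0"
        by (subst (asm) AE_iff_measurable[of "ball z e"]) (auto simp: sets_\<mu>)
      then show False using z e by (auto simp: msupport_def)
    qed
  qed
  then show False using fin inf_supp finite_subset by blast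
qed

lemma degree_\<Phi> [simp]: "degree (\<Phi> i) = i" and coeff_\<Phi> [simp]: "coeff (\<Phi> i) i = 1"
  using OP unfolding monic_OP_def by metis+

lemma \<Phi>_nonzero [simp]: "\<Phi> i \<noteq> 0" using coeff_\<Phi>[of i] by (metis coeff_0 zero_neq_one)

lemma \<Phi>_orth: "j < i \<Longrightarrow> ip (\<Phi> i) (\<Phi> j) = 0"
  using OP unfolding monic_OP_def ip_def by blast

lemma span_\<Phi>:
  assumes "\<And>k. k \<ge> n \<Longrightarrow> coeff q k = 0"
  shows "\<exists>c. q = (\<Sum>j<n. smult (c j) (\<Phi> j))"
  using assms
proof (induction n arbitrary: q)
  case 0
  then show ?case by (simp add: poly_eq_iff)
next
  case (Suc n)
  define q' where "q' = q - smult (coeff q n) (\<Phi> n)"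
  have "coeff q' k = 0" if "k \<ge> n" for k
    using that Suc.prems[of k] by (cases "k = n") (auto simp: q'_def coeff_eq_0)
  then obtain c where c: "q' = (\<Sum>j<n. smult (c j) (\<Phi> j))" using Suc.IH by blast
  have "q = (\<Sum>j<n. smult ((c(n := coeff q n)) j) (\<Phi> j)) + smult (coeff q n) (\<Phi> n)"
    using c by (simp add: q'_def diff_eq_eq)
  then show ?case by (intro exI[of _ "c(n := coeff q n)"]) simp
qed

lemma orth_lower:
  assumes "\<And>k. k \<ge> i \<Longrightarrow> coeff q k = 0" shows "ip (\<Phi> i) q = 0"
proof -
  obtain c where c: "q = (\<Sum>j<i. smult (c j) (\<Phi> j))" using span_\<Phi>[OF assms] by blast
  show ?thesis unfolding c by (auto simp: ip_sum_right ip_smult_right \<Phi>_orth)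
qed

section \<open>Reality from conjugation symmetry\<close>

lemma distr_cnj: "distr \<mu> borel cnj = \<mu>"
proof (rule measure_eqI)
  show "sets (distr \<mu> borel cnj) = sets \<mu>" by (simp add: sets_\<mu>)
  have cm: "cnj \<in> borel_measurable borel" by (intro borel_measurable_continuous_onI continuous_intros)
  fix A assume "A \<in> sets (distr \<mu> borel cnj)"
  then have A: "A \<in> sets borel" by simp
  have "cnj -` A = cnj ` A" by (auto simp: image_iff) (metis complex_cnj_cnj)
  then have "emeasure (distr \<mu> borel cnj) A = emeasure \<mu> (cnj ` A)"
    using A cm by (subst emeasure_distr) (auto simp: measurable_cong_sets[OF sets_\<mu> refl])
  then show "emeasure (distr \<mu> borel cnj) A = emeasure \<mu> A"
    using symm A by (simp add: conj_symmetric_def sets_\<mu>)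
qed

lemma integral_cnj_arg:
  fixes f :: "complex \<Rightarrow> complex"
  assumes "continuous_on UNIV f"
  shows "(LINT z|\<mu>. f (cnj z)) = (LINT z|\<mu>. f z)"
proof -
  have cm: "cnj \<in> borel_measurable \<mu>" unfolding measurable_cong_sets[OF sets_\<mu> refl]
    by (intro borel_measurable_continuous_onI continuous_intros)
  have "(LINT z|distr \<mu> borel cnj. f z) = (LINT z|\<mu>. f (cnj z))"
    by (rule integral_distr[OF cm]) (rule borel_measurable_continuous_onI[OF assms])
  then show ?thesis by (simp add: distr_cnj)
qed

lemma poly_map_cnj: "poly (map_poly cnj p) z = cnj (poly p (cnj z))"
  by (metis complex_cnj_cnj poly_cnj)

text \<open>Uniqueness of the monic orthogonal polynomial: the conjugated polynomial is orthogonal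
  to lower degrees as well, so the difference, of lower degree, is orthogonal to itself. Reality is
  also why the reversal without conjugation in the recursion agrees with the usual reversed
  polynomial.\<close>

lemma \<Phi>_real: "map_poly cnj (\<Phi> i) = \<Phi> i"
proof -
  define \<Psi> where "\<Psi> = map_poly cnj (\<Phi> i)"
  define D where "D = \<Phi> i - \<Psi>"
  have cD: "coeff D k = 0" if "k \<ge> i" for k
    using that by (cases "k = i") (auto simp: D_def \<Psi>_def coeff_map_poly coeff_eq_0)
  have "ip \<Psi> q = cnj (ip (\<Phi> i) (map_poly cnj q))" for q
  proof -
    have "ip \<Psi> q = (LINT z|\<mu>. cnj (poly (\<Phi> i) (cnj z)) * cnj (poly q (cnj (cnj z))))"
      by (simp add: ip_def \<Psi>_def poly_map_cnj)
    also have "\<dots> = (LINT z|\<mu>. cnj (poly (\<Phi> i) z) * cnj (poly q (cnj z)))"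
      by (rule integral_cnj_arg[where f = "\<lambda>z. cnj (poly (\<Phi> i) z) * cnj (poly q (cnj z))"]) (intro continuous_intros)
    also have "\<dots> = cnj (ip (\<Phi> i) (map_poly cnj q))"
      unfolding ip_def by (subst Bochner_Integration.integral_cnj[symmetric]) (simp add: poly_map_cnj)
    finally show ?thesis .
  qed
  then have "ip \<Psi> D = 0" using cD by (simp add: orth_lower coeff_map_poly)
  moreover have "ip (\<Phi> i) D = 0" using cD by (rule orth_lower)
  ultimately have "ip D D = 0" unfolding D_def by (simp add: ip_diff_left)
  then have "D = 0" using norm2_pos[of D] by (auto simp: ip_self)
  then show ?thesis by (simp add: D_def \<Psi>_def)
qed

lemma \<Phi>_cnj: "poly (\<Phi> i) (cnj z) = cnj (poly (\<Phi> i) z)"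
  using poly_map_cnj[of "\<Phi> i" "cnj z"] by (simp add: \<Phi>_real)

lemma \<alpha>_real: "cnj (\<alpha> i) = \<alpha> i"
proof -
  have "coeff (\<Phi> (Suc i)) 0 = - \<alpha> i" unfolding szego by (simp add: coeff_0_reflect_poly)
  moreover have "cnj (coeff (\<Phi> (Suc i)) 0) = coeff (\<Phi> (Suc i)) 0"
    using arg_cong[OF \<Phi>_real, of "\<lambda>p. coeff p 0"] by (simp add: coeff_map_poly)
  ultimately show ?thesis by simp
qed

lemma poly_reflect: "z \<noteq> 0 \<Longrightarrow> poly (reflect_poly (\<Phi> i)) z = z ^ i * poly (\<Phi> i) (1 / z)"
  by (simp add: poly_reflect_poly_nz inverse_eq_divide)

lemma reflect_circle: "cmod z = 1 \<Longrightarrow> cmod (poly (reflect_poly (\<Phi> i)) z) = cmod (poly (\<Phi> i) z)"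
proof -
  assume z: "cmod z = 1"
  then have "z \<noteq> 0" by auto
  moreover have "1 / z = cnj z" using z by (simp add: divide_conv_cnj)
  ultimately show ?thesis by (simp add: poly_reflect norm_mult norm_power z \<Phi>_cnj)
qed

section \<open>Norms and orthonormal expansions\<close>

definition Phi_norm2 :: "nat \<Rightarrow> real" where "Phi_norm2 i = (LINT z|\<mu>. (cmod (poly (\<Phi> i) z))\<^sup>2)"

lemma Phi_norm2_pos: "Phi_norm2 i > 0" unfolding Phi_norm2_def by (rule norm2_pos) simp

text \<open>Pythagoras for z Phi_i = Phi_(i+1) + \<alpha>_i Phi_i^*: the reversed polynomial has
  degree at most i, hence is orthogonal to Phi_(i+1), and on the circle both it and z Phi_i have the
  modulus of Phi_i.\<close>

lemma Phi_norm2_Suc: "Phi_norm2 (Suc i) = (1 - (cmod (\<alpha> i))\<^sup>2) * Phi_norm2 i"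
proof -
  let ?R = "reflect_poly (\<Phi> i)"
  have 1: "ip ([:0, 1:] * \<Phi> i) ([:0, 1:] * \<Phi> i) = of_real (Phi_norm2 i)"
    unfolding ip_self Phi_norm2_def
    by (intro arg_cong[where f = of_real] integral_cong_AE norm2_integrable[THEN borel_measurable_integrable])
       (use AE_circle in \<open>auto simp: norm_mult elim!: eventually_mono\<close>)
  have 2: "ip ?R ?R = of_real (Phi_norm2 i)"
    unfolding ip_self Phi_norm2_def
    by (intro arg_cong[where f = of_real] integral_cong_AE norm2_integrable[THEN borel_measurable_integrable])
       (use AE_circle reflect_circle in \<open>auto elim!: eventually_mono\<close>)
  have 3: "ip (\<Phi> (Suc i)) ?R = 0"
  proof (rule orth_lower)
    fix k assume "Suc i \<le> k"
    then have "degree ?R < k" using degree_reflect_poly_le[of "\<Phi> i"] by simp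
    then show "coeff ?R k = 0" by (rule coeff_eq_0)
  qed
  then have 4: "ip ?R (\<Phi> (Suc i)) = 0" by (subst ip_cnj) simp
  have "[:0, 1:] * \<Phi> i = \<Phi> (Suc i) - smult (- \<alpha> i) ?R" by (simp add: szego)
  then have "of_real (Phi_norm2 i) = ip (\<Phi> (Suc i) - smult (- \<alpha> i) ?R) (\<Phi> (Suc i) - smult (- \<alpha> i) ?R)"
    using 1 by (simp only:)
  also have "\<dots> = ip (\<Phi> (Suc i)) (\<Phi> (Suc i)) + \<alpha> i * cnj (\<alpha> i) * of_real (Phi_norm2 i)"
    by (simp only: ip_diff_left ip_diff_right ip_smult_left ip_smult_right 2 3 4) simp
  also have "\<dots> = of_real (Phi_norm2 (Suc i) + (cmod (\<alpha> i))\<^sup>2 * Phi_norm2 i)"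
    by (simp only: ip_self Phi_norm2_def[symmetric] complex_norm_square[symmetric]) simp
  finally have "Phi_norm2 i = Phi_norm2 (Suc i) + (cmod (\<alpha> i))\<^sup>2 * Phi_norm2 i" by (simp only: of_real_eq_iff)
  then show ?thesis by (simp add: algebra_simps)
qed

lemma \<alpha>_less_1: "cmod (\<alpha> i) < 1"
proof -
  have "0 < 1 - (cmod (\<alpha> i))\<^sup>2" using Phi_norm2_pos[of "Suc i"] Phi_norm2_pos[of i] by (simp add: Phi_norm2_Suc zero_less_mult_iff)
  then show ?thesis by (simp add: power_less_one_iff)
qed

abbreviation \<phi> :: "nat \<Rightarrow> complex poly" where "\<phi> \<equiv> orthonormal_poly \<mu> \<Phi>"

lemma poly_\<phi>: "poly (\<phi> i) z = of_real (1 / sqrt (Phi_norm2 i)) * poly (\<Phi> i) z"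
  by (simp add: orthonormal_poly_def L2norm_poly_def Phi_norm2_def)

lemma cmod_\<phi>: "(cmod (poly (\<phi> i) z))\<^sup>2 = (cmod (poly (\<Phi> i) z))\<^sup>2 / Phi_norm2 i"
  using Phi_norm2_pos[of i] by (simp add: poly_\<phi> norm_mult norm_divide power_mult_distrib power_divide)

lemma degree_\<phi> [simp]: "degree (\<phi> i) = i"
  using Phi_norm2_pos[of i] by (simp add: orthonormal_poly_def L2norm_poly_def Phi_norm2_def[symmetric])

lemma \<phi>_nonzero [simp]: "\<phi> i \<noteq> 0"
  using Phi_norm2_pos[of i] by (simp add: orthonormal_poly_def L2norm_poly_def Phi_norm2_def[symmetric])

lemma \<phi>_cnj: "poly (\<phi> i) (cnj z) = cnj (poly (\<phi> i) z)"
  by (simp add: poly_\<phi> \<Phi>_cnj)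

lemma \<phi>_orthonormal: "ip (\<phi> i) (\<phi> j) = (if i = j then 1 else 0)"
proof -
  have \<phi>: "\<phi> i = smult (of_real (1 / sqrt (Phi_norm2 i))) (\<Phi> i)" for i
    by (simp add: orthonormal_poly_def L2norm_poly_def Phi_norm2_def)
  have "ip (\<Phi> i) (\<Phi> j) = (if i = j then of_real (Phi_norm2 i) else 0)"
    using \<Phi>_orth[of j i] \<Phi>_orth[of i j] ip_cnj[of "\<Phi> j" "\<Phi> i"] by (cases i j rule: linorder_cases) (auto simp: ip_self Phi_norm2_def)
  moreover have "complex_of_real (1 / sqrt (Phi_norm2 i)) * (of_real (1 / sqrt (Phi_norm2 i)) * of_real (Phi_norm2 i)) = 1"
    using Phi_norm2_pos[of i] by (simp only: of_real_mult[symmetric]) (simp add: real_div_sqrt)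
  ultimately show ?thesis unfolding \<phi> ip_smult_left ip_smult_right by auto
qed

lemma expand_\<phi>:
  assumes "degree q < n"
  shows "q = (\<Sum>i<n. smult (ip q (\<phi> i)) (\<phi> i))" and "ip q q = (\<Sum>i<n. of_real ((cmod (ip q (\<phi> i)))\<^sup>2))"
proof -
  obtain c where "q = (\<Sum>j<n. smult (c j) (\<Phi> j))" using span_\<Phi>[of n q] assms by (auto simp: coeff_eq_0)
  moreover define d where "d j = c j * of_real (sqrt (Phi_norm2 j))" for j
  have "smult (c j) (\<Phi> j) = smult (d j) (\<phi> j)" for j
    using Phi_norm2_pos[of j] by (simp add: d_def orthonormal_poly_def L2norm_poly_def Phi_norm2_def[symmetric])
  ultimately have q: "q = (\<Sum>j<n. smult (d j) (\<phi> j))" by simp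
  have d: "ip q (\<phi> i) = d i" if "i < n" for i
    unfolding q using that by (simp add: ip_sum_left ip_smult_left \<phi>_orthonormal if_distrib[of "\<lambda>x. _ * x"] cong: if_cong)
  show "q = (\<Sum>i<n. smult (ip q (\<phi> i)) (\<phi> i))" using q d by simp
  have "ip q q = (\<Sum>i<n. cnj (d i) * ip q (\<phi> i))"
    by (subst (2) q) (simp add: ip_sum_right ip_smult_right)
  also have "\<dots> = (\<Sum>i<n. of_real ((cmod (ip q (\<phi> i)))\<^sup>2))"
    by (intro sum.cong refl) (simp only: complex_norm_square d lessThan_iff mult.commute)
  finally show "ip q q = (\<Sum>i<n. of_real ((cmod (ip q (\<phi> i)))\<^sup>2))" .
qed

section \<open>The reproducing kernel\<close>

definition K :: "nat \<Rightarrow> complex \<Rightarrow> complex \<Rightarrow> complex" where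
  "K n z v = (\<Sum>i<n. poly (\<phi> i) z * cnj (poly (\<phi> i) v))"

definition Kdiag :: "nat \<Rightarrow> complex \<Rightarrow> real" where
  "Kdiag n z = (\<Sum>i<n. (cmod (poly (\<phi> i) z))\<^sup>2)"

lemma K_diag: "K n z z = of_real (Kdiag n z)"
  by (simp only: K_def Kdiag_def of_real_sum complex_norm_square)

lemma Kdiag_nonneg: "Kdiag n z \<ge> 0" by (simp add: Kdiag_def sum_nonneg)

lemma K_cauchy_schwarz: "(cmod (K n z v))\<^sup>2 \<le> Kdiag n z * Kdiag n v"
proof -
  have "cmod (K n z v) \<le> (\<Sum>i<n. cmod (poly (\<phi> i) z) * cmod (poly (\<phi> i) v))"
    unfolding K_def by (rule order_trans[OF norm_sum]) (simp add: norm_mult)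
  then have "(cmod (K n z v))\<^sup>2 \<le> (\<Sum>i<n. cmod (poly (\<phi> i) z) * cmod (poly (\<phi> i) v))\<^sup>2"
    by (intro power_mono) auto
  also have "\<dots> \<le> Kdiag n z * Kdiag n v" unfolding Kdiag_def by (rule Cauchy_Schwarz_ineq_sum)
  finally show ?thesis .
qed

text \<open>One half of the extremal property of the diagonal kernel, in the form that yields lower
  bounds for \<open>Kdiag\<close> from test polynomials.\<close>

lemma poly_bound_Kdiag:
  assumes "degree q < n"
  shows "(cmod (poly q z))\<^sup>2 \<le> (LINT z|\<mu>. (cmod (poly q z))\<^sup>2) * Kdiag n z"
proof -
  have eq: "(LINT z|\<mu>. (cmod (poly q z))\<^sup>2) = (\<Sum>i<n. (cmod (ip q (\<phi> i)))\<^sup>2)"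
    using expand_\<phi>(2)[OF assms] unfolding ip_self by (simp only: of_real_sum[symmetric] of_real_eq_iff)
  have "poly q z = (\<Sum>i<n. ip q (\<phi> i) * poly (\<phi> i) z)"
    by (subst expand_\<phi>(1)[OF assms]) (simp add: poly_sum)
  then have "cmod (poly q z) \<le> (\<Sum>i<n. cmod (ip q (\<phi> i)) * cmod (poly (\<phi> i) z))"
    by (auto intro!: order_trans[OF norm_sum] simp: norm_mult)
  then have "(cmod (poly q z))\<^sup>2 \<le> (\<Sum>i<n. cmod (ip q (\<phi> i)) * cmod (poly (\<phi> i) z))\<^sup>2"
    by (intro power_mono) auto
  also have "\<dots> \<le> (\<Sum>i<n. (cmod (ip q (\<phi> i)))\<^sup>2) * Kdiag n z" unfolding Kdiag_def by (rule Cauchy_Schwarz_ineq_sum)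
  finally show ?thesis by (simp add: eq)
qed

definition Kpoly :: "nat \<Rightarrow> complex \<Rightarrow> complex poly" where
  "Kpoly n v = (\<Sum>i<n. smult (cnj (poly (\<phi> i) v)) (\<phi> i))"

lemma poly_Kpoly: "poly (Kpoly n v) z = K n z v"
  by (simp add: Kpoly_def K_def poly_sum mult.commute)

lemma degree_Kpoly: "n > 0 \<Longrightarrow> degree (Kpoly n v) < n"
  unfolding Kpoly_def
proof -
  assume n: "n > 0"
  have "degree (\<Sum>i<n. smult (cnj (poly (\<phi> i) v)) (\<phi> i)) \<le> n - 1"
    by (intro degree_sum_le) (auto intro: order_trans[OF degree_smult_le])
  then show "degree (\<Sum>i<n. smult (cnj (poly (\<phi> i) v)) (\<phi> i)) < n" using n by simp
qed

lemma norm_Kpoly: "(LINT z|\<mu>. (cmod (K n z v))\<^sup>2) = Kdiag n v"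
proof -
  have "ip (Kpoly n v) (Kpoly n v) = (\<Sum>i<n. poly (\<phi> i) v * cnj (poly (\<phi> i) v))"
    unfolding Kpoly_def
    by (simp add: ip_sum_left ip_sum_right ip_smult_left ip_smult_right \<phi>_orthonormal if_distrib[of "\<lambda>x. _ * x"] cong: if_cong)
  also have "\<dots> = of_real (Kdiag n v)"
    by (simp only: Kdiag_def of_real_sum complex_norm_square)
  finally show ?thesis unfolding ip_self poly_Kpoly by (simp only: of_real_eq_iff)
qed

section \<open>Christoffel-Darboux formula and growth on the circle\<close>

definition \<phi>s :: "nat \<Rightarrow> complex \<Rightarrow> complex" where "\<phi>s n z = z ^ n * poly (\<phi> n) (1 / z)"

text \<open>The bilinear version: without conjugation the denominator is 1 - z w. Reversing the
  recursion gives G' = G - \<alpha> z F; in G' G' - F' F' the cross terms cancel, and the factor 1 -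
  \<alpha>^2 that remains is the ratio of consecutive squared norms because \<alpha> is
  real.\<close>

lemma christoffel_darboux:
  assumes "z \<noteq> 0" "w \<noteq> 0"
  shows "(1 - z * w) * (\<Sum>i<n. poly (\<phi> i) z * poly (\<phi> i) w) = \<phi>s n z * \<phi>s n w - poly (\<phi> n) z * poly (\<phi> n) w"
proof (induction n)
  case 0
  have "\<Phi> 0 = 1" using degree_\<Phi>[of 0] coeff_\<Phi>[of 0] by (metis degree_eq_zeroE coeff_pCons_0 one_pCons)
  then show ?case by (simp add: \<phi>s_def poly_\<phi>)
next
  case (Suc n)
  define F where "F z = poly (\<Phi> n) z" for z
  define G where "G z = z ^ n * poly (\<Phi> n) (1 / z)" for z
  define F' where "F' z = poly (\<Phi> (Suc n)) z" for z
  define G' where "G' z = z ^ Suc n * poly (\<Phi> (Suc n)) (1 / z)" for z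
  have F': "F' z = z * F z - \<alpha> n * G z" if "z \<noteq> 0" for z
    using that by (simp add: F'_def F_def G_def szego poly_reflect)
  have G': "G' z = G z - \<alpha> n * z * F z" if "z \<noteq> 0" for z
    using that by (simp add: G'_def F_def G_def szego poly_reflect field_simps)
  have key: "G' z * G' w - F' z * F' w = (1 - \<alpha> n * \<alpha> n) * (G z * G w - z * w * F z * F w)"
    unfolding F'[OF assms(1)] F'[OF assms(2)] G'[OF assms(1)] G'[OF assms(2)] by (simp add: algebra_simps)
  have aa: "\<alpha> n * \<alpha> n = of_real ((cmod (\<alpha> n))\<^sup>2)"
    using \<alpha>_real[of n] complex_norm_square[of "\<alpha> n"] by simp
  have sq: "complex_of_real (1 / sqrt (Phi_norm2 k)) * of_real (1 / sqrt (Phi_norm2 k)) = of_real (1 / Phi_norm2 k)" for k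
    using Phi_norm2_pos[of k] by (simp only: of_real_mult[symmetric]) simp
  have s: "\<phi>s k z * \<phi>s k w - poly (\<phi> k) z * poly (\<phi> k) w = of_real (1 / Phi_norm2 k) *
    (z ^ k * poly (\<Phi> k) (1 / z) * (w ^ k * poly (\<Phi> k) (1 / w)) - poly (\<Phi> k) z * poly (\<Phi> k) w)" for k
    unfolding sq[symmetric] \<phi>s_def poly_\<phi> by (simp add: algebra_simps)
  have p: "poly (\<phi> n) z * poly (\<phi> n) w = of_real (1 / Phi_norm2 n) * (F z * F w)"
    unfolding sq[symmetric] F_def poly_\<phi> by (simp add: algebra_simps)
  have IH: "(1 - z * w) * (\<Sum>i<n. poly (\<phi> i) z * poly (\<phi> i) w) = of_real (1 / Phi_norm2 n) * (G z * G w - F z * F w)"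
    unfolding Suc.IH s G_def F_def ..
  have "(1 - z * w) * (\<Sum>i<Suc n. poly (\<phi> i) z * poly (\<phi> i) w)
     = of_real (1 / Phi_norm2 n) * (G z * G w - F z * F w) + (1 - z * w) * (of_real (1 / Phi_norm2 n) * (F z * F w))"
    by (simp only: sum.lessThan_Suc distrib_left IH p)
  also have "r * (G z * G w - F z * F w) + (1 - z * w) * (r * (F z * F w)) = r * (G z * G w - z * w * F z * F w)" for r
    by (simp add: algebra_simps)
  also have "of_real (1 / Phi_norm2 n) = of_real (1 / Phi_norm2 (Suc n)) * (1 - \<alpha> n * \<alpha> n)"
  proof -
    have "1 - (cmod (\<alpha> n))\<^sup>2 \<noteq> 0" using Phi_norm2_pos[of "Suc n"] by (auto simp: Phi_norm2_Suc)
    then have "1 / Phi_norm2 n = 1 / Phi_norm2 (Suc n) * (1 - (cmod (\<alpha> n))\<^sup>2)" by (simp add: Phi_norm2_Suc)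
    then show ?thesis unfolding aa by (metis of_real_1 of_real_diff of_real_mult)
  qed
  also have "of_real (1 / Phi_norm2 (Suc n)) * (1 - \<alpha> n * \<alpha> n) * (G z * G w - z * w * F z * F w)
    = of_real (1 / Phi_norm2 (Suc n)) * (G' z * G' w - F' z * F' w)"
    unfolding key by (simp only: mult.assoc)
  also have "\<dots> = \<phi>s (Suc n) z * \<phi>s (Suc n) w - poly (\<phi> (Suc n)) z * poly (\<phi> (Suc n)) w"
    unfolding s F'_def G'_def ..
  finally show ?case .
qed

text \<open>On the circle one recursion step multiplies |Phi|^2 by at most (1 + |\<alpha>|)^2 and
  the squared norm by 1 - |\<alpha>|^2, so |\<phi>|^2 grows at most by (1 + |\<alpha>|) / (1 -
  |\<alpha>|), which tends to 1. This crude bound holds on the whole circle, with no assumption on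
  \<mu> near the point.\<close>

lemma \<phi>_growth:
  assumes lim: "\<alpha> \<longlonglongrightarrow> 0" and \<epsilon>: "\<epsilon> > 0"
  shows "\<exists>C>0. \<forall>i z. cmod z = 1 \<longrightarrow> (cmod (poly (\<phi> i) z))\<^sup>2 \<le> C * exp (\<epsilon> * real i)"
proof -
  have "(\<lambda>i. (1 + cmod (\<alpha> i)) / (1 - cmod (\<alpha> i))) \<longlonglongrightarrow> (1 + cmod 0) / (1 - cmod 0)"
    by (intro tendsto_intros lim) auto
  then have "eventually (\<lambda>i. (1 + cmod (\<alpha> i)) / (1 - cmod (\<alpha> i)) < exp \<epsilon>) sequentially"
    using \<epsilon> by (intro order_tendstoD) auto
  then obtain i0 where i0: "\<And>i. i \<ge> i0 \<Longrightarrow> (1 + cmod (\<alpha> i)) / (1 - cmod (\<alpha> i)) < exp \<epsilon>"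
    by (auto simp: eventually_sequentially)
  have step: "(cmod (poly (\<phi> (Suc i)) z))\<^sup>2 \<le> (1 + cmod (\<alpha> i)) / (1 - cmod (\<alpha> i)) * (cmod (poly (\<phi> i) z))\<^sup>2"
    if z: "cmod z = 1" for i z
  proof -
    define a where "a = cmod (\<alpha> i)"
    have a: "0 \<le> a" "a < 1" using \<alpha>_less_1 by (auto simp: a_def)
    have "cmod (poly (\<Phi> (Suc i)) z) \<le> cmod (z * poly (\<Phi> i) z) + cmod (\<alpha> i * poly (reflect_poly (\<Phi> i)) z)"
      unfolding szego by (simp add: norm_triangle_ineq4)
    also have "\<dots> = (1 + a) * cmod (poly (\<Phi> i) z)" by (simp add: norm_mult z reflect_circle a_def algebra_simps)
    finally have "(cmod (poly (\<Phi> (Suc i)) z))\<^sup>2 \<le> ((1 + a) * cmod (poly (\<Phi> i) z))\<^sup>2" by (intro power_mono) auto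
    then have "(cmod (poly (\<Phi> (Suc i)) z))\<^sup>2 / Phi_norm2 (Suc i) \<le> ((1 + a) * cmod (poly (\<Phi> i) z))\<^sup>2 / Phi_norm2 (Suc i)"
      using Phi_norm2_pos[of "Suc i"] by (intro divide_right_mono) auto
    also have "\<dots> = (1 + a) / (1 - a) * ((cmod (poly (\<Phi> i) z))\<^sup>2 / Phi_norm2 i)"
    proof -
      have "1 - a\<^sup>2 = (1 - a) * (1 + a)" by (simp add: power2_eq_square algebra_simps)
      then show ?thesis using a Phi_norm2_pos[of i] unfolding Phi_norm2_Suc a_def[symmetric]
        by (simp add: power_mult_distrib power2_eq_square)
    qed
    finally show ?thesis
      unfolding cmod_\<phi> a_def .
  qed
  have "\<exists>B. \<forall>z. cmod z = 1 \<longrightarrow> (cmod (poly (\<phi> i) z))\<^sup>2 \<le> B" for i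
  proof -
    have "bounded ((\<lambda>z. (cmod (poly (\<phi> i) z))\<^sup>2) ` sphere 0 1)"
      by (intro compact_imp_bounded compact_continuous_image continuous_intros) auto
    then obtain B where "\<forall>x\<in>(\<lambda>z. (cmod (poly (\<phi> i) z))\<^sup>2) ` sphere 0 1. norm x \<le> B" unfolding bounded_iff by blast
    then have "\<forall>z. cmod z = 1 \<longrightarrow> (cmod (poly (\<phi> i) z))\<^sup>2 \<le> B" by simp
    then show ?thesis by blast
  qed
  then obtain B where B: "\<And>i z. cmod z = 1 \<Longrightarrow> (cmod (poly (\<phi> i) z))\<^sup>2 \<le> B i" by metis
  have B0: "B i \<ge> 0" for i using B[of 1 i] order_trans[OF zero_le_power2] by force
  define C where "C = 1 + (\<Sum>i\<le>i0. B i)"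
  have C: "C > 0" unfolding C_def using B0 by (simp add: add_pos_nonneg sum_nonneg)
  have "(cmod (poly (\<phi> i) z))\<^sup>2 \<le> C * exp (\<epsilon> * real i)" if z: "cmod z = 1" for i z
  proof (induction i)
    case 0
    have "B 0 \<le> (\<Sum>i\<le>i0. B i)" using B0 by (intro member_le_sum) auto
    then show ?case using B[OF z, of 0] by (simp add: C_def)
  next
    case (Suc i)
    show ?case
    proof (cases "Suc i \<le> i0")
      case True
      then have "B (Suc i) \<le> (\<Sum>i\<le>i0. B i)" using B0 by (intro member_le_sum) auto
      then have "(cmod (poly (\<phi> (Suc i)) z))\<^sup>2 \<le> C * 1" using B[OF z, of "Suc i"] by (simp add: C_def)
      also have "\<dots> \<le> C * exp (\<epsilon> * real (Suc i))" using C \<epsilon> by (intro mult_left_mono) auto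
      finally show ?thesis .
    next
      case False
      have "(cmod (poly (\<phi> (Suc i)) z))\<^sup>2 \<le> (1 + cmod (\<alpha> i)) / (1 - cmod (\<alpha> i)) * (cmod (poly (\<phi> i) z))\<^sup>2"
        by (rule step[OF z])
      also have "\<dots> \<le> exp \<epsilon> * (C * exp (\<epsilon> * real i))"
        using False i0[of i] Suc.IH by (intro mult_mono) auto
      also have "\<dots> = C * exp (\<epsilon> * real (Suc i))" by (simp add: exp_add algebra_simps)
      finally show ?thesis .
    qed
  qed
  then show ?thesis using C by blast
qed

end

section \<open>Universality of the reproducing kernel\<close>

text \<open>\<open>2 \<pi>\<close> times the reproducing kernel of arclength measure.\<close>

definition Kgeo :: "nat \<Rightarrow> complex \<Rightarrow> complex \<Rightarrow> complex" where
  "Kgeo N z v = (\<Sum>j<N. (z * cnj v) ^ j)"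

definition Kgeo_diag :: "nat \<Rightarrow> complex \<Rightarrow> real" where
  "Kgeo_diag N v = (\<Sum>j<N. cmod v ^ (2 * j))"

definition Kgeo_poly :: "nat \<Rightarrow> complex \<Rightarrow> complex poly" where
  "Kgeo_poly N v = (\<Sum>j<N. monom (cnj v ^ j) j)"

lemma coeff_Kgeo_poly: "coeff (Kgeo_poly N v) j = (if j < N then cnj v ^ j else 0)"
  by (simp add: Kgeo_poly_def coeff_sum)

lemma poly_Kgeo_poly: "poly (Kgeo_poly N v) z = Kgeo N z v"
  by (simp add: Kgeo_poly_def Kgeo_def poly_sum poly_monom power_mult_distrib mult.commute)

lemma degree_Kgeo_poly: "N > 0 \<Longrightarrow> degree (Kgeo_poly N v) < N"
proof -
  assume "N > 0"
  moreover have "degree (Kgeo_poly N v) \<le> N - 1"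
    by (rule degree_le) (auto simp: coeff_Kgeo_poly)
  ultimately show ?thesis by simp
qed

lemma Kgeo_self: "Kgeo N v v = of_real (Kgeo_diag N v)"
  by (simp add: Kgeo_def Kgeo_diag_def complex_norm_square[symmetric] power_mult del: of_real_power flip: of_real_power)

lemma norm_power_even: "(cmod (cnj v ^ j))\<^sup>2 = cmod v ^ (2 * j)"
  by (simp add: norm_power power_mult[symmetric] mult.commute)

lemma Kgeo_diag_ge_1: "N > 0 \<Longrightarrow> 1 \<le> Kgeo_diag N v"
  unfolding Kgeo_diag_def using member_le_sum[of 0 "{..<N}" "\<lambda>j. cmod v ^ (2 * j)"] by simp

lemma Kgeo_cauchy_schwarz_circle:
  assumes "cmod z = 1" shows "(cmod (Kgeo m z v))\<^sup>2 \<le> real m * Kgeo_diag m v"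
proof -
  have "Kgeo m z v = (\<Sum>j<m. cnj v ^ j * z ^ j)" by (simp add: Kgeo_def power_mult_distrib mult.commute)
  then have "(cmod (Kgeo m z v))\<^sup>2 \<le> (\<Sum>j<m. (cmod (cnj v ^ j))\<^sup>2) * (\<Sum>j<m. (cmod z) ^ (2*j))"
    using poly_eval_bound[of "\<lambda>j. cnj v ^ j" z m] by simp
  then show ?thesis using assms by (simp add: norm_power_even Kgeo_diag_def mult.commute)
qed

lemma parseval_Kgeo_poly:
  assumes "m > 0"
  shows "(\<integral>\<^sup>+ t. ennreal ((cmod (Kgeo m (cis t) v))\<^sup>2) * indicator {0..<2*pi} t \<partial>lborel) = ennreal (2 * pi * Kgeo_diag m v)"
proof -
  have "(\<Sum>j<m. (cmod (coeff (Kgeo_poly m v) j))\<^sup>2) = Kgeo_diag m v"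
    unfolding Kgeo_diag_def by (intro sum.cong refl) (simp only: coeff_Kgeo_poly lessThan_iff if_True norm_power_even)
  then show ?thesis using parseval_circle[OF degree_Kgeo_poly[OF assms], of v] by (simp add: poly_Kgeo_poly)
qed

text \<open>Of modulus at most 1 on the circle, exponentially small away from \<open>\<zeta>\<close>, and close to 1 at distance
  \<open>O(1/n)\<close> from \<open>\<zeta>\<close> when \<open>M = o(n)\<close>: multiplication by it localises a kernel at the cost of raising the degree by \<open>M\<close>.\<close>

definition peak :: "complex \<Rightarrow> nat \<Rightarrow> complex poly" where
  "peak \<zeta> M = [:1 / 2, cnj \<zeta> / 2:] ^ M"

lemma poly_peak: "poly (peak \<zeta> M) z = ((1 + z * cnj \<zeta>) / 2) ^ M"
  by (simp add: peak_def poly_power add_divide_distrib)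

lemma degree_peak: "degree (peak \<zeta> M) \<le> M"
proof -
  have "degree (peak \<zeta> M) \<le> degree [:1 / 2, cnj \<zeta> / 2:] * M" unfolding peak_def by (rule degree_power_le)
  also have "\<dots> \<le> 1 * M" by (intro mult_right_mono) auto
  finally show ?thesis by simp
qed

lemma peak_circle_identity:
  assumes "cmod z = 1" "cmod \<zeta> = 1"
  shows "(cmod ((1 + z * cnj \<zeta>) / 2))\<^sup>2 = 1 - (cmod (z - \<zeta>))\<^sup>2 / 4"
proof -
  have 1: "(Re z)\<^sup>2 + (Im z)\<^sup>2 = 1" "(Re \<zeta>)\<^sup>2 + (Im \<zeta>)\<^sup>2 = 1" using assms by (simp_all add: cmod_power2[symmetric])
  define c where "c = Re z * Re \<zeta> + Im z * Im \<zeta>"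
  define s where "s = Im z * Re \<zeta> - Re z * Im \<zeta>"
  have cs: "c\<^sup>2 + s\<^sup>2 = 1"
  proof -
    have "c\<^sup>2 + s\<^sup>2 = ((Re z)\<^sup>2 + (Im z)\<^sup>2) * ((Re \<zeta>)\<^sup>2 + (Im \<zeta>)\<^sup>2)"
      by (simp add: c_def s_def power2_eq_square algebra_simps)
    then show ?thesis using 1 by simp
  qed
  have "(cmod (1 + z * cnj \<zeta>))\<^sup>2 = (1 + c)\<^sup>2 + s\<^sup>2" unfolding cmod_power2 by (simp add: c_def s_def)
  also have "\<dots> = 2 + 2 * c" using cs by (simp add: power2_eq_square algebra_simps)
  finally have "(cmod ((1 + z * cnj \<zeta>) / 2))\<^sup>2 = (2 + 2 * c) / 4" by (simp add: norm_divide power_divide)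
  moreover have "(cmod (z - \<zeta>))\<^sup>2 = 2 - 2 * c"
    unfolding cmod_power2 using 1 by (simp add: c_def power2_eq_square algebra_simps)
  ultimately show ?thesis by (simp add: field_simps)
qed

lemma cmod_peak: "(cmod (poly (peak \<zeta> M) z))\<^sup>2 = ((cmod ((1 + z * cnj \<zeta>) / 2))\<^sup>2) ^ M"
  unfolding poly_peak norm_power power_mult[symmetric] by (simp only: mult.commute)

lemma peak_le_1:
  assumes "cmod z = 1" "cmod \<zeta> = 1" shows "(cmod (poly (peak \<zeta> M) z))\<^sup>2 \<le> 1"
proof -
  have "(cmod ((1 + z * cnj \<zeta>) / 2))\<^sup>2 \<le> 1" unfolding peak_circle_identity[OF assms] by simp
  then have "((cmod ((1 + z * cnj \<zeta>) / 2))\<^sup>2) ^ M \<le> 1" by (rule power_le_one[OF zero_le_power2])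
  then show ?thesis unfolding cmod_peak .
qed

lemma peak_far:
  assumes "cmod z = 1" "cmod \<zeta> = 1" "\<delta> \<le> cmod (z - \<zeta>)" "0 \<le> \<delta>"
  shows "(cmod (poly (peak \<zeta> M) z))\<^sup>2 \<le> (1 - \<delta>\<^sup>2 / 4) ^ M"
proof -
  have "(cmod ((1 + z * cnj \<zeta>) / 2))\<^sup>2 \<le> 1 - \<delta>\<^sup>2 / 4"
    unfolding peak_circle_identity[OF assms(1,2)] using power_mono[OF assms(3,4), of 2] by simp
  then have "((cmod ((1 + z * cnj \<zeta>) / 2))\<^sup>2) ^ M \<le> (1 - \<delta>\<^sup>2 / 4) ^ M" by (intro power_mono) auto
  then show ?thesis unfolding cmod_peak .
qed

section \<open>Localised comparison with arclength\<close>

text \<open>The density \<open>w\<close> is taken with respect to the angle itself, not the angle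
  divided by 2 pi; hence the factor \<open>2 * pi * w \<zeta>\<close> in every kernel limit.
  Continuity is along the circle and only at points of \<open>S\<close>.\<close>

locale opuc_ac = opuc +
  fixes S U :: "complex set" and w :: "complex \<Rightarrow> real"
  assumes alpha_lim: "\<alpha> \<longlonglongrightarrow> 0"
    and S_compact: "compact S" and S_sub: "S \<subseteq> sphere 0 1 - {1, -1}"
    and U_open: "open U" and S_U: "S \<subseteq> U"
    and w_meas [measurable]: "w \<in> borel_measurable borel" and w_nonneg: "\<And>z. w z \<ge> 0"
    and ac: "\<And>A. A \<in> sets borel \<Longrightarrow> A \<subseteq> U \<Longrightarrow>
       emeasure \<mu> A = (\<integral>\<^sup>+ \<theta>. indicator ({0..<2*pi} \<inter> {\<theta>. cis \<theta> \<in> A}) \<theta> * ennreal (w (cis \<theta>)) \<partial>lborel)"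
    and w_pos: "\<And>z. z \<in> S \<Longrightarrow> w z > 0"
    and w_cont: "\<And>z. z \<in> S \<Longrightarrow> continuous (at z within sphere 0 1) w"
begin

lemma S_circle: "z \<in> S \<Longrightarrow> cmod z = 1" using S_sub by auto

lemma cis_measurable [measurable]: "cis \<in> borel_measurable borel"
  by (intro borel_measurable_continuous_onI continuous_intros)

text \<open>The density hypothesis speaks of sets. It says that \<mu> restricted to \<open>A\<close>
  is the image under \<open>cis\<close> of a measure with density on the period, which extends it to
  integrals.\<close>

lemma nn_integral_ac:
  assumes A [measurable]: "A \<in> sets borel" "A \<subseteq> U" and g [measurable]: "g \<in> borel_measurable borel"
  shows "(\<integral>\<^sup>+ z. g z * indicator A z \<partial>\<mu>)
    = (\<integral>\<^sup>+ t. g (cis t) * indicator A (cis t) * ennreal (w (cis t)) * indicator {0..<2*pi} t \<partial>lborel)"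
proof -
  define D where "D = density lborel (\<lambda>t. indicator {0..<2*pi} t * indicator A (cis t) * ennreal (w (cis t)))"
  have eq: "density \<mu> (indicator A) = distr D borel cis"
  proof (rule measure_eqI)
    show "sets (density \<mu> (indicator A)) = sets (distr D borel cis)" by (simp add: sets_\<mu>)
    fix B assume "B \<in> sets (density \<mu> (indicator A))"
    then have B [measurable]: "B \<in> sets borel" by (simp add: sets_\<mu>)
    have "emeasure (density \<mu> (indicator A)) B = (\<integral>\<^sup>+ z. indicator A z * indicator B z \<partial>\<mu>)"
      by (subst emeasure_density) (auto simp: sets_\<mu>)
    also have "\<dots> = (\<integral>\<^sup>+ z. indicator (A \<inter> B) z \<partial>\<mu>)" by (simp only: indicator_inter_arith)
    also have "\<dots> = emeasure \<mu> (A \<inter> B)" by (simp add: sets_\<mu>)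
    also have "\<dots> = (\<integral>\<^sup>+ \<theta>. indicator ({0..<2*pi} \<inter> {\<theta>. cis \<theta> \<in> A \<inter> B}) \<theta> * ennreal (w (cis \<theta>)) \<partial>lborel)"
      using A by (intro ac) auto
    also have "\<dots> = (\<integral>\<^sup>+ t. (indicator {0..<2*pi} t * indicator A (cis t) * ennreal (w (cis t))) * indicator (cis -` B) t \<partial>lborel)"
      by (intro nn_integral_cong) (auto simp: indicator_def)
    also have "\<dots> = emeasure D (cis -` B)"
      unfolding D_def using measurable_sets[OF cis_measurable B] by (subst emeasure_density) auto
    also have "\<dots> = emeasure (distr D borel cis) B"
      by (subst emeasure_distr) (auto simp: D_def)
    finally show "emeasure (density \<mu> (indicator A)) B = emeasure (distr D borel cis) B" .
  qed
  have "(\<integral>\<^sup>+ z. g z * indicator A z \<partial>\<mu>) = (\<integral>\<^sup>+ z. g z \<partial>density \<mu> (indicator A))"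
    by (subst nn_integral_density) (auto simp: mult.commute)
  also have "\<dots> = (\<integral>\<^sup>+ t. g (cis t) \<partial>D)" unfolding eq by (rule nn_integral_distr) (auto simp: D_def)
  also have "\<dots> = (\<integral>\<^sup>+ t. (indicator {0..<2*pi} t * indicator A (cis t) * ennreal (w (cis t))) * g (cis t) \<partial>lborel)"
    unfolding D_def by (subst nn_integral_density) auto
  also have "\<dots> = (\<integral>\<^sup>+ t. g (cis t) * indicator A (cis t) * ennreal (w (cis t)) * indicator {0..<2*pi} t \<partial>lborel)"
    by (intro nn_integral_cong) (simp add: mult_ac)
  finally show ?thesis .
qed

lemma w_bounds: "\<exists>w0 w1. 0 < w0 \<and> 0 < w1 \<and> (\<forall>\<zeta>\<in>S. w0 \<le> w \<zeta> \<and> w \<zeta> \<le> w1)"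
proof (cases "S = {}")
  case False
  have cont: "continuous_on S w"
    unfolding continuous_on_eq_continuous_within
  proof
    fix z assume "z \<in> S"
    from w_cont[OF this] show "continuous (at z within S) w" by (rule continuous_within_subset) (use S_sub in blast)
  qed
  obtain a where a: "a \<in> S" "\<And>z. z \<in> S \<Longrightarrow> w a \<le> w z"
    using continuous_attains_inf[OF S_compact False cont] by auto
  obtain b where b: "b \<in> S" "\<And>z. z \<in> S \<Longrightarrow> w z \<le> w b"
    using continuous_attains_sup[OF S_compact False cont] by auto
  show ?thesis using a b w_pos by (intro exI[of _ "w a"] exI[of _ "w b"]) auto
qed (rule exI[of _ 1], rule exI[of _ 1], simp)

text \<open>Uniformity is in the base point \<zeta> of the compact set only; \<open>z\<close> ranges
  over all nearby points of the circle, where \<open>w\<close> may be discontinuous. Hence a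
  Lebesgue number of the cover by the continuity balls is used rather than uniform continuity of
  \<open>w\<close>.\<close>

lemma w_uniform:
  assumes "e > 0"
  shows "\<exists>\<delta>>0. \<delta> \<le> 1 \<and> (\<forall>\<zeta>\<in>S. ball \<zeta> \<delta> \<subseteq> U \<and> (\<forall>z. cmod z = 1 \<longrightarrow> dist z \<zeta> < \<delta> \<longrightarrow> \<bar>w z - w \<zeta>\<bar> \<le> e))"
proof -
  have "\<exists>d>0. ball \<zeta> d \<subseteq> U \<and> (\<forall>z. cmod z = 1 \<longrightarrow> dist z \<zeta> < d \<longrightarrow> \<bar>w z - w \<zeta>\<bar> < e / 2)" if z: "\<zeta> \<in> S" for \<zeta>
  proof -
    have "e / 2 > 0" using assms by simp
    then obtain d1 where d1: "d1 > 0" "\<And>z. z \<in> sphere 0 1 \<Longrightarrow> dist z \<zeta> < d1 \<Longrightarrow> dist (w z) (w \<zeta>) < e / 2"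
      using w_cont[OF z] unfolding continuous_within_eps_delta by blast
    obtain d2 where d2: "d2 > 0" "ball \<zeta> d2 \<subseteq> U" using U_open S_U z openE by blast
    show ?thesis
    proof (intro exI[of _ "min d1 d2"] conjI allI impI)
      show "ball \<zeta> (min d1 d2) \<subseteq> U" using d2(2) by auto
      fix z assume "cmod z = 1" "dist z \<zeta> < min d1 d2"
      then show "\<bar>w z - w \<zeta>\<bar> < e / 2" using d1(2)[of z] by (simp add: dist_real_def)
    qed (use d1 d2 in auto)
  qed
  then obtain d where d: "\<And>\<zeta>. \<zeta> \<in> S \<Longrightarrow> d \<zeta> > 0" "\<And>\<zeta>. \<zeta> \<in> S \<Longrightarrow> ball \<zeta> (d \<zeta>) \<subseteq> U"
    "\<And>\<zeta> z. \<zeta> \<in> S \<Longrightarrow> cmod z = 1 \<Longrightarrow> dist z \<zeta> < d \<zeta> \<Longrightarrow> \<bar>w z - w \<zeta>\<bar> < e / 2" by metis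
  obtain \<delta> where \<delta>: "\<delta> > 0" "\<And>x. x \<in> S \<Longrightarrow> \<exists>G \<in> (\<lambda>\<zeta>. ball \<zeta> (d \<zeta>)) ` S. ball x \<delta> \<subseteq> G"
  proof (rule Heine_Borel_lemma[OF S_compact, of "(\<lambda>\<zeta>. ball \<zeta> (d \<zeta>)) ` S"])
    show "S \<subseteq> \<Union> ((\<lambda>\<zeta>. ball \<zeta> (d \<zeta>)) ` S)" using d(1) by auto
  qed auto
  show ?thesis
  proof (intro exI[of _ "min \<delta> 1"] conjI ballI allI impI)
    fix \<zeta> assume z: "\<zeta> \<in> S"
    obtain \<xi> where \<xi>: "\<xi> \<in> S" "ball \<zeta> \<delta> \<subseteq> ball \<xi> (d \<xi>)" using \<delta>(2)[OF z] by blast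
    show "ball \<zeta> (min \<delta> 1) \<subseteq> U" using \<xi> d(2)[of \<xi>] by auto
    fix z assume z1: "cmod z = 1" "dist z \<zeta> < min \<delta> 1"
    then have "z \<in> ball \<xi> (d \<xi>)" using \<xi>(2) by (auto simp: dist_commute)
    then have 1: "\<bar>w z - w \<xi>\<bar> < e / 2" using d(3)[OF \<xi>(1) z1(1)] by (simp add: dist_commute)
    have "\<zeta> \<in> ball \<xi> (d \<xi>)" using subsetD[OF \<xi>(2), of \<zeta>] \<delta>(1) by simp
    then have 2: "\<bar>w \<zeta> - w \<xi>\<bar> < e / 2" using d(3)[OF \<xi>(1) S_circle[OF z]] by (simp add: dist_commute)
    show "\<bar>w z - w \<zeta>\<bar> \<le> e" using 1 2 by linarith
  qed (use \<delta> in auto)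
qed

text \<open>The extremal inequality at \<open>v\<close> for the test polynomial geometric kernel
  times peak, of degree below n. Near \<zeta> the weight is at most (1 + e) w \<zeta> and Parseval
  evaluates the integral; elsewhere the peak supplies the small factor and \<mu> contributes only
  its total mass. The point \<open>v\<close> need not lie on the circle.\<close>

lemma kernel_lower:
  assumes \<zeta>: "\<zeta> \<in> S" and \<delta>: "0 < \<delta>" "\<delta> \<le> 1" and nbh: "ball \<zeta> \<delta> \<subseteq> U"
    and wz: "\<And>z. cmod z = 1 \<Longrightarrow> dist z \<zeta> < \<delta> \<Longrightarrow> w z \<le> (1 + e) * w \<zeta>"
    and m: "m > 0" "m + M \<le> n" and e: "e \<ge> 0"
  shows "Kgeo_diag m v * (cmod (poly (peak \<zeta> M) v))\<^sup>2
    \<le> Kdiag n v * ((1 + e) * (2 * pi * w \<zeta>) + (1 - \<delta>\<^sup>2 / 4) ^ M * real m)"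
proof -
  have z1: "cmod \<zeta> = 1" using \<zeta> by (rule S_circle)
  define p where "p = Kgeo_poly m v * peak \<zeta> M"
  have pz: "poly p z = Kgeo m z v * poly (peak \<zeta> M) z" for z by (simp add: p_def poly_Kgeo_poly)
  have degp: "degree p < n"
    using degree_mult_le[of "Kgeo_poly m v" "peak \<zeta> M"] degree_Kgeo_poly[OF m(1), of v] degree_peak[of \<zeta> M] m
    unfolding p_def by linarith
  define \<theta> where "\<theta> = (1 - \<delta>\<^sup>2 / 4) ^ M"
  have kp: "Kgeo_diag m v \<ge> 1" using m by (intro Kgeo_diag_ge_1)
  have pm [measurable]: "(\<lambda>z. poly p z) \<in> borel_measurable borel"
    by (intro borel_measurable_continuous_onI continuous_intros)
  have km [measurable]: "(\<lambda>z. Kgeo m z v) \<in> borel_measurable borel"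
    unfolding Kgeo_def by (intro borel_measurable_continuous_onI continuous_intros)
  have near: "(\<integral>\<^sup>+ z. ennreal ((cmod (poly p z))\<^sup>2) * indicator (ball \<zeta> \<delta>) z \<partial>\<mu>)
     \<le> ennreal ((1 + e) * w \<zeta> * (2 * pi * Kgeo_diag m v))"
  proof -
    have "(\<integral>\<^sup>+ z. ennreal ((cmod (poly p z))\<^sup>2) * indicator (ball \<zeta> \<delta>) z \<partial>\<mu>)
      = (\<integral>\<^sup>+ t. ennreal ((cmod (poly p (cis t)))\<^sup>2) * indicator (ball \<zeta> \<delta>) (cis t) * ennreal (w (cis t)) * indicator {0..<2*pi} t \<partial>lborel)"
      using nbh by (intro nn_integral_ac) auto
    also have "\<dots> \<le> (\<integral>\<^sup>+ t. ennreal ((1 + e) * w \<zeta>) * (ennreal ((cmod (Kgeo m (cis t) v))\<^sup>2) * indicator {0..<2*pi} t) \<partial>lborel)"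
    proof (rule nn_integral_mono)
      fix t :: real
      have *: "(cmod (poly p (cis t)))\<^sup>2 * w (cis t) \<le> (1 + e) * w \<zeta> * (cmod (Kgeo m (cis t) v))\<^sup>2" if "cis t \<in> ball \<zeta> \<delta>"
      proof -
        have "(cmod (poly p (cis t)))\<^sup>2 \<le> (cmod (Kgeo m (cis t) v))\<^sup>2 * 1"
          unfolding pz norm_mult power_mult_distrib using peak_le_1[OF _ z1, of "cis t" M] by (intro mult_left_mono) auto
        moreover have "w (cis t) \<le> (1 + e) * w \<zeta>" using that by (intro wz) (auto simp: dist_commute)
        ultimately have "(cmod (poly p (cis t)))\<^sup>2 * w (cis t) \<le> ((cmod (Kgeo m (cis t) v))\<^sup>2 * 1) * ((1 + e) * w \<zeta>)"
          using w_nonneg by (intro mult_mono) auto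
        then show ?thesis by (simp add: mult_ac)
      qed
      then show "ennreal ((cmod (poly p (cis t)))\<^sup>2) * indicator (ball \<zeta> \<delta>) (cis t) * ennreal (w (cis t)) * indicator {0..<2*pi} t
        \<le> ennreal ((1 + e) * w \<zeta>) * (ennreal ((cmod (Kgeo m (cis t) v))\<^sup>2) * indicator {0..<2*pi} t)"
        using w_nonneg e by (auto simp: indicator_def ennreal_mult[symmetric] intro!: ennreal_leI)
    qed
    also have "\<dots> = ennreal ((1 + e) * w \<zeta>) * ennreal (2 * pi * Kgeo_diag m v)"
      by (subst nn_integral_cmult) (auto simp: parseval_Kgeo_poly[OF m(1)])
    also have "\<dots> = ennreal ((1 + e) * w \<zeta> * (2 * pi * Kgeo_diag m v))"
      using e w_nonneg kp by (intro ennreal_mult[symmetric]) auto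
    finally show ?thesis .
  qed
  have \<theta>0: "0 \<le> \<theta>"
    unfolding \<theta>_def using \<delta> power_le_one[of \<delta> 2] by (intro zero_le_power) simp
  have far: "(\<integral>\<^sup>+ z. ennreal ((cmod (poly p z))\<^sup>2) * indicator (- ball \<zeta> \<delta>) z \<partial>\<mu>) \<le> ennreal (\<theta> * (real m * Kgeo_diag m v))"
  proof -
    have "(\<integral>\<^sup>+ z. ennreal ((cmod (poly p z))\<^sup>2) * indicator (- ball \<zeta> \<delta>) z \<partial>\<mu>) \<le> (\<integral>\<^sup>+ z. ennreal (\<theta> * (real m * Kgeo_diag m v)) \<partial>\<mu>)"
    proof (rule nn_integral_mono_AE)
      show "AE z in \<mu>. ennreal ((cmod (poly p z))\<^sup>2) * indicator (- ball \<zeta> \<delta>) z \<le> ennreal (\<theta> * (real m * Kgeo_diag m v))"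
        using AE_circle
      proof eventually_elim
        case (elim z)
        show ?case
        proof (cases "z \<in> ball \<zeta> \<delta>")
          case False
          then have d: "\<delta> \<le> cmod (z - \<zeta>)" by (auto simp: dist_norm norm_minus_commute)
          have "(cmod (poly p z))\<^sup>2 \<le> (real m * Kgeo_diag m v) * \<theta>"
            unfolding pz norm_mult power_mult_distrib
            using Kgeo_cauchy_schwarz_circle[OF elim, of m v] peak_far[OF elim z1 d, of M] \<delta> kp
            by (intro mult_mono) (auto simp: \<theta>_def)
          then show ?thesis using False by (simp add: mult.commute ennreal_leI)
        qed simp
      qed
    qed
    then show ?thesis using emeasure_space_1 by simp
  qed
  have split: "ennreal (LINT z|\<mu>. (cmod (poly p z))\<^sup>2) =
    (\<integral>\<^sup>+ z. ennreal ((cmod (poly p z))\<^sup>2) * indicator (ball \<zeta> \<delta>) z \<partial>\<mu>) +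
    (\<integral>\<^sup>+ z. ennreal ((cmod (poly p z))\<^sup>2) * indicator (- ball \<zeta> \<delta>) z \<partial>\<mu>)"
  proof -
    have "ennreal (LINT z|\<mu>. (cmod (poly p z))\<^sup>2) = (\<integral>\<^sup>+ z. ennreal ((cmod (poly p z))\<^sup>2) \<partial>\<mu>)"
      by (rule nn_integral_eq_integral[symmetric]) (auto simp: norm2_integrable)
    also have "\<dots> = (\<integral>\<^sup>+ z. ennreal ((cmod (poly p z))\<^sup>2) * indicator (ball \<zeta> \<delta>) z + ennreal ((cmod (poly p z))\<^sup>2) * indicator (- ball \<zeta> \<delta>) z \<partial>\<mu>)"
      by (intro nn_integral_cong) (auto simp: indicator_def)
    also have "\<dots> = (\<integral>\<^sup>+ z. ennreal ((cmod (poly p z))\<^sup>2) * indicator (ball \<zeta> \<delta>) z \<partial>\<mu>) +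
      (\<integral>\<^sup>+ z. ennreal ((cmod (poly p z))\<^sup>2) * indicator (- ball \<zeta> \<delta>) z \<partial>\<mu>)"
      by (rule nn_integral_add) (auto intro!: borel_measurable_times_ennreal borel_measurable_indicator measurable_compose[OF _ measurable_ennreal]
          norm2_integrable[THEN borel_measurable_integrable] simp: sets_\<mu>)
    finally show ?thesis .
  qed
  have nn: "0 \<le> (1 + e) * w \<zeta> * (2 * pi * Kgeo_diag m v)" "0 \<le> \<theta> * (real m * Kgeo_diag m v)"
    using e w_nonneg[of \<zeta>] kp \<theta>0 by simp_all
  have "ennreal (LINT z|\<mu>. (cmod (poly p z))\<^sup>2) \<le> ennreal ((1 + e) * w \<zeta> * (2 * pi * Kgeo_diag m v) + \<theta> * (real m * Kgeo_diag m v))"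
    unfolding split ennreal_plus[OF nn] using near far by (rule add_mono)
  then have int: "(LINT z|\<mu>. (cmod (poly p z))\<^sup>2) \<le> Kgeo_diag m v * ((1 + e) * (2 * pi * w \<zeta>) + \<theta> * real m)"
    using nn by (subst (asm) ennreal_le_iff) (simp_all add: algebra_simps)
  have "(cmod (poly p v))\<^sup>2 \<le> (LINT z|\<mu>. (cmod (poly p z))\<^sup>2) * Kdiag n v"
    by (rule poly_bound_Kdiag[OF degp])
  also have "\<dots> \<le> Kgeo_diag m v * ((1 + e) * (2 * pi * w \<zeta>) + \<theta> * real m) * Kdiag n v"
    using int Kdiag_nonneg by (intro mult_right_mono)
  \<comment> \<open>At \<open>v\<close> the geometric kernel equals its own diagonal value, which
    also bounds the norm; one factor \<open>Kgeo_diag m v\<close> therefore cancels.\<close>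
  also have "(cmod (poly p v))\<^sup>2 = Kgeo_diag m v * (Kgeo_diag m v * (cmod (poly (peak \<zeta> M) v))\<^sup>2)"
    using kp by (simp add: pz norm_mult power_mult_distrib Kgeo_self power2_eq_square)
  finally show ?thesis using kp unfolding \<theta>_def by (simp add: mult.assoc mult.commute[of "Kdiag n v"])
qed


text \<open>The coefficient distance between W K_n(., v) peak, with W = 2 pi w \<zeta>, and the
  geometric kernel of degree below n + M. The norm of the first is bounded by Parseval: near \<zeta>
  through the lower bound on the weight and the reproducing norm, elsewhere through the peak against
  the bound \<open>B\<close> on the kernel. The cross term is exact, because the geometric kernel
  reproduces the value at \<open>v\<close>. The coefficient distance then bounds the difference at
  any \<open>z\<close>.\<close>

lemma kernel_compare:
  assumes \<zeta>: "\<zeta> \<in> S" and \<delta>: "0 < \<delta>" "\<delta> \<le> 1" and nbh: "ball \<zeta> \<delta> \<subseteq> U"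
    and wz: "\<And>z. cmod z = 1 \<Longrightarrow> dist z \<zeta> < \<delta> \<Longrightarrow> (1 - e) * w \<zeta> \<le> w z"
    and n: "n > 0" and e: "0 \<le> e" "e < 1"
    and B: "\<And>z. cmod z = 1 \<Longrightarrow> Kdiag n z \<le> B"
  defines "W \<equiv> 2 * pi * w \<zeta>"
  shows "(cmod (of_real W * K n z v * poly (peak \<zeta> M) z - Kgeo (n + M) z v))\<^sup>2
    \<le> Kgeo_diag (n + M) z * (Kdiag n v * (W / (1 - e) + W\<^sup>2 * (1 - \<delta>\<^sup>2 / 4) ^ M * B - 2 * W * Re (poly (peak \<zeta> M) v)) + Kgeo_diag (n + M) v)"
proof -
  have z1: "cmod \<zeta> = 1" using \<zeta> by (rule S_circle)
  have W: "W > 0" using w_pos[OF \<zeta>] by (simp add: W_def)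
  have c0: "0 < (1 - e) * w \<zeta>" using w_pos[OF \<zeta>] e by simp
  have B0: "0 \<le> B" using B[of 1] Kdiag_nonneg[of n 1] by simp
  define N where "N = n + M"
  define E where "E = Kpoly n v * peak \<zeta> M"
  define c where "c = coeff E"
  define \<theta> where "\<theta> = (1 - \<delta>\<^sup>2 / 4) ^ M"
  have \<theta>0: "0 \<le> \<theta>"
    unfolding \<theta>_def using \<delta> power_le_one[of \<delta> 2] by (intro zero_le_power) simp
  have Ez: "poly E z = K n z v * poly (peak \<zeta> M) z" for z by (simp add: E_def poly_Kpoly)
  have degE: "degree E < N"
    using degree_mult_le[of "Kpoly n v" "peak \<zeta> M"] degree_Kpoly[OF n, of v] degree_peak[of \<zeta> M]
    unfolding E_def N_def by linarith
  have Km [measurable]: "(\<lambda>z. K n z v) \<in> borel_measurable borel"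
    unfolding K_def by (intro borel_measurable_continuous_onI continuous_intros)
  have [measurable]: "ball \<zeta> \<delta> \<in> sets borel" by simp
  have "(\<lambda>z. ennreal ((cmod (K n z v))\<^sup>2) * indicator (ball \<zeta> \<delta>) z * ennreal (w z)) \<in> borel_measurable borel"
    by measurable
  from measurable_compose[OF cis_measurable this]
  have gm: "(\<lambda>t. ennreal ((cmod (K n (cis t) v))\<^sup>2) * indicator (ball \<zeta> \<delta>) (cis t) * ennreal (w (cis t)) * indicator {0..<2*pi} t) \<in> borel_measurable borel"
    by (intro borel_measurable_times_ennreal) auto
  have "ennreal (2 * pi * (\<Sum>j<N. (cmod (c j))\<^sup>2)) = (\<integral>\<^sup>+ t. ennreal ((cmod (poly E (cis t)))\<^sup>2) * indicator {0..<2*pi} t \<partial>lborel)"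
    unfolding c_def by (rule parseval_circle[OF degE, symmetric])
  also have "\<dots> \<le> (\<integral>\<^sup>+ t. ennreal (1 / ((1 - e) * w \<zeta>)) * (ennreal ((cmod (K n (cis t) v))\<^sup>2) * indicator (ball \<zeta> \<delta>) (cis t) * ennreal (w (cis t)) * indicator {0..<2*pi} t)
       + ennreal (\<theta> * (B * Kdiag n v)) * indicator {0..<2*pi} t \<partial>lborel)"
  proof (rule nn_integral_mono)
    fix t :: real
    show "ennreal ((cmod (poly E (cis t)))\<^sup>2) * indicator {0..<2*pi} t \<le> ennreal (1 / ((1 - e) * w \<zeta>)) * (ennreal ((cmod (K n (cis t) v))\<^sup>2) * indicator (ball \<zeta> \<delta>) (cis t) * ennreal (w (cis t)) * indicator {0..<2*pi} t)
       + ennreal (\<theta> * (B * Kdiag n v)) * indicator {0..<2*pi} t"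
    proof (cases "cis t \<in> ball \<zeta> \<delta>")
      case True
      have "(cmod (poly E (cis t)))\<^sup>2 \<le> (cmod (K n (cis t) v))\<^sup>2 * 1"
        unfolding Ez norm_mult power_mult_distrib using peak_le_1[OF _ z1, of "cis t" M] by (intro mult_left_mono) auto
      also have "\<dots> \<le> (cmod (K n (cis t) v))\<^sup>2 * (1 / ((1 - e) * w \<zeta>) * w (cis t))"
        using wz[of "cis t"] True c0 by (intro mult_left_mono) (simp_all add: dist_commute)
      finally have "(cmod (poly E (cis t)))\<^sup>2 \<le> 1 / ((1 - e) * w \<zeta>) * ((cmod (K n (cis t) v))\<^sup>2 * w (cis t))"
        by (simp add: mult_ac)
      then have "ennreal ((cmod (poly E (cis t)))\<^sup>2) \<le> ennreal (1 / ((1 - e) * w \<zeta>) * ((cmod (K n (cis t) v))\<^sup>2 * w (cis t)))"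
        by (rule ennreal_leI)
      also have "\<dots> = ennreal (1 / ((1 - e) * w \<zeta>)) * (ennreal ((cmod (K n (cis t) v))\<^sup>2) * ennreal (w (cis t)))"
        using c0 w_nonneg by (subst ennreal_mult, simp, simp, subst ennreal_mult) auto
      finally show ?thesis using True by (auto simp: indicator_def intro: order_trans)
    next
      case False
      then have d: "\<delta> \<le> cmod (cis t - \<zeta>)" by (auto simp: dist_norm norm_minus_commute)
      have "(cmod (K n (cis t) v))\<^sup>2 \<le> Kdiag n (cis t) * Kdiag n v" by (rule K_cauchy_schwarz)
      also have "\<dots> \<le> B * Kdiag n v" using B Kdiag_nonneg by (intro mult_right_mono) auto
      finally have "(cmod (poly E (cis t)))\<^sup>2 \<le> (B * Kdiag n v) * \<theta>"
        unfolding Ez norm_mult power_mult_distrib \<theta>_def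
        using peak_far[OF _ z1 d, of M] \<delta> B0 Kdiag_nonneg by (intro mult_mono) auto
      then show ?thesis using False by (auto simp: indicator_def mult.commute intro!: ennreal_leI)
    qed
  qed
  also have "\<dots> = (\<integral>\<^sup>+ t. ennreal (1 / ((1 - e) * w \<zeta>)) * (ennreal ((cmod (K n (cis t) v))\<^sup>2) * indicator (ball \<zeta> \<delta>) (cis t) * ennreal (w (cis t)) * indicator {0..<2*pi} t) \<partial>lborel)
       + (\<integral>\<^sup>+ t. ennreal (\<theta> * (B * Kdiag n v)) * indicator {0..<2*pi} t \<partial>lborel)"
  proof (rule nn_integral_add)
    show "(\<lambda>t. ennreal (1 / ((1 - e) * w \<zeta>)) * (ennreal ((cmod (K n (cis t) v))\<^sup>2) * indicator (ball \<zeta> \<delta>) (cis t) * ennreal (w (cis t)) * indicator {0..<2*pi} t)) \<in> borel_measurable lborel"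
      using borel_measurable_times_ennreal[OF borel_measurable_const gm] by simp
  qed auto
  finally have bd: "ennreal (2 * pi * (\<Sum>j<N. (cmod (c j))\<^sup>2)) \<le>
      (\<integral>\<^sup>+ t. ennreal (1 / ((1 - e) * w \<zeta>)) * (ennreal ((cmod (K n (cis t) v))\<^sup>2) * indicator (ball \<zeta> \<delta>) (cis t) * ennreal (w (cis t)) * indicator {0..<2*pi} t) \<partial>lborel)
       + (\<integral>\<^sup>+ t. ennreal (\<theta> * (B * Kdiag n v)) * indicator {0..<2*pi} t \<partial>lborel)" .
  have "(\<integral>\<^sup>+ t. ennreal (1 / ((1 - e) * w \<zeta>)) * (ennreal ((cmod (K n (cis t) v))\<^sup>2) * indicator (ball \<zeta> \<delta>) (cis t) * ennreal (w (cis t)) * indicator {0..<2*pi} t) \<partial>lborel)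
    = ennreal (1 / ((1 - e) * w \<zeta>)) * (\<integral>\<^sup>+ z. ennreal ((cmod (K n z v))\<^sup>2) * indicator (ball \<zeta> \<delta>) z \<partial>\<mu>)"
  proof -
    have gK: "(\<lambda>z. ennreal ((cmod (K n z v))\<^sup>2)) \<in> borel_measurable borel" by measurable
    show ?thesis unfolding nn_integral_ac[OF _ nbh gK, simplified] by (rule nn_integral_cmult) (use gm in simp)
  qed
  also have "\<dots> \<le> ennreal (1 / ((1 - e) * w \<zeta>)) * ennreal (Kdiag n v)"
  proof (intro mult_left_mono)
    have "(\<integral>\<^sup>+ z. ennreal ((cmod (K n z v))\<^sup>2) * indicator (ball \<zeta> \<delta>) z \<partial>\<mu>) \<le> (\<integral>\<^sup>+ z. ennreal ((cmod (K n z v))\<^sup>2) \<partial>\<mu>)"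
      by (intro nn_integral_mono) (auto simp: indicator_def)
    also have "\<dots> = ennreal (LINT z|\<mu>. (cmod (K n z v))\<^sup>2)"
      using norm2_integrable[of "Kpoly n v"] by (intro nn_integral_eq_integral) (auto simp: poly_Kpoly)
    finally show "(\<integral>\<^sup>+ z. ennreal ((cmod (K n z v))\<^sup>2) * indicator (ball \<zeta> \<delta>) z \<partial>\<mu>) \<le> ennreal (Kdiag n v)"
      by (simp only: norm_Kpoly)
  qed auto
  finally have I1: "(\<integral>\<^sup>+ t. ennreal (1 / ((1 - e) * w \<zeta>)) * (ennreal ((cmod (K n (cis t) v))\<^sup>2) * indicator (ball \<zeta> \<delta>) (cis t) * ennreal (w (cis t)) * indicator {0..<2*pi} t) \<partial>lborel)
    \<le> ennreal (1 / ((1 - e) * w \<zeta>)) * ennreal (Kdiag n v)" .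
  have I2: "(\<integral>\<^sup>+ t. ennreal (\<theta> * (B * Kdiag n v)) * indicator {0..<2*pi} t \<partial>lborel) = ennreal (\<theta> * (B * Kdiag n v)) * ennreal (2 * pi)"
    by (subst nn_integral_cmult) auto
  have "ennreal (2 * pi * (\<Sum>j<N. (cmod (c j))\<^sup>2)) \<le> ennreal (1 / ((1 - e) * w \<zeta>)) * ennreal (Kdiag n v) + ennreal (\<theta> * (B * Kdiag n v)) * ennreal (2 * pi)"
    using bd unfolding I2 by (rule order_trans) (intro add_mono I1 order_refl)
  also have "ennreal (1 / ((1 - e) * w \<zeta>)) * ennreal (Kdiag n v) + ennreal (\<theta> * (B * Kdiag n v)) * ennreal (2 * pi)
    = ennreal (1 / ((1 - e) * w \<zeta>) * Kdiag n v + \<theta> * (B * Kdiag n v) * (2 * pi))"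
  proof -
    have nn: "0 \<le> 1 / ((1 - e) * w \<zeta>)" "0 \<le> Kdiag n v" "0 \<le> \<theta> * (B * Kdiag n v)" "0 \<le> 2 * pi"
      using c0 Kdiag_nonneg[of n v] \<theta>0 B0 by (auto intro!: mult_nonneg_nonneg)
    show ?thesis
      unfolding ennreal_mult[OF nn(1,2), symmetric] ennreal_mult[OF nn(3,4), symmetric]
      by (rule ennreal_plus[symmetric]) (rule mult_nonneg_nonneg[OF nn(1,2)], rule mult_nonneg_nonneg[OF nn(3,4)])
  qed
  finally have "2 * pi * (\<Sum>j<N. (cmod (c j))\<^sup>2) \<le> 1 / ((1 - e) * w \<zeta>) * Kdiag n v + \<theta> * (B * Kdiag n v) * (2 * pi)"
  proof (subst (asm) ennreal_le_iff)
    show "0 \<le> 1 / ((1 - e) * w \<zeta>) * Kdiag n v + \<theta> * (B * Kdiag n v) * (2 * pi)"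
      using c0 Kdiag_nonneg[of n v] \<theta>0 B0 by (intro add_nonneg_nonneg mult_nonneg_nonneg) auto
  qed
  then have "W * w \<zeta> * (2 * pi * (\<Sum>j<N. (cmod (c j))\<^sup>2)) \<le> W * w \<zeta> * (1 / ((1 - e) * w \<zeta>) * Kdiag n v + \<theta> * (B * Kdiag n v) * (2 * pi))"
    using W w_pos[OF \<zeta>] by (intro mult_left_mono) auto
  also have "\<dots> = Kdiag n v * (W / (1 - e) + W * (2 * pi * w \<zeta>) * \<theta> * B)"
    using w_pos[OF \<zeta>] e by (simp add: field_simps)
  also have "W * (2 * pi * w \<zeta>) = W\<^sup>2" by (simp add: W_def power2_eq_square)
  finally have sumc: "W\<^sup>2 * (\<Sum>j<N. (cmod (c j))\<^sup>2) \<le> Kdiag n v * (W / (1 - e) + W\<^sup>2 * \<theta> * B)"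
    by (simp add: W_def power2_eq_square mult_ac)
  have polyE: "poly E z = (\<Sum>j<N. c j * z ^ j)" for z
  proof -
    have "poly E z = (\<Sum>j\<le>degree E. c j * z ^ j)" by (simp add: poly_altdef c_def)
    also have "\<dots> = (\<Sum>j<N. c j * z ^ j)"
      using degE by (intro sum.mono_neutral_left) (auto simp: c_def coeff_eq_0)
    finally show ?thesis .
  qed
  \<comment> \<open>Coefficients of the difference. Pairing c_j with cnj v^j sums to the value at
    \<open>v\<close>, which is \<open>Kdiag n v\<close> times the peak.\<close>
  define b where "b j = of_real W * c j - cnj v ^ j" for j
  have sq: "(cmod (b j))\<^sup>2 = W\<^sup>2 * (cmod (c j))\<^sup>2 - 2 * W * Re (c j * v ^ j) + cmod v ^ (2 * j)" for j
  proof -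
    have gen: "(cmod (x - y))\<^sup>2 = (cmod x)\<^sup>2 - 2 * Re (x * cnj y) + (cmod y)\<^sup>2" for x y
      by (simp only: cmod_power2) (simp add: power2_eq_square algebra_simps)
    have "Re (of_real W * c j * cnj (cnj v ^ j)) = W * Re (c j * v ^ j)" by (simp add: algebra_simps)
    then show ?thesis
      unfolding b_def gen norm_power_even by (simp add: norm_mult power_mult_distrib)
  qed
  have "(\<Sum>j<N. (cmod (b j))\<^sup>2) = W\<^sup>2 * (\<Sum>j<N. (cmod (c j))\<^sup>2) - 2 * W * Re (poly E v) + Kgeo_diag N v"
    by (simp only: sq polyE Kgeo_diag_def Re_sum sum.distrib sum_subtractf sum_distrib_left)
  also have "Re (poly E v) = Kdiag n v * Re (poly (peak \<zeta> M) v)" by (simp add: Ez K_diag)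
  finally have sumb: "(\<Sum>j<N. (cmod (b j))\<^sup>2) \<le> Kdiag n v * (W / (1 - e) + W\<^sup>2 * \<theta> * B - 2 * W * Re (poly (peak \<zeta> M) v)) + Kgeo_diag N v"
    using sumc by (simp add: algebra_simps)
  have "of_real W * K n z v * poly (peak \<zeta> M) z - Kgeo N z v = (\<Sum>j<N. b j * z ^ j)"
  proof -
    have "of_real W * K n z v * poly (peak \<zeta> M) z = (\<Sum>j<N. of_real W * c j * z ^ j)"
      using polyE[of z] by (simp add: Ez mult.assoc sum_distrib_left)
    moreover have "Kgeo N z v = (\<Sum>j<N. cnj v ^ j * z ^ j)" by (simp add: Kgeo_def power_mult_distrib mult.commute)
    ultimately show ?thesis by (simp add: b_def left_diff_distrib sum_subtractf)
  qed
  then have "(cmod (of_real W * K n z v * poly (peak \<zeta> M) z - Kgeo N z v))\<^sup>2 \<le> (\<Sum>j<N. (cmod (b j))\<^sup>2) * Kgeo_diag N z"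
    using poly_eval_bound[of b z N] by (simp add: Kgeo_diag_def)
  also have "\<dots> \<le> (Kdiag n v * (W / (1 - e) + W\<^sup>2 * \<theta> * B - 2 * W * Re (poly (peak \<zeta> M) v)) + Kgeo_diag N v) * Kgeo_diag N z"
    by (intro mult_right_mono sumb) (auto simp: Kgeo_diag_def sum_nonneg)
  finally show ?thesis by (simp add: N_def \<theta>_def mult.commute)
qed

text \<open>Combines the two preceding estimates. What remains is small because
  \<open>Kgeo_diag\<close> at n + M and at m = n - M differ in only 2 M terms.\<close>

lemma kernel_core:
  assumes \<zeta>: "\<zeta> \<in> S" and \<delta>: "0 < \<delta>" "\<delta> \<le> 1" and nbh: "ball \<zeta> \<delta> \<subseteq> U"
    and wz: "\<And>z. cmod z = 1 \<Longrightarrow> dist z \<zeta> < \<delta> \<Longrightarrow> \<bar>w z - w \<zeta>\<bar> \<le> e * w \<zeta>"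
    and m: "m > 0" "m + M = n" and e: "0 \<le> e" "e \<le> 1 / 10"
    and B: "\<And>z. cmod z = 1 \<Longrightarrow> Kdiag n z \<le> B"
  defines "W \<equiv> 2 * pi * w \<zeta>" and "\<theta> \<equiv> (1 - \<delta>\<^sup>2 / 4) ^ M"
  assumes h1: "\<theta> * real m \<le> e * W" and h2: "W * \<theta> * B \<le> e"
    and q: "cmod (poly (peak \<zeta> M) v - 1) \<le> e"
  shows "(cmod (of_real W * K n z v * poly (peak \<zeta> M) z - Kgeo (n + M) z v))\<^sup>2
    \<le> Kgeo_diag (n + M) z * (Kgeo_diag (n + M) v - Kgeo_diag m v + 9 * e * Kgeo_diag m v)"
proof -
  have W: "W > 0" using w_pos[OF \<zeta>] by (simp add: W_def)
  define q where "q = poly (peak \<zeta> M) v"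
  have q1: "cmod (q - 1) \<le> e" using q by (simp add: q_def)
  have "\<bar>Re (q - 1)\<bar> \<le> e" using abs_Re_le_cmod[of "q - 1"] q1 by linarith
  then have Req: "1 - e \<le> Re q" by (simp add: abs_le_iff)
  have "Re q \<le> cmod q" by (rule complex_Re_le_cmod)
  then have cq: "(1 - e)\<^sup>2 \<le> (cmod q)\<^sup>2" using Req e by (intro power_mono) auto
  have kd: "0 \<le> Kgeo_diag m v" by (simp add: Kgeo_diag_def sum_nonneg)
  have "Kgeo_diag m v * (cmod q)\<^sup>2 \<le> Kdiag n v * ((1 + e) * W + \<theta> * real m)"
    unfolding q_def W_def \<theta>_def
    by (rule kernel_lower[OF \<zeta> \<delta> nbh]) (use wz m e in \<open>auto simp: abs_le_iff algebra_simps\<close>)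
  also have "\<dots> \<le> Kdiag n v * ((1 + 2 * e) * W)" using h1 Kdiag_nonneg by (intro mult_left_mono) (auto simp: algebra_simps)
  finally have low: "Kgeo_diag m v * (1 - e)\<^sup>2 \<le> (1 + 2 * e) * (W * Kdiag n v)"
    using mult_left_mono[OF cq kd] by (simp add: mult_ac)
  \<comment> \<open>The 9 makes the linear terms of (1 - 9 e) (1 + 2 e) and (1 - 5 e) (1 - e)^2
    agree; the quadratic remainder has the right sign for e \<le> 1/10.\<close>
  have low2: "(1 - 9 * e) * Kgeo_diag m v \<le> (1 - 5 * e) * (W * Kdiag n v)"
  proof -
    have a: "(1 - 9 * e) * (1 + 2 * e) \<le> (1 - 5 * e) * (1 - e)\<^sup>2"
    proof -
      have "(1 - 5 * e) * (1 - e)\<^sup>2 - (1 - 9 * e) * (1 + 2 * e) = e * (29 * e - 5 * e\<^sup>2)"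
        by (simp add: power2_eq_square algebra_simps)
      moreover have "5 * e\<^sup>2 \<le> 29 * e" using e mult_mono[of e "1/10" e e] by (simp add: power2_eq_square)
      ultimately show ?thesis using e mult_nonneg_nonneg[of e "29 * e - 5 * e\<^sup>2"] by linarith
    qed
    have "(1 + 2 * e) * ((1 - 9 * e) * Kgeo_diag m v) \<le> (1 - 5 * e) * (1 - e)\<^sup>2 * Kgeo_diag m v"
      using mult_right_mono[OF a kd] by (simp add: mult_ac)
    also have "\<dots> = (1 - 5 * e) * (Kgeo_diag m v * (1 - e)\<^sup>2)" by (simp add: mult_ac)
    also have "\<dots> \<le> (1 - 5 * e) * ((1 + 2 * e) * (W * Kdiag n v))" using e low by (intro mult_left_mono) auto
    also have "\<dots> = (1 + 2 * e) * ((1 - 5 * e) * (W * Kdiag n v))" by (simp add: mult_ac)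
    finally show ?thesis using e by (subst (asm) mult_le_cancel_left_pos) auto
  qed
  have e1: "1 / (1 - e) \<le> 1 + 2 * e"
  proof -
    have "e * e \<le> 1 / 10 * e" using e by (intro mult_right_mono) auto
    then have "1 \<le> (1 + 2 * e) * (1 - e)" using e by (simp add: algebra_simps)
    then show ?thesis using e by (simp add: divide_le_eq)
  qed
  \<comment> \<open>The bracket is at most (1 + 2 e) + e - 2 (1 - e) = - (1 - 5 e), so the
    coefficient of \<open>Kdiag n v\<close> is negative and a lower bound for
    \<open>Kdiag n v\<close> bounds the error from above. No separate upper bound for the kernel is
    required.\<close>
  have "W / (1 - e) + W\<^sup>2 * \<theta> * B - 2 * W * Re q = W * (1 / (1 - e) + W * \<theta> * B - 2 * Re q)"
    by (simp add: algebra_simps power2_eq_square)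
  also have "\<dots> \<le> W * (- (1 - 5 * e))" using e1 h2 Req W by (intro mult_left_mono) auto
  finally have "Kdiag n v * (W / (1 - e) + W\<^sup>2 * \<theta> * B - 2 * W * Re q) \<le> Kdiag n v * (W * (- (1 - 5 * e)))"
    using Kdiag_nonneg by (intro mult_left_mono)
  also have "\<dots> = - ((1 - 5 * e) * (W * Kdiag n v))" by (simp add: algebra_simps)
  also have "\<dots> \<le> - ((1 - 9 * e) * Kgeo_diag m v)" using low2 by simp
  finally have up: "Kdiag n v * (W / (1 - e) + W\<^sup>2 * \<theta> * B - 2 * W * Re q) + Kgeo_diag (n + M) v \<le> Kgeo_diag (n + M) v - Kgeo_diag m v + 9 * e * Kgeo_diag m v"
    by (simp add: algebra_simps)
  have "(cmod (of_real W * K n z v * poly (peak \<zeta> M) z - Kgeo (n + M) z v))\<^sup>2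
    \<le> Kgeo_diag (n + M) z * (Kdiag n v * (W / (1 - e) + W\<^sup>2 * \<theta> * B - 2 * W * Re q) + Kgeo_diag (n + M) v)"
    unfolding W_def \<theta>_def q_def
    by (rule kernel_compare[OF \<zeta> \<delta> nbh]) (use wz m e B in \<open>auto simp: abs_le_iff algebra_simps\<close>)
  also have "\<dots> \<le> Kgeo_diag (n + M) z * (Kgeo_diag (n + M) v - Kgeo_diag m v + 9 * e * Kgeo_diag m v)"
    by (intro mult_left_mono up) (auto simp: Kgeo_diag_def sum_nonneg)
  finally show ?thesis .
qed

end

section \<open>Scaling limit at distance 1/n\<close>

lemma power_one_plus_bound:
  fixes y :: complex
  shows "cmod ((1 + y) ^ M - 1) \<le> exp (real M * cmod y) - 1"
proof -
  have "cmod ((1 + y) ^ M - 1) \<le> (1 + cmod y) ^ M - 1"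
  proof (induction M)
    case (Suc M)
    have "(1 + y) ^ Suc M - 1 = (1 + y) * ((1 + y) ^ M - 1) + y" by (simp add: algebra_simps)
    then have "cmod ((1 + y) ^ Suc M - 1) \<le> cmod (1 + y) * cmod ((1 + y) ^ M - 1) + cmod y"
      by (metis norm_mult norm_triangle_ineq)
    also have "\<dots> \<le> (1 + cmod y) * ((1 + cmod y) ^ M - 1) + cmod y"
      using Suc.IH norm_triangle_ineq[of 1 y] by (intro add_right_mono mult_mono) auto
    also have "\<dots> = (1 + cmod y) ^ Suc M - 1" by (simp add: algebra_simps)
    finally show ?case .
  qed simp
  also have "(1 + cmod y) ^ M \<le> exp (cmod y) ^ M" by (intro power_mono exp_ge_add_one_self) auto
  also have "\<dots> = exp (real M * cmod y)" by (simp add: exp_of_nat_mult)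
  finally show ?thesis by simp
qed

lemma cmod_exp_minus_1: "cmod u \<le> 1 \<Longrightarrow> cmod (exp u - 1) \<le> 4 * cmod u"
proof -
  assume u: "cmod u \<le> 1"
  have "cmod (Hc u) \<le> cmod (Hc u - 1) + 1" using norm_triangle_ineq[of "Hc u - 1" 1] by simp
  also have "\<dots> \<le> 4" using Hc_near_0[OF u] u by linarith
  finally have "cmod u * cmod (Hc u) \<le> cmod u * 4" by (intro mult_left_mono) auto
  then show ?thesis by (simp add: Hc_mult[symmetric] norm_mult)
qed

text \<open>At distance R / n from \<zeta> the peak is (1 + y)^M with |y| \<le> 2 R / n, so M R
  \<le> e n / 4 gives M |y| \<le> e / 2 and the deviation from 1 is at most exp (e / 2) - 1 \<le>
  e.\<close>

lemma peak_near:
  assumes \<zeta>: "cmod \<zeta> = 1" and n: "n > 0" and R: "cmod b \<le> R" "R \<le> real n" "R > 0"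
    and M: "real M * R \<le> e / 4 * real n" and e: "0 \<le> e" "e \<le> 1"
  shows "cmod (poly (peak \<zeta> M) (\<zeta> * exp (b / of_nat n)) - 1) \<le> e"
proof -
  define y where "y = (exp (b / of_nat n) - 1) / 2"
  have bn: "cmod (b / of_nat n) \<le> R / real n" "R / real n \<le> 1"
    using R n by (auto simp: norm_divide divide_right_mono)
  then have y: "cmod y \<le> 2 * (R / real n)"
    using cmod_exp_minus_1[of "b / of_nat n"] by (simp add: y_def norm_divide)
  have "\<zeta> * cnj \<zeta> = 1" using complex_norm_square[of \<zeta>] \<zeta> by simp
  then have zz: "\<zeta> * exp (b / of_nat n) * cnj \<zeta> = exp (b / of_nat n)"
    by (metis mult.assoc mult.commute mult_1)
  have "poly (peak \<zeta> M) (\<zeta> * exp (b / of_nat n)) = (1 + y) ^ M"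
    unfolding poly_peak zz y_def by (simp add: field_simps)
  then have "cmod (poly (peak \<zeta> M) (\<zeta> * exp (b / of_nat n)) - 1) \<le> exp (real M * cmod y) - 1"
    using power_one_plus_bound[of y M] by simp
  also have "real M * cmod y \<le> real M * (2 * (R / real n))" using y by (intro mult_left_mono) auto
  also have "\<dots> \<le> e / 2" using M n by (simp add: field_simps)
  finally have "cmod (poly (peak \<zeta> M) (\<zeta> * exp (b / of_nat n)) - 1) \<le> exp (e / 2) - 1" by simp
  also have "\<dots> \<le> e"
  proof -
    have "exp (e / 2) \<le> 1 + e / 2 + (e / 2)\<^sup>2" using e by (intro exp_bound) auto
    moreover have "(e / 2)\<^sup>2 \<le> e / 2"
      using mult_left_mono[of e 2 e] e by (simp add: power2_eq_square)
    ultimately show ?thesis by simp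
  qed
  finally show ?thesis .
qed

context opuc_ac
begin

lemma kernel_universality:
  assumes R: "R \<ge> 1" and \<epsilon>: "\<epsilon> > 0"
  shows "eventually (\<lambda>n. \<forall>\<zeta>\<in>S. \<forall>a b. cmod a \<le> R \<longrightarrow> cmod b \<le> R \<longrightarrow>
    cmod (of_real (2 * pi * w \<zeta> / real n) * K n (\<zeta> * exp (a / of_nat n)) (\<zeta> * exp (b / of_nat n)) - Hc (a + cnj b)) \<le> \<epsilon>) sequentially"
proof -
  \<comment> \<open>A point \<zeta> exp (a / n) has modulus at most exp (R / n), and the powers that
    occur have exponents below 4 n; \<open>X\<close> bounds them all.\<close>
  define X where "X = exp (4 * R)"
  have X: "X \<ge> 1" using R by (simp add: X_def)
  \<comment> \<open>The comparison bounds a square, so errors come out as multiples of sqrt e, in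
    total 14 sqrt e X: 5 from the comparison, 8 from removing the peak, 1 from reducing the degree n
    + M to n. The factor 28 leaves half of \<epsilon> for the limit of the geometric sum.\<close>
  define e where "e = min (1 / 10) ((\<epsilon> / (28 * X))\<^sup>2)"
  have e: "0 < e" "e \<le> 1 / 10" using \<epsilon> X by (auto simp: e_def)
  have sqe: "14 * sqrt e * X \<le> \<epsilon> / 2"
  proof -
    have "sqrt e \<le> sqrt ((\<epsilon> / (28 * X))\<^sup>2)" unfolding e_def by (intro real_sqrt_le_mono) auto
    also have "\<dots> = \<epsilon> / (28 * X)" using \<epsilon> X by simp
    finally show ?thesis using X by (simp add: field_simps)
  qed
  have se: "e \<le> sqrt e" "sqrt e \<le> 1"
  proof -
    show "e \<le> sqrt e" using e by (intro real_le_rsqrt) (simp add: power2_eq_square)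
    show "sqrt e \<le> 1" using e by simp
  qed
  obtain w0 w1 where w01: "0 < w0" "0 < w1" "\<And>\<zeta>. \<zeta> \<in> S \<Longrightarrow> w0 \<le> w \<zeta> \<and> w \<zeta> \<le> w1" using w_bounds by blast
  have "e * w0 > 0" using e w01 by simp
  from w_uniform[OF this] obtain \<delta> where \<delta>: "0 < \<delta>" "\<delta> \<le> 1" "\<And>\<zeta>. \<zeta> \<in> S \<Longrightarrow> ball \<zeta> \<delta> \<subseteq> U"
    "\<And>\<zeta> z. \<zeta> \<in> S \<Longrightarrow> cmod z = 1 \<Longrightarrow> dist z \<zeta> < \<delta> \<Longrightarrow> \<bar>w z - w \<zeta>\<bar> \<le> e * w0" by blast
  define \<theta> where "\<theta> = 1 - \<delta>\<^sup>2 / 4"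
  have \<theta>: "0 < \<theta>" "\<theta> < 1" using \<delta> power_le_one[of \<delta> 2] by (auto simp: \<theta>_def)
  \<comment> \<open>The degree of the peak as a fraction of n, the largest for which the peak stays
    within e of 1 at distance R / n.\<close>
  define \<eta> where "\<eta> = e / (4 * R)"
  have \<eta>: "0 < \<eta>" "\<eta> \<le> e"
  proof -
    show "0 < \<eta>" using e R by (simp add: \<eta>_def)
    have "e / (4 * R) \<le> e / 1" using e R by (intro divide_left_mono) auto
    then show "\<eta> \<le> e" by (simp add: \<eta>_def)
  qed
  \<comment> \<open>With M about \<eta> n the far-field factor \<theta>^M decays like exp (-
    \<Lambda> n). The growth exponent of |\<phi>|^2 is then taken as \<Lambda> / 2, so that the
    product with the kernel bound still decays.\<close>
  define \<Lambda> where "\<Lambda> = - \<eta> * ln \<theta>"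
  have \<Lambda>: "\<Lambda> > 0" using \<theta> \<eta> by (simp add: \<Lambda>_def mult_pos_neg)
  obtain C where C: "C > 0" "\<And>i z. cmod z = 1 \<Longrightarrow> (cmod (poly (\<phi> i) z))\<^sup>2 \<le> C * exp (\<Lambda> / 2 * real i)"
    using \<phi>_growth[OF alpha_lim, of "\<Lambda> / 2"] \<Lambda> by auto
  define B where "B n = real n * (C * exp (\<Lambda> / 2 * real n))" for n :: nat
  have KB: "Kdiag n z \<le> B n" if "cmod z = 1" for n z
  proof -
    have "Kdiag n z \<le> (\<Sum>i<n. C * exp (\<Lambda> / 2 * real n))"
      unfolding Kdiag_def
    proof (intro sum_mono)
      fix i assume "i \<in> {..<n}"
      then have "\<Lambda> / 2 * real i \<le> \<Lambda> / 2 * real n" using \<Lambda> by (intro mult_left_mono) auto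
      then show "(cmod (poly (\<phi> i) z))\<^sup>2 \<le> C * exp (\<Lambda> / 2 * real n)"
        using C(2)[OF that, of i] C(1) by (intro order_trans[OF C(2)[OF that, of i]] mult_left_mono) auto
    qed
    then show ?thesis by (simp add: B_def)
  qed
  define M where "M n = nat \<lfloor>\<eta> * real n\<rfloor>" for n
  have M: "real (M n) \<le> \<eta> * real n" "\<eta> * real n - 1 \<le> real (M n)" for n
    using \<eta> by (auto simp: M_def)
  \<comment> \<open>Rounding \<eta> n down costs at most one factor 1 / \<theta>.\<close>
  have thM: "\<theta> ^ M n \<le> exp (- \<Lambda> * real n) / \<theta>" for n
  proof -
    have "\<theta> ^ M n = exp (real (M n) * ln \<theta>)" using \<theta> by (simp add: exp_of_nat_mult)
    also have "\<dots> \<le> exp ((\<eta> * real n - 1) * ln \<theta>)" using M(2)[of n] \<theta> by (simp add: mult_right_mono_neg)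
    also have "(\<eta> * real n - 1) * ln \<theta> = - \<Lambda> * real n - ln \<theta>" by (simp add: \<Lambda>_def algebra_simps)
    also have "exp \<dots> = exp (- \<Lambda> * real n) / \<theta>" using \<theta> by (simp add: exp_diff)
    finally show ?thesis .
  qed
  have lim: "(\<lambda>n::nat. real n * exp (- c * real n)) \<longlonglongrightarrow> 0" if "c > 0" for c :: real
    using that by real_asymp
  have "(\<lambda>n. (1 / \<theta>) * (real n * exp (- \<Lambda> * real n))) \<longlonglongrightarrow> (1 / \<theta>) * 0"
    by (intro tendsto_intros lim \<Lambda>)
  then have ev1: "eventually (\<lambda>n. (1 / \<theta>) * (real n * exp (- \<Lambda> * real n)) < e * (2 * pi * w0)) sequentially"
    by (rule order_tendstoD) (use e w01 in simp)
  have "(\<lambda>n. (2 * pi * w1 * C / \<theta>) * (real n * exp (- (\<Lambda> / 2) * real n))) \<longlonglongrightarrow> (2 * pi * w1 * C / \<theta>) * 0"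
    by (intro tendsto_intros lim) (use \<Lambda> in simp)
  then have ev2: "eventually (\<lambda>n. (2 * pi * w1 * C / \<theta>) * (real n * exp (- (\<Lambda> / 2) * real n)) < e) sequentially"
    by (rule order_tendstoD) (use e in simp)
  have "(\<lambda>n::nat. X * 6 * R / real n) \<longlonglongrightarrow> 0" by (rule lim_const_over_n)
  then have ev3: "eventually (\<lambda>n. X * 6 * R / real n < \<epsilon> / 2) sequentially"
    by (rule order_tendstoD) (use \<epsilon> in simp)
  obtain n0 :: nat where n0: "2 * R \<le> real n0" using real_arch_simple by blast
  show ?thesis
    using ev1 ev2 ev3 eventually_ge_at_top[of n0] eventually_gt_at_top[of 0]
  proof eventually_elim
    case (elim n)
    have Rn: "2 * R \<le> real n" using n0 elim(4) by (meson of_nat_le_iff order_trans)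
    have n: "n > 0" by (rule elim(5))
    have MltR: "real (M n) \<le> e * real n"
      using M(1)[of n] mult_right_mono[OF \<eta>(2), of "real n"] by simp
    have "real (M n) < real n" 
    proof -
      have "e * real n \<le> 1 / 10 * real n" using e by (intro mult_right_mono) auto
      moreover have "0 < real n" using n by simp
      ultimately show ?thesis using MltR by linarith
    qed
    then have Mn: "M n < n" by simp
    define m where "m = n - M n"
    have m: "m > 0" "m + M n = n" using Mn by (auto simp: m_def)
    show ?case
    proof (intro ballI allI impI)
      fix \<zeta> a b assume \<zeta>: "\<zeta> \<in> S" and a: "cmod a \<le> R" and b: "cmod b \<le> R"
      define z where "z = \<zeta> * exp (a / of_nat n)"
      define v where "v = \<zeta> * exp (b / of_nat n)"
      define W where "W = 2 * pi * w \<zeta>"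
      have z1: "cmod \<zeta> = 1" by (rule S_circle[OF \<zeta>])
      have W: "2 * pi * w0 \<le> W" "W \<le> 2 * pi * w1" "W > 0" using w01(3)[OF \<zeta>] w01(1) by (auto simp: W_def)
      have pw: "cmod x ^ (2 * j) \<le> X" if x: "x = \<zeta> * exp (c / of_nat n)" "cmod c \<le> R" "j < 2 * n" for x c j
      proof -
        have "Re c / real n \<le> R / real n" using complex_Re_le_cmod[of c] x(2) by (intro divide_right_mono) auto
        then have "cmod x \<le> exp (R / real n)" using z1 by (simp add: x(1) norm_mult)
        then have "cmod x ^ (2 * j) \<le> exp (R / real n) ^ (2 * j)" by (intro power_mono) auto
        also have "\<dots> = exp (real (2 * j) * (R / real n))" by (rule exp_of_nat_mult[symmetric])
        also have "\<dots> \<le> X"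
        proof -
          have "real (2 * j) * (R / real n) \<le> (4 * real n) * (R / real n)"
            using x(3) R by (intro mult_right_mono) auto
          then show ?thesis using n by (simp add: X_def)
        qed
        finally show ?thesis .
      qed
      have kd: "Kgeo_diag N x \<le> real N * X" if "x = \<zeta> * exp (c / of_nat n)" "cmod c \<le> R" "N \<le> 2 * n" for N x c
      proof -
        have "Kgeo_diag N x \<le> (\<Sum>j<N. X)" unfolding Kgeo_diag_def by (intro sum_mono pw[OF that(1,2)]) (use that(3) in auto)
        then show ?thesis by simp
      qed
      have Phi_norm2: "n + M n \<le> 2 * n" using Mn by simp
      have kdiff: "Kgeo_diag (n + M n) v - Kgeo_diag m v \<le> 2 * e * real n * X"
      proof -
        have "m \<le> n + M n" using m by linarith
        then have "Kgeo_diag (n + M n) v = Kgeo_diag m v + (\<Sum>j=m..<n + M n. cmod v ^ (2 * j))"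
          using sum.atLeastLessThan_concat[of 0 m "n + M n" "\<lambda>j. cmod v ^ (2 * j)"] by (simp add: Kgeo_diag_def lessThan_atLeast0)
        moreover have "(\<Sum>j=m..<n + M n. cmod v ^ (2 * j)) \<le> (\<Sum>j=m..<n + M n. X)"
          by (intro sum_mono pw[OF v_def b]) (use Phi_norm2 in auto)
        moreover have "(\<Sum>j=m..<n + M n. X) = 2 * real (M n) * X"
        proof -
          have "n + M n - m = 2 * M n" using m by linarith
          then show ?thesis by simp
        qed
        moreover have "2 * real (M n) * X \<le> 2 * (e * real n) * X" using MltR X by (intro mult_right_mono mult_left_mono) auto
        ultimately show ?thesis by linarith
      qed
      have Kgeo_abs: "cmod (z * cnj v) ^ j \<le> X" if "j < 2 * n" for j
      proof -
        have "Re a / real n \<le> R / real n" "Re b / real n \<le> R / real n"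
          using complex_Re_le_cmod[of a] a complex_Re_le_cmod[of b] b by (auto intro!: divide_right_mono)
        then have "cmod (z * cnj v) \<le> exp (2 * R / real n)"
          using z1 by (simp add: z_def v_def norm_mult exp_add[symmetric])
        then have "cmod (z * cnj v) ^ j \<le> exp (2 * R / real n) ^ j" by (intro power_mono) auto
        also have "\<dots> = exp (real j * (2 * R / real n))" by (rule exp_of_nat_mult[symmetric])
        also have "\<dots> \<le> X"
        proof -
          have "real j * (2 * R / real n) \<le> (2 * real n) * (2 * R / real n)"
            using that R by (intro mult_right_mono) auto
          then show ?thesis using n by (simp add: X_def)
        qed
        finally show ?thesis .
      qed
      have Kgeo_N: "cmod (Kgeo N z v) \<le> real N * X" if "N \<le> 2 * n" for N
      proof -
        have "cmod (Kgeo N z v) \<le> (\<Sum>j<N. X)"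
          unfolding Kgeo_def by (intro sum_norm_le) (use Kgeo_abs that in \<open>auto simp: norm_power\<close>)
        then show ?thesis by simp
      qed
      have Kgeo_diag_diff: "cmod (Kgeo (n + M n) z v - Kgeo n z v) \<le> e * real n * X"
      proof -
        have "Kgeo (n + M n) z v - Kgeo n z v = (\<Sum>j=n..<n + M n. (z * cnj v) ^ j)"
          using sum.atLeastLessThan_concat[of 0 n "n + M n" "\<lambda>j. (z * cnj v) ^ j"] by (simp add: Kgeo_def lessThan_atLeast0 algebra_simps)
        also have "cmod \<dots> \<le> (\<Sum>j=n..<n + M n. X)"
          by (intro sum_norm_le) (use Kgeo_abs Phi_norm2 in \<open>auto simp: norm_power\<close>)
        also have "\<dots> = real (M n) * X" by simp
        also have "\<dots> \<le> e * real n * X" using MltR X by (intro mult_right_mono) auto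
        finally show ?thesis .
      qed
      have MR: "real (M n) * R \<le> e / 4 * real n"
      proof -
        have "real (M n) * R \<le> \<eta> * real n * R" using M(1)[of n] R by (intro mult_right_mono) auto
        also have "\<dots> = e / 4 * real n" using R by (simp add: \<eta>_def)
        finally show ?thesis .
      qed
      have qv: "cmod (poly (peak \<zeta> (M n)) v - 1) \<le> e" and qz: "cmod (poly (peak \<zeta> (M n)) z - 1) \<le> e"
        unfolding v_def z_def
        by (rule peak_near[OF z1 n _ _ _ MR]; use a b Rn R e in simp)+
      define q where "q = poly (peak \<zeta> (M n)) z"
      define k where "k = of_real W * K n z v"
      have core: "(cmod (k * q - Kgeo (n + M n) z v))\<^sup>2
         \<le> Kgeo_diag (n + M n) z * (Kgeo_diag (n + M n) v - Kgeo_diag m v + 9 * e * Kgeo_diag m v)"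
        unfolding k_def q_def W_def
      proof (rule kernel_core[OF \<zeta> \<delta>(1,2) \<delta>(3)[OF \<zeta>], where B = "B n"])
        fix x assume "cmod x = 1" "dist x \<zeta> < \<delta>"
        then have "\<bar>w x - w \<zeta>\<bar> \<le> e * w0" by (rule \<delta>(4)[OF \<zeta>])
        also have "\<dots> \<le> e * w \<zeta>" using w01(3)[OF \<zeta>] e by (intro mult_left_mono) auto
        finally show "\<bar>w x - w \<zeta>\<bar> \<le> e * w \<zeta>" .
      next
        have "(1 - \<delta>\<^sup>2 / 4) ^ M n * real m \<le> (exp (- \<Lambda> * real n) / \<theta>) * real n"
          using thM[of n] \<theta> m unfolding \<theta>_def[symmetric] by (intro mult_mono) auto
        also have "\<dots> = (1 / \<theta>) * (real n * exp (- \<Lambda> * real n))" by simp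
        also have "\<dots> \<le> e * (2 * pi * w0)" using elim(1) by simp
        also have "\<dots> \<le> e * (2 * pi * w \<zeta>)" using W(1) e by (intro mult_left_mono) (auto simp: W_def)
        finally show "(1 - \<delta>\<^sup>2 / 4) ^ M n * real m \<le> e * (2 * pi * w \<zeta>)" .
        have "2 * pi * w \<zeta> * (1 - \<delta>\<^sup>2 / 4) ^ M n * B n \<le> 2 * pi * w1 * (exp (- \<Lambda> * real n) / \<theta>) * B n"
          using thM[of n] \<theta> W C w01 unfolding \<theta>_def[symmetric] B_def W_def
          by (intro mult_right_mono mult_mono) auto
        also have "\<dots> = (2 * pi * w1 * C / \<theta>) * (real n * (exp (- \<Lambda> * real n) * exp (\<Lambda> / 2 * real n)))"
          by (simp add: B_def)
        also have "exp (- \<Lambda> * real n) * exp (\<Lambda> / 2 * real n) = exp (- (\<Lambda> / 2) * real n)"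
          by (simp add: exp_add[symmetric])
        also have "(2 * pi * w1 * C / \<theta>) * (real n * exp (- (\<Lambda> / 2) * real n)) \<le> e" using elim(2) by simp
        finally show "2 * pi * w \<zeta> * (1 - \<delta>\<^sup>2 / 4) ^ M n * B n \<le> e" .
      qed (use m e KB qv in auto)
      also have "\<dots> \<le> (2 * real n * X) * (2 * e * real n * X + 9 * e * (real n * X))"
      proof (rule mult_mono)
        show "Kgeo_diag (n + M n) z \<le> 2 * real n * X"
          using kd[OF z_def a Phi_norm2] Phi_norm2 X mult_right_mono[of "real (n + M n)" "2 * real n" X] by linarith
        have "Kgeo_diag m v \<le> real m * X" using m by (intro kd[OF v_def b]) auto
        also have "\<dots> \<le> real n * X" using m X by (intro mult_right_mono) auto
        finally have "9 * e * Kgeo_diag m v \<le> 9 * e * (real n * X)" using e by (intro mult_left_mono) auto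
        with kdiff show "Kgeo_diag (n + M n) v - Kgeo_diag m v + 9 * e * Kgeo_diag m v \<le> 2 * e * real n * X + 9 * e * (real n * X)"
          by (rule add_mono)
        have "Kgeo_diag m v \<le> Kgeo_diag (n + M n) v" unfolding Kgeo_diag_def using m by (intro sum_mono2) auto
        moreover have "0 \<le> Kgeo_diag m v" by (simp add: Kgeo_diag_def sum_nonneg)
        ultimately show "0 \<le> Kgeo_diag (n + M n) v - Kgeo_diag m v + 9 * e * Kgeo_diag m v" using e by simp
      qed (use X in auto)
      also have "\<dots> \<le> (5 * sqrt e * X * real n)\<^sup>2"
      proof -
        have "(2 * real n * X) * (2 * e * real n * X + 9 * e * (real n * X)) = 22 * (e * X\<^sup>2 * (real n)\<^sup>2)"
          by (simp add: power2_eq_square algebra_simps)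
        also have "\<dots> \<le> 25 * (e * X\<^sup>2 * (real n)\<^sup>2)" using e by simp
        also have "\<dots> = (5 * sqrt e * X * real n)\<^sup>2" using e by (simp add: power_mult_distrib)
        finally show ?thesis .
      qed
      finally have c1: "cmod (k * q - Kgeo (n + M n) z v) \<le> 5 * sqrt e * X * real n"
        using X e by (rule_tac power2_le_imp_le) auto
      have nX: "0 \<le> real n * X" using X by simp
      have "cmod (k * q) \<le> cmod (k * q - Kgeo (n + M n) z v) + cmod (Kgeo (n + M n) z v)"
        using norm_triangle_ineq[of "k * q - Kgeo (n + M n) z v" "Kgeo (n + M n) z v"] by simp
      also have "\<dots> \<le> 5 * (real n * X) + 2 * (real n * X)"
      proof (intro add_mono)
        have "5 * sqrt e * X * real n = sqrt e * (5 * (real n * X))" by simp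
        also have "\<dots> \<le> 1 * (5 * (real n * X))" using se nX by (intro mult_right_mono) auto
        finally show "cmod (k * q - Kgeo (n + M n) z v) \<le> 5 * (real n * X)" using c1 by linarith
        have "real (n + M n) * X \<le> (2 * real n) * X" using Phi_norm2 X by (intro mult_right_mono) auto
        then show "cmod (Kgeo (n + M n) z v) \<le> 2 * (real n * X)" using Kgeo_N[OF Phi_norm2] by simp
      qed
      finally have kq: "cmod k * cmod q \<le> 7 * (real n * X)" by (simp add: norm_mult mult.commute)
      have "cmod q \<ge> 9 / 10"
        using norm_triangle_ineq2[of 1 "1 - q"] qz e by (simp add: q_def norm_minus_commute)
      then have "cmod k * (9 / 10) \<le> cmod k * cmod q" by (intro mult_left_mono) auto
      then have k8: "cmod k \<le> 8 * (real n * X)" using kq nX by simp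
      have "cmod (k - k * q) = cmod k * cmod (q - 1)" 
      proof -
        have "k - k * q = - (k * (q - 1))" by (simp add: algebra_simps)
        then show ?thesis by (simp only: norm_minus_cancel norm_mult)
      qed
      also have "\<dots> \<le> 8 * (real n * X) * sqrt e"
        using k8 qz se nX by (intro mult_mono) (auto simp: q_def)
      finally have c2: "cmod (k - k * q) \<le> 8 * sqrt e * X * real n" by (simp add: mult_ac)
      have c3: "cmod (Kgeo (n + M n) z v - Kgeo n z v) \<le> sqrt e * X * real n"
        using Kgeo_diag_diff mult_right_mono[OF se(1) nX] by (simp add: mult_ac)
      have "cmod (k - Kgeo n z v) \<le> cmod (k - k * q) + cmod (k * q - Kgeo (n + M n) z v) + cmod (Kgeo (n + M n) z v - Kgeo n z v)"
        using norm_triangle_ineq[of "k - k * q" "k * q - Kgeo n z v"]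
          norm_triangle_ineq[of "k * q - Kgeo (n + M n) z v" "Kgeo (n + M n) z v - Kgeo n z v"] by simp
      also have "\<dots> \<le> 14 * sqrt e * X * real n" using c1 c2 c3 by simp
      also have "\<dots> \<le> \<epsilon> / 2 * real n" using sqe by (intro mult_right_mono) auto
      finally have d1: "cmod (k / of_nat n - Kgeo n z v / of_nat n) \<le> \<epsilon> / 2"
        using n by (simp add: diff_divide_distrib[symmetric] norm_divide divide_le_eq)
      define x where "x = a + cnj b"
      have zv: "z * cnj v = exp (x / of_nat n)"
      proof -
        have "\<zeta> * cnj \<zeta> = 1" using complex_norm_square[of \<zeta>] z1 by simp
        moreover have "z * cnj v = (\<zeta> * cnj \<zeta>) * (exp (a / of_nat n) * exp (cnj b / of_nat n))"
          by (simp add: z_def v_def exp_cnj mult_ac)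
        ultimately show ?thesis by (simp add: x_def exp_add[symmetric] add_divide_distrib)
      qed
      have "Kgeo n z v * Hc (x / of_nat n) = of_nat n * Hc x"
        using geometric_Hc[OF n, of x] by (simp add: Kgeo_def zv exp_of_nat_mult[symmetric])
      \<comment> \<open>The geometric kernel is an exact quotient of values of \<open>Hc\<close>;
        only the factor \<open>Hc (x / n)\<close>, within 6 R / n of 1, has to be estimated.\<close>
      then have hx: "Kgeo n z v / of_nat n * Hc (x / of_nat n) = Hc x" using n by (simp add: field_simps)
      have xn: "cmod x \<le> 2 * R" using norm_triangle_ineq[of a "cnj b"] a b by (simp add: x_def)
      then have xn1: "cmod (x / of_nat n) \<le> 2 * R / real n" "cmod (x / of_nat n) \<le> 1"
        using n Rn by (auto simp: norm_divide divide_right_mono divide_le_eq)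
      have "Kgeo n z v / of_nat n - Hc x = - (Kgeo n z v / of_nat n * (Hc (x / of_nat n) - 1))"
        by (simp only: hx[symmetric] right_diff_distrib mult_1_right minus_diff_eq)
      then have "cmod (Kgeo n z v / of_nat n - Hc x) = cmod (Kgeo n z v / of_nat n) * cmod (Hc (x / of_nat n) - 1)"
        by (simp only: norm_minus_cancel norm_mult)
      also have "\<dots> \<le> X * (3 * (2 * R / real n))"
      proof (intro mult_mono)
        show "cmod (Kgeo n z v / of_nat n) \<le> X" using Kgeo_N[of n] n by (simp add: norm_divide divide_le_eq mult.commute)
        show "cmod (Hc (x / of_nat n) - 1) \<le> 3 * (2 * R / real n)" using Hc_near_0[OF xn1(2)] xn1(1) by linarith
      qed (use X in auto)
      also have "\<dots> \<le> \<epsilon> / 2" using elim(3) by simp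
      finally have d2: "cmod (Kgeo n z v / of_nat n - Hc x) \<le> \<epsilon> / 2" .
      have "cmod (k / of_nat n - Hc x) \<le> \<epsilon>"
        using norm_triangle_ineq[of "k / of_nat n - Kgeo n z v / of_nat n" "Kgeo n z v / of_nat n - Hc x"] d1 d2 by simp
      then show "cmod (of_real (2 * pi * w \<zeta> / real n) * K n (\<zeta> * exp (a / of_nat n)) (\<zeta> * exp (b / of_nat n)) - Hc (a + cnj b)) \<le> \<epsilon>"
        by (simp add: k_def W_def x_def z_def v_def)
    qed
  qed
qed


section \<open>The sum without conjugation\<close>

definition Ksym :: "nat \<Rightarrow> complex \<Rightarrow> complex \<Rightarrow> complex" where
  "Ksym n z z' = (\<Sum>i<n. poly (\<phi> i) z * poly (\<phi> i) z')"

text \<open>The top term is the difference of the kernels for n + 1 and n at the same point, and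
  both have the same limit after scaling. This needs no asymptotics of the polynomials
  themselves.\<close>

lemma phi_small:
  assumes R: "R \<ge> 1" and \<epsilon>: "\<epsilon> > 0"
  shows "eventually (\<lambda>n. \<forall>\<zeta>\<in>S. \<forall>a. cmod a \<le> R \<longrightarrow>
    2 * pi * w \<zeta> / real n * (cmod (poly (\<phi> n) (\<zeta> * exp (a / of_nat n))))\<^sup>2 \<le> \<epsilon>) sequentially"
proof -
  define J where "J = cball (0::complex) (4 * R)"
  have "compact (Hc ` J)" unfolding J_def by (intro compact_continuous_image Hc_continuous continuous_on_id compact_cball)
  then obtain G where G: "\<And>y. y \<in> J \<Longrightarrow> cmod (Hc y) \<le> G" using compact_imp_bounded[of "Hc ` J"] by (auto simp: bounded_iff)
  have "uniformly_continuous_on J Hc" unfolding J_def by (intro compact_uniformly_continuous Hc_continuous continuous_on_id compact_cball)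
  then obtain d where d: "d > 0" "\<And>y y'. y \<in> J \<Longrightarrow> y' \<in> J \<Longrightarrow> dist y' y < d \<Longrightarrow> dist (Hc y') (Hc y) < \<epsilon> / 4"
    unfolding uniformly_continuous_on_def using \<epsilon> by (metis divide_pos_pos zero_less_numeral)
  have e4: "\<epsilon> / 4 > 0" using \<epsilon> by simp
  have R2: "2 * R \<ge> 1" using R by simp
  note U = kernel_universality[OF R2 e4]
  have U1: "eventually (\<lambda>n. \<forall>\<zeta>\<in>S. \<forall>a b. cmod a \<le> 2 * R \<longrightarrow> cmod b \<le> 2 * R \<longrightarrow>
    cmod (of_real (2 * pi * w \<zeta> / real (Suc n)) * K (Suc n) (\<zeta> * exp (a / of_nat (Suc n))) (\<zeta> * exp (b / of_nat (Suc n))) - Hc (a + cnj b)) \<le> \<epsilon> / 4) sequentially"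
    using eventually_compose_filterlim[OF U filterlim_Suc] .
  have "(\<lambda>n::nat. 2 * R / real n) \<longlonglongrightarrow> 0" by (rule lim_const_over_n)
  then have ev1: "eventually (\<lambda>n. 2 * R / real n < d) sequentially" by (rule order_tendstoD) (rule d)
  have "(\<lambda>n::nat. (\<bar>G\<bar> + \<epsilon> / 4) / real n) \<longlonglongrightarrow> 0" by (rule lim_const_over_n)
  then have ev2: "eventually (\<lambda>n. (\<bar>G\<bar> + \<epsilon> / 4) / real n < \<epsilon> / 4) sequentially" by (rule order_tendstoD) (use \<epsilon> in simp)
  show ?thesis
    using U U1 ev1 ev2 eventually_gt_at_top[of 0]
  proof eventually_elim
    case (elim n)
    show ?case
    proof (intro ballI allI impI)
      fix \<zeta> a assume \<zeta>: "\<zeta> \<in> S" and a: "cmod a \<le> R"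
      have n: "n > 0" by (rule elim(5))
      \<comment> \<open>The same point in the scale of n + 1. It differs from \<open>a\<close> by a
        / n, and has modulus at most 2 R, which is why universality was invoked with 2 R.\<close>
      define a' where "a' = a * of_nat (Suc n) / of_nat n"
      define z where "z = \<zeta> * exp (a / of_nat n)"
      define c where "c = 2 * pi * w \<zeta>"
      have za': "z = \<zeta> * exp (a' / of_nat (Suc n))" using n by (simp add: z_def a'_def del: of_nat_Suc)
      have diff: "a' - a = a / of_nat n" using n by (simp add: a'_def field_simps)
      have an: "cmod (a / of_nat n) \<le> R / real n" using a by (simp add: norm_divide divide_right_mono)
      have "R / real n \<le> R / 1" using n R by (intro divide_left_mono) auto
      moreover have "cmod a' \<le> cmod a + cmod (a' - a)" using norm_triangle_ineq[of a "a' - a"] by simp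
      ultimately have a'R: "cmod a' \<le> 2 * R" using an a unfolding diff by simp
      have aR: "cmod a \<le> 2 * R" using a R by simp
      define u where "u = Re (of_real (c / real n) * K n z z)"
      define u' where "u' = Re (of_real (c / real (Suc n)) * K (Suc n) z z)"
      have cl: "cmod (of_real (c / real n) * K n z z - Hc (a + cnj a)) \<le> \<epsilon> / 4"
        using elim(1) \<zeta> aR unfolding z_def c_def by blast
      have cl': "cmod (of_real (c / real (Suc n)) * K (Suc n) z z - Hc (a' + cnj a')) \<le> \<epsilon> / 4"
        using elim(2) \<zeta> a'R unfolding za' c_def by blast
      have J1: "a + cnj a \<in> J" "a' + cnj a' \<in> J"
        using norm_triangle_ineq[of a "cnj a"] norm_triangle_ineq[of a' "cnj a'"] aR a'R by (auto simp: J_def)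
      have "dist (a' + cnj a') (a + cnj a) = cmod ((a' - a) + cnj (a' - a))" by (simp add: dist_norm algebra_simps)
      also have "\<dots> \<le> 2 * R / real n" using norm_triangle_ineq[of "a' - a" "cnj (a' - a)"] an unfolding diff complex_mod_cnj by simp
      finally have "dist (Hc (a' + cnj a')) (Hc (a + cnj a)) < \<epsilon> / 4" using elim(3) J1 by (intro d(2)) auto
      then have h: "Re (Hc (a' + cnj a')) - Re (Hc (a + cnj a)) \<le> \<epsilon> / 4"
        using complex_Re_le_cmod[of "Hc (a' + cnj a') - Hc (a + cnj a)"] by (simp add: dist_norm)
      have uu: "\<bar>u - Re (Hc (a + cnj a))\<bar> \<le> \<epsilon> / 4" "\<bar>u' - Re (Hc (a' + cnj a'))\<bar> \<le> \<epsilon> / 4"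
        using order_trans[OF abs_Re_le_cmod cl] order_trans[OF abs_Re_le_cmod cl'] by (simp_all add: u_def u'_def)
      have "\<bar>Re (Hc (a' + cnj a'))\<bar> \<le> \<bar>G\<bar>" using order_trans[OF abs_Re_le_cmod G[OF J1(2)]] by linarith
      then have u'b: "u' \<le> \<bar>G\<bar> + \<epsilon> / 4" using uu(2) by linarith
      have u1: "u = c / real n * Kdiag n z" by (simp add: u_def K_diag)
      have u2: "u' = c / real (Suc n) * Kdiag (Suc n) z" by (simp add: u'_def K_diag del: of_nat_Suc)
      have "c / real n * (cmod (poly (\<phi> n) z))\<^sup>2 = c / real n * (Kdiag (Suc n) z - Kdiag n z)" by (simp add: Kdiag_def)
      also have "\<dots> = u' + u' / real n - u"
      proof -
        have "c * Kdiag (Suc n) z = u' * real (Suc n)" by (simp add: u2 del: of_nat_Suc)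
        then have "c / real n * Kdiag (Suc n) z = u' + u' / real n" using n by (simp add: field_simps)
        then show ?thesis by (simp add: u1 right_diff_distrib)
      qed
      also have "\<dots> \<le> (u' - u) + (\<bar>G\<bar> + \<epsilon> / 4) / real n" using u'b by (simp add: divide_right_mono)
      also have "\<dots> \<le> \<epsilon>" using uu h elim(4) by linarith
      finally show "2 * pi * w \<zeta> / real n * (cmod (poly (\<phi> n) (\<zeta> * exp (a / of_nat n))))\<^sup>2 \<le> \<epsilon>"
        by (simp add: c_def z_def)
    qed
  qed
qed

text \<open>In the Christoffel-Darboux formula the right side is controlled by \<phi>_n alone,
  because the conjugate of 1 / z for z = \<zeta> exp (x / n) is \<zeta> exp (- cnj x / n), again a
  point at scale 1/n from \<zeta>. The denominator is close to 1 - \<zeta>^2, bounded away from 0 on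
  the compact set.\<close>

lemma Ksym_small:
  assumes R: "R \<ge> 1" and \<epsilon>: "\<epsilon> > 0"
  shows "eventually (\<lambda>n. \<forall>\<zeta>\<in>S. \<forall>a b. cmod a \<le> R \<longrightarrow> cmod b \<le> R \<longrightarrow>
    cmod (of_real (2 * pi * w \<zeta> / real n) * Ksym n (\<zeta> * exp (a / of_nat n)) (\<zeta> * exp (b / of_nat n))) \<le> \<epsilon>) sequentially"
proof -
  have "\<exists>d>0. \<forall>\<zeta>\<in>S. d \<le> cmod (1 - \<zeta>\<^sup>2)"
  proof (cases "S = {}")
    case False
    have "continuous_on S (\<lambda>z. cmod (1 - z\<^sup>2))" by (intro continuous_intros)
    from continuous_attains_inf[OF S_compact False this]
    obtain z0 where z0: "z0 \<in> S" "\<And>z. z \<in> S \<Longrightarrow> cmod (1 - z0\<^sup>2) \<le> cmod (1 - z\<^sup>2)" by blast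
    have "z0 \<noteq> 1" "z0 \<noteq> -1" using z0(1) S_sub by auto
    then have "z0\<^sup>2 \<noteq> 1" by (simp add: power2_eq_1_iff)
    then show ?thesis using z0 by (intro exI[of _ "cmod (1 - z0\<^sup>2)"]) auto
  qed (auto intro: exI[of _ 1])
  then obtain d where d: "d > 0" "\<And>\<zeta>. \<zeta> \<in> S \<Longrightarrow> d \<le> cmod (1 - \<zeta>\<^sup>2)" by blast
  \<comment> \<open>The term with the reversed polynomial carries |z|^(2 n) \<le> exp (2 R), the
    other one 1; d / 2 is the lower bound for the denominator.\<close>
  define \<epsilon>' where "\<epsilon>' = \<epsilon> * (d / 2) / (exp (2 * R) + 1)"
  have ep: "\<epsilon>' > 0" using \<epsilon> d by (simp add: \<epsilon>'_def add_pos_pos)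
  have "(\<lambda>n::nat. 8 * R / real n) \<longlonglongrightarrow> 0" by (rule lim_const_over_n)
  then have ev1: "eventually (\<lambda>n. 8 * R / real n < min (d / 2) 1) sequentially" by (rule order_tendstoD) (use d in simp)
  show ?thesis
    using phi_small[OF R ep] ev1 eventually_gt_at_top[of 0]
  proof eventually_elim
    case (elim n)
    show ?case
    proof (intro ballI allI impI)
      fix \<zeta> a b assume \<zeta>: "\<zeta> \<in> S" and a: "cmod a \<le> R" and b: "cmod b \<le> R"
      have n: "n > 0" by (rule elim(3))
      have z1: "cmod \<zeta> = 1" by (rule S_circle[OF \<zeta>])
      define c where "c = 2 * pi * w \<zeta> / real n"
      have c0: "c \<ge> 0" using w_nonneg by (simp add: c_def)
      define z where "z x = \<zeta> * exp (x / of_nat n)" for x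
      have znz: "z x \<noteq> 0" for x using z1 by (auto simp: z_def)
      have sm: "c * (cmod (poly (\<phi> n) (z x)))\<^sup>2 \<le> \<epsilon>'" if "cmod x \<le> R" for x
        using elim(1) \<zeta> that unfolding c_def z_def by blast
      have zn: "cmod (z x ^ n) \<le> exp R" if "cmod x \<le> R" for x
      proof -
        have "cmod (z x ^ n) = exp (Re x / real n) ^ n" by (simp add: z_def norm_power norm_mult z1)
        also have "\<dots> = exp (Re x)" using n by (simp add: exp_of_nat_mult[symmetric])
        also have "\<dots> \<le> exp R" using complex_Re_le_cmod[of x] that by simp
        finally show ?thesis .
      qed
      have inv: "cmod (poly (\<phi> n) (1 / z x)) = cmod (poly (\<phi> n) (z (- cnj x)))" for x
      proof -
        have "\<zeta> * cnj \<zeta> = 1" using complex_norm_square[of \<zeta>] z1 by simp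
        then have "1 / cnj \<zeta> = \<zeta>" by (metis mult_zero_right nonzero_eq_divide_eq zero_neq_one)
        moreover have "cnj (1 / z x) = (1 / cnj \<zeta>) * (1 / exp (cnj x / of_nat n))" by (simp add: z_def exp_cnj)
        moreover have "1 / exp (cnj x / of_nat n) = exp (- cnj x / of_nat n)" by (simp add: exp_minus inverse_eq_divide)
        ultimately have "cnj (1 / z x) = z (- cnj x)" by (simp only: z_def)
        then show ?thesis by (metis \<phi>_cnj complex_mod_cnj)
      qed
      have sms: "c * (cmod (\<phi>s n (z x)))\<^sup>2 \<le> exp (2 * R) * \<epsilon>'" if x: "cmod x \<le> R" for x
      proof -
        have "(cmod (\<phi>s n (z x)))\<^sup>2 = (cmod (z x ^ n))\<^sup>2 * (cmod (poly (\<phi> n) (z (- cnj x))))\<^sup>2"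
          by (simp only: \<phi>s_def norm_mult inv power_mult_distrib)
        also have "\<dots> \<le> (exp R)\<^sup>2 * (cmod (poly (\<phi> n) (z (- cnj x))))\<^sup>2"
          by (intro mult_right_mono power_mono zn x) auto
        finally have "c * (cmod (\<phi>s n (z x)))\<^sup>2 \<le> (exp R)\<^sup>2 * (c * (cmod (poly (\<phi> n) (z (- cnj x))))\<^sup>2)"
          using mult_left_mono[OF _ c0] by (simp only: mult.left_commute[of "(exp R)\<^sup>2" c])
        also have "\<dots> \<le> (exp R)\<^sup>2 * \<epsilon>'" using x by (intro mult_left_mono sm) auto
        also have "(exp R)\<^sup>2 = exp (2 * R)" by (simp add: exp_double)
        finally show ?thesis .
      qed
      have prod: "c * (x * y) \<le> t" if "c * x\<^sup>2 \<le> t" "c * y\<^sup>2 \<le> t" for x y t :: real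
      proof -
        have "0 \<le> c * (x - y)\<^sup>2" using c0 by simp
        then show ?thesis using that by (simp add: power2_diff algebra_simps)
      qed
      have "c * cmod ((1 - z a * z b) * Ksym n (z a) (z b)) = c * cmod (\<phi>s n (z a) * \<phi>s n (z b) - poly (\<phi> n) (z a) * poly (\<phi> n) (z b))"
        unfolding Ksym_def christoffel_darboux[OF znz znz] ..
      also have "\<dots> \<le> c * (cmod (\<phi>s n (z a)) * cmod (\<phi>s n (z b)) + cmod (poly (\<phi> n) (z a)) * cmod (poly (\<phi> n) (z b)))"
        using c0 by (intro mult_left_mono order_trans[OF norm_triangle_ineq4]) (auto simp: norm_mult)
      also have "\<dots> \<le> exp (2 * R) * \<epsilon>' + \<epsilon>'"
        unfolding distrib_left by (intro add_mono prod sms sm a b)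
      also have "\<dots> = \<epsilon> * (d / 2)"
      proof -
        have "exp (2 * R) + 1 \<noteq> 0" using exp_gt_zero[of "2 * R"] by linarith
        then have "\<epsilon>' * (exp (2 * R) + 1) = \<epsilon> * (d / 2)" using nonzero_eq_divide_eq \<epsilon>'_def by blast
        then show ?thesis by (simp add: algebra_simps)
      qed
      finally have up: "cmod (1 - z a * z b) * (c * cmod (Ksym n (z a) (z b))) \<le> \<epsilon> * (d / 2)"
        by (simp add: norm_mult mult_ac)
      have low: "d / 2 \<le> cmod (1 - z a * z b)"
      proof -
        define u where "u = (a + b) / of_nat n"
        have "cmod u \<le> 2 * R / real n"
          using norm_triangle_ineq[of a b] a b by (simp add: u_def norm_divide divide_right_mono)
        then have u: "4 * cmod u \<le> d / 2" "cmod u \<le> 1" using elim(2) R by (auto simp: min_def split: if_splits)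
        have "z a * z b = \<zeta>\<^sup>2 * exp u" by (simp add: z_def u_def power2_eq_square exp_add add_divide_distrib)
        then have e: "1 - \<zeta>\<^sup>2 = (1 - z a * z b) + \<zeta>\<^sup>2 * (exp u - 1)" by (simp add: algebra_simps)
        have "cmod (1 - \<zeta>\<^sup>2) \<le> cmod (1 - z a * z b) + cmod (exp u - 1)"
          by (subst e, rule order_trans[OF norm_triangle_ineq]) (simp add: norm_mult norm_power z1)
        then show ?thesis using d(2)[OF \<zeta>] cmod_exp_minus_1[OF u(2)] u(1) by linarith
      qed
      have "(d / 2) * (c * cmod (Ksym n (z a) (z b))) \<le> cmod (1 - z a * z b) * (c * cmod (Ksym n (z a) (z b)))"
        using low c0 by (intro mult_right_mono) auto
      then have "(d / 2) * (c * cmod (Ksym n (z a) (z b))) \<le> (d / 2) * \<epsilon>" using up by (simp only: mult.commute[of \<epsilon>])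
      then have "c * cmod (Ksym n (z a) (z b)) \<le> \<epsilon>" by (rule mult_left_le_imp_le) (use d in simp)
      then show "cmod (of_real (2 * pi * w \<zeta> / real n) * Ksym n (\<zeta> * exp (a / of_nat n)) (\<zeta> * exp (b / of_nat n))) \<le> \<epsilon>"
        using c0 unfolding norm_mult norm_of_real c_def[symmetric] z_def by simp
    qed
  qed
qed

end

section \<open>Second differences of the expected logarithm\<close>

lemma taylor_remainder:
  fixes f :: "complex \<Rightarrow> complex"
  assumes hol: "f holomorphic_on ball z0 (2 * \<rho>)" and \<rho>: "\<rho> > 0"
    and B: "\<And>z. z \<in> ball z0 (2 * \<rho>) \<Longrightarrow> cmod (f z) \<le> B" and d: "cmod d \<le> \<rho> / 2"
  shows "cmod (f (z0 + d) - (\<Sum>k<m. (deriv ^^ k) f z0 / fact k * d ^ k)) \<le> 2 * B * (cmod d / \<rho>) ^ m"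
proof -
  define a where "a k = (deriv ^^ k) f z0 / fact k * d ^ k" for k
  define q where "q = cmod d / \<rho>"
  have q: "0 \<le> q" "q \<le> 1 / 2" using d \<rho> by (auto simp: q_def divide_le_eq)
  have B0: "0 \<le> B" using B[of z0] \<rho> norm_ge_zero[of "f z0"] by (metis centre_in_ball mult_pos_pos order_trans zero_less_numeral)
  have sub: "cball z0 \<rho> \<subseteq> ball z0 (2 * \<rho>)" using \<rho> by auto
  have "(\<lambda>k. (deriv ^^ k) f z0 / fact k * (z0 + d - z0) ^ k) sums f (z0 + d)"
    by (rule holomorphic_power_series[OF hol]) (use d \<rho> in \<open>auto simp: dist_norm\<close>)
  then have sums: "a sums f (z0 + d)" by (simp add: a_def[abs_def])
  have cau: "cmod ((deriv ^^ k) f z0) \<le> fact k * B / \<rho> ^ k" for k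
  proof (rule Cauchy_inequality)
    show "f holomorphic_on ball z0 \<rho>" using hol sub by (meson ball_subset_cball holomorphic_on_subset subset_trans)
    show "continuous_on (cball z0 \<rho>) f"
      using hol sub by (meson holomorphic_on_imp_continuous_on holomorphic_on_subset)
    show "cmod (f x) \<le> B" if "cmod (z0 - x) = \<rho>" for x using that sub by (intro B) (auto simp: dist_norm)
  qed (rule \<rho>)
  have ak: "cmod (a k) \<le> B * q ^ k" for k
  proof -
    have "cmod (a k) = cmod ((deriv ^^ k) f z0) / fact k * cmod d ^ k"
      by (simp add: a_def norm_mult norm_divide norm_power)
    also have "\<dots> \<le> (fact k * B / \<rho> ^ k) / fact k * cmod d ^ k"
      by (intro mult_right_mono divide_right_mono cau) auto
    also have "\<dots> = B * q ^ k" by (simp add: q_def power_divide)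
    finally show ?thesis .
  qed
  have geo: "(\<lambda>k. B * q ^ (k + m)) sums (B * q ^ m * (1 / (1 - q)))"
    using sums_mult[OF geometric_sums[of q], of "B * q ^ m"] q by (simp add: power_add mult_ac)
  have "(\<lambda>k. a (k + m)) sums (f (z0 + d) - (\<Sum>k<m. a k))"
    using sums_split_initial_segment[OF sums, of m] .
  then have "f (z0 + d) - (\<Sum>k<m. a k) = (\<Sum>k. a (k + m))" by (simp add: sums_iff)
  also have "cmod \<dots> \<le> (\<Sum>k. B * q ^ (k + m))"
    by (rule norm_suminf_le) (use geo ak in \<open>auto simp: sums_iff\<close>)
  also have "\<dots> = B * q ^ m * (1 / (1 - q))" using geo by (simp add: sums_iff)
  also have "\<dots> \<le> B * q ^ m * 2" using q B0 by (intro mult_left_mono) (auto simp: divide_le_eq)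
  finally show ?thesis by (simp add: a_def q_def mult_ac)
qed

text \<open>Odd Taylor terms cancel. The first form is for functions that are uniformly small, where
  a bound of size sup |f| times |d|^2 is wanted; the second is for a fixed function whose second
  derivative is to be isolated.\<close>

lemma second_difference_bound:
  fixes f :: "complex \<Rightarrow> complex"
  assumes hol: "f holomorphic_on ball z0 (2 * \<rho>)" and \<rho>: "\<rho> > 0"
    and B: "\<And>z. z \<in> ball z0 (2 * \<rho>) \<Longrightarrow> cmod (f z) \<le> B" and d: "cmod d \<le> \<rho> / 2"
  shows "cmod (f (z0 + d) + f (z0 - d) - 2 * f z0) \<le> 4 * B * (cmod d / \<rho>) ^ 2"
    and "cmod (f (z0 + d) + f (z0 - d) - 2 * f z0 - deriv (deriv f) z0 * d\<^sup>2) \<le> 4 * B * (cmod d / \<rho>) ^ 3"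
proof -
  define r where "r m e = f (z0 + e) - (\<Sum>k<m. (deriv ^^ k) f z0 / fact k * e ^ k)" for m e
  have rb: "cmod (r m e) \<le> 2 * B * (cmod d / \<rho>) ^ m" if "e = d \<or> e = - d" for m e
    using taylor_remainder[OF hol \<rho> B, of e m] d that unfolding r_def by auto
  have tri: "cmod (r m d + r m (- d)) \<le> 4 * B * (cmod d / \<rho>) ^ m" for m
    using norm_triangle_ineq[of "r m d" "r m (- d)"] rb[of d m] rb[of "- d" m] by simp
  have "f (z0 + d) + f (z0 - d) - 2 * f z0 = r 2 d + r 2 (- d)"
    by (simp add: r_def eval_nat_numeral)
  then show "cmod (f (z0 + d) + f (z0 - d) - 2 * f z0) \<le> 4 * B * (cmod d / \<rho>) ^ 2" using tri[of 2] by simp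
  have "f (z0 + d) + f (z0 - d) - 2 * f z0 - deriv (deriv f) z0 * d\<^sup>2 = r 3 d + r 3 (- d)"
    by (simp add: r_def eval_nat_numeral)
  then show "cmod (f (z0 + d) + f (z0 - d) - 2 * f z0 - deriv (deriv f) z0 * d\<^sup>2) \<le> 4 * B * (cmod d / \<rho>) ^ 3"
    using tri[of 3] by simp
qed

lemma Ln_lipschitz:
  assumes g: "g > 0" and "g \<le> Re z" "g \<le> Re w"
  shows "cmod (Ln z - Ln w) \<le> 1 / g * cmod (z - w)"
proof (rule field_differentiable_bound[where S = "{z. Re z \<ge> g}"])
  show "convex {z. g \<le> Re z}" by (rule convex_halfspace_Re_ge)
  fix x assume x: "x \<in> {z. g \<le> Re z}"
  then have "x \<notin> \<real>\<^sub>\<le>\<^sub>0" using g by (auto simp: complex_nonpos_Reals_iff)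
  then have "(Ln has_field_derivative inverse x) (at x)" by (rule has_field_derivative_Ln)
  then show "(Ln has_field_derivative inverse x) (at x within {z. g \<le> Re z})" by (rule has_field_derivative_at_within)
  have "g \<le> cmod x" using x complex_Re_le_cmod[of x] by auto
  then show "cmod (inverse x) \<le> 1 / g" using g by (simp add: norm_divide inverse_eq_divide frac_le)
qed (use assms in auto)

text \<open>Rationalise: the principal root has nonnegative real part, so the conjugate factor has
  modulus at least 1.\<close>

lemma csqrt_near_1: "cmod (csqrt (1 - D) - 1) \<le> cmod D"
proof -
  have "(csqrt (1 - D) - 1) * (csqrt (1 - D) + 1) = - D"
    by (simp add: algebra_simps power2_eq_square[symmetric])
  then have "cmod (csqrt (1 - D) - 1) * cmod (csqrt (1 - D) + 1) = cmod D"
    by (metis norm_minus_cancel norm_mult)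
  moreover have "1 \<le> cmod (csqrt (1 - D) + 1)"
  proof -
    have "1 \<le> Re (csqrt (1 - D) + 1)" using Re_csqrt[of "1 - D"] by (simp del: csqrt.sel)
    also have "\<dots> \<le> cmod (csqrt (1 - D) + 1)" by (rule complex_Re_le_cmod)
    finally show ?thesis .
  qed
  then have "cmod (csqrt (1 - D) - 1) * 1 \<le> cmod (csqrt (1 - D) - 1) * cmod (csqrt (1 - D) + 1)"
    by (intro mult_left_mono) auto
  ultimately show ?thesis by simp
qed

definition LnH :: "complex \<Rightarrow> complex" where "LnH y = Ln (Hc y)"

text \<open>A holomorphic version of \<open>k + sqrt (k\<^sup>2 - \<bar>b\<bar>\<^sup>2)\<close>, to be evaluated at \<open>A = k\<close>, \<open>B1 = b\<close>, \<open>B2 = cnj b\<close>.\<close>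

definition root_sum :: "complex \<Rightarrow> complex \<Rightarrow> complex \<Rightarrow> complex" where
  "root_sum A B1 B2 = A * (1 + csqrt (1 - B1 * B2 / A\<^sup>2))"

text \<open>The difference between the logarithm of \<open>root_sum\<close> and ln 2 + ln
  \<open>Hc\<close> is small on a complex disc of fixed radius, so its second difference is a small
  multiple of s^2; the rest is the second difference of ln \<open>Hc\<close> at displacement 2 s
  \<gamma>. The divisors 4 and 2 come from averaging two antipodal values and from the factor 1/2 in
  the expected logarithm; they turn (2 s \<gamma>)^2 into s^2 \<gamma>^2.\<close>

lemma second_difference_log:
  assumes R: "R > 0" and \<epsilon>: "\<epsilon> > 0"
  shows "\<exists>\<rho> \<epsilon>' s0. 0 < \<rho> \<and> \<rho> \<le> 1 / 2 \<and> 0 < \<epsilon>' \<and> 0 < s0 \<and> s0 < \<rho> \<and>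
    (\<forall>x \<gamma> A B1 B2 s. \<bar>x\<bar> \<le> 2 * R \<longrightarrow> \<bar>\<gamma>\<bar> \<le> 1 \<longrightarrow>
       A holomorphic_on ball 0 (2 * \<rho>) \<longrightarrow> B1 holomorphic_on ball 0 (2 * \<rho>) \<longrightarrow> B2 holomorphic_on ball 0 (2 * \<rho>) \<longrightarrow>
       (\<forall>s \<in> ball 0 (2 * \<rho>). cmod (A s - Hc (of_real x + 2 * s * of_real \<gamma>)) \<le> \<epsilon>' \<and> cmod (B1 s) \<le> \<epsilon>' \<and> cmod (B2 s) \<le> \<epsilon>') \<longrightarrow>
       0 < s \<longrightarrow> s \<le> s0 \<longrightarrow>
       \<bar>(ln (cmod (root_sum (A (of_real s)) (B1 (of_real s)) (B2 (of_real s)))) + ln (cmod (root_sum (A (of_real (- s))) (B1 (of_real (- s))) (B2 (of_real (- s)))))) / 4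
          - ln (cmod (root_sum (A 0) (B1 0) (B2 0))) / 2 - s\<^sup>2 * \<gamma>\<^sup>2 * Re (deriv (deriv LnH) (of_real x))\<bar> \<le> \<epsilon> * s\<^sup>2)"
proof -
  define J where "J = cball (0::complex) (2 * R + 4)"
  have "compact (Hc ` J)" unfolding J_def by (intro compact_continuous_image Hc_continuous continuous_on_id compact_cball)
  then obtain G1 where G1: "\<And>y. y \<in> J \<Longrightarrow> cmod (Hc y) \<le> G1" using compact_imp_bounded[of "Hc ` J"] by (auto simp: bounded_iff)
  have "continuous_on {-2*R..2*R} H"
  proof -
    have "continuous_on {-2*R..2*R} (\<lambda>x. Re (Hc (of_real x)))" by (intro continuous_intros)
    then show ?thesis by (simp add: Hc_of_real)
  qed
  then obtain x0 where x0: "\<And>x. x \<in> {-2*R..2*R} \<Longrightarrow> H x0 \<le> H x"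
    using continuous_attains_inf[of "{-2*R..2*R}" H] R by (metis atLeastAtMost_iff compact_Icc empty_iff less_eq_real_def neg_le_0_iff_le mult_minus_left mult_nonneg_nonneg zero_le_numeral)
  define g0 where "g0 = H x0"
  have g0: "g0 > 0" "\<And>x. \<bar>x\<bar> \<le> 2 * R \<Longrightarrow> g0 \<le> H x" using H_pos x0 by (auto simp: g0_def abs_le_iff)
  have "uniformly_continuous_on J Hc" unfolding J_def by (intro compact_uniformly_continuous Hc_continuous continuous_on_id compact_cball)
  then obtain d0 where d0: "d0 > 0" "\<And>y y'. y \<in> J \<Longrightarrow> y' \<in> J \<Longrightarrow> dist y' y < d0 \<Longrightarrow> dist (Hc y') (Hc y) < g0 / 4"
    unfolding uniformly_continuous_on_def using g0(1) by (metis divide_pos_pos zero_less_numeral)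
  \<comment> \<open>Within 8 \<rho> of the real points considered, \<open>Hc\<close> varies by less
    than g0 / 4, so its real part stays above 3 g0 / 4 and its logarithm is holomorphic
    there.\<close>
  define \<rho> where "\<rho> = min (1 / 2) (d0 / 8)"
  have \<rho>: "0 < \<rho>" "\<rho> \<le> 1 / 2" "8 * \<rho> \<le> d0" using d0 by (auto simp: \<rho>_def)
  define C1 where "C1 = \<bar>ln (3 * g0 / 4)\<bar> + \<bar>ln (\<bar>G1\<bar> + 1)\<bar> + pi"
  have C1: "C1 > 0" by (simp add: C1_def add_nonneg_pos)
  \<comment> \<open>An error \<epsilon>' in the kernels gives an error 6 \<epsilon>' / g0 in the
    logarithm, and the second bound makes this at most \<epsilon> \<rho>^2 / 2. The first one keeps
    \<open>root_sum\<close> in the right half-plane.\<close>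
  define \<epsilon>' where "\<epsilon>' = min (g0 / 4) (\<epsilon> * \<rho>\<^sup>2 * g0 / 12)"
  have \<epsilon>': "0 < \<epsilon>'" "\<epsilon>' \<le> g0 / 4" "12 * \<epsilon>' \<le> \<epsilon> * \<rho>\<^sup>2 * g0" using g0 \<epsilon> \<rho> by (auto simp: \<epsilon>'_def)
  \<comment> \<open>Chosen so that the cubic remainder C1 (s / \<rho>)^3 is at most \<epsilon> s^2 /
    2 for s \<le> s0.\<close>
  define s0 where "s0 = min (\<rho> / 2) (\<epsilon> * \<rho> ^ 3 / (2 * C1))"
  have s0: "0 < s0" "s0 \<le> \<rho> / 2" "2 * C1 * s0 \<le> \<epsilon> * \<rho> ^ 3"
  proof -
    show "0 < s0" "s0 \<le> \<rho> / 2" using \<rho> \<epsilon> C1 by (auto simp: s0_def)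
    have "s0 \<le> \<epsilon> * \<rho> ^ 3 / (2 * C1)" by (simp add: s0_def)
    then show "2 * C1 * s0 \<le> \<epsilon> * \<rho> ^ 3" using C1 by (simp add: field_simps)
  qed
  have ReHc: "3 * g0 / 4 \<le> Re (Hc y)" "cmod (Hc y) \<le> G1" if "\<bar>x\<bar> \<le> 2 * R" "cmod (y - of_real x) < 8 * \<rho>" for x y
  proof -
    have y: "y \<in> J" "of_real x \<in> J"
      using norm_triangle_ineq[of "y - of_real x" "of_real x"] that \<rho> by (auto simp: J_def)
    have "dist (Hc y) (Hc (of_real x)) < g0 / 4" using that \<rho> y by (intro d0(2)) (auto simp: dist_norm)
    then have "\<bar>Re (Hc y - Hc (of_real x))\<bar> < g0 / 4" using abs_Re_le_cmod[of "Hc y - Hc (of_real x)"] by (simp add: dist_norm)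
    then have "\<bar>Re (Hc y) - H x\<bar> < g0 / 4" by (simp add: Hc_of_real)
    then show "3 * g0 / 4 \<le> Re (Hc y)" using g0(2)[OF that(1)] by linarith
    show "cmod (Hc y) \<le> G1" by (rule G1[OF y(1)])
  qed
  show ?thesis
  proof (rule exI[of _ \<rho>], rule exI[of _ \<epsilon>'], rule exI[of _ s0], intro conjI allI impI)
    fix x \<gamma> A B1 B2 s
    assume x: "\<bar>x\<bar> \<le> 2 * R" and \<gamma>: "\<bar>\<gamma>\<bar> \<le> 1"
      and hol: "A holomorphic_on ball 0 (2 * \<rho>)" "B1 holomorphic_on ball 0 (2 * \<rho>)" "B2 holomorphic_on ball 0 (2 * \<rho>)"
      and close: "\<forall>s \<in> ball 0 (2 * \<rho>). cmod (A s - Hc (of_real x + 2 * s * of_real \<gamma>)) \<le> \<epsilon>' \<and> cmod (B1 s) \<le> \<epsilon>' \<and> cmod (B2 s) \<le> \<epsilon>'"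
      and s: "0 < s" "s \<le> s0"
    define y where "y s = complex_of_real x + 2 * s * of_real \<gamma>" for s
    define Q where "Q s = root_sum (A s) (B1 s) (B2 s)" for s
    define D where "D s = B1 s * B2 s / (A s)\<^sup>2" for s
    have yb: "cmod (y s - of_real x) < 8 * \<rho>" if "s \<in> ball 0 (2 * \<rho>)" for s
    proof -
      have "cmod (2 * s * of_real \<gamma>) \<le> 2 * cmod s * 1" unfolding norm_mult using \<gamma> by (intro mult_mono) auto
      then show ?thesis using that \<rho> by (simp add: y_def)
    qed
    have pt: "g0 / 2 \<le> Re (A s) \<and> cmod (D s) \<le> 1 / 4 \<and> g0 / 2 \<le> Re (Q s) \<and> cmod (Q s - 2 * Hc (y s)) \<le> 3 * \<epsilon>'"
      if sb: "s \<in> ball 0 (2 * \<rho>)" for s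
    proof -
      have c: "cmod (A s - Hc (y s)) \<le> \<epsilon>'" "cmod (B1 s) \<le> \<epsilon>'" "cmod (B2 s) \<le> \<epsilon>'" using close sb by (auto simp: y_def)
      have rh: "3 * g0 / 4 \<le> Re (Hc (y s))" using ReHc(1)[OF x yb[OF sb]] .
      have "\<bar>Re (A s - Hc (y s))\<bar> \<le> \<epsilon>'" using abs_Re_le_cmod[of "A s - Hc (y s)"] c(1) by linarith
      then have ra: "g0 / 2 \<le> Re (A s)" using rh \<epsilon>'(2) by (simp add: abs_le_iff)
      then have ca: "g0 / 2 \<le> cmod (A s)" using complex_Re_le_cmod[of "A s"] by linarith
      have BB: "cmod (B1 s * B2 s) \<le> \<epsilon>' * \<epsilon>'" unfolding norm_mult using c \<epsilon>'(1) by (intro mult_mono) auto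
      have "cmod (D s) \<le> (\<epsilon>' * \<epsilon>') / (g0 / 2)\<^sup>2"
        unfolding D_def norm_divide norm_power using BB ca g0(1) by (intro frac_le power_mono) auto
      also have "\<dots> \<le> (g0 / 4 * (g0 / 4)) / (g0 / 2)\<^sup>2" using \<epsilon>' g0(1) by (intro divide_right_mono mult_mono) auto
      also have "\<dots> = 1 / 4" using g0(1) by (simp add: power2_eq_square)
      finally have cD: "cmod (D s) \<le> 1 / 4" .
      have "Q s - 2 * A s = A s * (csqrt (1 - D s) - 1)" by (simp add: Q_def root_sum_def D_def algebra_simps)
      then have "cmod (Q s - 2 * A s) \<le> cmod (A s) * cmod (D s)"
        using csqrt_near_1[of "D s"] by (simp add: norm_mult mult_left_mono)
      also have "\<dots> = cmod (B1 s * B2 s) / cmod (A s)"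
        
      proof -
        have "cmod (A s) \<noteq> 0" using ca g0(1) by linarith
        then show ?thesis unfolding D_def norm_divide norm_power by (simp add: power2_eq_square)
      qed
      also have "\<dots> \<le> (\<epsilon>' * \<epsilon>') / (g0 / 2)" using BB ca g0(1) by (intro frac_le) auto
      also have "\<dots> \<le> \<epsilon>'"
        using \<epsilon>'(1,2) g0(1) mult_left_mono[of \<epsilon>' "g0 / 2" \<epsilon>'] by (simp add: divide_le_eq)
      finally have q1: "cmod (Q s - 2 * A s) \<le> \<epsilon>'" .
      have "cmod (2 * A s - 2 * Hc (y s)) = 2 * cmod (A s - Hc (y s))"
      proof -
        have "2 * A s - 2 * Hc (y s) = 2 * (A s - Hc (y s))" by simp
        then show ?thesis by (simp only: norm_mult norm_numeral)
      qed
      then have q2: "cmod (Q s - 2 * Hc (y s)) \<le> 3 * \<epsilon>'"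
        using norm_triangle_ineq[of "Q s - 2 * A s" "2 * A s - 2 * Hc (y s)"] q1 c(1) by simp
      have "\<bar>Re (Q s - 2 * Hc (y s))\<bar> \<le> 3 * \<epsilon>'" using abs_Re_le_cmod[of "Q s - 2 * Hc (y s)"] q2 by linarith
      then have "g0 / 2 \<le> Re (Q s)" using rh \<epsilon>'(2) g0(1) by (simp add: abs_le_iff)
      then show ?thesis using ra cD q2 by blast
    qed
    define f where "f s = Ln (Q s) - Ln 2 - LnH (y s)" for s
    have holQ: "Q holomorphic_on ball 0 (2 * \<rho>)"
    proof -
      have nz: "1 - B1 s * B2 s / (A s)\<^sup>2 \<notin> \<real>\<^sub>\<le>\<^sub>0" "A s \<noteq> 0" if "s \<in> ball 0 (2 * \<rho>)" for s
      proof -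
        have "Re (D s) \<le> 1 / 4" using pt[OF that] complex_Re_le_cmod[of "D s"] by linarith
        then show "1 - B1 s * B2 s / (A s)\<^sup>2 \<notin> \<real>\<^sub>\<le>\<^sub>0" by (auto simp: complex_nonpos_Reals_iff D_def)
        show "A s \<noteq> 0" using pt[OF that] g0(1) by auto
      qed
      show ?thesis unfolding Q_def root_sum_def
        by (intro holomorphic_intros hol) (use nz in auto)
    qed
    have holLH: "LnH holomorphic_on ball (of_real x) (8 * \<rho>)"
      unfolding LnH_def
    proof (intro holomorphic_intros)
      fix z assume "z \<in> ball (complex_of_real x) (8 * \<rho>)"
      then have "3 * g0 / 4 \<le> Re (Hc z)" by (intro ReHc(1)[OF x]) (auto simp: dist_norm norm_minus_commute)
      then show "Hc z \<notin> \<real>\<^sub>\<le>\<^sub>0" using g0(1) by (auto simp: complex_nonpos_Reals_iff)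
    qed
    have holf: "f holomorphic_on ball 0 (2 * \<rho>)"
    proof -
      have "(\<lambda>s. LnH (y s)) holomorphic_on ball 0 (2 * \<rho>)"
      proof -
        have "y holomorphic_on ball 0 (2 * \<rho>)" unfolding y_def by (intro holomorphic_intros)
        moreover have "y ` ball 0 (2 * \<rho>) \<subseteq> ball (of_real x) (8 * \<rho>)"
          using yb by (simp add: image_subset_iff dist_norm norm_minus_commute)
        ultimately show ?thesis using holomorphic_on_compose_gen[OF _ holLH] unfolding o_def by blast
      qed
      moreover have "(\<lambda>s. Ln (Q s)) holomorphic_on ball 0 (2 * \<rho>)"
      proof (intro holomorphic_intros holQ)
        fix z assume "z \<in> ball (0::complex) (2 * \<rho>)"
        then have "g0 / 2 \<le> Re (Q z)" using pt by blast
        then show "Q z \<notin> \<real>\<^sub>\<le>\<^sub>0" using g0(1) by (simp add: complex_nonpos_Reals_iff)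
      qed
      ultimately show ?thesis unfolding f_def
        using holomorphic_on_diff[OF holomorphic_on_diff[OF _ holomorphic_on_const]] by blast
    qed
    define Bf where "Bf = 6 * \<epsilon>' / g0"
    have fb: "cmod (f s) \<le> Bf" if sb: "s \<in> ball 0 (2 * \<rho>)" for s
    proof -
      have rh: "3 * g0 / 4 \<le> Re (Hc (y s))" using ReHc(1)[OF x yb[OF sb]] .
      have "0 < Re (Hc (y s))" using rh g0(1) by linarith
      then have "Hc (y s) \<noteq> 0" by auto
      then have "Ln (2 * Hc (y s)) = ln 2 + Ln (Hc (y s))"
        using Ln_times_of_real[of 2 "Hc (y s)"] by simp
      moreover have "Ln 2 = complex_of_real (ln 2)" using Ln_of_real[of 2] by simp
      ultimately have "f s = Ln (Q s) - Ln (2 * Hc (y s))" by (simp add: f_def LnH_def)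
      also have "cmod \<dots> \<le> 1 / (g0 / 2) * cmod (Q s - 2 * Hc (y s))"
        using pt[OF sb] rh g0(1) by (intro Ln_lipschitz) auto
      also have "\<dots> \<le> 1 / (g0 / 2) * (3 * \<epsilon>')" using pt[OF sb] g0(1) by (intro mult_left_mono) auto
      finally show ?thesis by (simp add: Bf_def)
    qed
    have sb: "cmod (of_real s) \<le> \<rho> / 2" using s s0 by simp
    have F: "cmod (f (of_real s) + f (- of_real s) - 2 * f 0) \<le> 4 * Bf * (s / \<rho>)\<^sup>2"
      using second_difference_bound(1)[OF holf \<rho>(1) fb sb] s by simp
    have LHb: "cmod (LnH z) \<le> C1" if "z \<in> ball (of_real x) (8 * \<rho>)" for z
    proof -
      have zz: "cmod (z - of_real x) < 8 * \<rho>" using that by (simp add: dist_norm norm_minus_commute)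
      have rh: "3 * g0 / 4 \<le> Re (Hc z)" "cmod (Hc z) \<le> G1" using ReHc[OF x zz] by auto
      have c: "3 * g0 / 4 \<le> cmod (Hc z)" using rh complex_Re_le_cmod[of "Hc z"] by linarith
      have ne: "Hc z \<noteq> 0" using c g0(1) by auto
      have "cmod (LnH z) \<le> \<bar>Re (LnH z)\<bar> + \<bar>Im (LnH z)\<bar>" by (rule cmod_le)
      also have "\<bar>Im (LnH z)\<bar> \<le> pi" unfolding LnH_def using mpi_less_Im_Ln[OF ne] Im_Ln_le_pi[OF ne] by linarith
      also have "\<bar>Re (LnH z)\<bar> \<le> \<bar>ln (3 * g0 / 4)\<bar> + \<bar>ln (\<bar>G1\<bar> + 1)\<bar>"
      proof -
        have "ln (3 * g0 / 4) \<le> ln (cmod (Hc z))" using c g0(1) by (intro ln_mono) auto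
        moreover have "ln (cmod (Hc z)) \<le> ln (\<bar>G1\<bar> + 1)" using rh ne by (intro ln_mono) auto
        moreover have "Re (LnH z) = ln (cmod (Hc z))" using ne by (simp add: LnH_def)
        ultimately show ?thesis by linarith
      qed
      finally show ?thesis by (simp add: C1_def)
    qed
    define d where "d = complex_of_real (2 * s * \<gamma>)"
    have dn: "cmod d \<le> 2 * s"
    proof -
      have "2 * s * \<bar>\<gamma>\<bar> \<le> 2 * s * 1" using \<gamma> s by (intro mult_left_mono) auto
      then show ?thesis using s unfolding d_def norm_of_real by (simp add: abs_mult)
    qed
    have sub: "ball (complex_of_real x) (2 * (2 * \<rho>)) \<subseteq> ball (of_real x) (8 * \<rho>)" using \<rho> by (intro subset_ball) auto
    have G: "cmod (LnH (of_real x + d) + LnH (of_real x - d) - 2 * LnH (of_real x) - deriv (deriv LnH) (of_real x) * d\<^sup>2) \<le> 4 * C1 * (cmod d / (2 * \<rho>)) ^ 3"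
    proof (rule second_difference_bound(2))
      show "LnH holomorphic_on ball (complex_of_real x) (2 * (2 * \<rho>))" using holLH sub by (rule holomorphic_on_subset)
      show "cmod d \<le> 2 * \<rho> / 2" using dn s s0 by linarith
    qed (use \<rho> sub LHb in auto)
    also have "\<dots> \<le> 4 * C1 * (s / \<rho>) ^ 3"
      using dn \<rho> C1 by (intro mult_left_mono power_mono) (auto simp: field_simps)
    finally have G: "cmod (LnH (of_real x + d) + LnH (of_real x - d) - 2 * LnH (of_real x) - deriv (deriv LnH) (of_real x) * d\<^sup>2) \<le> 4 * C1 * (s / \<rho>) ^ 3" .
    have lnQ: "ln (cmod (Q s)) = Re (f s) + ln 2 + Re (LnH (y s))" if "s \<in> ball 0 (2 * \<rho>)" for s
    proof -
      have "Q s \<noteq> 0" using pt[OF that] g0(1) by auto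
      then have "ln (cmod (Q s)) = Re (Ln (Q s))" by simp
      moreover have "Ln 2 = complex_of_real (ln 2)" using Ln_of_real[of 2] by simp
      ultimately show ?thesis by (simp add: f_def)
    qed
    have ys: "y (of_real s) = of_real x + d" "y (of_real (- s)) = of_real x - d" "y 0 = of_real x"
      by (simp_all add: y_def d_def)
    have inb: "complex_of_real s \<in> ball 0 (2 * \<rho>)" "complex_of_real (- s) \<in> ball 0 (2 * \<rho>)" "0 \<in> ball (0::complex) (2 * \<rho>)"
      using s s0 \<rho> by auto
    define T where "T = Re (deriv (deriv LnH) (of_real x))"
    have Rd: "Re (deriv (deriv LnH) (of_real x) * d\<^sup>2) = T * (4 * s\<^sup>2 * \<gamma>\<^sup>2)"
    proof -
      have "d\<^sup>2 = of_real (4 * s\<^sup>2 * \<gamma>\<^sup>2)" unfolding d_def of_real_power[symmetric] by (simp add: power_mult_distrib)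
      then show ?thesis by (simp add: T_def del: of_real_mult of_real_power)
    qed
    define E1 where "E1 = Re (f (of_real s)) + Re (f (- of_real s)) - 2 * Re (f 0)"
    define E2 where "E2 = Re (LnH (of_real x + d)) + Re (LnH (of_real x - d)) - 2 * Re (LnH (of_real x)) - T * (4 * s\<^sup>2 * \<gamma>\<^sup>2)"
    have e1: "\<bar>E1\<bar> \<le> 4 * Bf * (s / \<rho>)\<^sup>2"
      using order_trans[OF abs_Re_le_cmod F] by (simp add: E1_def)
    have e2: "\<bar>E2\<bar> \<le> 4 * C1 * (s / \<rho>) ^ 3"
      using order_trans[OF abs_Re_le_cmod G] Rd by (simp add: E2_def)
    have "(ln (cmod (Q (of_real s))) + ln (cmod (Q (of_real (- s))))) / 4 - ln (cmod (Q 0)) / 2 - s\<^sup>2 * \<gamma>\<^sup>2 * T = (E1 + E2) / 4"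
      unfolding lnQ[OF inb(1)] lnQ[OF inb(2)] lnQ[OF inb(3)] ys E1_def E2_def by (simp add: field_simps)
    also have "\<bar>\<dots>\<bar> \<le> Bf * (s / \<rho>)\<^sup>2 + C1 * (s / \<rho>) ^ 3"
    proof -
      have "\<bar>(E1 + E2) / 4\<bar> \<le> (\<bar>E1\<bar> + \<bar>E2\<bar>) / 4" by simp
      also have "\<dots> \<le> (4 * Bf * (s / \<rho>)\<^sup>2 + 4 * C1 * (s / \<rho>) ^ 3) / 4" by (intro divide_right_mono add_mono e1 e2) simp
      finally show ?thesis by (simp add: add_divide_distrib)
    qed
    also have "\<dots> \<le> \<epsilon> / 2 * s\<^sup>2 + \<epsilon> / 2 * s\<^sup>2"
    proof (intro add_mono)
      have "Bf \<le> \<epsilon> / 2 * \<rho>\<^sup>2" using \<epsilon>'(3) g0(1) by (simp add: Bf_def field_simps)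
      then have "Bf * (s / \<rho>)\<^sup>2 \<le> \<epsilon> / 2 * \<rho>\<^sup>2 * (s / \<rho>)\<^sup>2" by (intro mult_right_mono) auto
      also have "\<dots> = \<epsilon> / 2 * s\<^sup>2" using \<rho> by (simp add: power_divide)
      finally show "Bf * (s / \<rho>)\<^sup>2 \<le> \<epsilon> / 2 * s\<^sup>2" .
      have "C1 * s \<le> C1 * s0" using s C1 by (intro mult_left_mono) auto
      then have "C1 * s \<le> \<epsilon> / 2 * \<rho> ^ 3" using s0(3) by linarith
      then have "C1 * s * (s\<^sup>2 / \<rho> ^ 3) \<le> \<epsilon> / 2 * \<rho> ^ 3 * (s\<^sup>2 / \<rho> ^ 3)" using \<rho> by (intro mult_right_mono) auto
      also have "\<dots> = \<epsilon> / 2 * s\<^sup>2" using \<rho> by simp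
      also have "C1 * s * (s\<^sup>2 / \<rho> ^ 3) = C1 * (s / \<rho>) ^ 3" by (simp add: power_divide power2_eq_square power3_eq_cube)
      finally show "C1 * (s / \<rho>) ^ 3 \<le> \<epsilon> / 2 * s\<^sup>2" .
    qed
    finally show "\<bar>(ln (cmod (root_sum (A (of_real s)) (B1 (of_real s)) (B2 (of_real s)))) + ln (cmod (root_sum (A (of_real (- s))) (B1 (of_real (- s))) (B2 (of_real (- s)))))) / 4
          - ln (cmod (root_sum (A 0) (B1 0) (B2 0))) / 2 - s\<^sup>2 * \<gamma>\<^sup>2 * Re (deriv (deriv LnH) (of_real x))\<bar> \<le> \<epsilon> * s\<^sup>2"
      by (simp add: Q_def T_def)
  qed (use \<rho> \<epsilon>' s0 in auto)
qed

section \<open>Logarithmic derivatives and log-convexity of H\<close>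

text \<open>Derivatives of ln H are taken through the holomorphic extension, so that smoothness at
  0, where \<open>H\<close> is defined by cases, comes for free.\<close>

definition dlnH :: "real \<Rightarrow> real" where "dlnH x = Re (deriv LnH (of_real x))"
definition d2lnH :: "real \<Rightarrow> real" where "d2lnH x = Re (deriv (deriv LnH) (of_real x))"

definition LnH_dom :: "complex set" where "LnH_dom = {y. Hc y \<notin> \<real>\<^sub>\<le>\<^sub>0}"

lemma open_LH_dom: "open LnH_dom"
proof -
  have "LnH_dom = Hc -` (- \<real>\<^sub>\<le>\<^sub>0)" by (auto simp: LnH_dom_def)
  moreover have "open (Hc -` (- \<real>\<^sub>\<le>\<^sub>0))"
    by (intro open_vimage Hc_continuous continuous_on_id) (simp add: closed_nonpos_Reals_complex open_Compl)
  ultimately show ?thesis by simp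
qed

lemma of_real_LH_dom: "of_real x \<in> LnH_dom"
  using H_pos[of x] by (simp add: LnH_dom_def Hc_of_real complex_nonpos_Reals_iff)

lemma LnH_holomorphic: "LnH holomorphic_on LnH_dom"
  unfolding LnH_def by (intro holomorphic_intros) (auto simp: LnH_dom_def)

lemma LnH_of_real: "LnH (of_real x) = of_real (ln (H x))"
  using H_pos[of x] by (simp add: LnH_def Hc_of_real Ln_of_real)

lemma Re_of_real_derivative:
  assumes "(f has_field_derivative f') (at (of_real x))"
  shows "((\<lambda>x. Re (f (of_real x))) has_real_derivative Re f') (at x)"
proof -
  have "((\<lambda>x. f (of_real x)) has_vector_derivative f') (at x)"
    using assms has_vector_derivative_real_field by blast
  then have "((\<lambda>x. Re (f (of_real x))) has_vector_derivative Re f') (at x)"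
    by (rule bounded_linear.has_vector_derivative[OF bounded_linear_Re])
  then show ?thesis by (simp add: has_real_derivative_iff_has_vector_derivative)
qed

lemma deriv_LH_holomorphic: "deriv LnH holomorphic_on LnH_dom"
  by (rule holomorphic_deriv[OF LnH_holomorphic open_LH_dom])

lemma dlnH_derivative: "(dlnH has_real_derivative d2lnH x) (at x)"
  unfolding dlnH_def d2lnH_def
  by (rule Re_of_real_derivative) (rule holomorphic_derivI[OF deriv_LH_holomorphic open_LH_dom of_real_LH_dom])

lemma dlnH_continuous: "isCont dlnH x"
  using dlnH_derivative by (rule DERIV_isCont)

lemma d2lnH_continuous: "continuous_on A d2lnH"
proof -
  have "continuous_on LnH_dom (deriv (deriv LnH))"
    by (intro holomorphic_on_imp_continuous_on holomorphic_deriv deriv_LH_holomorphic open_LH_dom)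
  then have "continuous_on A (\<lambda>x. deriv (deriv LnH) (of_real x))"
    by (rule continuous_on_compose2) (auto intro!: continuous_intros simp: of_real_LH_dom)
  then show ?thesis unfolding d2lnH_def by (intro continuous_intros)
qed

lemma dlnH_eq: "dlnH x = deriv H x / H x"
proof -
  have "((\<lambda>x. Re (LnH (of_real x))) has_real_derivative dlnH x) (at x)"
    unfolding dlnH_def by (rule Re_of_real_derivative) (rule holomorphic_derivI[OF LnH_holomorphic open_LH_dom of_real_LH_dom])
  then have 1: "((\<lambda>x. ln (H x)) has_real_derivative dlnH x) (at x)" by (simp add: LnH_of_real)
  have "((\<lambda>x. Re (Hc (of_real x))) has_real_derivative Re (deriv Hc (of_real x))) (at x)"
    by (rule Re_of_real_derivative) (rule holomorphic_derivI[OF Hc_holomorphic_UNIV], auto)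
  then have H': "(H has_real_derivative Re (deriv Hc (of_real x))) (at x)" by (simp add: Hc_of_real)
  then have "((\<lambda>x. ln (H x)) has_real_derivative (1 / H x * Re (deriv Hc (of_real x)))) (at x)"
    using H_pos[of x] by (auto intro!: derivative_eq_intros)
  then have "dlnH x = 1 / H x * Re (deriv Hc (of_real x))" using 1 DERIV_unique by blast
  moreover have "deriv H x = Re (deriv Hc (of_real x))" using H' by (rule DERIV_imp_deriv)
  ultimately show ?thesis by simp
qed

text \<open>H x is the integral of exp (t x) over t in [0, 1], the moment generating function of the
  uniform law. As a limit of finite sums it inherits log-convexity from Cauchy-Schwarz.\<close>

lemma riemann_sum_H: "(\<lambda>n. (\<Sum>j<n. exp (real j * x / real n)) / real n) \<longlonglongrightarrow> H x"
proof -
  have "(\<lambda>n. x / real n) \<longlonglongrightarrow> 0" by (rule lim_const_over_n)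
  then have "(\<lambda>n. complex_of_real (x / real n)) \<longlonglongrightarrow> of_real 0" by (rule tendsto_of_real)
  moreover have "isCont Hc 0"
    using Hc_continuous[of UNIV "\<lambda>x. x"] by (simp add: continuous_on_eq_continuous_at)
  ultimately have "(\<lambda>n. Re (Hc (of_real (x / real n)))) \<longlonglongrightarrow> Re (Hc 0)"
    by (intro tendsto_Re) (use isCont_tendsto_compose[of 0 Hc "\<lambda>n. complex_of_real (x / real n)" sequentially] in simp)
  then have "(\<lambda>n. H (x / real n)) \<longlonglongrightarrow> 1" unfolding Hc_of_real by (simp add: Hc_def)
  then have lim: "(\<lambda>n. H x / H (x / real n)) \<longlonglongrightarrow> H x / 1" by (intro tendsto_intros) auto
  have "eventually (\<lambda>n. H x / H (x / real n) = (\<Sum>j<n. exp (real j * x / real n)) / real n) sequentially"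
    using eventually_gt_at_top[of 0]
  proof eventually_elim
    case (elim n)
    have "complex_of_real ((\<Sum>j<n. exp (real j * x / real n)) * H (x / real n)) = of_real (real n * H x)"
    proof -
      have "exp (of_nat j * complex_of_real x / of_nat n) = of_real (exp (real j * x / real n))" for j
        by (simp flip: exp_of_real)
      then show ?thesis using geometric_Hc[OF elim, of "of_real x"] by (simp add: Hc_of_real[symmetric])
    qed
    then have "(\<Sum>j<n. exp (real j * x / real n)) * H (x / real n) = real n * H x" by (simp only: of_real_eq_iff)
    then show ?case using elim H_pos[of "x / real n"] by (simp add: field_simps)
  qed
  from Lim_transform_eventually[OF lim this] show ?thesis by simp
qed

lemma H_log_convex: "(H x)\<^sup>2 \<le> H (x + h) * H (x - h)"
proof (rule LIMSEQ_le)
  show "(\<lambda>n. ((\<Sum>j<n. exp (real j * x / real n)) / real n)\<^sup>2) \<longlonglongrightarrow> (H x)\<^sup>2"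
    by (intro tendsto_intros riemann_sum_H)
  show "(\<lambda>n. (\<Sum>j<n. exp (real j * (x + h) / real n)) / real n * ((\<Sum>j<n. exp (real j * (x - h) / real n)) / real n)) \<longlonglongrightarrow> H (x + h) * H (x - h)"
    by (intro tendsto_intros riemann_sum_H)
  have "(\<Sum>j<n. exp (real j * x / real n))\<^sup>2 \<le> (\<Sum>j<n. exp (real j * (x + h) / real n)) * (\<Sum>j<n. exp (real j * (x - h) / real n))" for n
  proof -
    have e: "exp (real j * x / real n) = exp (real j * (x + h) / (2 * real n)) * exp (real j * (x - h) / (2 * real n))" for j
      by (simp add: exp_add[symmetric] add_divide_distrib[symmetric] algebra_simps)
    have e2: "(exp (real j * y / (2 * real n)))\<^sup>2 = exp (real j * y / real n)" for j y
      by (simp add: exp_double[symmetric])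
    show ?thesis
      unfolding e using Cauchy_Schwarz_ineq_sum[of "\<lambda>j. exp (real j * (x + h) / (2 * real n))" "\<lambda>j. exp (real j * (x - h) / (2 * real n))" "{..<n}"]
      by (simp only: e2)
  qed
  then show "\<exists>N. \<forall>n\<ge>N. ((\<Sum>j<n. exp (real j * x / real n)) / real n)\<^sup>2
     \<le> (\<Sum>j<n. exp (real j * (x + h) / real n)) / real n * ((\<Sum>j<n. exp (real j * (x - h) / real n)) / real n)"
    by (intro exI[of _ 0] allI impI) (simp add: power_divide power2_eq_square[of "real _"] divide_right_mono)
qed

text \<open>A negative value would make a second difference of ln H negative for small d, the
  remainder being cubic, against log-convexity. Nonnegativity lets the limiting intensity be
  integrated as a density, with primitive \<open>dlnH\<close>.\<close>

lemma d2lnH_nonneg: "d2lnH x \<ge> 0"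
proof (rule ccontr)
  assume "\<not> d2lnH x \<ge> 0"
  then have neg: "d2lnH x < 0" by simp
  obtain e where e: "e > 0" "ball (of_real x) e \<subseteq> LnH_dom" using open_LH_dom of_real_LH_dom openE by blast
  define \<rho> where "\<rho> = e / 4"
  have \<rho>: "\<rho> > 0" using e by (simp add: \<rho>_def)
  have sub: "cball (of_real x) (2 * \<rho>) \<subseteq> LnH_dom" using e by (intro order_trans[OF _ e(2)]) (auto simp: \<rho>_def)
  have hol: "LnH holomorphic_on ball (of_real x) (2 * \<rho>)"
    using LnH_holomorphic sub by (meson ball_subset_cball holomorphic_on_subset subset_trans)
  have "bounded (LnH ` cball (of_real x) (2 * \<rho>))"
    by (intro compact_imp_bounded compact_continuous_image compact_cball holomorphic_on_imp_continuous_on holomorphic_on_subset[OF LnH_holomorphic sub])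
  then obtain B where B: "\<And>z. z \<in> cball (of_real x) (2 * \<rho>) \<Longrightarrow> cmod (LnH z) \<le> B" unfolding bounded_iff by blast
  have bd: "- d2lnH x * d\<^sup>2 \<le> 4 * B * (d / \<rho>) ^ 3" if d: "0 < d" "d \<le> \<rho> / 2" for d
  proof -
    have "cmod (LnH (of_real x + of_real d) + LnH (of_real x - of_real d) - 2 * LnH (of_real x) - deriv (deriv LnH) (of_real x) * (of_real d)\<^sup>2) \<le> 4 * B * (cmod (of_real d) / \<rho>) ^ 3"
      by (rule second_difference_bound(2)[OF hol \<rho>]) (use B d in auto)
    then have "\<bar>Re (LnH (of_real (x + d)) + LnH (of_real (x - d)) - 2 * LnH (of_real x) - deriv (deriv LnH) (of_real x) * of_real (d\<^sup>2))\<bar> \<le> 4 * B * (d / \<rho>) ^ 3"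
      using abs_Re_le_cmod order_trans d by fastforce
    then have "ln (H (x + d)) + ln (H (x - d)) - 2 * ln (H x) - d2lnH x * d\<^sup>2 \<le> 4 * B * (d / \<rho>) ^ 3"
      unfolding LnH_of_real by (simp add: d2lnH_def abs_le_iff del: of_real_power)
    moreover have "2 * ln (H x) \<le> ln (H (x + d)) + ln (H (x - d))"
    proof -
      have "ln ((H x)\<^sup>2) \<le> ln (H (x + d) * H (x - d))" using H_log_convex[of x d] H_pos[of x] by (intro ln_mono) auto
      then show ?thesis using H_pos[of x] H_pos[of "x + d"] H_pos[of "x - d"] by (simp add: ln_mult ln_realpow)
    qed
    ultimately show ?thesis by simp
  qed
  have lim: "((\<lambda>d. 4 * B * d / \<rho> ^ 3) \<longlongrightarrow> 4 * B * 0 / \<rho> ^ 3) (at_right 0)"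
    by (intro tendsto_intros) (use \<rho> in auto)
  have "eventually (\<lambda>d. 4 * B * d / \<rho> ^ 3 < - d2lnH x) (at_right 0)"
    using lim by (rule order_tendstoD) (use neg in simp)
  moreover have "eventually (\<lambda>d. d \<in> {0<..<\<rho> / 2}) (at_right 0)" by (rule eventually_at_right_real) (use \<rho> in simp)
  ultimately have "eventually (\<lambda>d. False) (at_right (0::real))"
  proof eventually_elim
    case (elim d)
    then have d: "0 < d" "d \<le> \<rho> / 2" by auto
    have "- d2lnH x * d\<^sup>2 \<le> (4 * B * d / \<rho> ^ 3) * d\<^sup>2" using bd[OF d] by (simp add: power_divide power2_eq_square power3_eq_cube)
    moreover have "(4 * B * d / \<rho> ^ 3) * d\<^sup>2 < - d2lnH x * d\<^sup>2" using elim(1) d by (intro mult_strict_right_mono) auto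
    ultimately show ?case by linarith
  qed
  then show False by simp
qed

lemma root_sum_conj:
  assumes k: "k > 0" and b: "cmod b \<le> k"
  shows "root_sum (of_real k) b (cnj b) = of_real (k + sqrt (k\<^sup>2 - (cmod b)\<^sup>2))"
proof -
  have "b * cnj b / (of_real k)\<^sup>2 = of_real ((cmod b)\<^sup>2 / k\<^sup>2)"
    by (simp add: complex_norm_square[symmetric] del: of_real_power flip: of_real_power)
  then have "1 - b * cnj b / (of_real k)\<^sup>2 = of_real (1 - (cmod b)\<^sup>2 / k\<^sup>2)" by simp
  moreover have le: "(cmod b)\<^sup>2 \<le> k\<^sup>2" using b by (intro power_mono) auto
  then have "0 \<le> 1 - (cmod b)\<^sup>2 / k\<^sup>2" using k by simp
  ultimately have "csqrt (1 - b * cnj b / (of_real k)\<^sup>2) = of_real (sqrt (1 - (cmod b)\<^sup>2 / k\<^sup>2))"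
    by (simp only: of_real_sqrt)
  moreover have "k * sqrt (1 - (cmod b)\<^sup>2 / k\<^sup>2) = sqrt (k\<^sup>2 - (cmod b)\<^sup>2)"
  proof -
    have "1 - (cmod b)\<^sup>2 / k\<^sup>2 = (k\<^sup>2 - (cmod b)\<^sup>2) / k\<^sup>2" using k by (simp add: diff_divide_distrib)
    then show ?thesis using k by (simp add: real_sqrt_divide)
  qed
  ultimately show ?thesis unfolding root_sum_def
    by (simp add: distrib_left flip: of_real_mult)
qed

section \<open>The expected logarithm as a potential\<close>

context opuc_ac
begin

text \<open>Twice the expected logarithm of the random polynomial at z, up to an additive
  constant.\<close>

definition log_pot :: "nat \<Rightarrow> complex \<Rightarrow> real" where
  "log_pot n z = ln (Kdiag n z + sqrt ((Kdiag n z)\<^sup>2 - (cmod (Ksym n z z))\<^sup>2))"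

text \<open>Supplies the hypotheses of the Gaussian formula uniformly at scale 1/n: after scaling,
  the diagonal kernel is close to H (2 Re a), which is positive on a compact interval, and the sum
  without conjugation is negligible against it.\<close>

lemma nondegenerate:
  assumes R: "R \<ge> 1"
  shows "\<exists>k0 k1. 0 < k0 \<and> (eventually (\<lambda>n. \<forall>\<zeta>\<in>S. \<forall>a. cmod a \<le> R \<longrightarrow>
     (let z = \<zeta> * exp (a / of_nat n); v = 2 * pi * w \<zeta> / real n in
      k0 \<le> v * Kdiag n z \<and> v * Kdiag n z \<le> k1 \<and> cmod (Ksym n z z) \<le> Kdiag n z / 2)) sequentially)"
proof -
  have cont: "continuous_on {-2*R..2*R} H"
  proof -
    have "continuous_on {-2*R..2*R} (\<lambda>x. Re (Hc (of_real x)))" by (intro continuous_intros)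
    then show ?thesis by (simp add: Hc_of_real)
  qed
  have ne: "{-2*R..2*R} \<noteq> {}" using R by simp
  obtain x0 where x0: "\<And>x. x \<in> {-2*R..2*R} \<Longrightarrow> H x0 \<le> H x"
    using continuous_attains_inf[OF compact_Icc ne cont] by blast
  obtain x1 where x1: "\<And>x. x \<in> {-2*R..2*R} \<Longrightarrow> H x \<le> H x1"
    using continuous_attains_sup[OF compact_Icc ne cont] by blast
  define g0 where "g0 = H x0"
  have g0: "g0 > 0" by (simp add: g0_def H_pos)
  have e: "g0 / 4 > 0" using g0 by simp
  show ?thesis
  proof (intro exI conjI)
    show "0 < g0 / 2" using g0 by simp
    show "eventually (\<lambda>n. \<forall>\<zeta>\<in>S. \<forall>a. cmod a \<le> R \<longrightarrow>
     (let z = \<zeta> * exp (a / of_nat n); v = 2 * pi * w \<zeta> / real n in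
      g0 / 2 \<le> v * Kdiag n z \<and> v * Kdiag n z \<le> H x1 + g0 / 4 \<and> cmod (Ksym n z z) \<le> Kdiag n z / 2)) sequentially"
      using kernel_universality[OF R e] Ksym_small[OF R e] eventually_gt_at_top[of 0]
    proof eventually_elim
      case (elim n)
      show ?case
      proof (intro ballI allI impI)
        fix \<zeta> a assume \<zeta>: "\<zeta> \<in> S" and a: "cmod a \<le> R"
        define z where "z = \<zeta> * exp (a / of_nat n)"
        define v where "v = 2 * pi * w \<zeta> / real n"
        have v: "v > 0" using w_pos[OF \<zeta>] elim(3) by (simp add: v_def)
        have "cmod (of_real v * K n z z - Hc (a + cnj a)) \<le> g0 / 4" using elim(1) \<zeta> a unfolding z_def v_def by blast
        moreover have "of_real v * K n z z = of_real (v * Kdiag n z)" by (simp add: K_diag)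
        moreover have "Hc (a + cnj a) = of_real (H (2 * Re a))"
          using Hc_of_real[of "2 * Re a"] by (simp add: complex_add_cnj)
        ultimately have "cmod (of_real (v * Kdiag n z - H (2 * Re a))) \<le> g0 / 4" by simp
        then have 1: "\<bar>v * Kdiag n z - H (2 * Re a)\<bar> \<le> g0 / 4" by (simp only: norm_of_real)
        have "\<bar>Re a\<bar> \<le> R" using abs_Re_le_cmod[of a] a by linarith
        then have "2 * Re a \<in> {-2*R..2*R}" by (auto simp: abs_le_iff)
        then have 2: "g0 \<le> H (2 * Re a)" "H (2 * Re a) \<le> H x1" using x0 x1 by (auto simp: g0_def)
        have k: "g0 / 2 \<le> v * Kdiag n z" "v * Kdiag n z \<le> H x1 + g0 / 4" using 1 2 g0 by linarith+
        have "cmod (of_real v * Ksym n z z) \<le> g0 / 4" using elim(2) \<zeta> a unfolding z_def v_def by blast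
        then have "v * cmod (Ksym n z z) \<le> g0 / 4" using v by (simp add: norm_mult)
        then have "v * cmod (Ksym n z z) \<le> v * (Kdiag n z / 2)" using k(1) by simp
        then have "cmod (Ksym n z z) \<le> Kdiag n z / 2" using v by (rule mult_left_le_imp_le)
        with k show "let z = \<zeta> * exp (a / of_nat n); v = 2 * pi * w \<zeta> / real n in
          g0 / 2 \<le> v * Kdiag n z \<and> v * Kdiag n z \<le> H x1 + g0 / 4 \<and> cmod (Ksym n z z) \<le> Kdiag n z / 2"
          by (simp add: Let_def z_def v_def)
      qed
    qed
  qed
qed

text \<open>The potential is only real-analytic in the real displacement s. Decoupling the two
  arguments of the kernel, c + s e and c + cnj s e, gives functions holomorphic in s that agree with
  the diagonal ones for real s, and universality off the diagonal controls them on a complex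
  disc.\<close>

lemma log_pot_second_difference:
  assumes R: "R \<ge> 1" and \<epsilon>: "\<epsilon> > 0"
  shows "\<exists>s0. 0 < s0 \<and> s0 < 1 \<and> (eventually (\<lambda>n. \<forall>\<zeta>\<in>S. \<forall>c e s. cmod c \<le> R \<longrightarrow> cmod e = 1 \<longrightarrow> 0 < s \<longrightarrow> s \<le> s0 \<longrightarrow>
     \<bar>(log_pot n (\<zeta> * exp ((c + of_real s * e) / of_nat n)) + log_pot n (\<zeta> * exp ((c - of_real s * e) / of_nat n))) / 4
       - log_pot n (\<zeta> * exp (c / of_nat n)) / 2 - s\<^sup>2 * (Re e)\<^sup>2 * d2lnH (2 * Re c)\<bar> \<le> \<epsilon> * s\<^sup>2) sequentially)"
proof -
  have R0: "R > 0" using R by simp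
  obtain \<rho> \<epsilon>' s0 where \<rho>: "0 < \<rho>" "\<rho> \<le> 1 / 2" "0 < \<epsilon>'" "0 < s0" "s0 < \<rho>"
    and sd: "\<And>x \<gamma> A B1 B2 s. \<bar>x\<bar> \<le> 2 * R \<Longrightarrow> \<bar>\<gamma>\<bar> \<le> 1 \<Longrightarrow>
       A holomorphic_on ball 0 (2 * \<rho>) \<Longrightarrow> B1 holomorphic_on ball 0 (2 * \<rho>) \<Longrightarrow> B2 holomorphic_on ball 0 (2 * \<rho>) \<Longrightarrow>
       (\<forall>s \<in> ball 0 (2 * \<rho>). cmod (A s - Hc (of_real x + 2 * s * of_real \<gamma>)) \<le> \<epsilon>' \<and> cmod (B1 s) \<le> \<epsilon>' \<and> cmod (B2 s) \<le> \<epsilon>') \<Longrightarrow>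
       0 < s \<Longrightarrow> s \<le> s0 \<Longrightarrow>
       \<bar>(ln (cmod (root_sum (A (of_real s)) (B1 (of_real s)) (B2 (of_real s)))) + ln (cmod (root_sum (A (of_real (- s))) (B1 (of_real (- s))) (B2 (of_real (- s)))))) / 4
          - ln (cmod (root_sum (A 0) (B1 0) (B2 0))) / 2 - s\<^sup>2 * \<gamma>\<^sup>2 * Re (deriv (deriv LnH) (of_real x))\<bar> \<le> \<epsilon> * s\<^sup>2"
    using second_difference_log[OF R0 \<epsilon>] by metis
  have R1: "R + 1 \<ge> 1" using R by simp
  obtain k0 k1 where k0: "0 < k0" and nd: "eventually (\<lambda>n. \<forall>\<zeta>\<in>S. \<forall>a. cmod a \<le> R + 1 \<longrightarrow>
     (let z = \<zeta> * exp (a / of_nat n); v = 2 * pi * w \<zeta> / real n in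
      k0 \<le> v * Kdiag n z \<and> v * Kdiag n z \<le> k1 \<and> cmod (Ksym n z z) \<le> Kdiag n z / 2)) sequentially"
    using nondegenerate[OF R1] by blast
  have "eventually (\<lambda>n. \<forall>\<zeta>\<in>S. \<forall>c e s. cmod c \<le> R \<longrightarrow> cmod e = 1 \<longrightarrow> 0 < s \<longrightarrow> s \<le> s0 \<longrightarrow>
     \<bar>(log_pot n (\<zeta> * exp ((c + of_real s * e) / of_nat n)) + log_pot n (\<zeta> * exp ((c - of_real s * e) / of_nat n))) / 4
       - log_pot n (\<zeta> * exp (c / of_nat n)) / 2 - s\<^sup>2 * (Re e)\<^sup>2 * d2lnH (2 * Re c)\<bar> \<le> \<epsilon> * s\<^sup>2) sequentially"
    using kernel_universality[OF R1 \<rho>(3)] Ksym_small[OF R1 \<rho>(3)] nd eventually_gt_at_top[of 0]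
  proof eventually_elim
    case (elim n)
    show ?case
    proof (intro ballI allI impI)
      fix \<zeta> c e s assume \<zeta>: "\<zeta> \<in> S" and c: "cmod c \<le> R" and e: "cmod e = 1" and s: "0 < s" "s \<le> s0"
      define v where "v = 2 * pi * w \<zeta> / real n"
      have v: "v > 0" using w_pos[OF \<zeta>] elim(4) by (simp add: v_def)
      define Z where "Z a = \<zeta> * exp (a / of_nat n)" for a
      define ca where "ca s = c + s * e" for s
      define cb where "cb s = c + cnj s * e" for s
      \<comment> \<open>Reality of the coefficients moves the conjugation from the value of the
        polynomial to its argument, so no conjugate of \<open>s\<close> is left and holomorphy is
        evident; the same is done in \<open>B2\<close>.\<close>
      define A where "A s = of_real v * (\<Sum>i<n. poly (\<phi> i) (Z (ca s)) * poly (\<phi> i) (cnj \<zeta> * exp ((cnj c + s * cnj e) / of_nat n)))" for s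
      define B1 where "B1 s = of_real v * Ksym n (Z (ca s)) (Z (ca s))" for s
      define B2 where "B2 s = of_real v * Ksym n (cnj \<zeta> * exp ((cnj c + s * cnj e) / of_nat n)) (cnj \<zeta> * exp ((cnj c + s * cnj e) / of_nat n))" for s
      have cZ: "cnj \<zeta> * exp ((cnj c + s * cnj e) / of_nat n) = cnj (Z (cb s))" for s
        by (simp add: Z_def cb_def exp_cnj)
      have AK: "A s = of_real v * K n (Z (ca s)) (Z (cb s))" for s
        unfolding A_def K_def cZ by (simp only: \<phi>_cnj)
      have B2K: "B2 s = cnj (of_real v * Ksym n (Z (cb s)) (Z (cb s)))" for s
        unfolding B2_def Ksym_def cZ by (simp add: \<phi>_cnj)
      have hp: "(\<lambda>x. poly p (f x)) holomorphic_on X" if "f holomorphic_on X" for p and f :: "complex \<Rightarrow> complex" and X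
      proof -
        have "(poly p \<circ> f) holomorphic_on X"
          by (rule holomorphic_on_compose_gen[OF that, of _ UNIV]) (auto intro!: holomorphic_intros)
        then show ?thesis by (simp add: o_def)
      qed
      have hol: "A holomorphic_on ball 0 (2 * \<rho>)" "B1 holomorphic_on ball 0 (2 * \<rho>)" "B2 holomorphic_on ball 0 (2 * \<rho>)"
        unfolding A_def B1_def B2_def Ksym_def Z_def ca_def
        by (intro holomorphic_intros hp; use elim(4) in simp)+
      have cab: "cmod (ca s) \<le> R + 1" "cmod (cb s) \<le> R + 1" if "s \<in> ball 0 (2 * \<rho>)" for s
        using that \<rho> c e norm_triangle_ineq[of c "s * e"] norm_triangle_ineq[of c "cnj s * e"]
        by (auto simp: ca_def cb_def norm_mult)
      have close: "\<forall>s \<in> ball 0 (2 * \<rho>). cmod (A s - Hc (of_real (2 * Re c) + 2 * s * of_real (Re e))) \<le> \<epsilon>' \<and> cmod (B1 s) \<le> \<epsilon>' \<and> cmod (B2 s) \<le> \<epsilon>'"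
      proof (intro ballI conjI)
        fix s assume sb: "s \<in> ball (0::complex) (2 * \<rho>)"
        have "ca s + cnj (cb s) = of_real (2 * Re c) + 2 * s * of_real (Re e)"
          by (simp add: ca_def cb_def complex_eq_iff algebra_simps)
        then show "cmod (A s - Hc (of_real (2 * Re c) + 2 * s * of_real (Re e))) \<le> \<epsilon>'"
          using elim(1) \<zeta> cab[OF sb] unfolding AK Z_def v_def by metis
        show "cmod (B1 s) \<le> \<epsilon>'" using elim(2) \<zeta> cab[OF sb] unfolding B1_def Z_def v_def by blast
        show "cmod (B2 s) \<le> \<epsilon>'" using elim(2) \<zeta> cab[OF sb] unfolding B2K complex_mod_cnj Z_def v_def by blast
      qed
      have cR: "\<bar>2 * Re c\<bar> \<le> 2 * R" using abs_Re_le_cmod[of c] c by simp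
      have eR: "\<bar>Re e\<bar> \<le> 1" using abs_Re_le_cmod[of e] e by simp
      \<comment> \<open>The scaling factor \<open>v\<close> contributes the same \<open>ln v\<close>
        at all three points, so it drops out of the second difference.\<close>
      have lnQ: "ln (cmod (root_sum (A (of_real s)) (B1 (of_real s)) (B2 (of_real s)))) = ln v + log_pot n (Z (c + of_real s * e))"
        if sb: "complex_of_real s \<in> ball 0 (2 * \<rho>)" for s :: real
      proof -
        define z where "z = Z (c + of_real s * e)"
        have cc: "ca (of_real s) = c + of_real s * e" "cb (of_real s) = c + of_real s * e" by (auto simp: ca_def cb_def)
        have "cmod (c + of_real s * e) \<le> R + 1" using cab(1)[OF sb] by (simp add: cc)
        then have "let z = \<zeta> * exp ((c + of_real s * e) / of_nat n); v = 2 * pi * w \<zeta> / real n in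
          k0 \<le> v * Kdiag n z \<and> v * Kdiag n z \<le> k1 \<and> cmod (Ksym n z z) \<le> Kdiag n z / 2"
          using elim(3) \<zeta> by blast
        then have "k0 \<le> v * Kdiag n z" and kk: "cmod (Ksym n z z) \<le> Kdiag n z / 2"
          unfolding Let_def z_def Z_def v_def by blast+
        have kp: "0 < v * Kdiag n z" "0 < Kdiag n z"
        proof -
          show *: "0 < v * Kdiag n z" using \<open>k0 \<le> v * Kdiag n z\<close> k0 by linarith
          show "0 < Kdiag n z" using * v by (simp add: zero_less_mult_iff)
        qed
        have "A (of_real s) = of_real (v * Kdiag n z)" unfolding AK cc z_def[symmetric] by (simp add: K_diag)
        moreover have "B2 (of_real s) = cnj (B1 (of_real s))" unfolding B2K B1_def cc ..
        moreover have "B1 (of_real s) = of_real v * Ksym n z z" unfolding B1_def cc z_def ..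
        moreover have "cmod (of_real v * Ksym n z z) \<le> v * Kdiag n z"
        proof -
          have "v * cmod (Ksym n z z) \<le> v * Kdiag n z" using kk kp v by (intro mult_left_mono) auto
          then show ?thesis using v by (simp add: norm_mult)
        qed
        ultimately have "root_sum (A (of_real s)) (B1 (of_real s)) (B2 (of_real s)) = of_real (v * Kdiag n z + sqrt ((v * Kdiag n z)\<^sup>2 - (cmod (of_real v * Ksym n z z))\<^sup>2))"
          using root_sum_conj[OF kp(1), of "of_real v * Ksym n z z"] by simp
        also have "sqrt ((v * Kdiag n z)\<^sup>2 - (cmod (of_real v * Ksym n z z))\<^sup>2) = v * sqrt ((Kdiag n z)\<^sup>2 - (cmod (Ksym n z z))\<^sup>2)"
        proof -
          have "(v * Kdiag n z)\<^sup>2 - (cmod (of_real v * Ksym n z z))\<^sup>2 = v\<^sup>2 * ((Kdiag n z)\<^sup>2 - (cmod (Ksym n z z))\<^sup>2)"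
            using v by (simp add: norm_mult power_mult_distrib algebra_simps)
          then show ?thesis using v by (simp add: real_sqrt_mult)
        qed
        finally have Q: "root_sum (A (of_real s)) (B1 (of_real s)) (B2 (of_real s)) = of_real (v * (Kdiag n z + sqrt ((Kdiag n z)\<^sup>2 - (cmod (Ksym n z z))\<^sup>2)))"
          by (simp add: distrib_left)
        have "(cmod (Ksym n z z))\<^sup>2 \<le> (Kdiag n z)\<^sup>2" using kk kp by (intro power_mono) auto
        then have pos: "0 < Kdiag n z + sqrt ((Kdiag n z)\<^sup>2 - (cmod (Ksym n z z))\<^sup>2)" using kp by (intro add_pos_nonneg) auto
        then have "cmod (root_sum (A (of_real s)) (B1 (of_real s)) (B2 (of_real s))) = v * (Kdiag n z + sqrt ((Kdiag n z)\<^sup>2 - (cmod (Ksym n z z))\<^sup>2))"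
          unfolding Q norm_of_real using v by simp
        then show ?thesis using v pos by (simp add: ln_mult log_pot_def z_def)
      qed
      have inb: "complex_of_real s \<in> ball 0 (2 * \<rho>)" "complex_of_real (- s) \<in> ball 0 (2 * \<rho>)" "complex_of_real 0 \<in> ball 0 (2 * \<rho>)"
        using s \<rho> by auto
      have "\<bar>(ln (cmod (root_sum (A (of_real s)) (B1 (of_real s)) (B2 (of_real s)))) + ln (cmod (root_sum (A (of_real (- s))) (B1 (of_real (- s))) (B2 (of_real (- s)))))) / 4
          - ln (cmod (root_sum (A 0) (B1 0) (B2 0))) / 2 - s\<^sup>2 * (Re e)\<^sup>2 * Re (deriv (deriv LnH) (of_real (2 * Re c)))\<bar> \<le> \<epsilon> * s\<^sup>2"
        by (rule sd[OF cR eR hol close s])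
      then show "\<bar>(log_pot n (\<zeta> * exp ((c + of_real s * e) / of_nat n)) + log_pot n (\<zeta> * exp ((c - of_real s * e) / of_nat n))) / 4
       - log_pot n (\<zeta> * exp (c / of_nat n)) / 2 - s\<^sup>2 * (Re e)\<^sup>2 * d2lnH (2 * Re c)\<bar> \<le> \<epsilon> * s\<^sup>2"
        using lnQ[OF inb(1)] lnQ[OF inb(2)] lnQ[OF inb(3)] by (simp add: Z_def d2lnH_def add_divide_distrib)
    qed
  qed
  then show ?thesis using \<rho> by (intro exI[of _ s0]) auto
qed

end

section \<open>Expected number of zeros\<close>

lemma unitI_cos_squared:
  "integrable unitI (\<lambda>t. (cos (2 * pi * t))\<^sup>2)" "(LINT t|unitI. (cos (2 * pi * t))\<^sup>2) = 1 / 2"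
proof -
  have c: "continuous_on {0..1} (\<lambda>t. (cos (2 * pi * t))\<^sup>2)" by (intro continuous_intros)
  have "((\<lambda>t. (cos (2 * pi * t))\<^sup>2) has_integral ((1 / 2 + sin (4 * pi * 1) / (8 * pi)) - (0 / 2 + sin (4 * pi * 0) / (8 * pi)))) {0..1}"
  proof (rule fundamental_theorem_of_calculus)
    fix t :: real
    have "((\<lambda>t. t / 2 + sin (4 * pi * t) / (8 * pi)) has_real_derivative (1 / 2 + cos (4 * pi * t) * (4 * pi) / (8 * pi))) (at t within {0..1})"
      by (auto intro!: derivative_eq_intros)
    moreover have "1 / 2 + cos (4 * pi * t) * (4 * pi) / (8 * pi) = (cos (2 * pi * t))\<^sup>2"
      using cos_double_cos[of "2 * pi * t"] by (simp add: field_simps)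
    ultimately show "((\<lambda>t. t / 2 + sin (4 * pi * t) / (8 * pi)) has_vector_derivative (cos (2 * pi * t))\<^sup>2) (at t within {0..1})"
      by (simp add: has_real_derivative_iff_has_vector_derivative)
  qed simp
  moreover have "sin (4 * pi) = 0" using sin_npi[of 4] by simp
  ultimately have "((\<lambda>t. (cos (2 * pi * t))\<^sup>2) has_integral (1 / 2)) {0..1}" by simp
  from has_bochner_integral_unitI[OF c this]
  show "integrable unitI (\<lambda>t. (cos (2 * pi * t))\<^sup>2)" "(LINT t|unitI. (cos (2 * pi * t))\<^sup>2) = 1 / 2" .
qed

locale opuc_gauss = opuc_ac \<mu> \<Phi> \<alpha> S U w + G: std_gaussians M \<eta>
  for \<mu> \<Phi> \<alpha> S U w and M :: "'a measure" and \<eta>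
begin

definition Pn :: "nat \<Rightarrow> 'a \<Rightarrow> complex poly" where
  "Pn n \<omega> = (\<Sum>i<n. smult (complex_of_real (\<eta> i \<omega>)) (\<phi> i))"

lemma poly_Pn: "poly (Pn n \<omega>) z = (\<Sum>i<n. poly (\<phi> i) z * of_real (\<eta> i \<omega>))"
  by (simp add: Pn_def poly_sum mult.commute)

lemma random_poly_Pn:
  assumes "n \<ge> 2"
  shows "random_poly M (Pn n) n"
proof (unfold_locales)
  have "(\<lambda>x. poly (\<phi> i) (snd x) * of_real (\<eta> i (fst x))) \<in> borel_measurable (M \<Otimes>\<^sub>M borel)" for i
  proof -
    have "(\<lambda>z. poly (\<phi> i) z) \<in> borel_measurable borel" by (intro borel_measurable_continuous_onI continuous_intros)
    from measurable_compose[OF measurable_snd this]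
    have [measurable]: "(\<lambda>x. poly (\<phi> i) (snd x)) \<in> borel_measurable (M \<Otimes>\<^sub>M borel)" .
    show ?thesis by measurable
  qed
  then show "(\<lambda>(\<omega>, z). poly (Pn n \<omega>) z) \<in> borel_measurable (M \<Otimes>\<^sub>M borel)"
    unfolding poly_Pn case_prod_beta by (intro borel_measurable_sum)
  show "AE \<omega> in M. rsquarefree (Pn n \<omega>)"
    unfolding Pn_def using assms by (intro G.AE_rsquarefree) auto
  show "degree (Pn n \<omega>) \<le> n" for \<omega>
    unfolding Pn_def by (intro degree_sum_le) (auto intro: order_trans[OF degree_smult_le])
qed

lemma log_Pn:
  assumes K: "Kdiag n z > 0" and L: "cmod (Ksym n z z) \<le> Kdiag n z / 2"
  shows "integrable M (\<lambda>\<omega>. ln (cmod (poly (Pn n \<omega>) z)))"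
    and "G.expectation (\<lambda>\<omega>. ln (cmod (poly (Pn n \<omega>) z))) = log_pot n z / 2 - ln 2 + gauss_log"
    and "G.expectation (\<lambda>\<omega>. \<bar>ln (cmod (poly (Pn n \<omega>) z))\<bar>) \<le> \<bar>ln (Kdiag n z)\<bar> + 4 + gauss_abs_log"
proof -
  have Ksym: "Ksym n z z = (\<Sum>i<n. (poly (\<phi> i) z)\<^sup>2)" by (simp add: Ksym_def power2_eq_square)
  show "integrable M (\<lambda>\<omega>. ln (cmod (poly (Pn n \<omega>) z)))"
    and "G.expectation (\<lambda>\<omega>. ln (cmod (poly (Pn n \<omega>) z))) = log_pot n z / 2 - ln 2 + gauss_log"
    and "G.expectation (\<lambda>\<omega>. \<bar>ln (cmod (poly (Pn n \<omega>) z))\<bar>) \<le> \<bar>ln (Kdiag n z)\<bar> + 4 + gauss_abs_log"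
    using G.gaussian_log[where n = n and c = "\<lambda>i. poly (\<phi> i) z"] K L unfolding poly_Pn log_pot_def Kdiag_def Ksym by auto
qed

text \<open>Expectation and circle mean are exchanged; the bound on |ln Kdiag| over the disc bounds
  the expected absolute logarithm uniformly along the circle, which gives integrability on the
  product space. The additive constants of circle and centre cancel.\<close>

lemma expected_log_excess:
  assumes nd: "\<And>x. cmod (x - \<zeta>0) \<le> r \<Longrightarrow> 0 < Kdiag n (exp x) \<and> cmod (Ksym n (exp x) (exp x)) \<le> Kdiag n (exp x) / 2 \<and> \<bar>ln (Kdiag n (exp x))\<bar> \<le> C"
    and r: "r > 0"
  shows "integrable M (\<lambda>\<omega>. log_excess (Pn n \<omega>) r \<zeta>0)"
    and "integrable unitI (\<lambda>t. (log_pot n (exp (\<zeta>0 + of_real r * cis (2*pi*t))) + log_pot n (exp (\<zeta>0 - of_real r * cis (2*pi*t)))) / 4)"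
    and "G.expectation (\<lambda>\<omega>. log_excess (Pn n \<omega>) r \<zeta>0)
      = (LINT t|unitI. (log_pot n (exp (\<zeta>0 + of_real r * cis (2*pi*t))) + log_pot n (exp (\<zeta>0 - of_real r * cis (2*pi*t)))) / 4) - log_pot n (exp \<zeta>0) / 2"
proof -
  interpret T: prob_space unitI by (rule prob_space_unitI)
  interpret TM: pair_prob_space unitI M ..
  define X where "X \<sigma> t \<omega> = ln (cmod (poly (Pn n \<omega>) (exp (\<zeta>0 + of_real \<sigma> * cis (2*pi*t)))))" for \<sigma> t \<omega>
  define f where "f t \<omega> = (X r t \<omega> + X (-r) t \<omega>) / 2" for t \<omega>
  have meas: "(\<lambda>(t, \<omega>). X \<sigma> t \<omega>) \<in> borel_measurable (unitI \<Otimes>\<^sub>M M)" for \<sigma>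
  proof -
    have "(\<lambda>x. poly (\<phi> i) (exp (\<zeta>0 + of_real \<sigma> * cis (2*pi*fst x))) * of_real (\<eta> i (snd x))) \<in> borel_measurable (unitI \<Otimes>\<^sub>M M)" for i
    proof -
      have "(\<lambda>t. poly (\<phi> i) (exp (\<zeta>0 + of_real \<sigma> * cis (2*pi*t)))) \<in> borel_measurable borel"
        unfolding cis_conv_exp by (intro borel_measurable_continuous_onI continuous_intros)
      from measurable_compose[OF measurable_fst measurable_unitI[OF this]]
      have [measurable]: "(\<lambda>x. poly (\<phi> i) (exp (\<zeta>0 + of_real \<sigma> * cis (2*pi*fst x)))) \<in> borel_measurable (unitI \<Otimes>\<^sub>M M)" .
      show ?thesis by measurable
    qed
    then have [measurable]: "(\<lambda>x. \<Sum>i<n. poly (\<phi> i) (exp (\<zeta>0 + of_real \<sigma> * cis (2*pi*fst x))) * of_real (\<eta> i (snd x))) \<in> borel_measurable (unitI \<Otimes>\<^sub>M M)"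
      by (intro borel_measurable_sum)
    show ?thesis unfolding X_def poly_Pn case_prod_beta by measurable
  qed
  have pt: "cmod ((\<zeta>0 + of_real \<sigma> * cis (2*pi*t)) - \<zeta>0) \<le> r" if "\<bar>\<sigma>\<bar> = r" for \<sigma> t
    using that by (simp add: norm_mult)
  have Xint: "integrable M (X \<sigma> t)" "G.expectation (X \<sigma> t) = log_pot n (exp (\<zeta>0 + of_real \<sigma> * cis (2*pi*t))) / 2 - ln 2 + gauss_log"
    "G.expectation (\<lambda>\<omega>. \<bar>X \<sigma> t \<omega>\<bar>) \<le> C + 4 + gauss_abs_log" if "\<bar>\<sigma>\<bar> = r" for \<sigma> t
  proof -
    note n1 = nd[OF pt[OF that, of t]]
    show "integrable M (X \<sigma> t)" "G.expectation (X \<sigma> t) = log_pot n (exp (\<zeta>0 + of_real \<sigma> * cis (2*pi*t))) / 2 - ln 2 + gauss_log"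
      using log_Pn(1,2)[of n "exp (\<zeta>0 + of_real \<sigma> * cis (2*pi*t))"] n1 unfolding X_def by blast+
    have "G.expectation (\<lambda>\<omega>. \<bar>X \<sigma> t \<omega>\<bar>) \<le> \<bar>ln (Kdiag n (exp (\<zeta>0 + of_real \<sigma> * cis (2*pi*t))))\<bar> + 4 + gauss_abs_log"
      using log_Pn(3)[of n "exp (\<zeta>0 + of_real \<sigma> * cis (2*pi*t))"] n1 unfolding X_def by blast
    then show "G.expectation (\<lambda>\<omega>. \<bar>X \<sigma> t \<omega>\<bar>) \<le> C + 4 + gauss_abs_log" using n1 by linarith
  qed
  have XUG: "integrable (unitI \<Otimes>\<^sub>M M) (\<lambda>(t, \<omega>). X \<sigma> t \<omega>)" if s: "\<bar>\<sigma>\<bar> = r" for \<sigma>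
  proof (rule TM.Fubini_integrable[OF meas])
    show "integrable unitI (\<lambda>t. LINT \<omega>|M. norm (case (t, \<omega>) of (t, \<omega>) \<Rightarrow> X \<sigma> t \<omega>))"
    proof (rule T.integrable_const_bound[where B = "C + 4 + gauss_abs_log"])
      show "AE t in unitI. norm (LINT \<omega>|M. norm (case (t, \<omega>) of (t, \<omega>) \<Rightarrow> X \<sigma> t \<omega>)) \<le> C + 4 + gauss_abs_log"
        using Xint(3)[OF s] by (intro AE_I2) simp
      show "(\<lambda>t. LINT \<omega>|M. norm (case (t, \<omega>) of (t, \<omega>) \<Rightarrow> X \<sigma> t \<omega>)) \<in> borel_measurable unitI"
        using meas[of \<sigma>] by (intro G.borel_measurable_lebesgue_integral) (simp add: case_prod_beta)
    qed
    show "AE t in unitI. integrable M (\<lambda>\<omega>. case (t, \<omega>) of (t, \<omega>) \<Rightarrow> X \<sigma> t \<omega>)"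
      using Xint(1)[OF s] by (intro AE_I2) simp
  qed
  have fUG: "integrable (unitI \<Otimes>\<^sub>M M) (\<lambda>(t, \<omega>). f t \<omega>)"
    unfolding f_def case_prod_beta using XUG[of r] XUG[of "- r"] r
    by (intro Bochner_Integration.integrable_divide_zero Bochner_Integration.integrable_add) (auto simp: case_prod_beta')
  have Ef: "G.expectation (f t) = (log_pot n (exp (\<zeta>0 + of_real r * cis (2*pi*t))) + log_pot n (exp (\<zeta>0 - of_real r * cis (2*pi*t)))) / 4 + (- ln 2 + gauss_log)" for t
    using Xint(1,2)[of r t] Xint(1,2)[of "- r" t] r unfolding f_def by (simp add: field_simps)
  have "integrable unitI (\<lambda>t. G.expectation (f t))"
    using TM.integrable_fst[OF fUG] .
  then show int2: "integrable unitI (\<lambda>t. (log_pot n (exp (\<zeta>0 + of_real r * cis (2*pi*t))) + log_pot n (exp (\<zeta>0 - of_real r * cis (2*pi*t)))) / 4)"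
    unfolding Ef using Bochner_Integration.integrable_diff[of unitI "\<lambda>t. (log_pot n (exp (\<zeta>0 + of_real r * cis (2*pi*t))) + log_pot n (exp (\<zeta>0 - of_real r * cis (2*pi*t)))) / 4 + (- ln 2 + gauss_log)" "\<lambda>_. - ln 2 + gauss_log"]
    by simp
  have le: "log_excess (Pn n \<omega>) r \<zeta>0 = (LINT t|unitI. f t \<omega>) - ln (cmod (poly (Pn n \<omega>) (exp \<zeta>0)))" for \<omega>
    by (simp add: log_excess_def f_def X_def)
  have n0: "0 < Kdiag n (exp \<zeta>0)" "cmod (Ksym n (exp \<zeta>0) (exp \<zeta>0)) \<le> Kdiag n (exp \<zeta>0) / 2" using nd[of \<zeta>0] r by auto
  have i1: "integrable M (\<lambda>\<omega>. LINT t|unitI. f t \<omega>)" using TM.integrable_snd[OF fUG] .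
  show "integrable M (\<lambda>\<omega>. log_excess (Pn n \<omega>) r \<zeta>0)"
    unfolding le by (intro Bochner_Integration.integrable_diff i1 log_Pn(1) n0)
  have "G.expectation (\<lambda>\<omega>. log_excess (Pn n \<omega>) r \<zeta>0) = G.expectation (\<lambda>\<omega>. LINT t|unitI. f t \<omega>) - (log_pot n (exp \<zeta>0) / 2 - ln 2 + gauss_log)"
    unfolding le using Bochner_Integration.integral_diff[OF i1 log_Pn(1)[OF n0]] log_Pn(2)[OF n0] by simp
  also have "G.expectation (\<lambda>\<omega>. LINT t|unitI. f t \<omega>) = (LINT t|unitI. G.expectation (f t))"
    by (rule TM.Fubini_integral[OF fUG])
  also have "\<dots> = (LINT t|unitI. (log_pot n (exp (\<zeta>0 + of_real r * cis (2*pi*t))) + log_pot n (exp (\<zeta>0 - of_real r * cis (2*pi*t)))) / 4) + (- ln 2 + gauss_log)"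
    unfolding Ef using int2 T.prob_space by (subst Bochner_Integration.integral_add) auto
  finally show "G.expectation (\<lambda>\<omega>. log_excess (Pn n \<omega>) r \<zeta>0)
      = (LINT t|unitI. (log_pot n (exp (\<zeta>0 + of_real r * cis (2*pi*t))) + log_pot n (exp (\<zeta>0 - of_real r * cis (2*pi*t)))) / 4) - log_pot n (exp \<zeta>0) / 2"
    by simp
qed

text \<open>The second difference in direction e is (Re e)^2 times d2lnH, since the limit kernel
  depends only on the real part of the displacement; averaging cos^2 over directions gives the
  factor 1/2.\<close>

lemma expected_log_excess_asymp:
  assumes R: "R \<ge> 1" and \<epsilon>: "\<epsilon> > 0"
  shows "\<exists>s0>0. eventually (\<lambda>n. \<forall>\<theta> c r. cis \<theta> \<in> S \<longrightarrow> cmod c \<le> R \<longrightarrow> 0 < r \<longrightarrow> real n * r \<le> s0 \<longrightarrow>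
    integrable M (\<lambda>\<omega>. log_excess (Pn n \<omega>) r (\<i> * of_real \<theta> + c / of_nat n)) \<and>
    \<bar>G.expectation (\<lambda>\<omega>. log_excess (Pn n \<omega>) r (\<i> * of_real \<theta> + c / of_nat n)) - (real n * r)\<^sup>2 * d2lnH (2 * Re c) / 2\<bar> \<le> \<epsilon> * (real n * r)\<^sup>2) sequentially"
proof -
  interpret T: prob_space unitI by (rule prob_space_unitI)
  obtain s0 where s0: "0 < s0" "s0 < 1" and sd: "eventually (\<lambda>n. \<forall>\<zeta>\<in>S. \<forall>c e s. cmod c \<le> R \<longrightarrow> cmod e = 1 \<longrightarrow> 0 < s \<longrightarrow> s \<le> s0 \<longrightarrow>
     \<bar>(log_pot n (\<zeta> * exp ((c + of_real s * e) / of_nat n)) + log_pot n (\<zeta> * exp ((c - of_real s * e) / of_nat n))) / 4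
       - log_pot n (\<zeta> * exp (c / of_nat n)) / 2 - s\<^sup>2 * (Re e)\<^sup>2 * d2lnH (2 * Re c)\<bar> \<le> \<epsilon> * s\<^sup>2) sequentially"
    using log_pot_second_difference[OF R \<epsilon>] by blast
  have R1: "R + 1 \<ge> 1" using R by simp
  obtain k0 k1 where k0: "0 < k0" and nd: "eventually (\<lambda>n. \<forall>\<zeta>\<in>S. \<forall>a. cmod a \<le> R + 1 \<longrightarrow>
     (let z = \<zeta> * exp (a / of_nat n); v = 2 * pi * w \<zeta> / real n in
      k0 \<le> v * Kdiag n z \<and> v * Kdiag n z \<le> k1 \<and> cmod (Ksym n z z) \<le> Kdiag n z / 2)) sequentially"
    using nondegenerate[OF R1] by blast
  have "eventually (\<lambda>n. \<forall>\<theta> c r. cis \<theta> \<in> S \<longrightarrow> cmod c \<le> R \<longrightarrow> 0 < r \<longrightarrow> real n * r \<le> s0 \<longrightarrow>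
    integrable M (\<lambda>\<omega>. log_excess (Pn n \<omega>) r (\<i> * of_real \<theta> + c / of_nat n)) \<and>
    \<bar>G.expectation (\<lambda>\<omega>. log_excess (Pn n \<omega>) r (\<i> * of_real \<theta> + c / of_nat n)) - (real n * r)\<^sup>2 * d2lnH (2 * Re c) / 2\<bar> \<le> \<epsilon> * (real n * r)\<^sup>2) sequentially"
    using sd nd eventually_gt_at_top[of 0]
  proof eventually_elim
    case (elim n)
    show ?case
    proof (intro allI impI)
      fix \<theta> c r assume \<zeta>: "cis \<theta> \<in> S" and c: "cmod c \<le> R" and r: "0 < r" "real n * r \<le> s0"
      define \<zeta>0 where "\<zeta>0 = \<i> * of_real \<theta> + c / of_nat n"
      define s where "s = real n * r"
      have n: "n > 0" by (rule elim(3))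
      have s: "0 < s" "s \<le> s0" using r n by (auto simp: s_def)
      define v where "v = 2 * pi * w (cis \<theta>) / real n"
      have v: "v > 0" using w_pos[OF \<zeta>] n by (simp add: v_def)
      have ex: "exp (\<zeta>0 + x) = cis \<theta> * exp ((c + of_nat n * x) / of_nat n)" for x
      proof -
        have "\<zeta>0 + x = \<i> * of_real \<theta> + (c + of_nat n * x) / of_nat n" using n by (simp add: \<zeta>0_def field_simps)
        then show ?thesis by (simp only: exp_add cis_conv_exp)
      qed
      define C where "C = \<bar>ln k0\<bar> + \<bar>ln k1\<bar> + \<bar>ln v\<bar>"
      have ndx: "0 < Kdiag n (exp x) \<and> cmod (Ksym n (exp x) (exp x)) \<le> Kdiag n (exp x) / 2 \<and> \<bar>ln (Kdiag n (exp x))\<bar> \<le> C"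
        if x: "cmod (x - \<zeta>0) \<le> r" for x
      proof -
        define z where "z = exp x"
        have z: "z = cis \<theta> * exp ((c + of_nat n * (x - \<zeta>0)) / of_nat n)" using ex[of "x - \<zeta>0"] by (simp add: z_def)
        have "cmod (of_nat n * (x - \<zeta>0)) \<le> real n * r" using x by (simp add: norm_mult mult_left_mono)
        then have "cmod (c + of_nat n * (x - \<zeta>0)) \<le> R + 1"
          using norm_triangle_ineq[of c "of_nat n * (x - \<zeta>0)"] c r s0 by linarith
        then have k: "k0 \<le> v * Kdiag n z" "v * Kdiag n z \<le> k1" "cmod (Ksym n z z) \<le> Kdiag n z / 2"
          using elim(2) \<zeta> unfolding Let_def z v_def by blast+
        have vk: "0 < v * Kdiag n z" using k k0 by linarith
        then have kp: "0 < Kdiag n z" using v by (simp add: zero_less_mult_iff)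
        have "ln k0 \<le> ln (v * Kdiag n z)" "ln (v * Kdiag n z) \<le> ln k1" using k k0 vk by (auto intro!: ln_mono)
        moreover have "ln (v * Kdiag n z) = ln v + ln (Kdiag n z)" using v kp by (simp add: ln_mult)
        ultimately have "\<bar>ln (Kdiag n z)\<bar> \<le> C" by (simp add: C_def)
        then show ?thesis using kp k(3) by (simp add: z_def)
      qed
      note E = expected_log_excess[OF ndx r(1), simplified]
      define D where "D t = (log_pot n (exp (\<zeta>0 + of_real r * cis (2*pi*t))) + log_pot n (exp (\<zeta>0 - of_real r * cis (2*pi*t)))) / 4 - log_pot n (exp \<zeta>0) / 2" for t
      have Dint: "integrable unitI D" unfolding D_def by (intro Bochner_Integration.integrable_diff E(2) T.integrable_const)
      have ED: "G.expectation (\<lambda>\<omega>. log_excess (Pn n \<omega>) r \<zeta>0) = (LINT t|unitI. D t)"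
        unfolding D_def using E(2,3) T.prob_space by (subst Bochner_Integration.integral_diff) auto
      have Db: "\<bar>D t - s\<^sup>2 * d2lnH (2 * Re c) * (cos (2 * pi * t))\<^sup>2\<bar> \<le> \<epsilon> * s\<^sup>2" for t
      proof -
        have 1: "exp (\<zeta>0 + of_real r * cis (2*pi*t)) = cis \<theta> * exp ((c + of_real s * cis (2*pi*t)) / of_nat n)"
          "exp (\<zeta>0 - of_real r * cis (2*pi*t)) = cis \<theta> * exp ((c - of_real s * cis (2*pi*t)) / of_nat n)"
          "exp \<zeta>0 = cis \<theta> * exp (c / of_nat n)"
          using ex[of "of_real r * cis (2*pi*t)"] ex[of "- (of_real r * cis (2*pi*t))"] ex[of 0] by (simp_all add: s_def mult.assoc)
        have "\<bar>(log_pot n (cis \<theta> * exp ((c + of_real s * cis (2*pi*t)) / of_nat n)) + log_pot n (cis \<theta> * exp ((c - of_real s * cis (2*pi*t)) / of_nat n))) / 4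
          - log_pot n (cis \<theta> * exp (c / of_nat n)) / 2 - s\<^sup>2 * (Re (cis (2*pi*t)))\<^sup>2 * d2lnH (2 * Re c)\<bar> \<le> \<epsilon> * s\<^sup>2"
          using elim(1) \<zeta> c s norm_cis by blast
        then show ?thesis unfolding D_def 1 by (simp add: mult_ac)
      qed
      have cint: "integrable unitI (\<lambda>t. s\<^sup>2 * d2lnH (2 * Re c) * (cos (2 * pi * t))\<^sup>2)"
        by (intro integrable_mult_right unitI_cos_squared)
      have "\<bar>(LINT t|unitI. D t - s\<^sup>2 * d2lnH (2 * Re c) * (cos (2 * pi * t))\<^sup>2)\<bar> \<le> (LINT t|unitI. \<epsilon> * s\<^sup>2)"
      proof -
        have "\<bar>(LINT t|unitI. D t - s\<^sup>2 * d2lnH (2 * Re c) * (cos (2 * pi * t))\<^sup>2)\<bar> \<le> (LINT t|unitI. \<bar>D t - s\<^sup>2 * d2lnH (2 * Re c) * (cos (2 * pi * t))\<^sup>2\<bar>)"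
          by (rule integral_abs_bound)
        also have "\<dots> \<le> (LINT t|unitI. \<epsilon> * s\<^sup>2)"
          using Db by (intro integral_mono integrable_abs Bochner_Integration.integrable_diff Dint cint) auto
        finally show ?thesis .
      qed
      also have "(LINT t|unitI. \<epsilon> * s\<^sup>2) = \<epsilon> * s\<^sup>2" using T.prob_space by simp
      also have "(LINT t|unitI. D t - s\<^sup>2 * d2lnH (2 * Re c) * (cos (2 * pi * t))\<^sup>2) = (LINT t|unitI. D t) - s\<^sup>2 * d2lnH (2 * Re c) / 2"
        using Dint cint unitI_cos_squared by (subst Bochner_Integration.integral_diff) auto
      finally have "\<bar>G.expectation (\<lambda>\<omega>. log_excess (Pn n \<omega>) r \<zeta>0) - s\<^sup>2 * d2lnH (2 * Re c) / 2\<bar> \<le> \<epsilon> * s\<^sup>2" by (simp only: ED)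
      then show "integrable M (\<lambda>\<omega>. log_excess (Pn n \<omega>) r (\<i> * of_real \<theta> + c / of_nat n)) \<and>
        \<bar>G.expectation (\<lambda>\<omega>. log_excess (Pn n \<omega>) r (\<i> * of_real \<theta> + c / of_nat n)) - (real n * r)\<^sup>2 * d2lnH (2 * Re c) / 2\<bar> \<le> \<epsilon> * (real n * r)\<^sup>2"
        using E(1) unfolding \<zeta>0_def s_def by blast
    qed
  qed
  then show ?thesis using s0 by blast
qed

end

section \<open>Integration of the intensity and passage to the limit\<close>

lemma tendsto_ennreal_eps:
  assumes "\<And>e. e > 0 \<Longrightarrow> eventually (\<lambda>n. ennreal (L - e) \<le> a n \<and> a n \<le> ennreal (L + e)) F"
  shows "(a \<longlongrightarrow> ennreal L) F"
proof (rule order_tendstoI)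
  fix y assume y: "y < ennreal L"
  have "((\<lambda>e. ennreal (L - e)) \<longlongrightarrow> ennreal (L - 0)) (at_right 0)" by (intro tendsto_intros)
  then have "eventually (\<lambda>e. y < ennreal (L - e)) (at_right 0)" using order_tendstoD(1) y by force
  then have "eventually (\<lambda>e. y < ennreal (L - e) \<and> 0 < e) (at_right 0)"
    using eventually_at_right_less by (intro eventually_conj) auto
  then obtain e where e: "y < ennreal (L - e)" "0 < e" using eventually_happens'[OF trivial_limit_at_right_real] by blast
  show "eventually (\<lambda>n. y < a n) F" using assms[OF e(2)] e(1) by (auto elim!: eventually_mono)
next
  fix y assume y: "ennreal L < y"
  have "((\<lambda>e. ennreal (L + e)) \<longlongrightarrow> ennreal (L + 0)) (at_right 0)" by (intro tendsto_intros)
  then have "eventually (\<lambda>e. ennreal (L + e) < y) (at_right 0)" using order_tendstoD(2) y by force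
  then have "eventually (\<lambda>e. ennreal (L + e) < y \<and> 0 < e) (at_right 0)"
    using eventually_at_right_less by (intro eventually_conj) auto
  then obtain e where e: "ennreal (L + e) < y" "0 < e" using eventually_happens'[OF trivial_limit_at_right_real] by blast
  show "eventually (\<lambda>n. a n < y) F" using assms[OF e(2)] e(1) by (auto elim!: eventually_mono)
qed

lemma scaled_ln_tendsto: "(\<lambda>n. real n * ln (1 + \<tau> / (2 * real n))) \<longlonglongrightarrow> \<tau> / 2"
proof -
  consider "\<tau> = 0" | "\<tau> > 0" | "\<tau> < 0" by linarith
  then show ?thesis by cases (simp, real_asymp+)
qed

lemma dlnH_mono: "s \<le> t \<Longrightarrow> dlnH s \<le> dlnH t"
  by (erule DERIV_nonneg_imp_nondecreasing) (use dlnH_derivative d2lnH_nonneg in blast)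

text \<open>A primitive of n^2 / pi * d2lnH (2 n x) is n / (2 pi) * dlnH (2 n x); the angular
  direction contributes only the measure of \<Theta>.\<close>

lemma nn_integral_intensity:
  fixes \<Theta> :: "real set"
  assumes \<Theta>: "\<Theta> \<in> sets borel" "emeasure lborel \<Theta> = ennreal m" "m \<ge> 0" and "a \<le> b" "\<epsilon> \<ge> 0" "n > 0"
  shows "(\<integral>\<^sup>+ \<zeta>. ennreal ((real n)\<^sup>2 / pi * (d2lnH (2 * real n * fst \<zeta>) + \<epsilon>)) * indicator ({a..b} \<times> \<Theta>) \<zeta> \<partial>lborel)
    = ennreal (m * (real n / (2 * pi) * (dlnH (2 * real n * b) - dlnH (2 * real n * a)) + (real n)\<^sup>2 / pi * \<epsilon> * (b - a)))"
proof -
  define g where "g x = (real n)\<^sup>2 / pi * (d2lnH (2 * real n * x) + \<epsilon>)" for x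
  define G where "G x = real n / (2 * pi) * dlnH (2 * real n * x) + (real n)\<^sup>2 / pi * \<epsilon> * x" for x
  have g0: "g x \<ge> 0" for x using d2lnH_nonneg assms by (simp add: g_def)
  have "continuous_on UNIV g" unfolding g_def
    by (intro continuous_intros continuous_on_compose2[OF d2lnH_continuous[of UNIV]]) auto
  then have gm [measurable]: "g \<in> borel_measurable borel" by (rule borel_measurable_continuous_onI)
  have Gd: "(G has_real_derivative g x) (at x)" for x
  proof -
    have "((\<lambda>x. dlnH (2 * real n * x)) has_real_derivative (d2lnH (2 * real n * x) * (2 * real n))) (at x)"
      by (rule DERIV_chain2[OF dlnH_derivative]) (auto intro!: derivative_eq_intros)
    then show ?thesis unfolding G_def g_def by (auto intro!: derivative_eq_intros simp: field_simps power2_eq_square)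
  qed
  note [measurable] = \<Theta>(1)
  have mble: "(\<lambda>\<zeta>. ennreal (g (fst \<zeta>)) * indicator ({a..b} \<times> \<Theta>) \<zeta>) \<in> borel_measurable (lborel \<Otimes>\<^sub>M lborel)"
  proof -
    have "{a..b} \<times> \<Theta> \<in> sets (lborel \<Otimes>\<^sub>M lborel)" using \<Theta>(1) by (intro pair_measureI) auto
    then show ?thesis by measurable
  qed
  have "(\<integral>\<^sup>+ \<zeta>. ennreal (g (fst \<zeta>)) * indicator ({a..b} \<times> \<Theta>) \<zeta> \<partial>lborel)
    = (\<integral>\<^sup>+ (x::real). \<integral>\<^sup>+ (y::real). ennreal (g x) * indicator ({a..b} \<times> \<Theta>) (x, y) \<partial>lborel \<partial>lborel)"
    unfolding lborel_prod[symmetric] using lborel.nn_integral_fst[OF mble] by simp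
  also have "\<dots> = (\<integral>\<^sup>+ (x::real). ennreal (g x) * indicator {a..b} x * ennreal m \<partial>lborel)"
  proof (rule nn_integral_cong)
    fix x :: real
    have "(\<integral>\<^sup>+ (y::real). ennreal (g x) * indicator ({a..b} \<times> \<Theta>) (x, y) \<partial>lborel)
      = (\<integral>\<^sup>+ (y::real). (ennreal (g x) * indicator {a..b} x) * indicator \<Theta> y \<partial>lborel)"
      by (intro nn_integral_cong) (simp add: indicator_times mult.assoc)
    also have "\<dots> = ennreal (g x) * indicator {a..b} x * ennreal m"
      using \<Theta>(1,2) by (subst nn_integral_cmult_indicator) auto
    finally show "(\<integral>\<^sup>+ (y::real). ennreal (g x) * indicator ({a..b} \<times> \<Theta>) (x, y) \<partial>lborel) = ennreal (g x) * indicator {a..b} x * ennreal m" .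
  qed
  also have "\<dots> = (\<integral>\<^sup>+ (x::real). ennreal (g x) * indicator {a..b} x \<partial>lborel) * ennreal m"
    by (rule nn_integral_multc) measurable
  also have "(\<integral>\<^sup>+ (x::real). ennreal (g x) * indicator {a..b} x \<partial>lborel) = ennreal (G b - G a)"
    by (rule nn_integral_FTC_Icc) (use Gd g0 assms in auto)
  also have "ennreal (G b - G a) * ennreal m = ennreal (m * (G b - G a))"
    by (subst ennreal_mult'[OF \<Theta>(3)]) (rule mult.commute)
  also have "G b - G a = real n / (2 * pi) * (dlnH (2 * real n * b) - dlnH (2 * real n * a)) + (real n)\<^sup>2 / pi * \<epsilon> * (b - a)"
    unfolding G_def right_diff_distrib by linarith
  finally show ?thesis by (simp only: g_def)
qed

context opuc_gauss begin

definition angles :: "real set" where "angles = {\<theta> \<in> {0..<2*pi}. cis \<theta> \<in> S}"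

lemma compact_angles: "compact angles"
proof -
  have "1 \<notin> S" using S_sub by auto
  \<comment> \<open>The half-open period can be closed because 1 is not in \<open>S\<close>; for the
    same reason the angles keep a distance from the cut of \<open>clog\<close>.\<close>
  have "angles = {0..2*pi} \<inter> cis -` S"
  proof (intro set_eqI iffI)
    fix x assume x: "x \<in> {0..2*pi} \<inter> cis -` S"
    have "x \<noteq> 2 * pi" using x \<open>1 \<notin> S\<close> by auto
    with x show "x \<in> angles" by (auto simp: angles_def)
  qed (auto simp: angles_def)
  moreover have "closed ({0..2*pi} \<inter> cis -` S)"
    using S_compact unfolding cis_conv_exp
    by (intro continuous_closed_preimage continuous_intros) (auto simp: compact_imp_closed)
  moreover have "bounded ({0..2*pi} \<inter> cis -` S)" by (rule bounded_subset[of "{0..2*pi}"]) auto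
  ultimately show ?thesis by (simp add: compact_eq_bounded_closed)
qed

lemma angles_margin: "\<exists>d>0. \<forall>\<theta>\<in>angles. d \<le> \<theta> \<and> \<theta> + d \<le> 2 * pi"
proof -
  have "0 \<notin> angles" "2 * pi \<notin> angles" using S_sub by (auto simp: angles_def)
  then obtain d1 d2 where d: "d1 > 0" "\<forall>x\<in>angles. d1 \<le> dist 0 x" "d2 > 0" "\<forall>x\<in>angles. d2 \<le> dist (2*pi) x"
    using separate_point_closed compact_imp_closed[OF compact_angles] by metis
  have "min d1 d2 \<le> \<theta> \<and> \<theta> + min d1 d2 \<le> 2 * pi" if "\<theta> \<in> angles" for \<theta>
  proof -
    have "0 \<le> \<theta>" "\<theta> < 2 * pi" using that by (auto simp: angles_def)
    then show ?thesis using d(2,4) that by (force simp: dist_real_def min_def)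
  qed
  then show ?thesis using d(1,3) by (intro exI[of _ "min d1 d2"]) auto
qed

lemma arclen_angles: "arclen S = measure lborel angles" "emeasure lborel angles = ennreal (arclen S)" "arclen S \<ge> 0"
proof -
  show 1: "arclen S = measure lborel angles" by (simp add: arclen_def angles_def)
  show "emeasure lborel angles = ennreal (arclen S)"
    unfolding 1 using emeasure_compact_finite[OF compact_angles] by (simp add: emeasure_eq_ennreal_measure top.not_eq_extremum)
  show "arclen S \<ge> 0" by (simp add: 1)
qed

lemma card_zeros_Omega:
  assumes "n > 0" "1 + \<tau>1 / (2 * real n) > 0" "\<tau>1 < \<tau>2"
  shows "card {z \<in> Omega S \<tau>1 \<tau>2 n. poly p z = 0}
    = zero_count p ({ln (1 + \<tau>1 / (2 * real n))<..<ln (1 + \<tau>2 / (2 * real n))} \<times> angles)"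
proof -
  have lt: "1 + \<tau>1 / (2 * real n) < 1 + \<tau>2 / (2 * real n)" using assms by (simp add: divide_strict_right_mono)
  have "z \<in> Omega S \<tau>1 \<tau>2 n \<longleftrightarrow> z \<noteq> 0 \<and>
    (Re (clog z), Im (clog z)) \<in> {ln (1 + \<tau>1 / (2 * real n))<..<ln (1 + \<tau>2 / (2 * real n))} \<times> angles" for z
  proof
    assume "z \<in> Omega S \<tau>1 \<tau>2 n"
    then obtain r s where z: "z = of_real r * s" "s \<in> S" and r: "1 + \<tau>1 / (2 * real n) < r" "r < 1 + \<tau>2 / (2 * real n)"
      by (auto simp: Omega_def)
    have r0: "r > 0" using r assms by linarith
    have s: "cmod s = 1" using z(2) S_sub by auto
    have nz: "cmod z = r" "z \<noteq> 0" using r0 s by (auto simp: z(1) norm_mult)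
    have "of_real r * cis (Arg2pi z) = z" using Arg2pi_eq[of z] nz by (simp add: cis_conv_exp)
    then have "cis (Arg2pi z) = s" using r0 by (simp add: z(1))
    then have "Arg2pi z \<in> angles" using z(2) Arg2pi_ge_0 Arg2pi_lt_2pi by (simp add: angles_def)
    then show "z \<noteq> 0 \<and> (Re (clog z), Im (clog z)) \<in> {ln (1 + \<tau>1 / (2 * real n))<..<ln (1 + \<tau>2 / (2 * real n))} \<times> angles"
      using r r0 nz assms lt by (auto simp: clog_def)
  next
    assume a: "z \<noteq> 0 \<and> (Re (clog z), Im (clog z)) \<in> {ln (1 + \<tau>1 / (2 * real n))<..<ln (1 + \<tau>2 / (2 * real n))} \<times> angles"
    then have z: "cmod z > 0" by simp
    have 1: "ln (1 + \<tau>1 / (2 * real n)) < ln (cmod z)" "ln (cmod z) < ln (1 + \<tau>2 / (2 * real n))" "cis (Arg2pi z) \<in> S"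
      using a by (auto simp: clog_def angles_def)
    have 2: "1 + \<tau>1 / (2 * real n) < cmod z" "cmod z < 1 + \<tau>2 / (2 * real n)"
      using 1 z assms lt by (auto simp: ln_less_cancel_iff)
    have "z = of_real (cmod z) * cis (Arg2pi z)" using Arg2pi_eq[of z] by (simp add: cis_conv_exp)
    then show "z \<in> Omega S \<tau>1 \<tau>2 n" unfolding Omega_def using 1 2 by blast
  qed
  then show ?thesis unfolding zero_count_def by (intro arg_cong[where f = card]) auto
qed

text \<open>The asymptotics are uniform in the scaled displacement c = n (\<zeta> - i \<theta>), so
  they also hold at points whose angle is not in \<open>angles\<close> but within 1/n of it; the
  open neighbourhoods in the upper bound need this. Splitting off pi r^2 / 2, the integral of the
  kernel, exhibits n^2 / pi * d2lnH (2 n x) as the intensity.\<close>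

lemma log_excess_near:
  assumes "T \<ge> 0" "\<epsilon> > 0"
  shows "\<exists>s0>0. eventually (\<lambda>n. \<forall>\<zeta> r x \<theta>. \<theta> \<in> angles \<longrightarrow> \<bar>real n * x\<bar> \<le> T \<longrightarrow> real n * dist \<zeta> (x, \<theta>) \<le> 1 \<longrightarrow> 0 < r \<longrightarrow> real n * r \<le> s0 \<longrightarrow>
    integrable M (\<lambda>\<omega>. log_excess (Pn n \<omega>) r (cpx \<zeta>)) \<and>
    \<bar>G.expectation (\<lambda>\<omega>. log_excess (Pn n \<omega>) r (cpx \<zeta>)) - pi * r\<^sup>2 / 2 * ((real n)\<^sup>2 / pi * d2lnH (2 * real n * fst \<zeta>))\<bar>
      \<le> pi * r\<^sup>2 / 2 * ((real n)\<^sup>2 / pi * \<epsilon>)) sequentially"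
proof -
  have R: "T + 1 \<ge> 1" and e2: "\<epsilon> / 2 > 0" using assms by auto
  obtain s0 where s0: "s0 > 0" and ev: "eventually (\<lambda>n. \<forall>\<theta> c r. cis \<theta> \<in> S \<longrightarrow> cmod c \<le> T + 1 \<longrightarrow> 0 < r \<longrightarrow> real n * r \<le> s0 \<longrightarrow>
    integrable M (\<lambda>\<omega>. log_excess (Pn n \<omega>) r (\<i> * of_real \<theta> + c / of_nat n)) \<and>
    \<bar>G.expectation (\<lambda>\<omega>. log_excess (Pn n \<omega>) r (\<i> * of_real \<theta> + c / of_nat n)) - (real n * r)\<^sup>2 * d2lnH (2 * Re c) / 2\<bar> \<le> \<epsilon> / 2 * (real n * r)\<^sup>2) sequentially"
    using expected_log_excess_asymp[OF R e2] by blast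
  from ev eventually_gt_at_top[of 0]
  have "eventually (\<lambda>n. \<forall>\<zeta> r x \<theta>. \<theta> \<in> angles \<longrightarrow> \<bar>real n * x\<bar> \<le> T \<longrightarrow> real n * dist \<zeta> (x, \<theta>) \<le> 1 \<longrightarrow> 0 < r \<longrightarrow> real n * r \<le> s0 \<longrightarrow>
    integrable M (\<lambda>\<omega>. log_excess (Pn n \<omega>) r (cpx \<zeta>)) \<and>
    \<bar>G.expectation (\<lambda>\<omega>. log_excess (Pn n \<omega>) r (cpx \<zeta>)) - pi * r\<^sup>2 / 2 * ((real n)\<^sup>2 / pi * d2lnH (2 * real n * fst \<zeta>))\<bar>
      \<le> pi * r\<^sup>2 / 2 * ((real n)\<^sup>2 / pi * \<epsilon>)) sequentially"
  proof eventually_elim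
    case (elim n)
    show ?case
    proof (intro allI impI)
      fix \<zeta> r x \<theta> assume h: "\<theta> \<in> angles" "\<bar>real n * x\<bar> \<le> T" "real n * dist \<zeta> (x, \<theta>) \<le> 1" "0 < r" "real n * r \<le> s0"
      define c where "c = of_nat n * (cpx \<zeta> - \<i> * of_real \<theta>)"
      have z: "cpx \<zeta> = \<i> * of_real \<theta> + c / of_nat n" using elim(2) by (simp add: c_def)
      have c': "c = of_nat n * (cpx \<zeta> - cpx (x, \<theta>)) + of_real (real n * x)"
        by (simp add: c_def cpx_def Complex_eq algebra_simps)
      have "cmod c \<le> T + 1"
        using norm_triangle_ineq[of "of_nat n * (cpx \<zeta> - cpx (x, \<theta>))" "of_real (real n * x)"] h(2,3)
        unfolding c' norm_mult dist_cpx norm_of_real norm_of_nat by linarith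
      moreover have "cis \<theta> \<in> S" using h(1) by (simp add: angles_def)
      ultimately have E: "integrable M (\<lambda>\<omega>. log_excess (Pn n \<omega>) r (cpx \<zeta>))"
        "\<bar>G.expectation (\<lambda>\<omega>. log_excess (Pn n \<omega>) r (cpx \<zeta>)) - (real n * r)\<^sup>2 * d2lnH (2 * Re c) / 2\<bar> \<le> \<epsilon> / 2 * (real n * r)\<^sup>2"
        using elim(1) h(4,5) unfolding z by blast+
      have "Re c = real n * fst \<zeta>" by (simp add: c_def)
      then have e1: "(real n * r)\<^sup>2 * d2lnH (2 * Re c) / 2 = pi * r\<^sup>2 / 2 * ((real n)\<^sup>2 / pi * d2lnH (2 * real n * fst \<zeta>))"
        by (simp add: power_mult_distrib mult.assoc)
      have e2: "\<epsilon> / 2 * (real n * r)\<^sup>2 = pi * r\<^sup>2 / 2 * ((real n)\<^sup>2 / pi * \<epsilon>)"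
        by (simp add: power_mult_distrib mult.assoc)
      show "integrable M (\<lambda>\<omega>. log_excess (Pn n \<omega>) r (cpx \<zeta>)) \<and>
        \<bar>G.expectation (\<lambda>\<omega>. log_excess (Pn n \<omega>) r (cpx \<zeta>)) - pi * r\<^sup>2 / 2 * ((real n)\<^sup>2 / pi * d2lnH (2 * real n * fst \<zeta>))\<bar>
          \<le> pi * r\<^sup>2 / 2 * ((real n)\<^sup>2 / pi * \<epsilon>)"
        using E unfolding e1 e2 by blast
    qed
  qed
  then show ?thesis using s0 by blast
qed

text \<open>Since \<open>S\<close> is only compact, its angles may have positive measure and empty
  interior. From above, the product set is therefore enclosed in an open set of barely larger
  measure; from below, the angles are closed already and only the radial interval is shrunk.\<close>

lemma expected_zeros_bounds:
  assumes T: "T \<ge> 0" and \<epsilon>: "\<epsilon> > 0"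
  shows "eventually (\<lambda>n. \<forall>x1 x2. \<bar>real n * x1\<bar> \<le> T \<longrightarrow> \<bar>real n * x2\<bar> \<le> T \<longrightarrow> x1 \<le> x2 \<longrightarrow>
     (\<integral>\<^sup>+ \<omega>. of_nat (zero_count (Pn n \<omega>) ({x1<..<x2} \<times> angles)) \<partial>M)
       \<le> ennreal (arclen S * (real n / (2 * pi) * (dlnH (2 * real n * x2) - dlnH (2 * real n * x1)) + (real n)\<^sup>2 / pi * \<epsilon> * (x2 - x1)) + 1) \<and>
     (\<forall>a b. x1 < a \<longrightarrow> a \<le> b \<longrightarrow> b < x2 \<longrightarrow>
       ennreal (arclen S * (real n / (2 * pi) * (dlnH (2 * real n * b) - dlnH (2 * real n * a))))
        \<le> (\<integral>\<^sup>+ \<omega>. of_nat (zero_count (Pn n \<omega>) ({x1<..<x2} \<times> angles)) \<partial>M)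
          + ennreal (arclen S * ((real n)\<^sup>2 / pi * \<epsilon> * (b - a))))) sequentially"
proof -
  obtain s0 where s0: "s0 > 0" and ev: "eventually (\<lambda>n. \<forall>\<zeta> r x \<theta>. \<theta> \<in> angles \<longrightarrow> \<bar>real n * x\<bar> \<le> T \<longrightarrow> real n * dist \<zeta> (x, \<theta>) \<le> 1 \<longrightarrow> 0 < r \<longrightarrow> real n * r \<le> s0 \<longrightarrow>
    integrable M (\<lambda>\<omega>. log_excess (Pn n \<omega>) r (cpx \<zeta>)) \<and>
    \<bar>G.expectation (\<lambda>\<omega>. log_excess (Pn n \<omega>) r (cpx \<zeta>)) - pi * r\<^sup>2 / 2 * ((real n)\<^sup>2 / pi * d2lnH (2 * real n * fst \<zeta>))\<bar>
      \<le> pi * r\<^sup>2 / 2 * ((real n)\<^sup>2 / pi * \<epsilon>)) sequentially"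
    using log_excess_near[OF T \<epsilon>] by blast
  obtain d where d: "d > 0" "\<And>\<theta>. \<theta> \<in> angles \<Longrightarrow> d \<le> \<theta> \<and> \<theta> + d \<le> 2 * pi" using angles_margin by blast
  have "eventually (\<lambda>n. 2 / real n < d) sequentially"
    using d(1) by real_asymp
  with ev eventually_ge_at_top[of 2] show ?thesis
  proof eventually_elim
    case (elim n)
    have n: "n > 0" using elim(2) by simp
    interpret P: random_poly M "Pn n" n using elim(2) by (rule random_poly_Pn)
    \<comment> \<open>The three bounds keep r in the range of the asymptotics, the discs around
      points within 1/n of the angles inside the strip, and the radius below 1.\<close>
    define r1 where "r1 = min (min (s0 / real n) (1 / real n)) (1 / 2)"
    have r1: "0 < r1" "r1 < 1" "real n * r1 \<le> s0" "r1 \<le> 1 / real n"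
      using s0 n by (auto simp: r1_def min_def field_simps)
    have nr: "real n * r \<le> s0" if "r \<le> r1" for r
      using r1(3) mult_left_mono[OF that, of "real n"] by linarith
    define \<gamma> where "\<gamma> \<sigma> \<zeta> = (real n)\<^sup>2 / pi * (d2lnH (2 * real n * fst \<zeta>) + \<sigma>)" for \<sigma> and \<zeta> :: "real \<times> real"
    have near: "integrable M (\<lambda>\<omega>. log_excess (Pn n \<omega>) r (cpx \<zeta>))"
      "G.expectation (\<lambda>\<omega>. log_excess (Pn n \<omega>) r (cpx \<zeta>)) \<le> pi * r\<^sup>2 / 2 * \<gamma> \<epsilon> \<zeta>"
      "pi * r\<^sup>2 / 2 * \<gamma> (- \<epsilon>) \<zeta> \<le> G.expectation (\<lambda>\<omega>. log_excess (Pn n \<omega>) r (cpx \<zeta>))"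
      if "\<theta> \<in> angles" "\<bar>real n * x\<bar> \<le> T" "real n * dist \<zeta> (x, \<theta>) \<le> 1" "0 < r" "r \<le> r1" for \<zeta> r x \<theta>
    proof -
      have E: "integrable M (\<lambda>\<omega>. log_excess (Pn n \<omega>) r (cpx \<zeta>))"
        "\<bar>G.expectation (\<lambda>\<omega>. log_excess (Pn n \<omega>) r (cpx \<zeta>)) - pi * r\<^sup>2 / 2 * ((real n)\<^sup>2 / pi * d2lnH (2 * real n * fst \<zeta>))\<bar>
          \<le> pi * r\<^sup>2 / 2 * ((real n)\<^sup>2 / pi * \<epsilon>)"
        using elim(1) that nr[OF that(5)] by blast+
      have g: "pi * r\<^sup>2 / 2 * \<gamma> \<epsilon> \<zeta> = pi * r\<^sup>2 / 2 * ((real n)\<^sup>2 / pi * d2lnH (2 * real n * fst \<zeta>)) + pi * r\<^sup>2 / 2 * ((real n)\<^sup>2 / pi * \<epsilon>)"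
        "pi * r\<^sup>2 / 2 * \<gamma> (- \<epsilon>) \<zeta> = pi * r\<^sup>2 / 2 * ((real n)\<^sup>2 / pi * d2lnH (2 * real n * fst \<zeta>)) - pi * r\<^sup>2 / 2 * ((real n)\<^sup>2 / pi * \<epsilon>)"
        by (simp_all only: \<gamma>_def distrib_left mult_minus_right diff_conv_add_uminus)
      show "integrable M (\<lambda>\<omega>. log_excess (Pn n \<omega>) r (cpx \<zeta>))" by (rule E(1))
      show "G.expectation (\<lambda>\<omega>. log_excess (Pn n \<omega>) r (cpx \<zeta>)) \<le> pi * r\<^sup>2 / 2 * \<gamma> \<epsilon> \<zeta>"
        "pi * r\<^sup>2 / 2 * \<gamma> (- \<epsilon>) \<zeta> \<le> G.expectation (\<lambda>\<omega>. log_excess (Pn n \<omega>) r (cpx \<zeta>))"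
        using E(2) unfolding g abs_le_iff by linarith+
    qed
    have \<gamma>m: "\<gamma> \<sigma> \<in> borel_measurable borel" for \<sigma>
      unfolding \<gamma>_def by (intro borel_measurable_continuous_onI continuous_intros continuous_on_compose2[OF d2lnH_continuous[of UNIV]]) auto
    show ?case
    proof (intro allI impI conjI)
      fix x1 x2 assume x: "\<bar>real n * x1\<bar> \<le> T" "\<bar>real n * x2\<bar> \<le> T" "x1 \<le> x2"
      have xT: "\<bar>real n * y\<bar> \<le> T" if "x1 \<le> y" "y \<le> x2" for y
      proof -
        have "real n * x1 \<le> real n * y" "real n * y \<le> real n * x2" using that by (auto intro: mult_left_mono)
        then show ?thesis using x by linarith
      qed
      define A where "A = {x1..x2} \<times> angles"
      have cA: "compact A" unfolding A_def by (intro compact_Times compact_angles) simp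
      then have A_borel: "A \<in> sets borel" by (intro borel_closed compact_imp_closed)
      define V where "V = (\<Union>a\<in>A. ball a (1 / real n))"
      have V: "open V" "A \<subseteq> V" using n by (auto simp: V_def)
      have nearV: "\<exists>y \<theta>. \<theta> \<in> angles \<and> \<bar>real n * y\<bar> \<le> T \<and> real n * dist \<zeta> (y, \<theta>) \<le> 1 \<and> \<bar>snd \<zeta> - \<theta>\<bar> < 1 / real n" if z: "\<zeta> \<in> V" for \<zeta>
      proof -
        obtain y \<theta> where 1: "y \<in> {x1..x2}" "\<theta> \<in> angles" "dist \<zeta> (y, \<theta>) < 1 / real n"
          using z by (auto simp: V_def A_def dist_commute)
        moreover have "\<bar>snd \<zeta> - \<theta>\<bar> \<le> dist \<zeta> (y, \<theta>)" using dist_snd_le[of \<zeta> "(y, \<theta>)"] by (simp add: dist_real_def)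
        moreover have "real n * dist \<zeta> (y, \<theta>) \<le> 1" using 1(3) n by (simp add: field_simps)
        ultimately show ?thesis using xT by (intro exI[of _ y] exI[of _ \<theta>]) auto
      qed
      have strip: "r1 < snd \<zeta> \<and> snd \<zeta> + r1 < 2 * pi" if "\<zeta> \<in> V" for \<zeta>
      proof -
        obtain \<theta> where "\<theta> \<in> angles" "\<bar>snd \<zeta> - \<theta>\<bar> < 1 / real n" using nearV[OF \<open>\<zeta> \<in> V\<close>] by blast
        moreover have "1 / real n + 1 / real n < d" using elim(3) by simp
        ultimately show ?thesis using d(2)[of \<theta>] r1(4) by linarith
      qed
      obtain B where B: "\<And>y. \<bar>y\<bar> \<le> 2 * (T + 1) \<Longrightarrow> d2lnH y \<le> B"
      proof -
        have "compact (d2lnH ` {- (2 * (T + 1))..2 * (T + 1)})" by (intro compact_continuous_image d2lnH_continuous) simp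
        then have "bdd_above (d2lnH ` {- (2 * (T + 1))..2 * (T + 1)})" by (intro bounded_imp_bdd_above compact_imp_bounded)
        then obtain B where "\<And>y. y \<in> d2lnH ` {- (2 * (T + 1))..2 * (T + 1)} \<Longrightarrow> y \<le> B" unfolding bdd_above_def by blast
        then have "\<And>y. \<bar>y\<bar> \<le> 2 * (T + 1) \<Longrightarrow> d2lnH y \<le> B" by (auto simp: abs_le_iff)
        then show ?thesis using that by blast
      qed
      define k where "k = (real n)\<^sup>2 / pi * (B + \<epsilon>)"
      have B0: "B \<ge> 0" using B[of 0] d2lnH_nonneg[of 0] T by simp
      have k: "k \<ge> 0" using B0 \<epsilon> by (simp add: k_def)
      have gk: "\<gamma> \<epsilon> \<zeta> \<le> k" if z: "\<zeta> \<in> V" for \<zeta>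
      proof -
        obtain y \<theta> where 1: "\<bar>real n * y\<bar> \<le> T" "real n * dist \<zeta> (y, \<theta>) \<le> 1" using nearV[OF z] by blast
        have "\<bar>fst \<zeta> - y\<bar> \<le> dist \<zeta> (y, \<theta>)" using dist_fst_le[of \<zeta> "(y, \<theta>)"] by (simp add: dist_real_def)
        then have "real n * \<bar>fst \<zeta> - y\<bar> \<le> real n * dist \<zeta> (y, \<theta>)" by (rule mult_left_mono) simp
        then have "\<bar>real n * (fst \<zeta> - y)\<bar> \<le> 1" using 1(2) by (simp add: abs_mult)
        then have "\<bar>real n * fst \<zeta>\<bar> \<le> T + 1" using 1(1) unfolding right_diff_distrib by linarith
        then have "\<bar>2 * real n * fst \<zeta>\<bar> \<le> 2 * (T + 1)" unfolding mult.assoc abs_mult[of 2] by simp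
        then have "d2lnH (2 * real n * fst \<zeta>) \<le> B" by (rule B)
        then show ?thesis unfolding \<gamma>_def k_def by (intro mult_left_mono) auto
      qed
      \<comment> \<open>The added open part costs at most k e \<le> 1 zeros in expectation, which
        disappears after division by n.\<close>
      define e where "e = 1 / (k + 1)"
      have e: "e > 0" using k by (simp add: e_def)
      obtain W where W: "open W" "A \<subseteq> W" "emeasure lborel (W - A) < ennreal e"
        using outer_regular_lborel[OF A_borel e] by blast
      define O' where "O' = V \<inter> W"
      have O: "open O'" "{x1<..<x2} \<times> angles \<subseteq> O'" "O' \<subseteq> V" using V W by (auto simp: O'_def A_def)
      have "(\<integral>\<^sup>+ \<omega>. of_nat (zero_count (Pn n \<omega>) ({x1<..<x2} \<times> angles)) \<partial>M) \<le> (\<integral>\<^sup>+ \<zeta>. ennreal (\<gamma> \<epsilon> \<zeta>) * indicator O' \<zeta> \<partial>lborel)"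
      proof (rule P.expected_zeros_upper[OF r1(1,2) _ O(1,2)])
        show "\<forall>\<zeta>\<in>O'. r1 < snd \<zeta> \<and> snd \<zeta> + r1 < 2 * pi" using strip O(3) by blast
        fix \<zeta> r assume zr: "\<zeta> \<in> O'" "0 < r" "r \<le> r1"
        then obtain y \<theta> where 1: "\<theta> \<in> angles" "\<bar>real n * y\<bar> \<le> T" "real n * dist \<zeta> (y, \<theta>) \<le> 1" using nearV O(3) by blast
        show "integrable M (\<lambda>\<omega>. log_excess (Pn n \<omega>) r (cpx \<zeta>))"
          "G.expectation (\<lambda>\<omega>. log_excess (Pn n \<omega>) r (cpx \<zeta>)) \<le> pi * r\<^sup>2 / 2 * \<gamma> \<epsilon> \<zeta>"
          using near(1,2)[OF 1 zr(2,3)] by blast+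
      qed
      also have "\<dots> \<le> (\<integral>\<^sup>+ \<zeta>. ennreal (\<gamma> \<epsilon> \<zeta>) * indicator A \<zeta> + ennreal k * indicator (W - A) \<zeta> \<partial>lborel)"
      proof (rule nn_integral_mono)
        fix \<zeta>
        have "\<zeta> \<in> O' \<Longrightarrow> ennreal (\<gamma> \<epsilon> \<zeta>) \<le> ennreal k" using O(3) by (intro ennreal_leI gk) blast
        then show "ennreal (\<gamma> \<epsilon> \<zeta>) * indicator O' \<zeta> \<le> ennreal (\<gamma> \<epsilon> \<zeta>) * indicator A \<zeta> + ennreal k * indicator (W - A) \<zeta>"
          by (cases "\<zeta> \<in> A"; cases "\<zeta> \<in> O'") (simp_all add: O'_def)
      qed
      also have "\<dots> = (\<integral>\<^sup>+ \<zeta>. ennreal (\<gamma> \<epsilon> \<zeta>) * indicator A \<zeta> \<partial>lborel) + ennreal k * emeasure lborel (W - A)"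
      proof -
        note [measurable] = \<gamma>m A_borel
        have WA [measurable]: "W - A \<in> sets borel" using A_borel borel_open[OF W(1)] by (rule sets.Diff[rotated])
        show ?thesis by (subst nn_integral_add) (measurable, simp add: nn_integral_cmult_indicator)
      qed
      also have "\<dots> \<le> ennreal (arclen S * (real n / (2 * pi) * (dlnH (2 * real n * x2) - dlnH (2 * real n * x1)) + (real n)\<^sup>2 / pi * \<epsilon> * (x2 - x1))) + 1"
      proof (rule add_mono)
        show "(\<integral>\<^sup>+ \<zeta>. ennreal (\<gamma> \<epsilon> \<zeta>) * indicator A \<zeta> \<partial>lborel)
          \<le> ennreal (arclen S * (real n / (2 * pi) * (dlnH (2 * real n * x2) - dlnH (2 * real n * x1)) + (real n)\<^sup>2 / pi * \<epsilon> * (x2 - x1)))"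
          unfolding \<gamma>_def A_def
          by (rule eq_refl) (rule nn_integral_intensity[OF borel_closed[OF compact_imp_closed[OF compact_angles]] arclen_angles(2,3) x(3) less_imp_le[OF \<epsilon>] n])
        have "ennreal k * emeasure lborel (W - A) \<le> ennreal k * ennreal e" using W(3) by (intro mult_left_mono) auto
        also have "\<dots> = ennreal (k * e)" using k e by (simp add: ennreal_mult)
        also have "\<dots> \<le> 1" using k by (simp add: e_def)
        finally show "ennreal k * emeasure lborel (W - A) \<le> 1" .
      qed
      also have "\<dots> = ennreal (arclen S * (real n / (2 * pi) * (dlnH (2 * real n * x2) - dlnH (2 * real n * x1)) + (real n)\<^sup>2 / pi * \<epsilon> * (x2 - x1)) + 1)"
      proof -
        have "dlnH (2 * real n * x1) \<le> dlnH (2 * real n * x2)"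
          using x(3) by (intro dlnH_mono mult_left_mono) simp_all
        then have "0 \<le> arclen S * (real n / (2 * pi) * (dlnH (2 * real n * x2) - dlnH (2 * real n * x1)) + (real n)\<^sup>2 / pi * \<epsilon> * (x2 - x1))"
          using arclen_angles(3) \<epsilon> x(3) by simp
        then show ?thesis by (simp only: ennreal_plus[OF _ zero_le_one] ennreal_1)
      qed
      finally show "(\<integral>\<^sup>+ \<omega>. of_nat (zero_count (Pn n \<omega>) ({x1<..<x2} \<times> angles)) \<partial>M)
       \<le> ennreal (arclen S * (real n / (2 * pi) * (dlnH (2 * real n * x2) - dlnH (2 * real n * x1)) + (real n)\<^sup>2 / pi * \<epsilon> * (x2 - x1)) + 1)" .
      fix a b assume ab: "x1 < a" "a \<le> b" "b < x2"
      define D where "D = {a..b} \<times> angles"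
      have DA: "D \<subseteq> {x1<..<x2} \<times> angles" "D \<subseteq> A" using ab by (auto simp: D_def A_def)
      have cD: "closed D" unfolding D_def using compact_imp_closed[OF compact_angles] by (intro closed_Times) auto
      then have D_borel: "D \<in> sets borel" by (rule borel_closed)
      have low: "(\<integral>\<^sup>+ \<zeta>. ennreal (\<gamma> (- \<epsilon>) \<zeta>) * indicator D \<zeta> \<partial>lborel) \<le> (\<integral>\<^sup>+ \<omega>. of_nat (zero_count (Pn n \<omega>) ({x1<..<x2} \<times> angles)) \<partial>M)"
      proof (rule P.expected_zeros_lower[OF r1(1,2) _ cD DA(1)])
        show "\<forall>\<zeta>\<in>D. r1 < snd \<zeta> \<and> snd \<zeta> + r1 < 2 * pi" using strip DA(2) V(2) by blast
        fix \<zeta> r assume zr: "\<zeta> \<in> D" "0 < r" "r \<le> r1"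
        then obtain y \<theta> where 1: "\<theta> \<in> angles" "\<bar>real n * y\<bar> \<le> T" "real n * dist \<zeta> (y, \<theta>) \<le> 1" using nearV DA(2) V(2) by blast
        show "integrable M (\<lambda>\<omega>. log_excess (Pn n \<omega>) r (cpx \<zeta>))"
          "pi * r\<^sup>2 / 2 * \<gamma> (- \<epsilon>) \<zeta> \<le> G.expectation (\<lambda>\<omega>. log_excess (Pn n \<omega>) r (cpx \<zeta>))"
          using near(1,3)[OF 1 zr(2,3)] by blast+
      qed
      have eD: "emeasure lborel D = ennreal (arclen S * (b - a))"
      proof -
        have "emeasure lborel D = emeasure lborel {a..b} * emeasure lborel angles"
          unfolding D_def lborel_prod[symmetric] using compact_imp_closed[OF compact_angles] by (intro lborel.emeasure_pair_measure_Times) auto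
        then show ?thesis using ab arclen_angles(2,3) by (simp add: ennreal_mult mult.commute)
      qed
      have "ennreal (arclen S * (real n / (2 * pi) * (dlnH (2 * real n * b) - dlnH (2 * real n * a))))
        = (\<integral>\<^sup>+ \<zeta>. ennreal (\<gamma> 0 \<zeta>) * indicator D \<zeta> \<partial>lborel)"
        unfolding \<gamma>_def D_def
        using nn_integral_intensity[OF borel_closed[OF compact_imp_closed[OF compact_angles]] arclen_angles(2,3) ab(2) order_refl n] by simp
      also have "\<dots> \<le> (\<integral>\<^sup>+ \<zeta>. ennreal (\<gamma> (- \<epsilon>) \<zeta>) * indicator D \<zeta> + ennreal ((real n)\<^sup>2 / pi * \<epsilon>) * indicator D \<zeta> \<partial>lborel)"
      proof (intro nn_integral_mono)
        fix \<zeta> :: "real \<times> real"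
        \<comment> \<open>The lower density with - \<epsilon> may be negative and is then cut off at
          0 by \<open>ennreal\<close>; so the error term is moved to the other side instead of being
          subtracted.\<close>
        have "\<gamma> 0 \<zeta> \<le> max 0 (\<gamma> (- \<epsilon>) \<zeta>) + (real n)\<^sup>2 / pi * \<epsilon>" by (auto simp: \<gamma>_def algebra_simps)
        then have "ennreal (\<gamma> 0 \<zeta>) \<le> ennreal (max 0 (\<gamma> (- \<epsilon>) \<zeta>) + (real n)\<^sup>2 / pi * \<epsilon>)" by (rule ennreal_leI)
        also have "\<dots> = ennreal (\<gamma> (- \<epsilon>) \<zeta>) + ennreal ((real n)\<^sup>2 / pi * \<epsilon>)"
          using \<epsilon> by (subst ennreal_plus) (auto simp: ennreal_max_0)
        finally show "ennreal (\<gamma> 0 \<zeta>) * indicator D \<zeta> \<le> ennreal (\<gamma> (- \<epsilon>) \<zeta>) * indicator D \<zeta> + ennreal ((real n)\<^sup>2 / pi * \<epsilon>) * indicator D \<zeta>"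
          by (auto simp: indicator_def)
      qed
      also have "\<dots> = (\<integral>\<^sup>+ \<zeta>. ennreal (\<gamma> (- \<epsilon>) \<zeta>) * indicator D \<zeta> \<partial>lborel) + ennreal ((real n)\<^sup>2 / pi * \<epsilon>) * emeasure lborel D"
      proof -
        note [measurable] = \<gamma>m D_borel
        show ?thesis by (subst nn_integral_add) (measurable, simp add: nn_integral_cmult_indicator)
      qed
      also have "\<dots> \<le> (\<integral>\<^sup>+ \<omega>. of_nat (zero_count (Pn n \<omega>) ({x1<..<x2} \<times> angles)) \<partial>M) + ennreal (arclen S * ((real n)\<^sup>2 / pi * \<epsilon> * (b - a)))"
      proof (rule add_mono[OF low])
        show "ennreal ((real n)\<^sup>2 / pi * \<epsilon>) * emeasure lborel D \<le> ennreal (arclen S * ((real n)\<^sup>2 / pi * \<epsilon> * (b - a)))"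
          unfolding eD using \<epsilon> by (subst ennreal_mult'[symmetric]) (auto simp: mult_ac)
      qed
      finally show "ennreal (arclen S * (real n / (2 * pi) * (dlnH (2 * real n * b) - dlnH (2 * real n * a))))
        \<le> (\<integral>\<^sup>+ \<omega>. of_nat (zero_count (Pn n \<omega>) ({x1<..<x2} \<times> angles)) \<partial>M)
          + ennreal (arclen S * ((real n)\<^sup>2 / pi * \<epsilon> * (b - a)))" .
    qed
  qed
qed


lemma expected_zeros_limit:
  assumes \<tau>: "\<tau>1 < \<tau>2"
  shows "(\<lambda>n. (\<integral>\<^sup>+ \<omega>. of_nat (card {z \<in> Omega S \<tau>1 \<tau>2 n. poly (Pn n \<omega>) z = 0}) \<partial>M) / of_nat n)
    \<longlonglongrightarrow> ennreal (arclen S / (2 * pi) * (dlnH \<tau>2 - dlnH \<tau>1))"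
proof (rule tendsto_ennreal_eps)
  fix \<delta> :: real assume \<delta>: "\<delta> > 0"
  define x1 where "x1 n = ln (1 + \<tau>1 / (2 * real n))" for n
  define x2 where "x2 n = ln (1 + \<tau>2 / (2 * real n))" for n
  \<comment> \<open>Shrinking the open radial interval to a closed one by 1/n^2 vanishes even after
    multiplication by n, the scale of the intensity.\<close>
  define a where "a n = x1 n + 1 / (real n)\<^sup>2" for n
  define b where "b n = x2 n - 1 / (real n)\<^sup>2" for n
  define T where "T = \<bar>\<tau>1\<bar> + \<bar>\<tau>2\<bar> + 1"
  \<comment> \<open>The radial interval has length about (\<tau>2 - \<tau>1) / (2 n), so the total
    error tends to at most \<delta> / 4; the added 1 covers arclength 0.\<close>
  define \<epsilon> where "\<epsilon> = pi * \<delta> / (2 * (arclen S + 1) * (\<tau>2 - \<tau>1))"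
  have m0: "arclen S \<ge> 0" by (rule arclen_angles)
  have \<epsilon>: "\<epsilon> > 0" using \<delta> \<tau> m0 by (simp add: \<epsilon>_def)
  have lx: "(\<lambda>n. real n * x1 n) \<longlonglongrightarrow> \<tau>1 / 2" "(\<lambda>n. real n * x2 n) \<longlonglongrightarrow> \<tau>2 / 2"
    unfolding x1_def x2_def by (rule scaled_ln_tendsto)+
  have inv: "(\<lambda>n. real n * (1 / (real n)\<^sup>2)) \<longlonglongrightarrow> 0" by real_asymp
  have la: "(\<lambda>n. real n * a n) \<longlonglongrightarrow> \<tau>1 / 2" "(\<lambda>n. real n * b n) \<longlonglongrightarrow> \<tau>2 / 2"
    using tendsto_add[OF lx(1) inv] tendsto_diff[OF lx(2) inv] by (simp_all add: a_def b_def algebra_simps)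
  have l1lim: "(\<lambda>n. dlnH (2 * real n * y n)) \<longlonglongrightarrow> dlnH t" if "(\<lambda>n. real n * y n) \<longlonglongrightarrow> t / 2" for y t
  proof -
    have "(\<lambda>n. 2 * (real n * y n)) \<longlonglongrightarrow> 2 * (t / 2)" by (intro tendsto_intros that)
    then have "(\<lambda>n. 2 * real n * y n) \<longlonglongrightarrow> t" by (simp add: mult.assoc)
    then show ?thesis by (rule isCont_tendsto_compose[OF dlnH_continuous])
  qed
  define L where "L = arclen S / (2 * pi) * (dlnH \<tau>2 - dlnH \<tau>1)"
  define e where "e = arclen S * (\<epsilon> / pi * ((\<tau>2 - \<tau>1) / 2))"
  have e: "e < \<delta> / 2"
  proof -
    have "m * (pi * \<delta> / (2 * p * q) / pi * (q / 2)) = m / p * (\<delta> / 4)" if "p > 0" "q > 0" for m p q :: real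
      using that by (simp add: field_simps)
    then have "e = arclen S / (arclen S + 1) * (\<delta> / 4)" using \<tau> m0 by (simp add: e_def \<epsilon>_def)
    also have "\<dots> \<le> 1 * (\<delta> / 4)" using m0 \<delta> by (intro mult_right_mono) auto
    finally show ?thesis using \<delta> by simp
  qed
  define u where "u n = arclen S * (1 / (2 * pi) * (dlnH (2 * real n * x2 n) - dlnH (2 * real n * x1 n)) + \<epsilon> / pi * (real n * x2 n - real n * x1 n)) + 1 / real n" for n
  define v where "v n = arclen S * (1 / (2 * pi) * (dlnH (2 * real n * b n) - dlnH (2 * real n * a n)))" for n
  define w' where "w' n = arclen S * (\<epsilon> / pi * (real n * b n - real n * a n))" for n
  have "(\<lambda>n. 1 / real n) \<longlonglongrightarrow> 0" by real_asymp
  then have "u \<longlonglongrightarrow> arclen S * (1 / (2 * pi) * (dlnH \<tau>2 - dlnH \<tau>1) + \<epsilon> / pi * (\<tau>2 / 2 - \<tau>1 / 2)) + 0"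
    unfolding u_def by (intro tendsto_intros l1lim lx)
  then have "u \<longlonglongrightarrow> L + e" by (simp add: L_def e_def field_simps)
  then have eu: "eventually (\<lambda>n. u n < L + \<delta>) sequentially" using e \<delta> by (intro order_tendstoD) auto
  have "(\<lambda>n. v n - w' n) \<longlonglongrightarrow> arclen S * (1 / (2 * pi) * (dlnH \<tau>2 - dlnH \<tau>1)) - arclen S * (\<epsilon> / pi * (\<tau>2 / 2 - \<tau>1 / 2))"
    unfolding v_def w'_def by (intro tendsto_intros l1lim la)
  then have "(\<lambda>n. v n - w' n) \<longlonglongrightarrow> L - e" by (simp add: L_def e_def field_simps)
  then have ev: "eventually (\<lambda>n. L - \<delta> < v n - w' n) sequentially" using e \<delta> by (intro order_tendstoD) auto
  have bounded: "eventually (\<lambda>n. \<bar>real n * y n\<bar> \<le> T) sequentially" if "(\<lambda>n. real n * y n) \<longlonglongrightarrow> t / 2" "\<bar>t / 2\<bar> < T" for y t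
    using order_tendstoD(2)[OF tendsto_rabs[OF that(1)] that(2)] by (auto elim!: eventually_mono)
  have ex1: "eventually (\<lambda>n. \<bar>real n * x1 n\<bar> \<le> T) sequentially" by (rule bounded[OF lx(1)]) (auto simp: T_def)
  have ex2: "eventually (\<lambda>n. \<bar>real n * x2 n\<bar> \<le> T) sequentially" by (rule bounded[OF lx(2)]) (auto simp: T_def)
  have "eventually (\<lambda>n. 0 < real n * b n - real n * a n) sequentially"
    using \<tau> by (intro order_tendstoD(1)[OF tendsto_diff[OF la(2) la(1)]]) simp
  moreover have "(\<lambda>n. 1 + \<tau>1 / (2 * real n)) \<longlonglongrightarrow> 1" by real_asymp
  then have "eventually (\<lambda>n. 0 < 1 + \<tau>1 / (2 * real n)) sequentially" by (rule order_tendstoD) simp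
  moreover have "T \<ge> 0" by (simp add: T_def)
  note expected_zeros_bounds[OF this \<epsilon>]
  ultimately show "eventually (\<lambda>n. ennreal (arclen S / (2 * pi) * (dlnH \<tau>2 - dlnH \<tau>1) - \<delta>)
      \<le> (\<integral>\<^sup>+ \<omega>. of_nat (card {z \<in> Omega S \<tau>1 \<tau>2 n. poly (Pn n \<omega>) z = 0}) \<partial>M) / of_nat n \<and>
     (\<integral>\<^sup>+ \<omega>. of_nat (card {z \<in> Omega S \<tau>1 \<tau>2 n. poly (Pn n \<omega>) z = 0}) \<partial>M) / of_nat n
      \<le> ennreal (arclen S / (2 * pi) * (dlnH \<tau>2 - dlnH \<tau>1) + \<delta>)) sequentially"
    using eu ev ex1 ex2 eventually_gt_at_top[of 0]
  proof eventually_elim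
    case (elim n)
    have n: "n > 0" using elim by simp
    define N where "N = (\<integral>\<^sup>+ \<omega>. of_nat (card {z \<in> Omega S \<tau>1 \<tau>2 n. poly (Pn n \<omega>) z = 0}) \<partial>M)"
    have N: "N = (\<integral>\<^sup>+ \<omega>. of_nat (zero_count (Pn n \<omega>) ({x1 n<..<x2 n} \<times> angles)) \<partial>M)"
      unfolding N_def x1_def x2_def using card_zeros_Omega[OF n elim(2) \<tau>] by simp
    have "real n * a n < real n * b n" using elim(1) by simp
    then have ab: "a n \<le> b n" using n by simp
    have xab: "x1 n < a n" "b n < x2 n" using n by (auto simp: a_def b_def)
    then have x12: "x1 n \<le> x2 n" using ab by simp
    note bd = elim(3)[rule_format, OF elim(6,7) x12, folded N]
    have of: "of_nat n = ennreal (real n)" by (simp add: ennreal_of_nat_eq_real_of_nat)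
    have "N \<le> ennreal (real n * u n)"
    proof -
      have "arclen S * (real n / (2 * pi) * (dlnH (2 * real n * x2 n) - dlnH (2 * real n * x1 n)) + (real n)\<^sup>2 / pi * \<epsilon> * (x2 n - x1 n)) + 1 = real n * u n"
        using n by (simp add: u_def field_simps power2_eq_square)
      then show ?thesis using bd by simp
    qed
    then have "N / of_nat n \<le> ennreal (real n * u n) / of_nat n" by (rule divide_right_mono_ennreal)
    also have "\<dots> = ennreal (u n)"
    proof (cases "u n \<ge> 0")
      case True
      then show ?thesis using n unfolding of by (subst divide_ennreal) auto
    next
      case False
      then have "real n * u n \<le> 0" by (simp add: mult_nonneg_nonpos)
      then show ?thesis using False by (simp add: ennreal_neg)
    qed
    also have "\<dots> \<le> ennreal (L + \<delta>)" using elim by (intro ennreal_leI) simp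
    finally have up: "N / of_nat n \<le> ennreal (L + \<delta>)" .
    have w0: "w' n \<ge> 0" using m0 \<epsilon> elim(1) unfolding w'_def by (intro mult_nonneg_nonneg) auto
    have "ennreal (real n * v n) \<le> N + ennreal (real n * w' n)"
    proof -
      have "arclen S * (real n / (2 * pi) * (dlnH (2 * real n * b n) - dlnH (2 * real n * a n))) = real n * v n"
        by (simp add: v_def)
      moreover have "arclen S * ((real n)\<^sup>2 / pi * \<epsilon> * (b n - a n)) = real n * w' n"
        by (simp add: w'_def field_simps power2_eq_square)
      ultimately show ?thesis using bd xab ab by metis
    qed
    then have "ennreal (real n * v n) - ennreal (real n * w' n) \<le> N"
      by (simp add: ennreal_minus_le_iff add.commute)
    then have "ennreal (real n * (v n - w' n)) \<le> N" using w0 by (simp add: ennreal_minus right_diff_distrib)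
    then have "ennreal (real n * (v n - w' n)) / of_nat n \<le> N / of_nat n" by (rule divide_right_mono_ennreal)
    moreover have "ennreal (v n - w' n) \<le> ennreal (real n * (v n - w' n)) / of_nat n"
    proof (cases "v n - w' n \<ge> 0")
      case True
      then show ?thesis using n unfolding of by (subst divide_ennreal) auto
    qed (simp add: ennreal_neg)
    moreover have "ennreal (L - \<delta>) \<le> ennreal (v n - w' n)" using elim by (intro ennreal_leI) simp
    ultimately have "ennreal (L - \<delta>) \<le> N / of_nat n" by order
    then show ?case using up by (simp add: N_def L_def)
  qed
qed

end

theorem theorem1p8:
  fixes \<mu> :: "complex measure" and \<Phi> :: "nat \<Rightarrow> complex poly" and \<alpha> :: "nat \<Rightarrow> complex"
    and M :: "'a measure" and \<eta> :: "nat \<Rightarrow> 'a \<Rightarrow> real"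
    and S :: "complex set" and \<tau>1 \<tau>2 :: real
  assumes prob: "prob_space \<mu>" and sets_\<mu>: "sets \<mu> = sets borel"
    and on_circle: "emeasure \<mu> (sphere 0 1) = 1"
    and symm: "conj_symmetric \<mu>"
    and inf_supp: "infinite (msupport \<mu>)"
    and OP: "monic_OP \<mu> \<Phi>"
    and szego: "\<forall>i. \<Phi> (Suc i) = [:0, 1:] * \<Phi> i - smult (\<alpha> i) (reflect_poly (\<Phi> i))"
    and alpha_lim: "\<alpha> \<longlonglongrightarrow> 0"
    and probM: "prob_space M"
    and indep: "prob_space.indep_vars M (\<lambda>_. borel) \<eta> UNIV"
    and gauss: "\<forall>i. distributed M lborel (\<eta> i) std_normal_density"
    and S_compact: "compact S" and S_sub: "S \<subseteq> sphere 0 1 - {1, -1}"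
    and ac: "\<exists>U w. open U \<and> S \<subseteq> U \<and> w \<in> borel_measurable borel \<and> (\<forall>z. w z \<ge> 0) \<and>
               (\<forall>A \<in> sets borel. A \<subseteq> U \<longrightarrow>
                  emeasure \<mu> A = (\<integral>\<^sup>+ \<theta>. indicator ({0..<2*pi} \<inter> {\<theta>. cis \<theta> \<in> A}) \<theta>
                                         * ennreal (w (cis \<theta>)) \<partial>lborel)) \<and>
               (\<forall>z\<in>S. w z > 0 \<and> continuous (at z within sphere 0 1) w)"
    and tau: "\<tau>1 < \<tau>2"
  shows "((\<lambda>n. (\<integral>\<^sup>+ \<omega>. of_nat (card {z \<in> Omega S \<tau>1 \<tau>2 n.
              poly (\<Sum>i<n. smult (complex_of_real (\<eta> i \<omega>)) (orthonormal_poly \<mu> \<Phi> i)) z = 0}) \<partial>M)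
            / of_nat n)
         \<longlongrightarrow> ennreal (arclen S / (2 * pi) * (deriv H \<tau>2 / H \<tau>2 - deriv H \<tau>1 / H \<tau>1)))
         sequentially"
proof -
  obtain U w where U: "open U" "S \<subseteq> U" "w \<in> borel_measurable borel" "\<forall>z. w z \<ge> 0"
    "\<forall>A \<in> sets borel. A \<subseteq> U \<longrightarrow>
       emeasure \<mu> A = (\<integral>\<^sup>+ \<theta>. indicator ({0..<2*pi} \<inter> {\<theta>. cis \<theta> \<in> A}) \<theta> * ennreal (w (cis \<theta>)) \<partial>lborel)"
    "\<forall>z\<in>S. w z > 0 \<and> continuous (at z within sphere 0 1) w"
    using ac by blast
  interpret opuc_gauss \<mu> \<Phi> \<alpha> S U w M \<eta>
  proof -
    interpret \<mu>: prob_space \<mu> by (rule prob)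
    interpret M: prob_space M by (rule probM)
    show "opuc_gauss \<mu> \<Phi> \<alpha> S U w M \<eta>"
      using sets_\<mu> on_circle symm inf_supp OP szego alpha_lim indep gauss S_compact S_sub U
      by unfold_locales auto
  qed
  show ?thesis using expected_zeros_limit[OF tau] by (simp only: Pn_def dlnH_eq)
qed

end
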